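(* Let $A\ge\mathbf{Z}$ be a ring without additive elements of order $2$, and let a nonabelian partial $A$-group $G$ be a CSA-group. If all maximal abelian subgroups of $G$ are faithful over $A$, then the tensor completion of $G$ by $A$ is the complete tensor extension of centralizers of $G$ by the ring $A$.
   Context: Rings are associative with identity, and $A$ and its subring $\mathbf{Z}$ have a common identity element. CSA-groups. A subgroup $H\le G$ is conjugately separated if $H\cap H^x=1$ for all $x\in G\setminus H$. $G$ is a CSA-group if all its maximal abelian subgroups are conjugately separated. $A$-groups. An $A$-group is a group $G$ with a map $G\times A\to G$, $(g,\alpha)\mapsto g^\alpha$, such that for all $g,h\in G$, $\alpha,\beta\in A$: (1) $g^1=g$, $g^0=1$, $1^\alpha=1$; (2) $g^{\alpha+\beta}=g^\alpha g^\beta$, $g^{\alpha\beta}=(g^\alpha)^\beta$; (3) $(h^{-1}gh)^\alpha=h^{-1}g^\alpha h$; (4) $[g,h]=1$ implies $(gh)^\alpha=g^\alpha h^\alpha$. An $A$-homomorphism is a group homomorphism $f$ with $f(g^\alpha)=f(g)^\alpha$. Partial $A$-groups. A group $G$ is a partial $A$-group if $g^\alpha$ is defined for some $g\in G$, $\alpha\in A$, and axioms (1)-(4) hold wherever the action is defined (this means, in particular, that if one side of the equalities in (1)-(4) is defined, then so is the other side, and they are equal to each other). A partial $A$-homomorphism $f$ is a group homomorphism such that whenever $g^\alpha$ is defined, so is $f(g)^\alpha$, and $f(g^\alpha)=f(g)^\alpha$. Subgroups are considered with the inherited partial action. Tensor completion. A tensor $A$-completion of a partial $A$-group $G$ is an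 $A$-group $G^A$ with a partial $A$-homomorphism $\lambda:G\to G^A$ such that $\lambda(G)$ generates $G^A$ as an $A$-group and for every $A$-group $H$ and partial $A$-homomorphism $\varphi:G\to H$ there is a unique $A$-homomorphism $\psi:G^A\to H$ with $\psi\circ\lambda=\varphi$. $G$ is faithful over $A$ if $\lambda$ is injective. If $C$ is an abelian partial $A$-group (a partial right $A$-module), its tensor $A$-completion is denoted $C\otimes A$; it is obtained from $C\otimes_{\mathbf{Z}}A$ by factoring out all relations $(x\alpha)\otimes\beta=x\otimes\alpha\beta$ for $x\in C$, $\alpha,\beta\in A$ (with $x\alpha$ defined). Complete tensor extension of centralizers. Let $G$ be a nonabelian partial $A$-group that is a CSA-group with all maximal abelian subgroups faithful over $A$. "Centralizer" means the centralizer $C_G(v)$ of a nontrivial element $v$. Let $\mathcal{C}=\{C_i\mid i\in I\}$ be a set of centralizers of $G$ satisfying condition (S): no $C\in\mathcal{C}$ is an $A$-module (as a partial abelian $A$-subgroup of $G$); no two distinct members of $\mathcal{C}$ are conjugate in $G$; every centralizer in $G$ which is not an $A$-module is conjugate to a member of $\mathcal{C}$. Let $\phi_i:C_i\hookrightarrow C_i\otimes A$ be the canonical embeddings. Let $G^\ast=G(\mathcal{C},A)$ be the fundamental group of the tree of groups having a central vertex with group $G$ and, for each $i\in I$, a vertex with group $C_i\otimes A$ joined to the central vertex by an edge with group $C_i$ (embedded by inclusion in $G$ and by $\phi_i$ in $C_i\otimes A$). The group $G^\ast$ is a partial $A$-group: for $1\neq g\in G$ the centralizer $C_{G^\ast}(g)$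 is isomorphic to $C_G(g)\otimes A$ and is given the corresponding $A$-module structure, and the action is extended to all conjugates of these centralizers in $G^\ast$ by $(x^{-1}ax)^\alpha=x^{-1}a^\alpha x$. Iterating, put $G^{(0)}=G$ and $G^{(n+1)}=G^{(n)}(\mathcal{C}_n,A)$, where $\mathcal{C}_n$ is a set of centralizers of $G^{(n)}$ satisfying (S) in $G^{(n)}$. The union $\bigcup_{n\in\omega}G^{(n)}$ of the chain $G=G^{(0)}<G^{(1)}<G^{(2)}<\cdots$ is called the complete tensor extension of centralizers of $G$ by the ring $A$.
   Formalization: Existence of the complete tensor extension of centralizers is shown only when no M⊗A (M a maximal abelian subgroup of G) has elements of order 2, since otherwise it can be ill-defined; that every complete tensor extension is a tensor completion is proved unconditionally. *)

theory Defs
  imports "HOL-Algebra.Ring" "HOL-Algebra.Coset" "HOL-Algebra.Generated_Groups"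
    "HOL-Algebra.Free_Abelian_Groups"
begin

section \<open>Groups with a (partial) exponentiation\<close>

text \<open>\<open>expo G g \<alpha> = Some h\<close> means that the power of \<open>g\<close> with exponent \<open>\<alpha>\<close> is defined and equal
  to \<open>h\<close>. Only values at arguments in the carriers of the group and of the ring are meaningful.\<close>

record ('g, 'r) exp_struct = "'g monoid" +
  expo :: "'g \<Rightarrow> 'r \<Rightarrow> 'g option"

definition conj_by :: "('g, 'm) monoid_scheme \<Rightarrow> 'g \<Rightarrow> 'g \<Rightarrow> 'g" where
  "conj_by G h g = inv\<^bsub>G\<^esub> h \<otimes>\<^bsub>G\<^esub> g \<otimes>\<^bsub>G\<^esub> h"

text \<open>\<open>g\<^sup>1\<close>, \<open>g\<^sup>0\<close>, \<open>1\<^sup>\<alpha>\<close> are always defined, and the two sides of the conjugation law are defined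
  simultaneously. In the laws for \<open>g\<close> to the power \<open>\<alpha> + \<beta>\<close>, for \<open>g\<close> to the power \<open>\<alpha>\<beta>\<close> and for
  \<open>(gh)\<^sup>\<alpha>\<close>, definedness of the side that evaluates two powers implies definedness of the other side.
  The converse cannot be demanded: because of \<open>1 = \<alpha> + (1 - \<alpha>)\<close> (or \<open>0 = \<alpha>0\<close>, or \<open>1 = g g\<^sup>-\<^sup>1\<close>) it
  would make all powers defined.\<close>

locale partial_exp_group = A?: ring A + G?: group G
  for A :: "('r, 'n) ring_scheme" (structure) and G :: "('g, 'r) exp_struct" (structure) +
  assumes expo_closed:
      "\<lbrakk>g \<in> carrier G; \<alpha> \<in> carrier A; expo G g \<alpha> = Some x\<rbrakk> \<Longrightarrow> x \<in> carrier G"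
    and expo_one: "g \<in> carrier G \<Longrightarrow> expo G g \<one>\<^bsub>A\<^esub> = Some g"
    and expo_zero: "g \<in> carrier G \<Longrightarrow> expo G g \<zero>\<^bsub>A\<^esub> = Some \<one>\<^bsub>G\<^esub>"
    and one_expo: "\<alpha> \<in> carrier A \<Longrightarrow> expo G \<one>\<^bsub>G\<^esub> \<alpha> = Some \<one>\<^bsub>G\<^esub>"
    and expo_add:
      "\<lbrakk>g \<in> carrier G; \<alpha> \<in> carrier A; \<beta> \<in> carrier A; expo G g \<alpha> = Some x; expo G g \<beta> = Some y\<rbrakk>
        \<Longrightarrow> expo G g (\<alpha> \<oplus>\<^bsub>A\<^esub> \<beta>) = Some (x \<otimes>\<^bsub>G\<^esub> y)"
    and expo_mult:
      "\<lbrakk>g \<in> carrier G; \<alpha> \<in> carrier A; \<beta> \<in> carrier A; expo G g \<alpha> = Some x; expo G x \<beta> = Some y\<rbrakk>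
        \<Longrightarrow> expo G g (\<alpha> \<otimes>\<^bsub>A\<^esub> \<beta>) = Some y"
    and expo_conj:
      "\<lbrakk>g \<in> carrier G; h \<in> carrier G; \<alpha> \<in> carrier A\<rbrakk>
        \<Longrightarrow> expo G (conj_by G h g) \<alpha> = map_option (conj_by G h) (expo G g \<alpha>)"
    and expo_commute:
      "\<lbrakk>g \<in> carrier G; h \<in> carrier G; \<alpha> \<in> carrier A; g \<otimes>\<^bsub>G\<^esub> h = h \<otimes>\<^bsub>G\<^esub> g;
        expo G g \<alpha> = Some x; expo G h \<alpha> = Some y\<rbrakk>
        \<Longrightarrow> expo G (g \<otimes>\<^bsub>G\<^esub> h) \<alpha> = Some (x \<otimes>\<^bsub>G\<^esub> y)"

text \<open>For a total exponentiation the definedness side conditions disappear, and the axioms become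
  those of an \<open>A\<close>-group.\<close>

locale exp_group = partial_exp_group +
  assumes expo_total: "\<lbrakk>g \<in> carrier G; \<alpha> \<in> carrier A\<rbrakk> \<Longrightarrow> expo G g \<alpha> \<noteq> None"

text \<open>If the exponentiation of \<open>G\<close> is total, these are exactly the \<open>A\<close>-homomorphisms.\<close>

definition exp_hom ::
  "('r, 'n) ring_scheme \<Rightarrow> ('g, 'r) exp_struct \<Rightarrow> ('h, 'r) exp_struct \<Rightarrow> ('g \<Rightarrow> 'h) set" where
  "exp_hom A G H = {f \<in> hom G H. \<forall>g\<in>carrier G. \<forall>\<alpha>\<in>carrier A. \<forall>x.
     expo G g \<alpha> = Some x \<longrightarrow> expo H (f g) \<alpha> = Some (f x)}"

definition exp_iso ::
  "('r, 'n) ring_scheme \<Rightarrow> ('g, 'r) exp_struct \<Rightarrow> ('h, 'r) exp_struct \<Rightarrow> ('g \<Rightarrow> 'h) set" where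
  "exp_iso A G H = {f \<in> iso G H. \<forall>g\<in>carrier G. \<forall>\<alpha>\<in>carrier A.
     expo H (f g) \<alpha> = map_option f (expo G g \<alpha>)}"

text \<open>The substructure on a subset, with the inherited partial exponentiation.\<close>

definition sub_exp :: "('g, 'r) exp_struct \<Rightarrow> 'g set \<Rightarrow> ('g, 'r) exp_struct" where
  "sub_exp G H = G\<lparr>carrier := H,
     expo := (\<lambda>x \<alpha>. case expo G x \<alpha> of None \<Rightarrow> None | Some y \<Rightarrow> if y \<in> H then Some y else None)\<rparr>"

definition is_exp_module ::
  "('r, 'n) ring_scheme \<Rightarrow> ('g, 'r) exp_struct \<Rightarrow> 'g set \<Rightarrow> bool" where
  "is_exp_module A G C \<longleftrightarrow> exp_group A (sub_exp G C) \<and> comm_group (sub_exp G C)"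

inductive_set exp_generate ::
  "('r, 'n) ring_scheme \<Rightarrow> ('g, 'r) exp_struct \<Rightarrow> 'g set \<Rightarrow> 'g set"
  for A and G and S where
    one: "\<one>\<^bsub>G\<^esub> \<in> exp_generate A G S"
  | incl: "s \<in> S \<Longrightarrow> s \<in> exp_generate A G S"
  | inv: "x \<in> exp_generate A G S \<Longrightarrow> inv\<^bsub>G\<^esub> x \<in> exp_generate A G S"
  | mult: "x \<in> exp_generate A G S \<Longrightarrow> y \<in> exp_generate A G S \<Longrightarrow> x \<otimes>\<^bsub>G\<^esub> y \<in> exp_generate A G S"
  | expo: "x \<in> exp_generate A G S \<Longrightarrow> \<alpha> \<in> carrier A \<Longrightarrow> expo G x \<alpha> = Some y
      \<Longrightarrow> y \<in> exp_generate A G S"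


section \<open>Tensor completions\<close>

text \<open>The test objects \<open>H\<close> of the universal property live in an arbitrary type \<open>'h\<close>, which has to
  appear as a parameter of the definition.\<close>

definition is_tensor_completion ::
  "'h itself \<Rightarrow> ('r, 'n) ring_scheme \<Rightarrow> ('g, 'r) exp_struct \<Rightarrow> ('u, 'r) exp_struct \<Rightarrow> ('g \<Rightarrow> 'u) \<Rightarrow> bool"
  where
  "is_tensor_completion _ A G U \<iota> \<longleftrightarrow>
     exp_group A U \<and> \<iota> \<in> exp_hom A G U \<and>
     exp_generate A U (\<iota> ` carrier G) = carrier U \<and>
     (\<forall>H :: ('h, 'r) exp_struct. \<forall>\<phi>. exp_group A H \<longrightarrow> \<phi> \<in> exp_hom A G H \<longrightarrow>
        (\<exists>!\<psi>. \<psi> \<in> exp_hom A U H \<and> \<psi> \<in> extensional (carrier U) \<and>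
              (\<forall>g\<in>carrier G. \<psi> (\<iota> g) = \<phi> g)))"

text \<open>The tensor completion of an abelian partial \<open>A\<close>-group \<open>C\<close> (written multiplicatively): the free
  abelian group on the symbols \<open>(x, \<alpha>)\<close>, standing for \<open>x \<otimes> \<alpha>\<close>, modulo the relators of
  \<open>C \<otimes>\<^sub>Z A\<close> and the relators \<open>x\<alpha> \<otimes> \<beta> - x \<otimes> \<alpha>\<beta>\<close>.\<close>

definition tensor_relators ::
  "('r, 'n) ring_scheme \<Rightarrow> ('g, 'r) exp_struct \<Rightarrow> ('g \<times> 'r \<Rightarrow>\<^sub>0 int) set" where
  "tensor_relators A C =
     {frag_of (x \<otimes>\<^bsub>C\<^esub> y, \<alpha>) - frag_of (x, \<alpha>) - frag_of (y, \<alpha>) | x y \<alpha>.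
        x \<in> carrier C \<and> y \<in> carrier C \<and> \<alpha> \<in> carrier A} \<union>
     {frag_of (x, \<alpha> \<oplus>\<^bsub>A\<^esub> \<beta>) - frag_of (x, \<alpha>) - frag_of (x, \<beta>) | x \<alpha> \<beta>.
        x \<in> carrier C \<and> \<alpha> \<in> carrier A \<and> \<beta> \<in> carrier A} \<union>
     {frag_of (y, \<beta>) - frag_of (x, \<alpha> \<otimes>\<^bsub>A\<^esub> \<beta>) | x y \<alpha> \<beta>.
        x \<in> carrier C \<and> \<alpha> \<in> carrier A \<and> \<beta> \<in> carrier A \<and> expo C x \<alpha> = Some y}"

definition tensor_free ::
  "('r, 'n) ring_scheme \<Rightarrow> ('g, 'r) exp_struct \<Rightarrow> ('g \<times> 'r \<Rightarrow>\<^sub>0 int) monoid" where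
  "tensor_free A C = free_Abelian_group (carrier C \<times> carrier A)"

definition tensor_null ::
  "('r, 'n) ring_scheme \<Rightarrow> ('g, 'r) exp_struct \<Rightarrow> ('g \<times> 'r \<Rightarrow>\<^sub>0 int) set" where
  "tensor_null A C = generate (tensor_free A C) (tensor_relators A C)"

text \<open>The exponentiation is the right action \<open>(x \<otimes> \<beta>)\<alpha> = x \<otimes> \<beta>\<alpha>\<close>, computed on cosets.\<close>

definition tensor ::
  "('r, 'n) ring_scheme \<Rightarrow> ('g, 'r) exp_struct \<Rightarrow> (('g \<times> 'r \<Rightarrow>\<^sub>0 int) set, 'r) exp_struct" where
  "tensor A C =
     (let Q = tensor_free A C Mod tensor_null A C in
      \<lparr>carrier = carrier Q, monoid.mult = mult Q, one = one Q,
       expo = (\<lambda>X \<alpha>. Some (tensor_null A C <#>\<^bsub>tensor_free A C\<^esub>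
                 (frag_extend (\<lambda>(x, \<beta>). frag_of (x, \<beta> \<otimes>\<^bsub>A\<^esub> \<alpha>)) ` X)))\<rparr>)"

definition tensor_map ::
  "('r, 'n) ring_scheme \<Rightarrow> ('g, 'r) exp_struct \<Rightarrow> 'g \<Rightarrow> ('g \<times> 'r \<Rightarrow>\<^sub>0 int) set" where
  "tensor_map A C x = tensor_null A C #>\<^bsub>tensor_free A C\<^esub> frag_of (x, \<one>\<^bsub>A\<^esub>)"

definition abelian_faithful :: "('r, 'n) ring_scheme \<Rightarrow> ('g, 'r) exp_struct \<Rightarrow> bool" where
  "abelian_faithful A C \<longleftrightarrow> inj_on (tensor_map A C) (carrier C)"


section \<open>CSA-groups and centralizers\<close>

definition maximal_abelian :: "('g, 'm) monoid_scheme \<Rightarrow> 'g set \<Rightarrow> bool" where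
  "maximal_abelian G M \<longleftrightarrow>
     subgroup M G \<and> comm_group (G\<lparr>carrier := M\<rparr>) \<and>
     (\<forall>K. subgroup K G \<and> comm_group (G\<lparr>carrier := K\<rparr>) \<and> M \<subseteq> K \<longrightarrow> K = M)"

definition conj_separated :: "('g, 'm) monoid_scheme \<Rightarrow> 'g set \<Rightarrow> bool" where
  "conj_separated G H \<longleftrightarrow> (\<forall>x \<in> carrier G - H. H \<inter> conj_by G x ` H = {\<one>\<^bsub>G\<^esub>})"

definition CSA :: "('g, 'm) monoid_scheme \<Rightarrow> bool" where
  "CSA G \<longleftrightarrow> (\<forall>M. maximal_abelian G M \<longrightarrow> conj_separated G M)"

definition centralizer :: "('g, 'm) monoid_scheme \<Rightarrow> 'g \<Rightarrow> 'g set" where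
  "centralizer G v = {x \<in> carrier G. x \<otimes>\<^bsub>G\<^esub> v = v \<otimes>\<^bsub>G\<^esub> x}"

definition centralizers :: "('g, 'm) monoid_scheme \<Rightarrow> 'g set set" where
  "centralizers G = centralizer G ` (carrier G - {\<one>\<^bsub>G\<^esub>})"

definition conjugate_in :: "('g, 'm) monoid_scheme \<Rightarrow> 'g set \<Rightarrow> 'g set \<Rightarrow> bool" where
  "conjugate_in G C D \<longleftrightarrow> (\<exists>x\<in>carrier G. D = conj_by G x ` C)"

definition condition_S ::
  "('r, 'n) ring_scheme \<Rightarrow> ('g, 'r) exp_struct \<Rightarrow> 'g set set \<Rightarrow> bool" where
  "condition_S A G \<C> \<longleftrightarrow>
     \<C> \<subseteq> centralizers G \<and>
     (\<forall>C\<in>\<C>. \<not> is_exp_module A G C) \<and>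
     (\<forall>C\<in>\<C>. \<forall>D\<in>\<C>. C \<noteq> D \<longrightarrow> \<not> conjugate_in G C D) \<and>
     (\<forall>C\<in>centralizers G. \<not> is_exp_module A G C \<longrightarrow> (\<exists>D\<in>\<C>. conjugate_in G C D))"


section \<open>The fundamental group of a star of groups\<close>

text \<open>Central vertex group \<open>G\<close>; for each \<open>i \<in> I\<close> an outer vertex group \<open>H i\<close> and an edge group
  \<open>C i \<subseteq> G\<close>, embedded in \<open>H i\<close> by \<open>\<phi> i\<close>. As the underlying graph is a tree there are no stable
  letters: the fundamental group is generated by the vertex groups, subject to their multiplication
  tables and to the identifications along the edges. The letters are \<open>Inl g\<close> for \<open>g \<in> G\<close> and
  \<open>Inr (i, t)\<close> for \<open>t \<in> H i\<close>.\<close>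

definition star_words ::
  "('g, 'm) monoid_scheme \<Rightarrow> 'i set \<Rightarrow> ('i \<Rightarrow> ('h, 'k) monoid_scheme) \<Rightarrow> ('g + 'i \<times> 'h) list set" where
  "star_words G I H = lists (Inl ` carrier G \<union> Inr ` (SIGMA i:I. carrier (H i)))"

inductive_set star_rel ::
  "('g, 'm) monoid_scheme \<Rightarrow> 'i set \<Rightarrow> ('i \<Rightarrow> ('h, 'k) monoid_scheme) \<Rightarrow> ('i \<Rightarrow> 'g set) \<Rightarrow>
   ('i \<Rightarrow> 'g \<Rightarrow> 'h) \<Rightarrow> (('g + 'i \<times> 'h) list \<times> ('g + 'i \<times> 'h) list) set"
  for G and I and H and C and \<phi> where
    refl: "w \<in> star_words G I H \<Longrightarrow> (w, w) \<in> star_rel G I H C \<phi>"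
  | sym: "(v, w) \<in> star_rel G I H C \<phi> \<Longrightarrow> (w, v) \<in> star_rel G I H C \<phi>"
  | trans: "(u, v) \<in> star_rel G I H C \<phi> \<Longrightarrow> (v, w) \<in> star_rel G I H C \<phi> \<Longrightarrow> (u, w) \<in> star_rel G I H C \<phi>"
  | append: "(u, u') \<in> star_rel G I H C \<phi> \<Longrightarrow> (v, v') \<in> star_rel G I H C \<phi>
      \<Longrightarrow> (u @ v, u' @ v') \<in> star_rel G I H C \<phi>"
  | central_one: "([Inl \<one>\<^bsub>G\<^esub>], []) \<in> star_rel G I H C \<phi>"
  | central_mult: "x \<in> carrier G \<Longrightarrow> y \<in> carrier G
      \<Longrightarrow> ([Inl x, Inl y], [Inl (x \<otimes>\<^bsub>G\<^esub> y)]) \<in> star_rel G I H C \<phi>"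
  | outer_one: "i \<in> I \<Longrightarrow> ([Inr (i, \<one>\<^bsub>H i\<^esub>)], []) \<in> star_rel G I H C \<phi>"
  | outer_mult: "i \<in> I \<Longrightarrow> s \<in> carrier (H i) \<Longrightarrow> t \<in> carrier (H i)
      \<Longrightarrow> ([Inr (i, s), Inr (i, t)], [Inr (i, s \<otimes>\<^bsub>H i\<^esub> t)]) \<in> star_rel G I H C \<phi>"
  | edge: "i \<in> I \<Longrightarrow> c \<in> C i \<Longrightarrow> ([Inl c], [Inr (i, \<phi> i c)]) \<in> star_rel G I H C \<phi>"

definition star_group ::
  "('g, 'm) monoid_scheme \<Rightarrow> 'i set \<Rightarrow> ('i \<Rightarrow> ('h, 'k) monoid_scheme) \<Rightarrow> ('i \<Rightarrow> 'g set) \<Rightarrow>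
   ('i \<Rightarrow> 'g \<Rightarrow> 'h) \<Rightarrow> ('g + 'i \<times> 'h) list set monoid" where
  "star_group G I H C \<phi> =
     (let R = star_rel G I H C \<phi> in
      \<lparr>carrier = star_words G I H // R,
       monoid.mult = (\<lambda>X Y. \<Union>x\<in>X. \<Union>y\<in>Y. R `` {x @ y}),
       one = R `` {[]}\<rparr>)"


section \<open>Tensor extensions of centralizers\<close>

text \<open>The tree of groups is indexed by the set \<open>\<C>\<close> of centralizers itself.\<close>

type_synonym ('g, 'r) ext_word = "('g + 'g set \<times> ('g \<times> 'r \<Rightarrow>\<^sub>0 int) set) list"

definition ext_rel ::
  "('r, 'n) ring_scheme \<Rightarrow> ('g, 'r) exp_struct \<Rightarrow> 'g set set \<Rightarrow>
   (('g, 'r) ext_word \<times> ('g, 'r) ext_word) set" where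
  "ext_rel A G \<C> = star_rel G \<C> (\<lambda>C. tensor A (sub_exp G C)) (\<lambda>C. C) (\<lambda>C. tensor_map A (sub_exp G C))"

definition ext_group ::
  "('r, 'n) ring_scheme \<Rightarrow> ('g, 'r) exp_struct \<Rightarrow> 'g set set \<Rightarrow> ('g, 'r) ext_word set monoid" where
  "ext_group A G \<C> =
     star_group G \<C> (\<lambda>C. tensor A (sub_exp G C)) (\<lambda>C. C) (\<lambda>C. tensor_map A (sub_exp G C))"

definition ext_central ::
  "('r, 'n) ring_scheme \<Rightarrow> ('g, 'r) exp_struct \<Rightarrow> 'g set set \<Rightarrow> 'g \<Rightarrow> ('g, 'r) ext_word set" where
  "ext_central A G \<C> g = ext_rel A G \<C> `` {[Inl g]}"

definition ext_outer ::
  "('r, 'n) ring_scheme \<Rightarrow> ('g, 'r) exp_struct \<Rightarrow> 'g set set \<Rightarrow> 'g set \<Rightarrow>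
   ('g \<times> 'r \<Rightarrow>\<^sub>0 int) set \<Rightarrow> ('g, 'r) ext_word set" where
  "ext_outer A G \<C> C t = ext_rel A G \<C> `` {[Inr (C, t)]}"

text \<open>The graph of the partial exponentiation of the extension. Let \<open>g \<noteq> 1\<close> in \<open>G\<close>. If \<open>C\<^sub>G(g)\<close> is an
  \<open>A\<close>-module then it coincides with \<open>C\<^sub>G(g) \<otimes> A\<close> and its action is kept; otherwise \<open>C\<^sub>G(g)\<close> is
  conjugate to some \<open>C \<in> \<C>\<close>, and the centralizer in the extension is conjugate to the vertex group
  \<open>C \<otimes> A\<close>. Both actions are carried over to all conjugates. The rule \<open>int\<close> adds the integer powers
  of the remaining elements, for which a partial \<open>A\<close>-group has to have at least \<open>g\<^sup>0\<close> and \<open>g\<^sup>1\<close>.\<close>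

inductive ext_expo ::
  "('r, 'n) ring_scheme \<Rightarrow> ('g, 'r) exp_struct \<Rightarrow> 'g set set \<Rightarrow>
   ('g, 'r) ext_word set \<Rightarrow> 'r \<Rightarrow> ('g, 'r) ext_word set \<Rightarrow> bool"
  for A and G and \<C> where
    module: "\<lbrakk>g \<in> carrier G; g \<noteq> \<one>\<^bsub>G\<^esub>; is_exp_module A G (centralizer G g);
        a \<in> centralizer G g; \<alpha> \<in> carrier A; expo G a \<alpha> = Some b; x \<in> carrier (ext_group A G \<C>)\<rbrakk>
      \<Longrightarrow> ext_expo A G \<C>
            (conj_by (ext_group A G \<C>) x (ext_central A G \<C> a)) \<alpha>
            (conj_by (ext_group A G \<C>) x (ext_central A G \<C> b))"
  | tensor: "\<lbrakk>C \<in> \<C>; t \<in> carrier (tensor A (sub_exp G C)); \<alpha> \<in> carrier A;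
        expo (tensor A (sub_exp G C)) t \<alpha> = Some s; x \<in> carrier (ext_group A G \<C>)\<rbrakk>
      \<Longrightarrow> ext_expo A G \<C>
            (conj_by (ext_group A G \<C>) x (ext_outer A G \<C> C t)) \<alpha>
            (conj_by (ext_group A G \<C>) x (ext_outer A G \<C> C s))"
  | int: "x \<in> carrier (ext_group A G \<C>)
      \<Longrightarrow> ext_expo A G \<C> x ([(n :: int)] \<cdot>\<^bsub>A\<^esub> \<one>\<^bsub>A\<^esub>) (x [^]\<^bsub>ext_group A G \<C>\<^esub> n)"

text \<open>\<open>H\<close> is a copy of the extension of \<open>G\<close> by means of \<open>\<C>\<close> that contains \<open>G\<close> itself.\<close>

definition is_centralizer_extension ::
  "('r, 'n) ring_scheme \<Rightarrow> ('u, 'r) exp_struct \<Rightarrow> 'u set set \<Rightarrow> ('u, 'r) exp_struct \<Rightarrow> bool" where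
  "is_centralizer_extension A G \<C> H \<longleftrightarrow>
     group H \<and>
     (\<exists>\<theta> \<in> iso (ext_group A G \<C>) H.
        (\<forall>g\<in>carrier G. \<theta> (ext_central A G \<C> g) = g) \<and>
        (\<forall>x\<in>carrier (ext_group A G \<C>). \<forall>\<alpha>\<in>carrier A. \<forall>z.
           expo H (\<theta> x) \<alpha> = Some z \<longleftrightarrow> (\<exists>y. ext_expo A G \<C> x \<alpha> y \<and> z = \<theta> y)))"

text \<open>All members of the chain live in a single type \<open>'u\<close>, so that the given \<open>G\<close> is replaced by
  an isomorphic copy in that type.\<close>

definition centralizer_chain ::
  "('r, 'n) ring_scheme \<Rightarrow> ('g, 'r) exp_struct \<Rightarrow> (nat \<Rightarrow> ('u, 'r) exp_struct) \<Rightarrow> ('g \<Rightarrow> 'u) \<Rightarrow> bool" where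
  "centralizer_chain A G Gs \<iota> \<longleftrightarrow>
     group (Gs 0) \<and> \<iota> \<in> exp_iso A G (Gs 0) \<and>
     (\<forall>n. \<exists>\<C>. condition_S A (Gs n) \<C> \<and> is_centralizer_extension A (Gs n) \<C> (Gs (Suc n)))"

definition chain_union :: "(nat \<Rightarrow> ('u, 'r) exp_struct) \<Rightarrow> ('u, 'r) exp_struct" where
  "chain_union Gs =
     \<lparr>carrier = (\<Union>n. carrier (Gs n)),
      monoid.mult = (\<lambda>x y. mult (Gs (LEAST n. x \<in> carrier (Gs n) \<and> y \<in> carrier (Gs n))) x y),
      one = one (Gs 0),
      expo = (\<lambda>x \<alpha>. if \<exists>n. x \<in> carrier (Gs n) \<and> expo (Gs n) x \<alpha> \<noteq> None
                    then expo (Gs (LEAST n. x \<in> carrier (Gs n) \<and> expo (Gs n) x \<alpha> \<noteq> None)) x \<alpha>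
                    else None)\<rparr>"

definition is_complete_tensor_extension ::
  "('r, 'n) ring_scheme \<Rightarrow> ('g, 'r) exp_struct \<Rightarrow> ('u, 'r) exp_struct \<Rightarrow> ('g \<Rightarrow> 'u) \<Rightarrow> bool" where
  "is_complete_tensor_extension A G U \<iota> \<longleftrightarrow>
     (\<exists>Gs. centralizer_chain A G Gs \<iota> \<and> U = chain_union Gs)"

definition no_involutions :: "('g, 'm) monoid_scheme \<Rightarrow> bool" where
  "no_involutions G \<longleftrightarrow> (\<forall>t\<in>carrier G. t \<otimes>\<^bsub>G\<^esub> t = \<one>\<^bsub>G\<^esub> \<longrightarrow> t = \<one>\<^bsub>G\<^esub>)"

end

theory Submission
  imports Defs "HOL-Algebra.Bij"
begin

text \<open>The syllable length \<open>L\<close> of the fundamental group of a star of groups satisfies the four point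
  inequality for \<open>d x y = L (x\<^sup>-\<^sup>1 y)\<close>: up to bounded corrections it measures displacements in the
  Bass-Serre tree. This alone gives the dichotomy that every element is either conjugate into a vertex group
  (elliptic), with centralizer conjugate to a vertex group or to a centralizer in \<open>G\<close>, or hyperbolic with an
  infinite cyclic centralizer. Hence the powers prescribed on the conjugates of the vertex groups do not
  conflict, and the extension of centralizers is again a faithful CSA partial \<open>A\<close>-group, into which every
  element of \<open>G\<close> is mapped with all its powers defined. The CSA property could only fail through an involution;
  either there are no involutions in the tensor products, or the existence of the next stage of the chain
  forbids it. The universal property of each stage is that of the fundamental group combined with that of
  the tensor products of the centralizers, and it passes to the union.\<close>

section \<open>CSA-groups\<close>

text \<open>The obstacle behind the whole structure is that powers are prescribed on all conjugates
  of many vertex groups at once, so the axioms can be checked only after it is known exactly when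
  two such conjugates share a nontrivial element. Condition (S) and the CSA property of
  \<open>G\<close> answer this for the edge groups, and reduced words carry the answer over to the
  extension. The second point is which centralizers still lack powers after a step. Those of
  elliptic elements have become \<open>A\<close>-modules; the others are infinite cyclic with
  integer powers only, and their tensor product is the additive group of \<open>A\<close>. Hence
  faithfulness persists because Z embeds in \<open>A\<close>, and this is where additive elements of
  order 2 matter: a nonabelian CSA-group has no involutions. The tensor products of the first stage
  depend on the given partial action of \<open>G\<close>, so the existence half speaks about their
  involutions separately. For existence all stages must share one type, although forming an
  extension enlarges the type; elements are therefore coded back as words.\<close>

context group begin

lemma inv_mult_cancel [simp]: "\<lbrakk>x \<in> carrier G; y \<in> carrier G\<rbrakk> \<Longrightarrow> inv x \<otimes> (x \<otimes> y) = y"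
  by (simp add: m_assoc[symmetric])

lemma mult_inv_cancel [simp]: "\<lbrakk>x \<in> carrier G; y \<in> carrier G\<rbrakk> \<Longrightarrow> x \<otimes> (inv x \<otimes> y) = y"
  by (simp add: m_assoc[symmetric])

lemma conj_by_closed [simp]: "\<lbrakk>x \<in> carrier G; y \<in> carrier G\<rbrakk> \<Longrightarrow> conj_by G x y \<in> carrier G"
  by (simp add: conj_by_def)

lemma conj_by_mult:
  "\<lbrakk>x \<in> carrier G; y \<in> carrier G; z \<in> carrier G\<rbrakk> \<Longrightarrow> conj_by G x (y \<otimes> z) = conj_by G x y \<otimes> conj_by G x z"
  by (simp add: conj_by_def m_assoc)

lemma conj_by_inv: "\<lbrakk>x \<in> carrier G; y \<in> carrier G\<rbrakk> \<Longrightarrow> conj_by G x (inv y) = inv (conj_by G x y)"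
  by (simp add: conj_by_def m_assoc inv_mult_group)

lemma conj_by_conj_by:
  "\<lbrakk>x \<in> carrier G; y \<in> carrier G; z \<in> carrier G\<rbrakk> \<Longrightarrow> conj_by G x (conj_by G y z) = conj_by G (y \<otimes> x) z"
  by (simp add: conj_by_def m_assoc inv_mult_group)

lemma conj_by_one [simp]: "x \<in> carrier G \<Longrightarrow> conj_by G x \<one> = \<one>"
  by (simp add: conj_by_def)

lemma conj_by_one_left [simp]: "x \<in> carrier G \<Longrightarrow> conj_by G \<one> x = x"
  by (simp add: conj_by_def)

lemma conj_by_inv_cancel [simp]:
  assumes "x \<in> carrier G" "y \<in> carrier G"
  shows "conj_by G (inv x) (conj_by G x y) = y" "conj_by G x (conj_by G (inv x) y) = y"
  using assms by (simp_all add: conj_by_conj_by)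

lemma conj_by_inj: "x \<in> carrier G \<Longrightarrow> y \<in> carrier G \<Longrightarrow> z \<in> carrier G \<Longrightarrow>
    conj_by G x y = conj_by G x z \<longleftrightarrow> y = z"
  by (metis conj_by_inv_cancel(1))

lemma conj_by_eq_one_iff [simp]: "x \<in> carrier G \<Longrightarrow> y \<in> carrier G \<Longrightarrow> conj_by G x y = \<one> \<longleftrightarrow> y = \<one>"
  by (metis conj_by_inj conj_by_one one_closed)

lemma conj_by_fixed_iff:
  "\<lbrakk>x \<in> carrier G; y \<in> carrier G\<rbrakk> \<Longrightarrow> conj_by G x y = y \<longleftrightarrow> x \<otimes> y = y \<otimes> x"
  by (metis conj_by_def inv_closed inv_solve_left' m_assoc m_closed)

lemma conj_by_pow: "\<lbrakk>x \<in> carrier G; y \<in> carrier G\<rbrakk> \<Longrightarrow> conj_by G x (y [^] (n::nat)) = conj_by G x y [^] n"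
  by (induction n) (simp_all add: conj_by_mult)

lemma conj_by_int_pow: "\<lbrakk>x \<in> carrier G; y \<in> carrier G\<rbrakk> \<Longrightarrow> conj_by G x (y [^] (n::int)) = conj_by G x y [^] n"
  by (cases n rule: int_cases2) (simp_all add: int_pow_int int_pow_neg_int conj_by_pow conj_by_inv)

lemma conj_by_commute:
  "\<lbrakk>x \<in> carrier G; y \<in> carrier G; z \<in> carrier G\<rbrakk> \<Longrightarrow>
    conj_by G x y \<otimes> conj_by G x z = conj_by G x z \<otimes> conj_by G x y \<longleftrightarrow> y \<otimes> z = z \<otimes> y"
  by (metis conj_by_inj conj_by_mult m_closed)

lemma commute_inv:
  assumes "x \<in> carrier G" "y \<in> carrier G" "x \<otimes> y = y \<otimes> x"
  shows "inv x \<otimes> y = y \<otimes> inv x"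
proof -
  have "conj_by G x y = y" using assms by (simp add: conj_by_fixed_iff)
  then have "conj_by G (inv x) y = y" using assms by (metis conj_by_inv_cancel(1))
  then show ?thesis using assms by (simp add: conj_by_fixed_iff)
qed

lemma centralizerD: "x \<in> centralizer G v \<Longrightarrow> x \<in> carrier G" "x \<in> centralizer G v \<Longrightarrow> x \<otimes> v = v \<otimes> x"
  by (simp_all add: centralizer_def)

lemma centralizerI: "x \<in> carrier G \<Longrightarrow> x \<otimes> v = v \<otimes> x \<Longrightarrow> x \<in> centralizer G v"
  unfolding centralizer_def by blast

lemma commute_int_pow:
  assumes "x \<in> carrier G" "y \<in> carrier G" "x \<otimes> y = y \<otimes> x"
  shows "x \<otimes> y [^] (k::int) = y [^] k \<otimes> x"
proof -
  have "conj_by G x y = y" using assms by (simp add: conj_by_fixed_iff)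
  then have "conj_by G x (y [^] k) = y [^] k" using assms by (simp add: conj_by_int_pow)
  then show ?thesis using assms by (simp add: conj_by_fixed_iff)
qed

lemma commute_mult:
  assumes "x \<in> carrier G" "y \<in> carrier G" "z \<in> carrier G" "x \<otimes> z = z \<otimes> x" "y \<otimes> z = z \<otimes> y"
  shows "(x \<otimes> y) \<otimes> z = z \<otimes> (x \<otimes> y)"
  using assms by (metis m_assoc)

lemma subgroup_centralizer: "v \<in> carrier G \<Longrightarrow> subgroup (centralizer G v) G"
  by (rule subgroupI) (auto simp: centralizer_def commute_inv commute_mult)

lemma centralizer_conj_by:
  assumes x: "x \<in> carrier G" and v: "v \<in> carrier G"
  shows "centralizer G (conj_by G x v) = conj_by G x ` centralizer G v"
proof
  show "conj_by G x ` centralizer G v \<subseteq> centralizer G (conj_by G x v)"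
    using x v by (auto simp: centralizer_def conj_by_commute)
  show "centralizer G (conj_by G x v) \<subseteq> conj_by G x ` centralizer G v"
  proof
    fix y assume y: "y \<in> centralizer G (conj_by G x v)"
    then have yG: "y \<in> carrier G" by (simp add: centralizer_def)
    have "conj_by G (inv x) y \<in> centralizer G v"
      using y conj_by_commute[of "inv x" y "conj_by G x v"] x v yG by (simp add: centralizer_def)
    moreover have "y = conj_by G x (conj_by G (inv x) y)" using x yG by simp
    ultimately show "y \<in> conj_by G x ` centralizer G v" by blast
  qed
qed

lemma abelian_subgroup_imp_comm_group:
  assumes "subgroup H G" "\<And>x y. x \<in> H \<Longrightarrow> y \<in> H \<Longrightarrow> x \<otimes> y = y \<otimes> x"
  shows "comm_group (G\<lparr>carrier := H\<rparr>)"
  using group.group_comm_groupI[OF subgroup.subgroup_is_group[OF assms(1) is_group]] assms(2) by simp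

lemma comm_group_subgroup_commute:
  assumes "comm_group (G\<lparr>carrier := H\<rparr>)" "x \<in> H" "y \<in> H"
  shows "x \<otimes> y = y \<otimes> x"
proof -
  interpret C: comm_group "G\<lparr>carrier := H\<rparr>" by fact
  show ?thesis using C.m_comm[of x y] assms by simp
qed

text \<open>Zorn's lemma is applied to sets of pairwise commuting elements instead of subgroups. A
  maximal such set contains every element that commutes with all of it, and this makes it a
  subgroup.\<close>

lemma abelian_subset_maximal_abelian:
  assumes "x \<in> carrier G"
  shows "\<exists>M. maximal_abelian G M \<and> x \<in> M"
proof -
  define \<A> where "\<A> = {K. K \<subseteq> carrier G \<and> (\<forall>a\<in>K. \<forall>b\<in>K. a \<otimes> b = b \<otimes> a) \<and> x \<in> K}"
  have "\<exists>M\<in>\<A>. \<forall>X\<in>\<A>. M \<subseteq> X \<longrightarrow> X = M"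
  proof (rule subset_Zorn_nonempty)
    have "{x} \<in> \<A>" using assms by (auto simp: \<A>_def)
    then show "\<A> \<noteq> {}" by blast
    fix \<C> assume C: "\<C> \<noteq> {}" "subset.chain \<A> \<C>"
    have "\<exists>K\<in>\<C>. a \<in> K \<and> b \<in> K" if "a \<in> \<Union>\<C>" "b \<in> \<Union>\<C>" for a b
    proof -
      obtain K L where KL: "K \<in> \<C>" "a \<in> K" "L \<in> \<C>" "b \<in> L" using \<open>a \<in> \<Union>\<C>\<close> \<open>b \<in> \<Union>\<C>\<close> by blast
      then have "K \<subseteq> L \<or> L \<subseteq> K" using C(2) by (auto simp: subset_chain_def)
      then show ?thesis using KL by blast
    qed
    moreover have sub: "\<C> \<subseteq> \<A>" using C(2) by (auto simp: subset_chain_def)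
    ultimately have "a \<otimes> b = b \<otimes> a" if "a \<in> \<Union>\<C>" "b \<in> \<Union>\<C>" for a b
      using that unfolding \<A>_def by blast
    then show "\<Union>\<C> \<in> \<A>" using C(1) sub unfolding \<A>_def by blast
  qed
  then obtain M where M: "M \<in> \<A>" and max: "\<And>X. X \<in> \<A> \<Longrightarrow> M \<subseteq> X \<Longrightarrow> X = M" by blast
  have MG: "M \<subseteq> carrier G" and Mc: "\<And>a b. a \<in> M \<Longrightarrow> b \<in> M \<Longrightarrow> a \<otimes> b = b \<otimes> a" and xM: "x \<in> M"
    using M by (auto simp: \<A>_def)
  have in_M: "c \<in> M" if "c \<in> carrier G" "\<And>a. a \<in> M \<Longrightarrow> c \<otimes> a = a \<otimes> c" for c
  proof -
    have "insert c M \<in> \<A>" using that MG Mc xM by (auto simp: \<A>_def)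
    from max[OF this] show ?thesis by blast
  qed
  have sub: "subgroup M G"
  proof (rule subgroupI)
    show "M \<subseteq> carrier G" "M \<noteq> {}" using MG xM by auto
    show "inv a \<in> M" if "a \<in> M" for a
      by (rule in_M) (use that MG Mc commute_inv in \<open>auto simp: subset_iff\<close>)
    show "a \<otimes> b \<in> M" if "a \<in> M" "b \<in> M" for a b
      by (rule in_M) (use that MG Mc commute_mult in \<open>auto simp: subset_iff\<close>)
  qed
  have "maximal_abelian G M"
    unfolding maximal_abelian_def
  proof (intro conjI allI impI)
    show "subgroup M G" by fact
    show "comm_group (G\<lparr>carrier := M\<rparr>)" using sub Mc by (rule abelian_subgroup_imp_comm_group)
    fix K assume K: "subgroup K G \<and> comm_group (G\<lparr>carrier := K\<rparr>) \<and> M \<subseteq> K"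
    have "K \<in> \<A>" using K xM comm_group_subgroup_commute[of K] by (auto simp: \<A>_def dest: subgroup.subset)
    then show "K = M" using max K by blast
  qed
  then show ?thesis using xM by blast
qed

end

section \<open>The CSA property in terms of elements\<close>

definition commutation_transitive :: "('g, 'm) monoid_scheme \<Rightarrow> bool" where
  "commutation_transitive G \<longleftrightarrow>
     (\<forall>v\<in>carrier G - {\<one>\<^bsub>G\<^esub>}. \<forall>x\<in>centralizer G v. \<forall>y\<in>centralizer G v. x \<otimes>\<^bsub>G\<^esub> y = y \<otimes>\<^bsub>G\<^esub> x)"

text \<open>Together with \<open>commutation_transitive\<close> this is the CSA property of a
  nonabelian group, stated for single elements (\<open>CSA_I\<close> gives the way back). In this
  form it can be checked in an extension by conjugating an element into a vertex group, without
  knowing the maximal abelian subgroups beforehand.\<close>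

definition commuting_conj_trivial :: "('g, 'm) monoid_scheme \<Rightarrow> bool" where
  "commuting_conj_trivial G \<longleftrightarrow>
     (\<forall>v\<in>carrier G - {\<one>\<^bsub>G\<^esub>}. \<forall>x\<in>carrier G. conj_by G x v \<in> centralizer G v \<longrightarrow> x \<in> centralizer G v)"

context group begin

text \<open>An element that commutes with \<open>v\<close> but lies outside \<open>M\<close> fixes
  \<open>v\<close> under conjugation, so \<open>M\<close> would meet its conjugate
  nontrivially.\<close>

lemma CSA_centralizer_eq:
  assumes "CSA G" "maximal_abelian G M" "v \<in> M" "v \<noteq> \<one>"
  shows "centralizer G v = M"
proof
  have MG: "M \<subseteq> carrier G" and Mc: "\<And>a b. a \<in> M \<Longrightarrow> b \<in> M \<Longrightarrow> a \<otimes> b = b \<otimes> a"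
    using assms(2) comm_group_subgroup_commute by (auto simp: maximal_abelian_def dest: subgroup.subset)
  then show "M \<subseteq> centralizer G v" using assms(3) by (auto simp: centralizer_def)
  show "centralizer G v \<subseteq> M"
  proof (rule ccontr)
    assume "\<not> centralizer G v \<subseteq> M"
    then obtain x where x: "x \<in> carrier G" "x \<otimes> v = v \<otimes> x" "x \<notin> M" by (auto simp: centralizer_def)
    then have "conj_by G x v = v" using assms(3) MG by (subst conj_by_fixed_iff) auto
    then have "v \<in> M \<inter> conj_by G x ` M" using assms(3) by (metis IntI imageI)
    moreover have "conj_separated G M" using assms(1,2) by (simp add: CSA_def)
    ultimately show False using x assms(4) by (auto simp: conj_separated_def)
  qed
qed

lemma CSA_maximal_abelian_centralizer:
  assumes "CSA G" "v \<in> carrier G" "v \<noteq> \<one>"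
  shows "maximal_abelian G (centralizer G v)"
  using abelian_subset_maximal_abelian[OF assms(2)] CSA_centralizer_eq[OF assms(1) _ _ assms(3)] by metis

lemma CSA_imp_commutation_transitive:
  assumes "CSA G" shows "commutation_transitive G"
  unfolding commutation_transitive_def
proof (intro ballI)
  fix v x y assume v: "v \<in> carrier G - {\<one>}" and xy: "x \<in> centralizer G v" "y \<in> centralizer G v"
  have "comm_group (G\<lparr>carrier := centralizer G v\<rparr>)"
    using CSA_maximal_abelian_centralizer[OF assms] v by (auto simp: maximal_abelian_def)
  then show "x \<otimes> y = y \<otimes> x" using xy by (rule comm_group_subgroup_commute)
qed

lemma CSA_imp_commuting_conj_trivial:
  assumes "CSA G" shows "commuting_conj_trivial G"
  unfolding commuting_conj_trivial_def
proof (intro ballI impI)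
  fix v x assume v: "v \<in> carrier G - {\<one>}" and x: "x \<in> carrier G" and *: "conj_by G x v \<in> centralizer G v"
  have M: "maximal_abelian G (centralizer G v)" using CSA_maximal_abelian_centralizer assms v by blast
  then have "conj_separated G (centralizer G v)" using assms by (simp add: CSA_def)
  moreover have "conj_by G x v \<in> centralizer G v \<inter> conj_by G x ` centralizer G v"
    using * v by (auto simp: centralizer_def)
  moreover have "conj_by G x v \<noteq> \<one>" using v x by simp
  ultimately show "x \<in> centralizer G v" using x unfolding conj_separated_def by blast
qed

lemma commutation_transitive_centralizer_eq:
  assumes "commutation_transitive G" "v \<in> carrier G" "v \<noteq> \<one>" "w \<in> centralizer G v" "w \<noteq> \<one>"
  shows "centralizer G w = centralizer G v"
proof -
  have w: "w \<in> carrier G" "v \<in> centralizer G w" using assms by (auto simp: centralizer_def)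
  have "centralizer G w \<subseteq> centralizer G v"
  proof
    fix x assume "x \<in> centralizer G w"
    then have "x \<otimes> v = v \<otimes> x" "x \<in> carrier G"
      using assms(1,5) w unfolding commutation_transitive_def centralizer_def by blast+
    then show "x \<in> centralizer G v" by (simp add: centralizer_def)
  qed
  moreover have "centralizer G v \<subseteq> centralizer G w"
  proof
    fix x assume "x \<in> centralizer G v"
    then have "x \<otimes> w = w \<otimes> x" "x \<in> carrier G"
      using assms unfolding commutation_transitive_def centralizer_def by blast+
    then show "x \<in> centralizer G w" by (simp add: centralizer_def)
  qed
  ultimately show ?thesis by blast
qed

lemma commutation_transitive_maximal_abelian_centralizer:
  assumes ct: "commutation_transitive G" and v: "v \<in> carrier G" "v \<noteq> \<one>"
  shows "maximal_abelian G (centralizer G v)"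
  unfolding maximal_abelian_def
proof (intro conjI allI impI)
  show "subgroup (centralizer G v) G" using v subgroup_centralizer by blast
  then show "comm_group (G\<lparr>carrier := centralizer G v\<rparr>)"
    using ct v by (intro abelian_subgroup_imp_comm_group) (auto simp: commutation_transitive_def)
  fix K assume K: "subgroup K G \<and> comm_group (G\<lparr>carrier := K\<rparr>) \<and> centralizer G v \<subseteq> K"
  then have "v \<in> K" using v by (auto simp: centralizer_def)
  then have "K \<subseteq> centralizer G v"
    using K comm_group_subgroup_commute[of K] by (auto simp: centralizer_def dest: subgroup.subset)
  then show "K = centralizer G v" using K by blast
qed

text \<open>Nonabelianness excludes the trivial subgroup: there is some nontrivial \<open>x\<close>,
  and its centralizer is a larger abelian subgroup.\<close>

lemma maximal_abelian_is_centralizer: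
  assumes M: "maximal_abelian G M" and nc: "\<not> comm_group G" and ct: "commutation_transitive G"
  shows "\<exists>v\<in>carrier G - {\<one>}. M = centralizer G v"
proof -
  have sub: "subgroup M G" using M by (simp add: maximal_abelian_def)
  have "\<exists>v\<in>M. v \<noteq> \<one>"
  proof (rule ccontr)
    assume "\<not> ?thesis"
    then have M1: "M \<subseteq> {\<one>}" by auto
    obtain x where x: "x \<in> carrier G" "x \<noteq> \<one>"
      using nc group_comm_groupI by (metis l_one r_one)
    have "maximal_abelian G (centralizer G x)"
      using commutation_transitive_maximal_abelian_centralizer ct x by blast
    moreover have "M \<subseteq> centralizer G x" using M1 x by (auto simp: centralizer_def)
    ultimately have "centralizer G x = M" using M by (auto simp: maximal_abelian_def)
    moreover have "x \<in> centralizer G x" using x by (auto simp: centralizer_def)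
    ultimately show False using M1 x by auto
  qed
  then obtain v where v: "v \<in> M" "v \<noteq> \<one>" by blast
  then have vG: "v \<in> carrier G" using sub subgroup.subset by blast
  have "maximal_abelian G (centralizer G v)"
    using commutation_transitive_maximal_abelian_centralizer ct v vG by blast
  moreover have "M \<subseteq> centralizer G v"
    using M v comm_group_subgroup_commute[of M] by (auto simp: centralizer_def maximal_abelian_def dest: subgroup.subset)
  ultimately have "M = centralizer G v" using M by (auto simp: maximal_abelian_def)
  then show ?thesis using v vG by blast
qed

text \<open>If \<open>m\<close> and its preimage \<open>m'\<close> under the conjugation both lie in
  \<open>M\<close>, they commute. Then \<open>x\<close> centralizes \<open>m'\<close>, whose
  centralizer is \<open>M\<close>.\<close>

lemma CSA_I:
  assumes nc: "\<not> comm_group G" and ct: "commutation_transitive G" and cc: "commuting_conj_trivial G"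
  shows "CSA G"
  unfolding CSA_def conj_separated_def
proof (intro allI impI ballI)
  fix M x assume M: "maximal_abelian G M" and x: "x \<in> carrier G - M"
  have sub: "subgroup M G" using M by (simp add: maximal_abelian_def)
  have "m = \<one>" if m: "m \<in> M" "m' \<in> M" "m = conj_by G x m'" for m m'
  proof (rule ccontr)
    assume "m \<noteq> \<one>"
    have mG: "m \<in> carrier G" "m' \<in> carrier G" using m sub subgroup.subset by blast+
    with m x \<open>m \<noteq> \<one>\<close> have n1: "m' \<noteq> \<one>" by auto
    have com: "m \<otimes> m' = m' \<otimes> m" using M m comm_group_subgroup_commute by (auto simp: maximal_abelian_def)
    then have "x \<in> centralizer G m'"
      using cc mG n1 x m unfolding commuting_conj_trivial_def centralizer_def by blast
    moreover obtain v where v: "v \<in> carrier G - {\<one>}" "M = centralizer G v"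
      using maximal_abelian_is_centralizer[OF M nc ct] by blast
    ultimately have "x \<in> M" using commutation_transitive_centralizer_eq[OF ct, of v m'] m n1 by blast
    then show False using x by blast
  qed
  moreover have "\<one> \<in> M" using sub by (simp add: subgroup.one_closed)
  moreover have "\<one> \<in> conj_by G x ` M" using \<open>\<one> \<in> M\<close> x by (metis DiffD1 conj_by_one imageI)
  ultimately show "M \<inter> conj_by G x ` M = {\<one>}" by blast
qed

text \<open>In a CSA-group, an involution \<open>t\<close> inverts \<open>t (x\<^sup>-\<^sup>1 t x)\<close>, hence commutes with it and with all its own
  conjugates; it is therefore central.\<close>

lemma CSA_no_involutions:
  assumes "CSA G" "\<not> comm_group G"
  shows "no_involutions G"
  unfolding no_involutions_def
proof (intro ballI impI, rule ccontr)
  fix t assume t: "t \<in> carrier G" "t \<otimes> t = \<one>" "t \<noteq> \<one>"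
  note ct = CSA_imp_commutation_transitive[OF assms(1)] and cc = CSA_imp_commuting_conj_trivial[OF assms(1)]
  have it: "inv t = t" using t by (simp add: inv_equality)
  have central: "x \<in> centralizer G t" if x: "x \<in> carrier G" for x
  proof -
    define s where "s = conj_by G x t"
    have s: "s \<in> carrier G" "s \<otimes> s = \<one>"
      using x t by (auto simp: s_def conj_by_mult[symmetric])
    have is': "inv s = s" using s by (simp add: inv_equality)
    define d where "d = t \<otimes> s"
    have d: "d \<in> carrier G" using t s by (simp add: d_def)
    have td: "conj_by G t d = inv d"
      using t s it is' by (simp add: d_def conj_by_def inv_mult_group m_assoc[symmetric])
    have "s \<in> centralizer G t"
    proof (cases "d = \<one>")
      case True
      then have "t = s" using t s is' by (metis d_def inv_equality it)
      then show ?thesis using t by (simp add: centralizer_def)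
    next
      case False
      have "conj_by G t d \<in> centralizer G d" using d td by (simp add: centralizer_def)
      then have "t \<in> centralizer G d" using cc d False t by (auto simp: commuting_conj_trivial_def)
      then have "t \<otimes> (t \<otimes> s) = t \<otimes> (s \<otimes> t)" using t s by (simp add: centralizer_def d_def m_assoc)
      then have "t \<otimes> s = s \<otimes> t" using t s by simp
      then show ?thesis using s by (simp add: centralizer_def)
    qed
    then show ?thesis using cc t x by (auto simp: commuting_conj_trivial_def s_def)
  qed
  have "comm_group G"
    by (rule group_comm_groupI) (use central ct t in \<open>auto simp: commutation_transitive_def\<close>)
  then show False using assms(2) by simp
qed

end

section \<open>Groups with a tree-like length function\<close>

text \<open>The last assumption is the four point condition of a 0-hyperbolic space for the
  left-invariant function L(x^-1 y). The points are group elements, that is, the orbit of one base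
  vertex; the other vertices of the tree never occur, so no tree has to be constructed.\<close>

locale length_group = group E for E :: "('e, 'm) monoid_scheme" (structure) +
  fixes L :: "'e \<Rightarrow> nat"
  assumes L_one: "L \<one> = 0"
    and L_inv: "x \<in> carrier E \<Longrightarrow> L (inv x) = L x"
    and L_four_point: "\<lbrakk>w \<in> carrier E; x \<in> carrier E; y \<in> carrier E; z \<in> carrier E\<rbrakk> \<Longrightarrow>
      L (inv w \<otimes> x) + L (inv y \<otimes> z) \<le> max (L (inv w \<otimes> y) + L (inv x \<otimes> z)) (L (inv w \<otimes> z) + L (inv x \<otimes> y))"
begin

definition d :: "'e \<Rightarrow> 'e \<Rightarrow> int" where "d x y = int (L (inv x \<otimes> y))"

lemma d_nonneg [simp]: "0 \<le> d x y"
  by (simp add: d_def)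

lemma d_refl [simp]: "x \<in> carrier E \<Longrightarrow> d x x = 0"
  by (simp add: d_def L_one)

lemma d_sym: "x \<in> carrier E \<Longrightarrow> y \<in> carrier E \<Longrightarrow> d x y = d y x"
  using L_inv[of "inv x \<otimes> y"] by (simp add: d_def inv_mult_group)

lemma d_one: "x \<in> carrier E \<Longrightarrow> d \<one> x = int (L x)"
  by (simp add: d_def)

lemma d_mult [simp]:
  "\<lbrakk>g \<in> carrier E; x \<in> carrier E; y \<in> carrier E\<rbrakk> \<Longrightarrow> d (g \<otimes> x) (g \<otimes> y) = d x y"
  by (simp add: d_def inv_mult_group m_assoc)

lemma d_mult_right: "\<lbrakk>x \<in> carrier E; y \<in> carrier E\<rbrakk> \<Longrightarrow> d x (x \<otimes> y) = int (L y)"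
  by (simp add: d_def)

lemma four_point:
  "\<lbrakk>w \<in> carrier E; x \<in> carrier E; y \<in> carrier E; z \<in> carrier E\<rbrakk> \<Longrightarrow>
      d w x + d y z \<le> max (d w y + d x z) (d w z + d x y)"
  using L_four_point[of w x y z] unfolding d_def by linarith

text \<open>The four point condition with two coinciding points.\<close>

lemma d_triangle:
  "\<lbrakk>x \<in> carrier E; y \<in> carrier E; z \<in> carrier E\<rbrakk> \<Longrightarrow> d x z \<le> d x y + d y z"
  using four_point[of x z y y] d_sym[of y z] by simp

lemma L_mult_le: "\<lbrakk>x \<in> carrier E; y \<in> carrier E\<rbrakk> \<Longrightarrow> L (x \<otimes> y) \<le> L x + L y"
  using d_triangle[of \<one> x "x \<otimes> y"] by (simp add: d_one d_mult_right)

lemma L_mult_left_zero: "\<lbrakk>x \<in> carrier E; y \<in> carrier E; L x = 0\<rbrakk> \<Longrightarrow> L (x \<otimes> y) = L y"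
  using L_mult_le[of x y] L_mult_le[of "inv x" "x \<otimes> y"] by (simp add: L_inv)

lemma L_mult_right_zero: "\<lbrakk>x \<in> carrier E; y \<in> carrier E; L y = 0\<rbrakk> \<Longrightarrow> L (x \<otimes> y) = L x"
  using L_mult_le[of x y] L_mult_le[of "x \<otimes> y" "inv y"] by (simp add: L_inv m_assoc)

text \<open>Two geodesics that overlap in a nondegenerate segment form a geodesic. For the points 1,
  x, xb, xby the four point condition leaves two alternatives, and the one without the total length
  would force \<open>L b = 0\<close>.\<close>

lemma L_concat:
  assumes "x \<in> carrier E" "b \<in> carrier E" "y \<in> carrier E"
    and "L (x \<otimes> b) = L x + L b" "L (b \<otimes> y) = L b + L y" "L b \<noteq> 0"
  shows "L (x \<otimes> b \<otimes> y) = L x + L b + L y"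
proof -
  have "d \<one> (x \<otimes> b) + d x (x \<otimes> (b \<otimes> y)) \<le>
      max (d \<one> x + d (x \<otimes> b) (x \<otimes> (b \<otimes> y))) (d \<one> (x \<otimes> (b \<otimes> y)) + d (x \<otimes> b) x)"
    using assms by (intro four_point) auto
  moreover have "d (x \<otimes> b) (x \<otimes> (b \<otimes> y)) = int (L y)" "d (x \<otimes> b) x = int (L b)"
    using assms by (simp_all add: d_mult_right d_sym[of "x \<otimes> b" x])
  ultimately have "L x + L b + L y \<le> L (x \<otimes> b \<otimes> y)"
    using assms by (simp add: d_one d_mult_right m_assoc)
  moreover have "L (x \<otimes> b \<otimes> y) \<le> L (x \<otimes> b) + L y" using assms by (intro L_mult_le) auto
  ultimately show ?thesis using assms by simp
qed

section \<open>Axial elements and positions on their axes\<close>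

definition axial :: "'e \<Rightarrow> bool" where
  "axial u \<longleftrightarrow> u \<in> carrier E \<and> 0 < L u \<and> L (u \<otimes> u) = 2 * L u"

text \<open>In the tree the base point lies on the axis of \<open>u\<close>. Consecutive translates
  overlap in a copy of \<open>u\<close>, so \<open>L_concat\<close> adds up the lengths.\<close>

lemma axial_L_pow:
  assumes "axial u" shows "L (u [^] k) = k * L u"
proof (induction k rule: less_induct)
  case (less k)
  have u: "u \<in> carrier E" "L u \<noteq> 0" "L (u \<otimes> u) = L u + L u" using assms by (auto simp: axial_def)
  consider "k = 0" | "k = 1" | j where "k = Suc (Suc j)" by (metis One_nat_def not0_implies_Suc)
  then show ?case
  proof cases
    case 3
    have "L (u [^] j \<otimes> u) = L (u [^] j) + L u" using less[of "Suc j"] less[of j] 3 by simp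
    then have "L (u [^] j \<otimes> u \<otimes> u) = L (u [^] j) + L u + L u" using u by (intro L_concat) auto
    then show ?thesis using less[of j] 3 by simp
  qed (use u L_one in simp_all)
qed

lemma axial_L_int_pow:
  assumes "axial u" shows "int (L (u [^] (k::int))) = \<bar>k\<bar> * int (L u)"
proof -
  have "u \<in> carrier E" using assms by (simp add: axial_def)
  then show ?thesis
    by (cases k rule: int_cases2) (simp_all add: int_pow_int int_pow_neg_int L_inv axial_L_pow[OF assms])
qed

lemma axial_d_pow:
  assumes "axial u" shows "d (u [^] (i::int)) (u [^] j) = \<bar>j - i\<bar> * int (L u)"
proof -
  have u: "u \<in> carrier E" using assms by (simp add: axial_def)
  have "inv (u [^] i) \<otimes> u [^] j = u [^] (j - i)"
    using u by (metis int_pow_neg int_pow_mult add.commute diff_conv_add_uminus)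
  then show ?thesis by (simp add: d_def axial_L_int_pow[OF assms])
qed

text \<open>The powers of an axial element \<open>u\<close> lie on a line, and \<open>pos_on u x m\<close> says that \<open>x\<close> lies on this
  line at the signed distance \<open>m\<close> from \<open>1\<close>.\<close>

definition pos_on :: "'e \<Rightarrow> 'e \<Rightarrow> int \<Rightarrow> bool" where
  "pos_on u x m \<longleftrightarrow> (\<exists>K0. \<forall>K\<ge>K0. d (u [^] (-K)) x = K * int (L u) + m \<and> d x (u [^] K) = K * int (L u) - m)"

text \<open>Commuting with \<open>u\<close>, the element \<open>x\<close> moves all powers of
  \<open>u\<close> by the same distance \<open>L x\<close>. Hence the line through these powers and
  its translate by \<open>x\<close> cannot diverge between -K and K once K exceeds
  \<open>L x\<close>, and \<open>x\<close>, a point of the translate, lies on the line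
  itself.\<close>

lemma pos_on_exists:
  assumes u: "axial u" and x: "x \<in> centralizer E u"
  shows "\<exists>m. pos_on u x m"
proof -
  let ?n = "int (L u)"
  have uE: "u \<in> carrier E" and n: "?n \<ge> 1" using u by (auto simp: axial_def)
  have xE: "x \<in> carrier E" and xu: "x \<otimes> u = u \<otimes> x" using x by (auto simp: centralizer_def)
  have com: "x \<otimes> u [^] k = u [^] k \<otimes> x" for k :: int
    using xE uE xu by (rule commute_int_pow)
  have shift: "d (u [^] k) (x \<otimes> u [^] k) = int (L x)" for k :: int
    unfolding com using uE xE by (simp add: d_mult_right)
  have between: "d (u [^] (-K)) x + d x (u [^] K) = 2 * K * ?n" if K: "K > int (L x)" for K :: int
  proof -
    let ?a = "x \<otimes> u [^] (-K)" and ?b = "x \<otimes> u [^] K" and ?a' = "u [^] (-K)" and ?b' = "u [^] K"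
    have c: "?a \<in> carrier E" "?b \<in> carrier E" "?a' \<in> carrier E" "?b' \<in> carrier E" using uE xE by auto
    have axe: "d ?a x = K * ?n" "d x ?b = K * ?n"
      using axial_d_pow[OF u, of "-K" 0] axial_d_pow[OF u, of 0 K] uE xE d_mult[of x "u [^] (-K)" \<one>]
        d_mult[of x \<one> "u [^] K"] K by simp_all
    have ab: "d ?a ?b = 2 * K * ?n" and ab': "d ?a' ?b' = 2 * K * ?n"
      using axial_d_pow[OF u, of "-K" K] uE xE K by simp_all
    have big: "K * ?n > int (L x)" using K n by (smt (verit) mult_le_cancel_left1 of_nat_0_le_iff)
    have 1: "d ?a' ?a = int (L x)" "d ?b' ?b = int (L x)" using shift by auto
    \<comment> \<open>First \<open>x\<close> is put on the geodesic from \<open>?a'\<close> to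
      \<open>?b\<close>, then on the one from \<open>?a'\<close> to \<open>?b'\<close>. In both
      cases the other alternative of the maximum would bound K times \<open>L u\<close> by
      \<open>L x\<close>.\<close>
    have "d ?a ?b + d ?a' x \<le> max (d ?a ?a' + d ?b x) (d ?a x + d ?b ?a')"
      using c xE by (intro four_point) auto
    then have 2: "d ?a' x + d x ?b \<le> d ?a' ?b"
      using axe ab 1 big c xE d_sym[of ?a ?a'] d_sym[of ?b x] d_sym[of ?b ?a']
      by (simp add: max_def split: if_splits) (use d_nonneg[of ?a' x] in linarith)
    have "d ?a' ?b + d x ?b' \<le> max (d ?a' x + d ?b ?b') (d ?a' ?b' + d ?b x)"
      using c xE by (intro four_point) auto
    then have "d ?a' x + d x ?b' \<le> d ?a' ?b'"
      using axe 1 2 big c xE d_sym[of ?b ?b'] d_sym[of ?b x]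
      by (simp add: max_def split: if_splits) (use d_nonneg[of x ?b'] in linarith)
    moreover have "d ?a' ?b' \<le> d ?a' x + d x ?b'" using c xE by (intro d_triangle) auto
    ultimately show ?thesis using ab' by simp
  qed
  \<comment> \<open>The smallest K to which \<open>between\<close> applies. The position is read off
    there; each further step changes either distance by at most \<open>L u\<close>, while their sum
    grows by twice \<open>L u\<close>, so both grow by exactly \<open>L u\<close>.\<close>
  define K0 where "K0 = int (L x) + 1"
  define m where "m = d (u [^] (-K0)) x - K0 * ?n"
  have "d (u [^] (-K)) x = K * ?n + m \<and> d x (u [^] K) = K * ?n - m" if "K0 \<le> K" for K
    using that
  proof (induction K rule: int_ge_induct)
    case base
    show ?case using between[of K0] by (simp add: m_def K0_def algebra_simps)
  next
    case (step K)
    have "d (u [^] (-(K+1))) x \<le> d (u [^] (-(K+1))) (u [^] (-K)) + d (u [^] (-K)) x"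
      using uE xE by (intro d_triangle) auto
    moreover have "d x (u [^] (K+1)) \<le> d x (u [^] K) + d (u [^] K) (u [^] (K+1))"
      using uE xE by (intro d_triangle) auto
    moreover have "d (u [^] (-(K+1))) x + d x (u [^] (K+1)) = 2 * (K+1) * ?n"
      using between[of "K+1"] step.hyps by (simp add: K0_def)
    ultimately show ?case
      using step.IH axial_d_pow[OF u, of "-(K+1)" "-K"] axial_d_pow[OF u, of K "K+1"]
      by (simp add: algebra_simps)
  qed
  then show ?thesis by (auto simp: pos_on_def)
qed

text \<open>With two powers of \<open>u\<close> far out on both sides, the four point condition
  bounds the distance from above and the triangle inequality from below.\<close>

lemma pos_on_d:
  assumes u: "axial u" and x: "x \<in> carrier E" "pos_on u x m" and y: "y \<in> carrier E" "pos_on u y m'"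
  shows "d x y = \<bar>m' - m\<bar>"
proof -
  let ?n = "int (L u)"
  have uE: "u \<in> carrier E" using u by (auto simp: axial_def)
  from x y obtain K1 K2
    where "\<And>K. K \<ge> K1 \<Longrightarrow> d (u [^] (-K)) x = K * ?n + m \<and> d x (u [^] K) = K * ?n - m"
      "\<And>K. K \<ge> K2 \<Longrightarrow> d (u [^] (-K)) y = K * ?n + m' \<and> d y (u [^] K) = K * ?n - m'"
    unfolding pos_on_def by blast
  then obtain K where K: "d (u [^] (-K)) x = K * ?n + m" "d x (u [^] K) = K * ?n - m"
      "d (u [^] (-K)) y = K * ?n + m'" "d y (u [^] K) = K * ?n - m'" "K \<ge> 0"
    by (metis max.cobounded1 max.cobounded2 max.coboundedI1 le_cases)
  let ?a = "u [^] (-K)" and ?b = "u [^] K"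
  have c: "?a \<in> carrier E" "?b \<in> carrier E" using uE by auto
  have "d ?a ?b + d x y \<le> max (d ?a x + d ?b y) (d ?a y + d ?b x)"
    using c x y by (intro four_point) auto
  moreover have "d ?a ?b = 2 * K * ?n" using axial_d_pow[OF u, of "-K" K] K by simp
  ultimately have "d x y \<le> \<bar>m' - m\<bar>"
    using K c x y d_sym[of ?b y] d_sym[of ?b x] by (simp add: max_def split: if_splits)
  moreover have "d ?a y \<le> d ?a x + d x y" "d ?a x \<le> d ?a y + d y x"
    using c x y by (auto intro: d_triangle)
  ultimately show ?thesis using K d_sym[of x y] x y by linarith
qed

lemma pos_on_shift:
  assumes u: "axial u" and x: "x \<in> carrier E" "pos_on u x m"
  shows "pos_on u (u [^] (j::int) \<otimes> x) (j * int (L u) + m)"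
proof -
  let ?n = "int (L u)"
  have uE: "u \<in> carrier E" using u by (auto simp: axial_def)
  from x obtain K1
    where K1: "\<And>K. K \<ge> K1 \<Longrightarrow> d (u [^] (-K)) x = K * ?n + m \<and> d x (u [^] K) = K * ?n - m"
    unfolding pos_on_def by blast
  have "d (u [^] (-K)) (u [^] j \<otimes> x) = K * ?n + (j * ?n + m) \<and> d (u [^] j \<otimes> x) (u [^] K) = K * ?n - (j * ?n + m)"
    if K: "K \<ge> \<bar>K1\<bar> + \<bar>j\<bar>" for K
  proof -
    have "d (u [^] (-K)) (u [^] j \<otimes> x) = d (u [^] (-(K+j))) x"
      using d_mult[of "u [^] j" "u [^] (-(K+j))" x] uE x int_pow_mult[of u j "-(K+j)"] by simp
    moreover have "d (u [^] j \<otimes> x) (u [^] K) = d x (u [^] (K-j))"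
      using d_mult[of "u [^] j" x "u [^] (K-j)"] uE x int_pow_mult[of u j "K-j"] by simp
    ultimately show ?thesis using K1[of "K+j"] K1[of "K-j"] K by (simp add: algebra_simps)
  qed
  then show ?thesis unfolding pos_on_def by blast
qed

lemma pos_on_one:
  assumes u: "axial u" shows "pos_on u \<one> 0"
  unfolding pos_on_def
proof (intro exI[of _ 0] allI impI)
  fix K :: int assume "0 \<le> K"
  then show "d (u [^] - K) \<one> = K * int (L u) + 0 \<and> d \<one> (u [^] K) = K * int (L u) - 0"
    using axial_d_pow[OF u, of "-K" 0] axial_d_pow[OF u, of 0 K] by simp
qed

text \<open>Left multiplication by \<open>inv x\<close> is an isometry and commutes with the powers
  of \<open>u\<close>, so the distances from \<open>x z\<close> to far powers of \<open>u\<close>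
  are those from \<open>z\<close> to shifts of \<open>inv x\<close> along the line. This gives the
  position k - l for \<open>x z\<close>, where l is the position of \<open>inv x\<close>; taking z =
  1 identifies -l with the position of \<open>x\<close>.\<close>

lemma pos_on_mult:
  assumes u: "axial u" and x: "x \<in> centralizer E u" "pos_on u x m" and y: "y \<in> centralizer E u" "pos_on u y m'"
  shows "pos_on u (x \<otimes> y) (m + m')"
proof -
  let ?n = "int (L u)"
  have uE: "u \<in> carrier E" and n: "?n \<ge> 1" using u by (auto simp: axial_def)
  have xE: "x \<in> carrier E" and yE: "y \<in> carrier E" using x y by (auto simp: centralizer_def)
  have ix: "inv x \<in> centralizer E u" using x uE subgroup_centralizer subgroup.m_inv_closed by metis
  then obtain l where l: "pos_on u (inv x) l" using pos_on_exists u by blast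
  have com: "inv x \<otimes> u [^] k = u [^] k \<otimes> inv x" for k :: int
    using ix uE by (intro commute_int_pow) (auto simp: centralizer_def)
  have *: "pos_on u (x \<otimes> z) (k - l)" if z: "z \<in> carrier E" "pos_on u z k" for z k
    unfolding pos_on_def
  proof (intro exI[of _ "\<bar>k\<bar> + \<bar>l\<bar>"] allI impI)
    fix K assume K: "\<bar>k\<bar> + \<bar>l\<bar> \<le> K"
    then have Kn: "\<bar>k\<bar> + \<bar>l\<bar> \<le> K * ?n" using n by (smt (verit) mult_le_cancel_left1)
    have "d (u [^] (-K)) (x \<otimes> z) = d (u [^] (-K) \<otimes> inv x) z"
      using d_mult[of "inv x" "u [^] (-K)" "x \<otimes> z"] com xE z uE by simp
    also have "\<dots> = \<bar>k - (- K * ?n + l)\<bar>"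
      by (rule pos_on_d[OF u _ pos_on_shift[OF u _ l]]) (use uE xE z in auto)
    finally have 1: "d (u [^] (-K)) (x \<otimes> z) = K * ?n + (k - l)" using Kn by simp
    have "d (x \<otimes> z) (u [^] K) = d z (u [^] K \<otimes> inv x)"
      using d_mult[of "inv x" "x \<otimes> z" "u [^] K"] com xE z uE by simp
    also have "\<dots> = \<bar>(K * ?n + l) - k\<bar>"
      by (rule pos_on_d[OF u _ _ _ pos_on_shift[OF u _ l]]) (use uE xE z in auto)
    finally have "d (x \<otimes> z) (u [^] K) = K * ?n - (k - l)" using Kn by simp
    with 1 show "d (u [^] - K) (x \<otimes> z) = K * ?n + (k - l) \<and> d (x \<otimes> z) (u [^] K) = K * ?n - (k - l)" by simp
  qed
  have "pos_on u x (0 - l)" using *[OF one_closed pos_on_one[OF u]] xE by simp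
  then have "m = - l" using pos_on_d[OF u xE x(2) xE] xE by simp
  then show ?thesis using *[OF yE y(2)] by simp
qed

section \<open>Hyperbolic elements\<close>

definition hyperbolic :: "'e \<Rightarrow> bool" where
  "hyperbolic e \<longleftrightarrow> e \<in> carrier E \<and> (\<exists>y\<in>carrier E. axial (conj_by E y e))"

lemma L_conj_le: "\<lbrakk>x \<in> carrier E; y \<in> carrier E\<rbrakk> \<Longrightarrow> L (conj_by E y x) \<le> L x + 2 * L y"
  using L_mult_le[of "inv y \<otimes> x" y] L_mult_le[of "inv y" x] by (simp add: conj_by_def L_inv)

text \<open>Conjugation by \<open>y\<close> changes lengths by at most \<open>2 * L y\<close>,
  whereas the lengths of the powers of an axial element grow linearly. This separates hyperbolic
  from elliptic elements.\<close>

lemma hyperbolic_unbounded: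
  assumes "hyperbolic e" "\<And>k::nat. L (e [^] k) \<le> c" shows False
proof -
  from assms obtain y where y: "y \<in> carrier E" "axial (conj_by E y e)" and e: "e \<in> carrier E"
    by (auto simp: hyperbolic_def)
  define k where "k = Suc (c + 2 * L y)"
  have "k \<le> L (conj_by E y e [^] k)"
    using y(2) axial_L_pow[OF y(2), of k] by (simp add: axial_def)
  also have "\<dots> = L (conj_by E y (e [^] k))" using y e by (simp add: conj_by_pow)
  also have "\<dots> \<le> c + 2 * L y" using L_conj_le[of "e [^] k" y] assms(2)[of k] y e by simp
  finally show False by (simp add: k_def)
qed

lemma hyperbolic_conj: "x \<in> carrier E \<Longrightarrow> e \<in> carrier E \<Longrightarrow> hyperbolic (conj_by E x e) \<longleftrightarrow> hyperbolic e"
  unfolding hyperbolic_def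
  by (metis conj_by_closed conj_by_conj_by conj_by_inv_cancel(1) inv_closed m_closed)

lemma hyperbolic_int_pow:
  assumes "hyperbolic e" "k \<noteq> 0" shows "hyperbolic (e [^] (k::int))"
proof -
  from assms obtain y where y: "y \<in> carrier E" "axial (conj_by E y e)" and e: "e \<in> carrier E"
    by (auto simp: hyperbolic_def)
  let ?u = "conj_by E y e"
  have u: "?u \<in> carrier E" "0 < L ?u" using y by (auto simp: axial_def)
  have "int (L (?u [^] (2 * k))) = 2 * int (L (?u [^] k))" using axial_L_int_pow[OF y(2)] by (simp add: abs_mult)
  moreover have "?u [^] (2 * k) = ?u [^] k \<otimes> ?u [^] k" using int_pow_mult[of ?u k k] u by simp
  moreover have "L (?u [^] k) \<noteq> 0" using axial_L_int_pow[OF y(2), of k] u assms(2)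
    by (metis abs_eq_0 mult_eq_0_iff of_nat_eq_0_iff not_less_zero)
  ultimately have "axial (?u [^] k)" using u by (simp add: axial_def)
  then have "axial (conj_by E y (e [^] k))" using conj_by_int_pow y e by simp
  then show ?thesis using y e by (auto simp: hyperbolic_def)
qed

lemma hyperbolic_not_one: "hyperbolic e \<Longrightarrow> e \<noteq> \<one>"
  using hyperbolic_unbounded[of \<one> 0] by (auto simp: L_one)

end

text \<open>\<open>L x = 0\<close> says that \<open>x\<close> fixes the base vertex, and the second
  equation that it fixes the translate of this vertex by \<open>e\<close>. So a segment between two
  such vertices has trivial stabilizer as soon as \<open>L e\<close> is at least 2.\<close>

locale acylindrical_group = length_group +
  assumes acylindrical: "\<lbrakk>x \<in> carrier E; e \<in> carrier E; L x = 0; L (conj_by E e x) = 0; 2 \<le> L e\<rbrakk> \<Longrightarrow> x = \<one>"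
begin

text \<open>The position is a homomorphism from the centralizer to the integers. Its kernel consists
  of elements of length 0 that commute with \<open>u \<otimes> u\<close>, an element of length at
  least 2, so it is trivial by acylindricity. A generator is an element of least positive
  position.\<close>

lemma axial_centralizer_cyclic:
  assumes u: "axial u"
  shows "\<exists>z\<in>centralizer E u. centralizer E u = range (\<lambda>k::int. z [^] k)"
proof -
  have uE: "u \<in> carrier E" and n: "0 < int (L u)" using u by (auto simp: axial_def)
  interpret C: subgroup "centralizer E u" E using uE by (rule subgroup_centralizer)
  define p where "p x = (SOME m. pos_on u x m)" for x
  have p: "pos_on u x (p x)" if "x \<in> centralizer E u" for x
    unfolding p_def using pos_on_exists[OF u that] by (rule someI_ex)
  have p_eq: "p x = m" if "x \<in> centralizer E u" "pos_on u x m" for x m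
    using pos_on_d[OF u _ that(2) _ p[OF that(1)]] that(1) C.mem_carrier by simp
  have p_mult: "p (x \<otimes> y) = p x + p y" if "x \<in> centralizer E u" "y \<in> centralizer E u" for x y
    using that by (intro p_eq pos_on_mult u p) auto
  have p_one: "p \<one> = 0" using pos_on_one[OF u] by (intro p_eq) auto
  have p_inv: "p (inv x) = - p x" if "x \<in> centralizer E u" for x
    using p_mult[of x "inv x"] p_one that C.mem_carrier by simp
  have p_pow: "p (x [^] (k::nat)) = int k * p x" if "x \<in> centralizer E u" for x k
  proof (induction k)
    case (Suc k)
    have "x [^] k \<in> centralizer E u" using that C.mem_carrier by (induction k) auto
    then show ?case using Suc that by (simp add: p_mult algebra_simps)
  qed (simp add: p_one)
  have p_zero: "x = \<one>" if x: "x \<in> centralizer E u" "p x = 0" for x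
  proof -
    have xE: "x \<in> carrier E" using x(1) by auto
    have "d \<one> x = 0" using pos_on_d[OF u one_closed pos_on_one[OF u] xE p[OF x(1)]] x(2) by simp
    then have L0: "L x = 0" using xE by (simp add: d_one)
    have "conj_by E u x = x" using centralizerD(2)[OF x(1), symmetric] conj_by_fixed_iff[OF uE xE] by blast
    then have "conj_by E (u \<otimes> u) x = x" using uE xE by (simp add: conj_by_conj_by[symmetric])
    moreover have "2 \<le> L (u \<otimes> u)" using u by (auto simp: axial_def)
    ultimately show ?thesis using acylindrical[of x "u \<otimes> u"] L0 uE xE by simp
  qed
  have uC: "u \<in> centralizer E u" using uE unfolding centralizer_def by blast
  have pu: "p u = int (L u)" using pos_on_shift[OF u one_closed pos_on_one[OF u], of 1] uE by (intro p_eq uC) simp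
  define S where "S = {k. 0 < k \<and> (\<exists>x\<in>centralizer E u. p x = int k)}"
  have "L u \<in> S" using pu uC n by (auto simp: S_def)
  define k where "k = (LEAST k. k \<in> S)"
  have kS: "k \<in> S" and kmin: "\<And>j. j \<in> S \<Longrightarrow> k \<le> j"
    using \<open>L u \<in> S\<close> by (auto simp: k_def intro: LeastI Least_le)
  then obtain z where z: "z \<in> centralizer E u" "p z = int k" and k0: "0 < k" by (auto simp: S_def)
  have zpow: "z [^] (j::int) \<in> centralizer E u" "p (z [^] j) = j * int k" for j
  proof -
    have nat: "z [^] (i::nat) \<in> centralizer E u" for i using z(1) C.mem_carrier
      by (induction i) auto
    show "z [^] j \<in> centralizer E u" using nat z(1) C.mem_carrier
      by (cases j rule: int_cases2) (auto simp: int_pow_int int_pow_neg_int)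
    show "p (z [^] j) = j * int k" using nat z C.mem_carrier
      by (cases j rule: int_cases2) (auto simp: int_pow_int int_pow_neg_int p_pow p_inv)
  qed
  have "x \<in> range (\<lambda>k::int. z [^] k)" if x: "x \<in> centralizer E u" for x
  proof -
    define q where "q = p x div int k"
    define y where "y = x \<otimes> inv (z [^] q)"
    have y: "y \<in> centralizer E u" "p y = p x mod int k"
      using x zpow by (auto simp: y_def p_mult p_inv q_def minus_div_mult_eq_mod)
    have "p y = 0"
    proof (rule ccontr)
      assume "p y \<noteq> 0"
      moreover have "0 \<le> p y" "p y < int k" using y(2) k0 by auto
      ultimately have "nat (p y) \<in> S" using y(1) by (auto simp: S_def)
      from kmin[OF this] show False using \<open>p y < int k\<close> \<open>0 \<le> p y\<close> by linarith
    qed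
    then have "y = \<one>" using p_zero y by blast
    moreover have "x = y \<otimes> z [^] q" using C.mem_carrier[OF x] C.mem_carrier[OF zpow(1)] by (simp add: y_def m_assoc)
    ultimately have "x = z [^] q" using C.mem_carrier[OF zpow(1)] by simp
    then show ?thesis by blast
  qed
  then show ?thesis using z zpow by blast
qed

lemma hyperbolic_centralizer_cyclic:
  assumes v: "hyperbolic v"
  shows "\<exists>z\<in>carrier E. centralizer E v = range (\<lambda>k::int. z [^] k)"
proof -
  from v obtain y where y: "y \<in> carrier E" "axial (conj_by E y v)" and vE: "v \<in> carrier E"
    by (auto simp: hyperbolic_def)
  obtain z where z: "z \<in> centralizer E (conj_by E y v)"
    "centralizer E (conj_by E y v) = range (\<lambda>k::int. z [^] k)"
    using axial_centralizer_cyclic[OF y(2)] by blast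
  have zE: "z \<in> carrier E" using z by (simp add: centralizer_def)
  have "centralizer E v = conj_by E (inv y) ` centralizer E (conj_by E y v)"
    using centralizer_conj_by[of "inv y" "conj_by E y v"] y vE by simp
  also have "\<dots> = range (\<lambda>k::int. conj_by E (inv y) z [^] k)"
    using z(2) zE y by (auto simp: conj_by_int_pow image_image)
  finally show ?thesis using zE y by auto
qed

end

text \<open>What is needed of the normal forms. \<open>L\<close> counts the letters from outer
  groups in a reduced word: \<open>decompose\<close> splits off the first of them, and the last
  assumption says that a word t a s with outer letters t and s is reduced unless all three letters
  lie in one outer group.\<close>

locale star_length = length_group E L
  for E :: "('e, 'm) monoid_scheme" (structure) and L +
  fixes G :: "'e set" and I :: "'i set" and H :: "'i \<Rightarrow> 'e set"
  assumes subgroup_central: "subgroup G E"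
    and subgroup_outer: "i \<in> I \<Longrightarrow> subgroup (H i) E"
    and outer_comm: "\<lbrakk>i \<in> I; x \<in> H i; y \<in> H i\<rbrakk> \<Longrightarrow> x \<otimes> y = y \<otimes> x"
    and L_zero_iff: "x \<in> carrier E \<Longrightarrow> L x = 0 \<longleftrightarrow> x \<in> G"
    and L_outer: "\<lbrakk>i \<in> I; t \<in> H i; t \<notin> G\<rbrakk> \<Longrightarrow> L t = 1"
    and decompose: "\<lbrakk>e \<in> carrier E; 0 < L e\<rbrakk> \<Longrightarrow>
      \<exists>g\<in>G. \<exists>i\<in>I. \<exists>t\<in>H i - G. \<exists>e'\<in>carrier E. e = g \<otimes> t \<otimes> e' \<and> L e = Suc (L e')"
    and L_outer_central_outer: "\<lbrakk>i \<in> I; j \<in> I; t \<in> H i; t \<notin> G; s \<in> H j; s \<notin> G; a \<in> G; i \<noteq> j \<or> a \<notin> H i\<rbrakk>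
      \<Longrightarrow> L (t \<otimes> a \<otimes> s) = 2"
begin

lemma central_closed [simp]: "g \<in> G \<Longrightarrow> g \<in> carrier E"
  using subgroup_central subgroup.subset by blast

lemma outer_closed [simp]: "i \<in> I \<Longrightarrow> t \<in> H i \<Longrightarrow> t \<in> carrier E"
  using subgroup_outer subgroup.subset by blast

lemma L_central [simp]: "g \<in> G \<Longrightarrow> L g = 0"
  using L_zero_iff by simp

lemma central_inv: "g \<in> G \<Longrightarrow> inv g \<in> G"
  using subgroup_central subgroup.m_inv_closed by fast

lemma central_mult: "g \<in> G \<Longrightarrow> h \<in> G \<Longrightarrow> g \<otimes> h \<in> G"
  using subgroup_central subgroup.m_closed by fast

lemma outer_inv: "i \<in> I \<Longrightarrow> t \<in> H i \<Longrightarrow> inv t \<in> H i"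
  using subgroup_outer subgroup.m_inv_closed by fast

lemma outer_mult: "i \<in> I \<Longrightarrow> s \<in> H i \<Longrightarrow> t \<in> H i \<Longrightarrow> s \<otimes> t \<in> H i"
  using subgroup_outer subgroup.m_closed by fast

lemma inv_in_central_iff: "g \<in> carrier E \<Longrightarrow> inv g \<in> G \<longleftrightarrow> g \<in> G"
  using central_inv by (metis inv_inv)

lemma conj_central: "g \<in> G \<Longrightarrow> x \<in> G \<Longrightarrow> conj_by E g x \<in> G"
  unfolding conj_by_def by (intro central_mult central_inv)

lemma conj_outer: "i \<in> I \<Longrightarrow> t \<in> H i \<Longrightarrow> x \<in> H i \<Longrightarrow> conj_by E t x = x"
  by (subst conj_by_fixed_iff) (auto intro: outer_comm)

lemma L_mult_left_central: "g \<in> G \<Longrightarrow> x \<in> carrier E \<Longrightarrow> L (g \<otimes> x) = L x"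
  by (simp add: L_mult_left_zero)

lemma L_mult_right_central: "g \<in> G \<Longrightarrow> x \<in> carrier E \<Longrightarrow> L (x \<otimes> g) = L x"
  by (simp add: L_mult_right_zero)

lemma L_le_one_outer: "i \<in> I \<Longrightarrow> t \<in> H i \<Longrightarrow> L t \<le> 1"
  using L_outer[of i t] by (cases "t \<in> G") auto

lemma decomposeE:
  assumes "e \<in> carrier E" "0 < L e"
  obtains g i t e' where "g \<in> G" "i \<in> I" "t \<in> H i" "t \<notin> G" "e' \<in> carrier E" "e = g \<otimes> (t \<otimes> e')"
    "L e = Suc (L e')" "L (t \<otimes> e') = Suc (L e')"
proof -
  obtain g i t e' where *: "g \<in> G" "i \<in> I" "t \<in> H i" "t \<notin> G" "e' \<in> carrier E" "e = g \<otimes> t \<otimes> e'"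
    "L e = Suc (L e')" using decompose[OF assms] by blast
  then have "e = g \<otimes> (t \<otimes> e')" by (simp add: m_assoc)
  moreover from this have "L (t \<otimes> e') = Suc (L e')" using * L_mult_left_central[of g "t \<otimes> e'"] by simp
  ultimately show ?thesis using * that by blast
qed

lemma conj_by_mult_right:
  "\<lbrakk>x \<in> carrier E; y \<in> carrier E; z \<in> carrier E\<rbrakk> \<Longrightarrow> conj_by E (x \<otimes> y) z = conj_by E y (conj_by E x z)"
  by (simp add: conj_by_conj_by)

text \<open>A word that is reduced at the junctions of \<open>f\<^sup>-\<^sup>1\<close>, \<open>b\<close> and \<open>f\<close> has additive length.\<close>

lemma L_conj_extend:
  assumes i: "i \<in> I" and t: "t \<in> H i" "t \<notin> G" and f: "f \<in> carrier E" "L (t \<otimes> f) = Suc (L f)"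
    and b: "b \<in> carrier E" and bt: "L (b \<otimes> t) = Suc (L b)" and tbt: "L (conj_by E t b) = Suc (Suc (L b))"
  shows "L (conj_by E (t \<otimes> f) b) = 2 * L f + 2 + L b"
proof -
  have tE: "t \<in> carrier E" and Lt: "L t = 1" "L (inv t) = 1" using i t L_outer by (auto simp: L_inv)
  have "L (b \<otimes> t \<otimes> f) = L b + L t + L f" using b tE f bt Lt by (intro L_concat) auto
  then have 1: "L (b \<otimes> t \<otimes> f) = Suc (L b + L f)" using Lt by simp
  have "L (inv t \<otimes> b \<otimes> t \<otimes> f) = L (inv t \<otimes> b) + L t + L f"
  proof (rule L_concat)
    have "L (inv t \<otimes> b) \<le> Suc (L b)" using L_mult_le[of "inv t" b] tE b Lt by simp
    moreover have "L (inv t \<otimes> b \<otimes> t) \<le> L (inv t \<otimes> b) + 1" using L_mult_le[of "inv t \<otimes> b" t] tE b Lt by simp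
    ultimately show "L (inv t \<otimes> b \<otimes> t) = L (inv t \<otimes> b) + L t" using tbt Lt by (simp add: conj_by_def)
    then have "L (inv t \<otimes> b) = Suc (L b)" using tbt Lt by (simp add: conj_by_def)
  qed (use b tE f Lt in auto)
  moreover have "L (inv t \<otimes> b) = Suc (L b)"
    using L_mult_le[of "inv t \<otimes> b" t] L_mult_le[of "inv t" b] tE b Lt tbt by (simp add: conj_by_def)
  ultimately have 2: "L (inv t \<otimes> (b \<otimes> t \<otimes> f)) = L (inv t) + L (b \<otimes> t \<otimes> f)" using 1 Lt tE b f by (simp add: m_assoc)
  have "L (inv f \<otimes> inv t) = L (inv f) + L (inv t)"
    using f tE Lt L_inv[of "t \<otimes> f"] by (simp add: inv_mult_group L_inv)
  then have "L (inv f \<otimes> inv t \<otimes> (b \<otimes> t \<otimes> f)) = L (inv f) + L (inv t) + L (b \<otimes> t \<otimes> f)"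
    using 2 f tE b Lt by (intro L_concat) auto
  moreover have "conj_by E (t \<otimes> f) b = inv f \<otimes> inv t \<otimes> (b \<otimes> t \<otimes> f)"
    using f tE b by (simp add: conj_by_def inv_mult_group m_assoc)
  ultimately show ?thesis using 1 Lt f by (simp add: L_inv)
qed

text \<open>The junctions of \<open>r\<close>, \<open>g\<close>, \<open>t\<close> and of
  \<open>inv t\<close>, \<open>inv g\<close>, \<open>r\<close> are both reduced, and the two
  resulting words overlap in \<open>r\<close>.\<close>

lemma L_conj_outer_by_outer:
  assumes i: "i \<in> I" and j: "j \<in> I" and t: "t \<in> H i" "t \<notin> G" and r: "r \<in> H j" "r \<notin> G" and g: "g \<in> G"
    and ne: "i \<noteq> j \<or> g \<notin> H i"
  shows "L (conj_by E g r \<otimes> t) = 2" "L (conj_by E t (conj_by E g r)) = 3"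
proof -
  have E: "t \<in> carrier E" "r \<in> carrier E" "g \<in> carrier E" using i j t r g by auto
  have "L (r \<otimes> g \<otimes> t) = 2"
    using L_outer_central_outer[OF j i r t g] ne by auto
  moreover have *: "conj_by E g r \<otimes> t = inv g \<otimes> (r \<otimes> g \<otimes> t)" using E by (simp add: conj_by_def m_assoc)
  ultimately show 1: "L (conj_by E g r \<otimes> t) = 2" using E g by (simp add: L_mult_left_central central_inv)
  have "L (inv t \<otimes> inv g \<otimes> r) = 2"
    using L_outer_central_outer[OF i j, of "inv t" r "inv g"] i t r g ne outer_inv inv_in_central_iff central_inv E
    by (metis inv_inv outer_inv)
  moreover have "L (inv t \<otimes> inv g \<otimes> r \<otimes> (g \<otimes> t)) = L (inv t \<otimes> inv g) + L r + L (g \<otimes> t)"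
    using E i j g t r \<open>L (inv t \<otimes> inv g \<otimes> r) = 2\<close> \<open>L (r \<otimes> g \<otimes> t) = 2\<close>
    by (intro L_concat) (auto simp: L_outer L_inv L_mult_right_central L_mult_left_central central_inv m_assoc)
  moreover have "conj_by E t (conj_by E g r) = inv t \<otimes> inv g \<otimes> r \<otimes> (g \<otimes> t)"
    using E by (simp add: conj_by_def m_assoc)
  ultimately show "L (conj_by E t (conj_by E g r)) = 3"
    using E i j g t r by (simp add: L_outer L_inv L_mult_right_central L_mult_left_central central_inv)
qed

lemma conj_outer_short:
  assumes j: "j \<in> I" and r: "r \<in> H j" "r \<notin> G" and f: "f \<in> carrier E" and short: "L (conj_by E f r) \<le> 1"
  shows "\<exists>h\<in>H j. \<exists>g\<in>G. f = h \<otimes> g"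
  using f short
proof (induction "L f" arbitrary: f rule: less_induct)
  case less
  show ?case
  proof (cases "L f = 0")
    case True
    then have "f \<in> G" using less L_zero_iff by simp
    moreover have "f = \<one> \<otimes> f" "\<one> \<in> H j" using less subgroup_outer[OF j] by (auto intro: subgroup.one_closed)
    ultimately show ?thesis by blast
  next
    case False
    then obtain g i t f' where d: "g \<in> G" "i \<in> I" "t \<in> H i" "t \<notin> G" "f' \<in> carrier E" "f = g \<otimes> (t \<otimes> f')"
      "L f = Suc (L f')" "L (t \<otimes> f') = Suc (L f')" using less decomposeE by blast
    have E: "g \<in> carrier E" "t \<in> carrier E" "r \<in> carrier E" using d j r by auto
    show ?thesis
    proof (cases "i = j \<and> g \<in> H j")
      case True
      then have gt: "g \<otimes> t \<in> H j" using d outer_mult[OF j] by blast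
      have "conj_by E f r = conj_by E f' (conj_by E (g \<otimes> t) r)"
        using d E by (simp add: conj_by_conj_by m_assoc)
      also have "\<dots> = conj_by E f' r" using conj_outer[OF j gt r(1)] by simp
      finally obtain h g' where h: "h \<in> H j" "g' \<in> G" "f' = h \<otimes> g'"
        using less d by (metis lessI)
      then have "f = (g \<otimes> t \<otimes> h) \<otimes> g'" using d E h j by (simp add: m_assoc)
      moreover have "g \<otimes> t \<otimes> h \<in> H j" using gt h outer_mult[OF j] by blast
      ultimately show ?thesis using h by blast
    next
      case False
      note L = L_conj_outer_by_outer[OF d(2) j d(3,4) r d(1)]
      have "L (conj_by E g r) = 1"
        using L_outer[OF j r] E d by (simp add: conj_by_def L_mult_left_central L_mult_right_central central_inv)
      then have "L (conj_by E (t \<otimes> f') (conj_by E g r)) = 2 * L f' + 2 + 1"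
        using L_conj_extend[OF d(2,3,4,5,8), of "conj_by E g r"] L False E d by auto
      then have "L (conj_by E f r) \<ge> 3" using d E by (simp add: conj_by_conj_by)
      then show ?thesis using less by simp
    qed
  qed
qed

lemma conj_outer_not_central:
  assumes j: "j \<in> I" and r: "r \<in> H j" "r \<notin> G" and f: "f \<in> carrier E"
  shows "conj_by E f r \<notin> G"
proof
  assume c: "conj_by E f r \<in> G"
  then obtain h g where h: "h \<in> H j" "g \<in> G" "f = h \<otimes> g" using conj_outer_short[OF j r f] by auto
  then have "conj_by E f r = conj_by E g r"
    using conj_outer[OF j h(1) r(1)] r j by (simp add: conj_by_mult_right)
  then have "r \<in> G" using c h conj_central[of "inv g" "conj_by E g r"] central_inv j r by simp
  then show False using r by simp
qed

lemma conj_outer_in_outer: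
  assumes j: "j \<in> I" and r: "r \<in> H j" "r \<notin> G" and f: "f \<in> carrier E" and i: "i \<in> I" and c: "conj_by E f r \<in> H i"
  shows "i = j \<and> f \<in> H j"
proof -
  have "L (conj_by E f r) \<le> 1" using L_le_one_outer[OF i c] .
  then obtain h g where h: "h \<in> H j" "g \<in> G" "f = h \<otimes> g" using conj_outer_short[OF j r f] by auto
  have E: "h \<in> carrier E" "g \<in> carrier E" "r \<in> carrier E" using h j r by auto
  have eq: "conj_by E f r = conj_by E g r"
    using conj_outer[OF j h(1) r(1)] E h by (simp add: conj_by_mult_right)
  define s where "s = conj_by E g r"
  have s: "s \<in> H i" "s \<notin> G" using c eq conj_outer_not_central[OF j r E(2)] by (auto simp: s_def)
  have "i = j \<and> g \<in> H j"
  proof (rule ccontr)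
    assume "\<not> ?thesis"
    then have "L (r \<otimes> g \<otimes> inv s) = 2"
      using L_outer_central_outer[OF j i r _ _ h(2), of "inv s"] s outer_inv[OF i s(1)]
        inv_in_central_iff[OF outer_closed[OF i s(1)]] by blast
    \<comment> \<open>By the choice of \<open>s\<close>, the word that should have length 2 is just
      \<open>g\<close>.\<close>
    moreover have "r \<otimes> g \<otimes> inv s = g" using E by (simp add: s_def conj_by_def inv_mult_group m_assoc)
    ultimately show False using h by simp
  qed
  then show ?thesis using h outer_mult[OF j] by blast
qed

end

section \<open>Malnormal edge groups\<close>

locale malnormal_star = star_length E L G I H
  for E :: "('e, 'm) monoid_scheme" (structure) and L and G and I :: "'i set" and H +
  assumes malnormal: "\<lbrakk>i \<in> I; j \<in> I; c \<in> H i; c \<in> G; c \<noteq> \<one>; g \<in> G; conj_by E g c \<in> H j\<rbrakk> \<Longrightarrow> i = j \<and> g \<in> H i"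
begin

text \<open>The first outer letter \<open>t\<close> of \<open>f\<close> meets an element of
  \<open>G\<close>. Unless this element lies in the outer group of \<open>t\<close>, nothing cancels
  on either side and the conjugate is too long. If it does, \<open>t\<close> commutes with it and
  disappears, and a second outer letter would meet the same element; by malnormality both letters
  would belong to one outer group and could be merged, so \<open>f\<close> would be shorter than it
  is.\<close>

lemma conj_central_short:
  assumes a: "a \<in> G" "a \<noteq> \<one>" and f: "f \<in> carrier E" "0 < L f" and short: "L (conj_by E f a) \<le> 1"
  shows "\<exists>i\<in>I. \<exists>g\<in>G. \<exists>h\<in>H i. \<exists>g'\<in>G. f = g \<otimes> h \<otimes> g' \<and> conj_by E g a \<in> H i"
proof -
  have step: "conj_by E g b \<in> H i"
    if "b \<in> G" "g \<in> G" "i \<in> I" "t \<in> H i" "t \<notin> G" "e \<in> carrier E" "L (t \<otimes> e) = Suc (L e)"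
      "L (conj_by E (g \<otimes> (t \<otimes> e)) b) \<le> 1" for b g i t e
  proof (rule ccontr)
    assume n: "conj_by E g b \<notin> H i"
    let ?b = "conj_by E g b"
    have E: "g \<in> carrier E" "t \<in> carrier E" "b \<in> carrier E" using that by auto
    have bG: "?b \<in> G" using that conj_central by blast
    have "L (inv t \<otimes> ?b \<otimes> t) = 2"
      using L_outer_central_outer[OF that(3,3), of "inv t" t ?b] that n bG outer_inv inv_in_central_iff E by blast
    then have "L (conj_by E t ?b) = 2" by (simp add: conj_by_def)
    moreover have "L (?b \<otimes> t) = 1" using bG that L_outer E by (simp add: L_mult_left_central)
    ultimately have "L (conj_by E (t \<otimes> e) ?b) = 2 * L e + 2"
      using L_conj_extend[OF that(3,4,5,6,7), of ?b] bG by simp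
    then show False using that E by (simp add: conj_by_conj_by)
  qed
  obtain g i t f' where d: "g \<in> G" "i \<in> I" "t \<in> H i" "t \<notin> G" "f' \<in> carrier E" "f = g \<otimes> (t \<otimes> f')"
      "L f = Suc (L f')" "L (t \<otimes> f') = Suc (L f')" using f decomposeE by blast
  have E: "g \<in> carrier E" "t \<in> carrier E" "a \<in> carrier E" using d a by auto
  let ?a = "conj_by E g a"
  have a': "?a \<in> H i" "?a \<in> G" "?a \<noteq> \<one>"
    using step[OF a(1) d(1-5) d(8)] short d a conj_central E by auto
  have "f' \<in> G"
  proof (rule ccontr)
    assume "f' \<notin> G"
    then have "0 < L f'" using L_zero_iff d by auto
    then obtain g2 j t2 f2 where d2: "g2 \<in> G" "j \<in> I" "t2 \<in> H j" "t2 \<notin> G" "f2 \<in> carrier E" "f' = g2 \<otimes> (t2 \<otimes> f2)"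
      "L f' = Suc (L f2)" "L (t2 \<otimes> f2) = Suc (L f2)" using d decomposeE by blast
    have "conj_by E f a = conj_by E f' (conj_by E t ?a)" using E d by (simp add: conj_by_conj_by m_assoc)
    also have "\<dots> = conj_by E f' ?a" using conj_outer[OF d(2,3) a'(1)] by simp
    finally have "conj_by E g2 ?a \<in> H j" using step[OF a'(2) d2(1-5) d2(8)] short d2 by simp
    from malnormal[OF d(2) d2(2) a' d2(1) this] have "i = j" "g2 \<in> H i" by auto
    then have "t \<otimes> g2 \<otimes> t2 \<in> H i" using d d2 outer_mult by blast
    then have le1: "L (t \<otimes> g2 \<otimes> t2) \<le> 1" using L_le_one_outer d by blast
    have E2: "g2 \<in> carrier E" "t2 \<in> carrier E" using d2 by auto
    have "L (t \<otimes> f') \<le> L (t \<otimes> g2 \<otimes> t2) + L f2"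
      using L_mult_le[of "t \<otimes> g2 \<otimes> t2" f2] E E2 d d2 by (simp add: m_assoc)
    then show False using le1 d d2 by simp
  qed
  then have "f = g \<otimes> t \<otimes> f'" using d E by (simp add: m_assoc)
  then show ?thesis using d a' \<open>f' \<in> G\<close> by blast
qed

text \<open>By \<open>conj_central_short\<close>, an \<open>e\<close> that conjugates a nontrivial
  element of \<open>G\<close> into \<open>G\<close> has at most one outer letter.\<close>

sublocale acylindrical_group E L
proof
  fix x e assume x: "x \<in> carrier E" "L x = 0" and e: "e \<in> carrier E" "2 \<le> L e" and c: "L (conj_by E e x) = 0"
  show "x = \<one>"
  proof (rule ccontr)
    assume "x \<noteq> \<one>"
    then obtain i g h g' where *: "i \<in> I" "g \<in> G" "h \<in> H i" "g' \<in> G" "e = g \<otimes> h \<otimes> g'"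
      using conj_central_short[of x e] x e c L_zero_iff by auto
    then have "L e = L h" by (simp add: L_mult_right_central L_mult_left_central)
    then show False using L_le_one_outer[of i h] * e by simp
  qed
qed

text \<open>For \<open>t\<close> outside \<open>G\<close> this is
  \<open>conj_outer_in_outer\<close>, and likewise, after inverting the conjugation, if the
  conjugate is outside \<open>G\<close>. If both lie in \<open>G\<close>, then \<open>f\<close> is
  in \<open>G\<close> or a product \<open>g h g'\<close> with \<open>g\<close> and \<open>g'\<close>
  in \<open>G\<close>, and malnormality inside \<open>G\<close> puts every factor into
  \<open>H i\<close>.\<close>

lemma outer_conj_in_outer:
  assumes i: "i \<in> I" and j: "j \<in> I" and t: "t \<in> H i" "t \<noteq> \<one>" and f: "f \<in> carrier E" and c: "conj_by E f t \<in> H j"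
  shows "i = j \<and> f \<in> H i"
proof (cases "t \<in> G")
  case False
  then show ?thesis using conj_outer_in_outer[OF i t(1) False f j c] by auto
next
  case True
  have tE: "t \<in> carrier E" using True by simp
  show ?thesis
  proof (cases "conj_by E f t \<in> G")
    case False
    have "conj_by E (inv f) (conj_by E f t) \<in> H i" using t f tE by simp
    then have "i = j \<and> inv f \<in> H j" using conj_outer_in_outer[OF j c False inv_closed[OF f] i] by blast
    then show ?thesis using outer_inv[OF j] f by (metis inv_inv)
  next
    case fG: True
    show ?thesis
    proof (cases "L f = 0")
      case True
      then show ?thesis using malnormal[OF i j t(1) \<open>t \<in> G\<close> t(2) _ c] f L_zero_iff by blast
    next
      case False
      then obtain k g h g' where *: "k \<in> I" "g \<in> G" "h \<in> H k" "g' \<in> G" "f = g \<otimes> h \<otimes> g'" "conj_by E g t \<in> H k"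
        using conj_central_short[of t f] True t f fG by auto
      have E: "g \<in> carrier E" "h \<in> carrier E" "g' \<in> carrier E" using * by auto
      have k: "i = k" "g \<in> H i" using malnormal[OF i *(1) t(1) True t(2) *(2,6)] by auto
      then have gh: "g \<otimes> h \<in> H i" using * outer_mult by blast
      have "conj_by E f t = conj_by E g' t"
        using conj_outer[OF i gh t(1)] * E tE by (simp add: conj_by_mult_right)
      then have "conj_by E g' t \<in> H j" using c by simp
      then have "i = j" "g' \<in> H i" using malnormal[OF i j t(1) True t(2) *(4)] by auto
      then show ?thesis using gh * outer_mult[OF i] by blast
    qed
  qed
qed

lemma central_conj_in_central:
  assumes a: "a \<in> G" "a \<noteq> \<one>" and n: "\<And>i g. i \<in> I \<Longrightarrow> g \<in> G \<Longrightarrow> conj_by E g a \<notin> H i"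
    and f: "f \<in> carrier E" and c: "conj_by E f a \<in> G"
  shows "f \<in> G"
  using conj_central_short[OF a f] c n L_zero_iff[OF f] by fastforce

lemma central_conj_not_in_outer:
  assumes a: "a \<in> G" "a \<noteq> \<one>" and n: "\<And>i g. i \<in> I \<Longrightarrow> g \<in> G \<Longrightarrow> conj_by E g a \<notin> H i"
    and f: "f \<in> carrier E" and i: "i \<in> I"
  shows "conj_by E f a \<notin> H i"
proof
  assume c: "conj_by E f a \<in> H i"
  show False
  proof (cases "conj_by E f a \<in> G")
    case True
    then show False using central_conj_in_central[OF a n f] c n i by blast
  next
    case False
    have "conj_by E (inv f) (conj_by E f a) \<notin> G"
      using conj_outer_not_central[OF i c False] f by simp
    then show False using a f by simp
  qed
qed

section \<open>The dichotomy between elliptic and hyperbolic elements\<close>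

definition elliptic :: "'e \<Rightarrow> bool" where
  "elliptic e \<longleftrightarrow> e \<in> carrier E \<and> (\<exists>y\<in>carrier E. conj_by E y e \<in> G \<or> (\<exists>i\<in>I. conj_by E y e \<in> H i))"

lemma elliptic_conj: "x \<in> carrier E \<Longrightarrow> e \<in> carrier E \<Longrightarrow> elliptic (conj_by E x e) \<longleftrightarrow> elliptic e"
  unfolding elliptic_def
  by (metis conj_by_closed conj_by_conj_by conj_by_inv_cancel(1) inv_closed m_closed)

lemma elliptic_bounded:
  assumes "elliptic e" shows "\<exists>c. \<forall>k::nat. L (e [^] k) \<le> c"
proof -
  from assms obtain y where e: "e \<in> carrier E" and y: "y \<in> carrier E"
    "conj_by E y e \<in> G \<or> (\<exists>i\<in>I. conj_by E y e \<in> H i)" by (auto simp: elliptic_def)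
  let ?f = "conj_by E y e"
  have pow: "?f [^] (k::nat) \<in> S" if "subgroup S E" "?f \<in> S" for S k
    using that y e by (induction k) (auto intro: subgroup.one_closed subgroup.m_closed)
  have short: "L (?f [^] (k::nat)) \<le> 1" for k
    using y(2) pow[of _ k] subgroup_central subgroup_outer L_le_one_outer L_central
    by (metis le_numeral_extra(4) zero_le_one)
  have "L (e [^] (k::nat)) \<le> 1 + 2 * L y" for k
  proof -
    have "L (conj_by E (inv y) (?f [^] k)) \<le> L (?f [^] k) + 2 * L (inv y)"
      using y e by (intro L_conj_le) auto
    moreover have "conj_by E (inv y) (?f [^] k) = e [^] k" using y e by (simp add: conj_by_pow)
    ultimately show ?thesis using short[of k] y by (simp add: L_inv)
  qed
  then show ?thesis by blast
qed

lemma elliptic_not_hyperbolic: "elliptic e \<Longrightarrow> \<not> hyperbolic e"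
  using elliptic_bounded hyperbolic_unbounded by blast

text \<open>Take a conjugate of least length and rotate it so that it starts with an outer letter
  \<open>t\<close>. If it has further outer letters and the last one could be merged with
  \<open>t\<close>, another rotation would shorten it; so its square is reduced and it is axial.
  With \<open>t\<close> as the only outer letter, merging means that the conjugate lies in
  \<open>H i\<close>.\<close>

lemma elliptic_or_hyperbolic:
  assumes e: "e \<in> carrier E" shows "elliptic e \<or> hyperbolic e"
proof -
  define n where "n = (LEAST n. \<exists>y\<in>carrier E. L (conj_by E y e) = n)"
  have "\<exists>y\<in>carrier E. L (conj_by E y e) = n"
    unfolding n_def by (rule LeastI_ex) (use one_closed in blast)
  then obtain y where y: "y \<in> carrier E" "L (conj_by E y e) = n" by blast
  have min: "n \<le> L (conj_by E x e)" if "x \<in> carrier E" for x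
    unfolding n_def by (rule Least_le) (use that in blast)
  show ?thesis
  proof (cases "n = 0")
    case True
    then show ?thesis using y e L_zero_iff[of "conj_by E y e"] by (auto simp: elliptic_def)
  next
    case False
    then obtain g i t f' where d: "g \<in> G" "i \<in> I" "t \<in> H i" "t \<notin> G" "f' \<in> carrier E"
        "conj_by E y e = g \<otimes> (t \<otimes> f')" "n = Suc (L f')" "L (t \<otimes> f') = Suc (L f')"
      using decomposeE[of "conj_by E y e"] y e by (metis conj_by_closed gr0I)
    \<comment> \<open>The central letter in front is moved to the end, which amounts to conjugating
      by \<open>g\<close>.\<close>
    define z where "z = f' \<otimes> g"
    have E: "g \<in> carrier E" "t \<in> carrier E" and z: "z \<in> carrier E" "L z = L f'"
      using d by (auto simp: z_def L_mult_right_central)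
    define f where "f = t \<otimes> z"
    have f: "f \<in> carrier E" "f = conj_by E (y \<otimes> g) e"
      using E z y e d conj_by_conj_by[of g y e, symmetric] by (auto simp: f_def z_def conj_by_def m_assoc)
    have Lf: "L f = n" using d E L_mult_right_central[of g "t \<otimes> f'"] by (simp add: f_def z_def m_assoc)
    have Lt: "L t = 1" using L_outer d by simp
    have red: "elliptic e \<or> hyperbolic e" if "elliptic f \<or> axial f"
      using that f y E e elliptic_conj[of "y \<otimes> g" e] by (auto simp: hyperbolic_def)
    show ?thesis
    proof (cases "L z = 0")
      case True
      then have zG: "z \<in> G" using L_zero_iff z by simp
      show ?thesis
      proof (cases "z \<in> H i")
        case True
        then have "f \<in> H i" using d outer_mult by (simp add: f_def)
        then have "conj_by E \<one> f \<in> H i" using f by simp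
        then have "elliptic f" using f d unfolding elliptic_def by blast
        then show ?thesis using red by blast
      next
        case False
        have "L (t \<otimes> z \<otimes> t) = 2" using L_outer_central_outer[OF d(2,2) d(3,4,3,4) zG] False by blast
        then have "L (t \<otimes> z \<otimes> t \<otimes> z) = 2" using L_mult_right_central[OF zG, of "t \<otimes> z \<otimes> t"] E z by simp
        moreover have "f \<otimes> f = t \<otimes> z \<otimes> t \<otimes> z" using E z by (simp add: f_def m_assoc)
        ultimately have "axial f" using Lf f(1) d(7) z True by (simp add: axial_def)
        then show ?thesis using red by blast
      qed
    next
      case False
      \<comment> \<open>Decomposing the inverse of \<open>z\<close> exhibits the last outer letter
        of \<open>z\<close>.\<close>
      then obtain a j s y0 where b: "a \<in> G" "j \<in> I" "s \<in> H j" "s \<notin> G" "y0 \<in> carrier E"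
        "inv z = a \<otimes> (s \<otimes> y0)" "L (inv z) = Suc (L y0)"
        using decomposeE[of "inv z"] z L_inv by (metis gr0I inv_closed)
      define y' s' a' where "y' = inv y0" and "s' = inv s" and "a' = inv a"
      have b': "y' \<in> carrier E" "s' \<in> H j" "s' \<notin> G" "a' \<in> G" "s' \<in> carrier E" "a' \<in> carrier E" "L y' = L y0"
        using b outer_inv central_inv inv_in_central_iff by (auto simp: y'_def s'_def a'_def L_inv)
      have zeq: "z = y' \<otimes> s' \<otimes> a'"
        using b b' z by (metis inv_inv inv_mult_group outer_closed central_closed m_closed y'_def s'_def a'_def)
      have Lz: "L z = Suc (L y')" using b(7) b'(7) L_inv[OF z(1)] by linarith
      have Ls: "L s' = 1" using L_outer b b' by simp
      show ?thesis
      proof (cases "j = i \<and> a' \<in> H i")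
        case True
        \<comment> \<open>The last letter, moved to the front, merges with \<open>t\<close>, and
          this conjugate is shorter than the minimum \<open>n\<close>.\<close>
        then have "s' \<otimes> a' \<otimes> t \<in> H i" using b' d outer_mult by blast
        then have "L (s' \<otimes> a' \<otimes> t \<otimes> y') \<le> 1 + L y'"
          using L_le_one_outer[OF d(2)] L_mult_le[of "s' \<otimes> a' \<otimes> t" y'] b' E by (meson add_le_mono1 le_trans m_closed)
        moreover have "s' \<otimes> a' \<otimes> t \<otimes> y' = conj_by E (t \<otimes> y') f"
          using E b' by (simp add: f_def zeq conj_by_def inv_mult_group m_assoc)
        then have "s' \<otimes> a' \<otimes> t \<otimes> y' = conj_by E ((y \<otimes> g) \<otimes> (t \<otimes> y')) e"
          using f E b' y e by (simp add: conj_by_conj_by)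
        ultimately have "n \<le> 1 + L y'" using min[of "(y \<otimes> g) \<otimes> (t \<otimes> y')"] y E b' by simp
        then show ?thesis using d z Lz by simp
      next
        case False
        have sat: "L (s' \<otimes> a' \<otimes> t) = 2"
          using L_outer_central_outer[OF b(2) d(2) b'(2,3) d(3,4) b'(4)] False by blast
        have ftys: "L (t \<otimes> y' \<otimes> s') = n"
          using Lf L_mult_right_central[of a' "t \<otimes> y' \<otimes> s'"] E b' by (simp add: f_def zeq m_assoc)
        have "L (t \<otimes> y' \<otimes> s') \<le> L (t \<otimes> y') + L s'" "L (t \<otimes> y') \<le> L t + L y'"
          using L_mult_le E b' by blast+
        then have Lty: "L (t \<otimes> y') = Suc (L y')" using ftys d z Lz Ls Lt by simp
        have Lat: "L (a' \<otimes> t) = 1" using L_mult_left_central[OF b'(4) E(2)] Lt by simp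
        have "L (s' \<otimes> (a' \<otimes> t)) = 2" using sat E b' by (simp add: m_assoc)
        moreover have "n = Suc (Suc (L y'))" using d z Lz by simp
        ultimately have "L (t \<otimes> y' \<otimes> s' \<otimes> (a' \<otimes> t)) = L (t \<otimes> y') + L s' + L (a' \<otimes> t)"
          using E b' ftys Lty Ls Lat by (intro L_concat) simp_all
        then have fat: "L (f \<otimes> t) = n + 1"
          using E b' Lty Ls Lt Lz z d by (simp add: f_def zeq m_assoc L_mult_left_central)
        have "L (f \<otimes> t \<otimes> z) = L f + L t + L z"
          using fat f E z Lf Lt d by (intro L_concat) (auto simp: f_def[symmetric])
        moreover have "f \<otimes> f = f \<otimes> t \<otimes> z" using E z by (simp add: f_def m_assoc)
        ultimately have "axial f" using Lf Lt z(2) d(7) f(1) by (simp add: axial_def)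
        then show ?thesis using red by blast
      qed
    qed
  qed
qed

end

section \<open>Centralizers and the CSA property in the star\<close>

locale csa_star = malnormal_star E L G I H
  for E :: "('e, 'm) monoid_scheme" (structure) and L and G and I :: "'i set" and H +
  assumes central_ct: "\<lbrakk>v \<in> G; v \<noteq> \<one>; x \<in> G; y \<in> G; x \<otimes> v = v \<otimes> x; y \<otimes> v = v \<otimes> y\<rbrakk> \<Longrightarrow> x \<otimes> y = y \<otimes> x"
    and central_cc: "\<lbrakk>v \<in> G; v \<noteq> \<one>; x \<in> G; conj_by E x v \<otimes> v = v \<otimes> conj_by E x v\<rbrakk> \<Longrightarrow> x \<otimes> v = v \<otimes> x"
begin

lemma elliptic_cases:
  assumes "elliptic v" "v \<noteq> \<one>"
  obtains (outer) z i where "z \<in> carrier E" "i \<in> I" "conj_by E z v \<in> H i"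
  | (central) z where "z \<in> carrier E" "conj_by E z v \<in> G"
      "\<And>i g. i \<in> I \<Longrightarrow> g \<in> carrier E \<Longrightarrow> conj_by E g (conj_by E z v) \<notin> H i"
proof -
  from assms obtain y where v: "v \<in> carrier E" and y: "y \<in> carrier E"
    "conj_by E y v \<in> G \<or> (\<exists>i\<in>I. conj_by E y v \<in> H i)" by (auto simp: elliptic_def)
  show ?thesis
  proof (cases "\<exists>i\<in>I. \<exists>g\<in>carrier E. conj_by E g (conj_by E y v) \<in> H i")
    case True
    then obtain i g where "i \<in> I" "g \<in> carrier E" "conj_by E (y \<otimes> g) v \<in> H i"
      using v y(1) by (auto simp: conj_by_conj_by)
    then show ?thesis using outer[of "y \<otimes> g" i] y by simp
  next
    case False
    moreover have "conj_by E \<one> (conj_by E y v) = conj_by E y v" using v y by simp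
    ultimately have "conj_by E y v \<in> G" using y(2) one_closed by metis
    then show ?thesis using central[of y] y False by blast
  qed
qed

lemma centralizer_outer:
  assumes "i \<in> I" "a \<in> H i" "a \<noteq> \<one>" shows "centralizer E a = H i"
proof
  show "H i \<subseteq> centralizer E a" using assms outer_comm unfolding centralizer_def by auto
  show "centralizer E a \<subseteq> H i"
  proof
    fix x assume x: "x \<in> centralizer E a"
    then have "conj_by E x a = a"
      using centralizerD[OF x] assms conj_by_fixed_iff by simp
    then show "x \<in> H i" using outer_conj_in_outer[OF assms(1,1,2,3)] centralizerD(1)[OF x] assms by auto
  qed
qed

lemma centralizer_central:
  assumes "a \<in> G" "a \<noteq> \<one>" "\<And>i g. i \<in> I \<Longrightarrow> g \<in> carrier E \<Longrightarrow> conj_by E g a \<notin> H i"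
  shows "centralizer E a \<subseteq> G"
proof
  fix x assume x: "x \<in> centralizer E a"
  then have "conj_by E x a = a"
    using centralizerD[OF x] assms conj_by_fixed_iff by simp
  then show "x \<in> G"
    using central_conj_in_central[OF assms(1,2) _ centralizerD(1)[OF x]] assms by auto
qed

text \<open>\<open>v\<close> and \<open>w\<close> are powers z^a and z^b with b nonzero, so w^a =
  v^b is hyperbolic. Powers of elliptic elements are elliptic, hence \<open>w\<close> is hyperbolic;
  its centralizer is then cyclic too, and elements of an abelian centralizer commute.\<close>

lemma hyperbolic_centralizer_eq:
  assumes v: "hyperbolic v" and w: "w \<in> centralizer E v" "w \<noteq> \<one>"
  shows "hyperbolic w \<and> centralizer E w = centralizer E v"
proof -
  have com: "x \<otimes> y = y \<otimes> x" if u: "hyperbolic u" and xy: "x \<in> centralizer E u" "y \<in> centralizer E u" for u x y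
  proof -
    obtain z where "z \<in> carrier E" "centralizer E u = range (\<lambda>k::int. z [^] k)"
      using hyperbolic_centralizer_cyclic[OF u] by blast
    then show ?thesis using xy by (auto simp: int_pow_mult[symmetric] add.commute)
  qed
  have vE: "v \<in> carrier E" using v by (simp add: hyperbolic_def)
  have wE: "w \<in> carrier E" using w centralizerD by blast
  obtain z where z: "z \<in> carrier E" "centralizer E v = range (\<lambda>k::int. z [^] k)"
    using hyperbolic_centralizer_cyclic[OF v] by blast
  have "v \<in> centralizer E v" using vE unfolding centralizer_def by simp
  then obtain a b :: int where ab: "v = z [^] a" "w = z [^] b" using z w by auto
  have "b \<noteq> 0" using ab w by auto
  have "w [^] a = v [^] b" using ab z by (simp add: int_pow_pow mult.commute)
  then have h: "hyperbolic (w [^] a)" using hyperbolic_int_pow[OF v \<open>b \<noteq> 0\<close>] by simp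
  have hw: "hyperbolic w"
  proof (rule ccontr)
    assume "\<not> hyperbolic w"
    then have ell: "elliptic w" using elliptic_or_hyperbolic wE by blast
    then obtain y where y: "y \<in> carrier E" "conj_by E y w \<in> G \<or> (\<exists>i\<in>I. conj_by E y w \<in> H i)"
      by (auto simp: elliptic_def)
    have "conj_by E y (w [^] a) \<in> S" if "subgroup S E" "conj_by E y w \<in> S" for S
      using subgroup_int_pow_closed[OF that(1) that(2), of a] y wE by (simp add: conj_by_int_pow)
    then have "elliptic (w [^] a)"
      using y subgroup_central subgroup_outer wE unfolding elliptic_def by (metis int_pow_closed)
    then show False using h elliptic_not_hyperbolic by blast
  qed
  moreover have "centralizer E w = centralizer E v"
  proof
    show "centralizer E v \<subseteq> centralizer E w" using com[OF v _ w(1)] centralizerD(1) unfolding centralizer_def by blast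
    have "v \<in> centralizer E w" using w(1) vE unfolding centralizer_def by auto
    then show "centralizer E w \<subseteq> centralizer E v" using com[OF hw] centralizerD(1) unfolding centralizer_def by blast
  qed
  ultimately show ?thesis by blast
qed

lemma commutation_transitive_star: "commutation_transitive E"
  unfolding commutation_transitive_def
proof (intro ballI)
  fix v x y assume v: "v \<in> carrier E - {\<one>}" and xy: "x \<in> centralizer E v" "y \<in> centralizer E v"
  have E: "v \<in> carrier E" "x \<in> carrier E" "y \<in> carrier E" using v xy centralizerD by auto
  show "x \<otimes> y = y \<otimes> x"
  proof (cases "hyperbolic v")
    case True
    then obtain z where "z \<in> carrier E" "centralizer E v = range (\<lambda>k::int. z [^] k)"
      using hyperbolic_centralizer_cyclic by blast
    then show ?thesis using xy by (auto simp: int_pow_mult[symmetric] add.commute)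
  next
    case False
    then have ell: "elliptic v" "v \<noteq> \<one>" using elliptic_or_hyperbolic E v by auto
    have conj: "conj_by E z x \<in> centralizer E (conj_by E z v)" "conj_by E z y \<in> centralizer E (conj_by E z v)"
      "conj_by E z v \<noteq> \<one>" if "z \<in> carrier E" for z
      using that xy v centralizer_conj_by by auto
    from ell show ?thesis
    proof (cases rule: elliptic_cases)
      case (outer z i)
      then have "conj_by E z x \<otimes> conj_by E z y = conj_by E z y \<otimes> conj_by E z x"
        using conj[of z] centralizer_outer[of i "conj_by E z v"] outer_comm[of i] by auto
      then show ?thesis using conj_by_commute E outer by blast
    next
      case (central z)
      have "centralizer E (conj_by E z v) \<subseteq> G"
        using centralizer_central[of "conj_by E z v"] central conj by blast
      then have "conj_by E z x \<in> G" "conj_by E z y \<in> G" using conj[OF central(1)] by auto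
      then have "conj_by E z x \<otimes> conj_by E z y = conj_by E z y \<otimes> conj_by E z x"
        using central_ct[OF central(2) conj(3)[OF central(1)] _ _ centralizerD(2)[OF conj(1)[OF central(1)]]
          centralizerD(2)[OF conj(2)[OF central(1)]]] by blast
      then show ?thesis using conj_by_commute E central by blast
    qed
  qed
qed

text \<open>Conjugate \<open>v\<close> into a vertex group. Its centralizer there is
  \<open>H i\<close> or lies in \<open>G\<close>, and malnormality, respectively the corresponding
  property of \<open>G\<close>, brings the conjugate of \<open>x\<close> into it.\<close>

lemma elliptic_commuting_conj:
  assumes v: "elliptic v" "v \<noteq> \<one>" and x: "x \<in> carrier E" and c: "conj_by E x v \<in> centralizer E v"
  shows "x \<in> centralizer E v"
proof -
  have E: "v \<in> carrier E" using v by (simp add: elliptic_def)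
  have conj: "conj_by E (conj_by E z x) (conj_by E z v) \<in> centralizer E (conj_by E z v)"
    "conj_by E z v \<noteq> \<one>" "conj_by E z v \<in> carrier E" "conj_by E z x \<in> carrier E" if "z \<in> carrier E" for z
  proof -
    have "conj_by E (conj_by E z x) (conj_by E z v) = conj_by E z (conj_by E x v)"
      using that x E by (simp add: conj_by_def m_assoc inv_mult_group)
    then show "conj_by E (conj_by E z x) (conj_by E z v) \<in> centralizer E (conj_by E z v)"
      using that c E centralizer_conj_by by auto
  qed (use that v x E in auto)
  have pull: "x \<in> centralizer E v"
    if "z \<in> carrier E" "conj_by E z x \<in> centralizer E (conj_by E z v)" for z
  proof -
    have "conj_by E z x \<in> conj_by E z ` centralizer E v" using centralizer_conj_by that E by simp
    then obtain y where "y \<in> centralizer E v" "conj_by E z x = conj_by E z y" by blast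
    then show ?thesis using conj_by_inj[OF that(1) x] centralizerD(1) by auto
  qed
  from v show ?thesis
  proof (cases rule: elliptic_cases)
    case (outer z i)
    have C: "centralizer E (conj_by E z v) = H i" using centralizer_outer outer conj by blast
    then have "conj_by E z x \<in> H i"
      using outer_conj_in_outer[OF outer(2,2,3)] conj[OF outer(1)] by blast
    then show ?thesis using pull outer(1) C by blast
  next
    case (central z)
    have C: "centralizer E (conj_by E z v) \<subseteq> G" using centralizer_central central conj by blast
    then have "conj_by E z x \<in> G"
      using central_conj_in_central[OF central(2) conj(2)[OF central(1)] _ conj(4)[OF central(1)]]
        central(3) central_closed subsetD[OF C conj(1)[OF central(1)]] by blast
    then have "conj_by E z x \<otimes> conj_by E z v = conj_by E z v \<otimes> conj_by E z x"
      using central_cc[of "conj_by E z v"] central conj[OF central(1)] centralizerD(2) by blast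
    then show ?thesis using pull[OF central(1)] conj[OF central(1)] unfolding centralizer_def by blast
  qed
qed

text \<open>An automorphism of the infinite cyclic centralizer of a hyperbolic element is \<open>\<plusminus>1\<close>; when it is
  induced by conjugation with an element outside, that element is an involution.\<close>

lemma hyperbolic_commuting_conj:
  assumes v: "hyperbolic v" and y: "y \<in> carrier E" "conj_by E y v \<in> centralizer E v" "y \<notin> centralizer E v"
  obtains z where "hyperbolic z" "centralizer E v = range (\<lambda>k::int. z [^] k)" "conj_by E y z = inv z"
    "y \<noteq> \<one>" "y \<otimes> y = \<one>"
proof -
  have vE: "v \<in> carrier E" and v1: "v \<noteq> \<one>" using v hyperbolic_not_one by (auto simp: hyperbolic_def)
  have vC: "v \<in> centralizer E v" using vE unfolding centralizer_def by simp
  obtain z where z: "z \<in> carrier E" "centralizer E v = range (\<lambda>k::int. z [^] k)"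
    using hyperbolic_centralizer_cyclic[OF v] by blast
  have zC: "z \<in> centralizer E v" using z(2) int_pow_1[OF z(1)] by (metis rangeI)
  have "z \<noteq> \<one>" using z(2) vC v1 by auto
  then have hz: "hyperbolic z" and Cz: "centralizer E z = centralizer E v"
    using hyperbolic_centralizer_eq[OF v zC] by auto
  have inj: "i = j" if "z [^] i = z [^] j" for i j :: int
  proof (rule ccontr)
    assume "i \<noteq> j"
    then have "hyperbolic (z [^] (i - j))" using hyperbolic_int_pow[OF hz] by simp
    moreover have "z [^] (i - j) = \<one>" using that z by (simp add: int_pow_diff)
    ultimately show False using hyperbolic_not_one by blast
  qed
  have pres: "conj_by E y ` centralizer E v = centralizer E v"
  proof -
    have "conj_by E y v \<noteq> \<one>" using y vE v1 by simp
    then have "centralizer E (conj_by E y v) = centralizer E v"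
      using hyperbolic_centralizer_eq[OF v y(2)] by blast
    then show ?thesis using centralizer_conj_by y vE by simp
  qed
  \<comment> \<open>The exponent a describes the automorphism of the infinite cyclic group induced
    by \<open>y\<close>, and b its inverse, so their product is 1.\<close>
  obtain a where a: "conj_by E y z = z [^] (a::int)" using pres zC z(2) by blast
  obtain b where b: "z = conj_by E y (z [^] (b::int))" using pres zC z(2) by (metis imageE rangeE)
  have "conj_by E y (z [^] b) = (z [^] a) [^] b" using conj_by_int_pow[OF y(1) z(1)] a by simp
  then have "z = (z [^] a) [^] b" by (rule HOL.trans[OF b])
  then have "z [^] (a * b) = z [^] (1::int)" using int_pow_pow[OF z(1), of a b] int_pow_1[OF z(1)] by argo
  then have "a * b = 1" using inj by blast
  then have "a = 1 \<or> a = -1" using pos_zmult_eq_1_iff_lemma by (auto simp: zmult_eq_1_iff)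
  moreover have "a \<noteq> 1"
  proof
    assume "a = 1"
    then have "conj_by E y z = z" using a z by simp
    then have "y \<in> centralizer E z" using y z conj_by_fixed_iff unfolding centralizer_def by blast
    then show False using Cz y by blast
  qed
  ultimately have yz: "conj_by E y z = inv z" using a z by (simp add: int_pow_neg)
  have "conj_by E (y \<otimes> y) z = z" using y z yz by (simp add: conj_by_conj_by[symmetric] conj_by_inv)
  then have "y \<otimes> y \<in> centralizer E z" using y z conj_by_fixed_iff[of "y \<otimes> y" z] unfolding centralizer_def by simp
  \<comment> \<open>The square of \<open>y\<close> is a power of \<open>z\<close> that is both fixed
    and inverted by conjugation with \<open>y\<close>, so its exponent is 0.\<close>
  then obtain k where k: "y \<otimes> y = z [^] (k::int)" using Cz z by auto
  have "conj_by E y (y \<otimes> y) = y \<otimes> y" using y by (simp add: conj_by_def m_assoc)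
  then have "z [^] (- k) = z [^] k"
    using k yz y z by (simp add: conj_by_int_pow int_pow_inv int_pow_neg)
  then have "k = 0" using inj by fastforce
  then have "y \<otimes> y = \<one>" using k by simp
  moreover have "y \<noteq> \<one>" using y vE unfolding centralizer_def by auto
  ultimately show ?thesis using that hz z(2) yz by blast
qed

text \<open>The powers of an involution have bounded length, so it is not hyperbolic and lies, up to
  conjugation, in a vertex group.\<close>

lemma no_involutions_star:
  assumes "\<And>g. g \<in> G \<Longrightarrow> g \<otimes> g = \<one> \<Longrightarrow> g = \<one>" "\<And>i t. i \<in> I \<Longrightarrow> t \<in> H i \<Longrightarrow> t \<otimes> t = \<one> \<Longrightarrow> t = \<one>"
  shows "no_involutions E"
  unfolding no_involutions_def
proof (intro ballI impI)
  fix t assume t: "t \<in> carrier E" "t \<otimes> t = \<one>"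
  have pow: "t [^] (k::nat) \<in> {\<one>, t}" for k using t by (induction k) auto
  have "L (t [^] (k::nat)) \<le> L t" for k using pow[of k] L_one by auto
  then have "\<not> hyperbolic t" using hyperbolic_unbounded by blast
  then obtain y where y: "y \<in> carrier E" "conj_by E y t \<in> G \<or> (\<exists>i\<in>I. conj_by E y t \<in> H i)"
    using elliptic_or_hyperbolic[OF t(1)] unfolding elliptic_def by blast
  have "conj_by E y t \<otimes> conj_by E y t = \<one>" using t y by (simp add: conj_by_mult[symmetric])
  then have "conj_by E y t = \<one>" using y assms by blast
  then show "t = \<one>" using y t by simp
qed

lemma commuting_conj_trivial_star:
  assumes "no_involutions E" shows "commuting_conj_trivial E"
  unfolding commuting_conj_trivial_def
proof (intro ballI impI)
  fix v x assume v: "v \<in> carrier E - {\<one>}" and x: "x \<in> carrier E" "conj_by E x v \<in> centralizer E v"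
  show "x \<in> centralizer E v"
  proof (cases "hyperbolic v")
    case True
    then show ?thesis using hyperbolic_commuting_conj[OF True x] assms x unfolding no_involutions_def by metis
  next
    case False
    then show ?thesis using elliptic_commuting_conj elliptic_or_hyperbolic v x by blast
  qed
qed

end

section \<open>Normal forms in a star of groups\<close>

locale star_of_groups = G: group G for G :: "('g, 'm) monoid_scheme" +
  fixes I :: "'i set" and H :: "'i \<Rightarrow> ('h, 'k) monoid_scheme" and C :: "'i \<Rightarrow> 'g set" and \<phi> :: "'i \<Rightarrow> 'g \<Rightarrow> 'h"
  assumes group_outer: "i \<in> I \<Longrightarrow> group (H i)"
    and subgroup_edge: "i \<in> I \<Longrightarrow> subgroup (C i) G"
    and edge_hom: "i \<in> I \<Longrightarrow> \<phi> i \<in> hom (G\<lparr>carrier := C i\<rparr>) (H i)"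
begin

abbreviation "R \<equiv> star_rel G I H C \<phi>"
abbreviation "S \<equiv> star_group G I H C \<phi>"

lemma edge_closed [simp]: "i \<in> I \<Longrightarrow> c \<in> C i \<Longrightarrow> c \<in> carrier G"
  using subgroup_edge subgroup.subset by blast

lemma edge_map_closed [simp]: "i \<in> I \<Longrightarrow> c \<in> C i \<Longrightarrow> \<phi> i c \<in> carrier (H i)"
  using edge_hom by (force simp: hom_def)

lemma edge_map_mult: "i \<in> I \<Longrightarrow> c \<in> C i \<Longrightarrow> c' \<in> C i \<Longrightarrow> \<phi> i (c \<otimes>\<^bsub>G\<^esub> c') = \<phi> i c \<otimes>\<^bsub>H i\<^esub> \<phi> i c'"
  using edge_hom by (force simp: hom_def)

lemma star_rel_words: "(v, w) \<in> R \<Longrightarrow> v \<in> star_words G I H \<and> w \<in> star_words G I H"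
proof (induction rule: star_rel.induct)
  case (outer_one i)
  then show ?case using group.is_monoid[OF group_outer] by (auto simp: star_words_def monoid.one_closed)
next
  case (outer_mult i s t)
  then show ?case using group.is_monoid[OF group_outer] by (auto simp: star_words_def monoid.m_closed)
qed (auto simp: star_words_def)

lemma equiv_star_rel: "equiv (star_words G I H) R"
proof (rule equivI)
  show "R \<subseteq> star_words G I H \<times> star_words G I H" using star_rel_words by auto
  show "refl_on (star_words G I H) R" using star_rel_words by (auto simp: refl_on_def intro: star_rel.refl)
  show "Relation.sym R" by (auto simp: Relation.sym_def intro: star_rel.sym)
  show "Relation.trans R" by (auto simp: Relation.trans_def intro: star_rel.trans)
qed

definition cls where "cls w = R `` {w}"

lemma cls_eq_iff: "v \<in> star_words G I H \<Longrightarrow> w \<in> star_words G I H \<Longrightarrow> cls v = cls w \<longleftrightarrow> (v, w) \<in> R"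
  unfolding cls_def using equiv_star_rel eq_equiv_class_iff by fastforce

lemma cls_eqI: "(v, w) \<in> R \<Longrightarrow> cls v = cls w"
  using cls_eq_iff star_rel_words by blast

lemma star_carrierE:
  assumes "x \<in> carrier S" obtains w where "w \<in> star_words G I H" "x = cls w"
  using assms by (auto simp: star_group_def Let_def cls_def elim: quotientE)

lemma cls_closed: "w \<in> star_words G I H \<Longrightarrow> cls w \<in> carrier S"
  by (auto simp: star_group_def Let_def cls_def intro: quotientI)

lemma words_append: "v \<in> star_words G I H \<Longrightarrow> w \<in> star_words G I H \<Longrightarrow> v @ w \<in> star_words G I H"
  by (auto simp: star_words_def)

lemma words_nil: "[] \<in> star_words G I H"
  by (auto simp: star_words_def)

lemma one_star: "\<one>\<^bsub>S\<^esub> = cls []"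
  by (simp add: star_group_def Let_def cls_def)

lemma mult_cls:
  assumes "v \<in> star_words G I H" "w \<in> star_words G I H"
  shows "cls v \<otimes>\<^bsub>S\<^esub> cls w = cls (v @ w)"
proof -
  have "cls x = cls v \<and> x \<in> star_words G I H" if "x \<in> cls v" for x v
    using that cls_eqI star_rel_words unfolding cls_def by fastforce
  then have "cls (x @ y) = cls (v @ w)" if "x \<in> cls v" "y \<in> cls w" for x y
    using that by (intro cls_eqI star_rel.append) (auto simp: cls_def intro: star_rel.sym)
  moreover have "v \<in> cls v" "w \<in> cls w" using assms by (auto simp: cls_def intro: star_rel.refl)
  ultimately have "(\<Union>x\<in>cls v. \<Union>y\<in>cls w. cls (x @ y)) = cls (v @ w)" by blast
  then show ?thesis by (simp add: star_group_def Let_def cls_def)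
qed

primrec letter_inv where
  "letter_inv (Inl g) = Inl (inv\<^bsub>G\<^esub> g)"
| "letter_inv (Inr p) = Inr (fst p, inv\<^bsub>H (fst p)\<^esub> (snd p))"

lemma group_star: "group S"
proof (rule groupI)
  show "x \<otimes>\<^bsub>S\<^esub> y \<in> carrier S" if "x \<in> carrier S" "y \<in> carrier S" for x y
    using that by (elim star_carrierE) (simp add: mult_cls cls_closed words_append)
  show "\<one>\<^bsub>S\<^esub> \<in> carrier S" by (simp add: one_star cls_closed words_nil)
  show "x \<otimes>\<^bsub>S\<^esub> y \<otimes>\<^bsub>S\<^esub> z = x \<otimes>\<^bsub>S\<^esub> (y \<otimes>\<^bsub>S\<^esub> z)"
    if "x \<in> carrier S" "y \<in> carrier S" "z \<in> carrier S" for x y z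
    using that by (elim star_carrierE) (simp add: mult_cls words_append)
  show "\<one>\<^bsub>S\<^esub> \<otimes>\<^bsub>S\<^esub> x = x" if "x \<in> carrier S" for x
    using that by (elim star_carrierE) (simp add: one_star mult_cls words_nil)
  show "\<exists>y\<in>carrier S. y \<otimes>\<^bsub>S\<^esub> x = \<one>\<^bsub>S\<^esub>" if "x \<in> carrier S" for x
  proof -
    have ex: "\<exists>v\<in>star_words G I H. (v @ w, []) \<in> R" if "w \<in> star_words G I H" for w
      using that
    proof (induction w)
      case Nil
      then show ?case using words_nil by (auto intro: star_rel.refl)
    next
      case (Cons a w)
      then have w: "w \<in> star_words G I H" and a: "[a] \<in> star_words G I H" by (auto simp: star_words_def)
      then obtain v where v: "v \<in> star_words G I H" "(v @ w, []) \<in> R" using Cons by blast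
      have a1: "[letter_inv a] \<in> star_words G I H \<and> ([letter_inv a] @ [a], []) \<in> R"
      proof (cases a)
        case (Inl g)
        then have g: "g \<in> carrier G" using a by (auto simp: star_words_def)
        then have "([Inl (inv\<^bsub>G\<^esub> g), Inl g], [Inl (inv\<^bsub>G\<^esub> g \<otimes>\<^bsub>G\<^esub> g)]) \<in> R"
          by (intro star_rel.central_mult) auto
        then have "([Inl (inv\<^bsub>G\<^esub> g), Inl g], []) \<in> R"
          using g star_rel.trans star_rel.central_one by fastforce
        then show ?thesis using Inl star_rel_words g by (auto simp: star_words_def)
      next
        case (Inr p)
        then obtain i t where p: "a = Inr (i, t)" "i \<in> I" "t \<in> carrier (H i)" using a by (auto simp: star_words_def)
        interpret Hi: group "H i" using group_outer p by blast
        have "([Inr (i, inv\<^bsub>H i\<^esub> t), Inr (i, t)], [Inr (i, inv\<^bsub>H i\<^esub> t \<otimes>\<^bsub>H i\<^esub> t)]) \<in> R"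
          using p by (intro star_rel.outer_mult) auto
        then have "([Inr (i, inv\<^bsub>H i\<^esub> t), Inr (i, t)], []) \<in> R"
          using p star_rel.trans star_rel.outer_one by fastforce
        then show ?thesis using p by (auto simp: star_words_def)
      qed
      have "([letter_inv a] @ [a], []) \<in> R" using a1 by blast
      from star_rel.append[OF star_rel.append[OF star_rel.refl[OF v(1)] this] star_rel.refl[OF w]]
      have "((v @ [letter_inv a]) @ a # w, v @ w) \<in> R" by simp
      then have "((v @ [letter_inv a]) @ a # w, []) \<in> R" using v(2) by (rule star_rel.trans)
      then show ?case using v a1 words_append by blast
    qed
    from that obtain w where w: "w \<in> star_words G I H" "x = cls w" by (elim star_carrierE)
    from ex[OF w(1)] obtain v where v: "v \<in> star_words G I H" "(v @ w, []) \<in> R" by blast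
    then have "cls v \<otimes>\<^bsub>S\<^esub> x = \<one>\<^bsub>S\<^esub>" using w cls_eqI by (simp add: mult_cls one_star)
    then show ?thesis using v cls_closed by blast
  qed
qed

lemma central_word: "g \<in> carrier G \<Longrightarrow> [Inl g] \<in> star_words G I H"
  by (simp add: star_words_def)

lemma outer_word: "i \<in> I \<Longrightarrow> t \<in> carrier (H i) \<Longrightarrow> [Inr (i, t)] \<in> star_words G I H"
  by (simp add: star_words_def)

lemma central_hom: "(\<lambda>g. cls [Inl g]) \<in> hom G S"
  by (rule homI) (simp_all add: cls_closed central_word mult_cls cls_eqI[OF star_rel.central_mult])

lemma outer_hom: "i \<in> I \<Longrightarrow> (\<lambda>t. cls [Inr (i, t)]) \<in> hom (H i) S"
  by (rule homI)
    (simp_all add: cls_closed outer_word mult_cls cls_eqI[OF star_rel.outer_mult] group_outer group.is_monoid monoid.m_closed)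

lemma edge_cls: "i \<in> I \<Longrightarrow> c \<in> C i \<Longrightarrow> cls [Inl c] = cls [Inr (i, \<phi> i c)]"
  by (intro cls_eqI star_rel.edge)

lemma star_induct [consumes 1, case_names one central outer]:
  assumes "x \<in> carrier S" and "P \<one>\<^bsub>S\<^esub>"
    and "\<And>g x. g \<in> carrier G \<Longrightarrow> x \<in> carrier S \<Longrightarrow> P x \<Longrightarrow> P (cls [Inl g] \<otimes>\<^bsub>S\<^esub> x)"
    and "\<And>i t x. i \<in> I \<Longrightarrow> t \<in> carrier (H i) \<Longrightarrow> x \<in> carrier S \<Longrightarrow> P x \<Longrightarrow> P (cls [Inr (i, t)] \<otimes>\<^bsub>S\<^esub> x)"
  shows "P x"
proof -
  from assms(1) obtain w where w: "w \<in> star_words G I H" "x = cls w" by (elim star_carrierE)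
  have "P (cls w)" using w(1)
  proof (induction w)
    case Nil
    then show ?case using assms(2) by (simp add: one_star)
  next
    case (Cons a w)
    then have w: "w \<in> star_words G I H" and a: "[a] \<in> star_words G I H" by (auto simp: star_words_def)
    then have "cls (a # w) = cls [a] \<otimes>\<^bsub>S\<^esub> cls w" by (simp add: mult_cls)
    then show ?case using assms(3,4) Cons.IH[OF w] a cls_closed[OF w] by (cases a) (auto simp: star_words_def)
  qed
  then show ?thesis using w by simp
qed

text \<open>Words are evaluated letter by letter, and every defining relation preserves the
  value.\<close>

lemma star_universal:
  assumes K: "group K" and f: "f \<in> hom G K" and h: "\<And>i. i \<in> I \<Longrightarrow> h i \<in> hom (H i) K"
    and fh: "\<And>i c. i \<in> I \<Longrightarrow> c \<in> C i \<Longrightarrow> f c = h i (\<phi> i c)"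
  shows "\<exists>F\<in>hom S K. (\<forall>g\<in>carrier G. F (cls [Inl g]) = f g) \<and>
    (\<forall>i\<in>I. \<forall>t\<in>carrier (H i). F (cls [Inr (i, t)]) = h i t)"
proof -
  interpret K: group K by fact
  define lv where "lv = case_sum f (\<lambda>(i, t). h i t)"
  define ev where "ev w = foldr (\<lambda>a y. lv a \<otimes>\<^bsub>K\<^esub> y) w \<one>\<^bsub>K\<^esub>" for w
  have lv: "lv a \<in> carrier K" if "[a] \<in> star_words G I H" for a
    using that f h by (cases a) (auto simp: lv_def star_words_def hom_def)
  have ev: "ev w \<in> carrier K" if "w \<in> star_words G I H" for w
    using that lv by (induction w) (auto simp: ev_def star_words_def)
  have ev_app: "ev (v @ w) = ev v \<otimes>\<^bsub>K\<^esub> ev w" if "v \<in> star_words G I H" "w \<in> star_words G I H" for v w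
    using that(1)
  proof (induction v)
    case Nil
    then show ?case using ev[OF that(2)] by (simp add: ev_def)
  next
    case (Cons a v)
    then have v: "v \<in> star_words G I H" and a: "[a] \<in> star_words G I H" by (auto simp: star_words_def)
    have "ev ((a # v) @ w) = lv a \<otimes>\<^bsub>K\<^esub> ev (v @ w)" by (simp add: ev_def)
    also have "\<dots> = ev (a # v) \<otimes>\<^bsub>K\<^esub> ev w"
      unfolding Cons.IH[OF v] using lv[OF a] ev[OF v] ev[OF that(2)] by (simp add: K.m_assoc[symmetric]) (simp add: ev_def)
    finally show ?case .
  qed
  have f1: "f \<one>\<^bsub>G\<^esub> = \<one>\<^bsub>K\<^esub>" using f K G.is_group by (simp add: hom_one)
  have h1: "h i \<one>\<^bsub>H i\<^esub> = \<one>\<^bsub>K\<^esub>" if "i \<in> I" for i using h[OF that] K group_outer[OF that] by (simp add: hom_one)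
  have ev1: "ev [a] = lv a" if "[a] \<in> star_words G I H" for a using lv[OF that] by (simp add: ev_def)
  have ev_rel: "ev v = ev w" if "(v, w) \<in> R" for v w
    using that
  proof (induction rule: star_rel.induct)
    case (append u u' v v')
    then show ?case using ev_app star_rel_words by metis
  next
    case central_one
    then show ?case using f1 ev1[OF central_word[OF G.one_closed]] by (simp add: lv_def) (simp add: ev_def)
  next
    case (central_mult x y)
    moreover have "f x \<in> carrier K" "f y \<in> carrier K" using f central_mult by (auto simp: hom_def)
    ultimately have "ev [Inl x, Inl y] = f x \<otimes>\<^bsub>K\<^esub> f y" by (simp add: ev_def lv_def)
    then show ?case using ev1[OF central_word[of "x \<otimes>\<^bsub>G\<^esub> y"]] central_mult f by (simp add: lv_def hom_def)
  next
    case (outer_one i)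
    then show ?case using h1 by (simp add: ev_def lv_def)
  next
    case (outer_mult i s t)
    interpret Hi: group "H i" using group_outer outer_mult by blast
    have "ev [Inr (i, s), Inr (i, t)] = h i s \<otimes>\<^bsub>K\<^esub> h i t" using h outer_mult by (simp add: ev_def lv_def hom_def Pi_iff)
    then show ?case
      using ev1[OF outer_word[of i "s \<otimes>\<^bsub>H i\<^esub> t"]] outer_mult h by (simp add: lv_def hom_def)
  next
    case (edge i c)
    then show ?case using fh by (simp add: ev_def lv_def)
  qed simp_all
  define F where "F X = the_elem (ev ` X)" for X
  have F: "F (cls w) = ev w" if "w \<in> star_words G I H" for w
  proof -
    have "w \<in> cls w" using that by (simp add: cls_def star_rel.refl)
    moreover have "ev x = ev w" if "x \<in> cls w" for x using that ev_rel by (fastforce simp: cls_def)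
    ultimately have "ev ` cls w = {ev w}" unfolding image_def by blast
    then show ?thesis by (simp add: F_def)
  qed
  have "F \<in> hom S K"
  proof (rule homI)
    show "F x \<in> carrier K" if "x \<in> carrier S" for x using that ev F by (elim star_carrierE) simp
    show "F (x \<otimes>\<^bsub>S\<^esub> y) = F x \<otimes>\<^bsub>K\<^esub> F y" if "x \<in> carrier S" "y \<in> carrier S" for x y
      using that ev_app F by (elim star_carrierE) (simp add: mult_cls words_append)
  qed
  moreover have "F (cls [Inl g]) = f g" if "g \<in> carrier G" for g
    using F[OF central_word[OF that]] ev1[OF central_word[OF that]] by (simp add: lv_def)
  moreover have "F (cls [Inr (i, t)]) = h i t" if "i \<in> I" "t \<in> carrier (H i)" for i t
    using F[OF outer_word[OF that]] ev1[OF outer_word[OF that]] by (simp add: lv_def)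
  ultimately show ?thesis by blast
qed

end

text \<open>Everything below takes place in an isomorphic copy \<open>E\<close>: a stage of the
  chain contains the preceding stage as a subset, so it is not the group of classes of words
  itself.\<close>

locale star_copy = star_of_groups G I H C \<phi> + E: group E
  for G :: "('g, 'm) monoid_scheme" and I :: "'i set" and H :: "'i \<Rightarrow> ('h, 'k) monoid_scheme" and C \<phi>
    and E :: "('e, 'l) monoid_scheme" +
  fixes \<theta>
  assumes iso: "\<theta> \<in> iso (star_group G I H C \<phi>) E"
begin

definition cen where "cen g = \<theta> (star_rel G I H C \<phi> `` {[Inl g]})"
definition out where "out i t = \<theta> (star_rel G I H C \<phi> `` {[Inr (i, t)]})"

lemma theta_hom: "\<theta> \<in> hom S E"
  using iso by (simp add: iso_def)

lemma cen_hom: "cen \<in> hom G E"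
  using hom_compose[OF central_hom theta_hom] by (simp add: cen_def[abs_def] cls_def comp_def)

lemma out_hom: "i \<in> I \<Longrightarrow> out i \<in> hom (H i) E"
  using hom_compose[OF outer_hom theta_hom] by (simp add: out_def[abs_def] cls_def comp_def)

lemma cen_edge: "i \<in> I \<Longrightarrow> c \<in> C i \<Longrightarrow> cen c = out i (\<phi> i c)"
  using edge_cls by (simp add: cen_def out_def cls_def)

lemma cen_closed [simp]: "g \<in> carrier G \<Longrightarrow> cen g \<in> carrier E"
  using cen_hom by (auto simp: hom_def)

lemma out_closed [simp]: "i \<in> I \<Longrightarrow> t \<in> carrier (H i) \<Longrightarrow> out i t \<in> carrier E"
  using out_hom by (auto simp: hom_def)

lemma cen_mult: "g \<in> carrier G \<Longrightarrow> h \<in> carrier G \<Longrightarrow> cen (g \<otimes>\<^bsub>G\<^esub> h) = cen g \<otimes>\<^bsub>E\<^esub> cen h"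
  using cen_hom by (auto simp: hom_def)

lemma out_mult: "i \<in> I \<Longrightarrow> s \<in> carrier (H i) \<Longrightarrow> t \<in> carrier (H i) \<Longrightarrow> out i (s \<otimes>\<^bsub>H i\<^esub> t) = out i s \<otimes>\<^bsub>E\<^esub> out i t"
  using out_hom by (auto simp: hom_def)

lemma cen_one [simp]: "cen \<one>\<^bsub>G\<^esub> = \<one>\<^bsub>E\<^esub>"
  using cen_hom by (simp add: hom_one)

lemma out_one [simp]: "i \<in> I \<Longrightarrow> out i \<one>\<^bsub>H i\<^esub> = \<one>\<^bsub>E\<^esub>"
  using out_hom group_outer by (simp add: hom_one)

lemma cen_inv: "g \<in> carrier G \<Longrightarrow> cen (inv\<^bsub>G\<^esub> g) = inv\<^bsub>E\<^esub> (cen g)"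
  using cen_hom group_hom.hom_inv[of G E cen g] by (simp add: group_hom_def group_hom_axioms_def)

lemma out_inv: "i \<in> I \<Longrightarrow> t \<in> carrier (H i) \<Longrightarrow> out i (inv\<^bsub>H i\<^esub> t) = inv\<^bsub>E\<^esub> (out i t)"
  using out_hom group_outer group_hom.hom_inv[of "H i" E "out i" t] by (simp add: group_hom_def group_hom_axioms_def)

lemma copy_induct [consumes 1, case_names one central outer]:
  assumes "x \<in> carrier E" and "P \<one>\<^bsub>E\<^esub>"
    and "\<And>g x. g \<in> carrier G \<Longrightarrow> x \<in> carrier E \<Longrightarrow> P x \<Longrightarrow> P (cen g \<otimes>\<^bsub>E\<^esub> x)"
    and "\<And>i t x. i \<in> I \<Longrightarrow> t \<in> carrier (H i) \<Longrightarrow> x \<in> carrier E \<Longrightarrow> P x \<Longrightarrow> P (out i t \<otimes>\<^bsub>E\<^esub> x)"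
  shows "P x"
proof -
  have "P (\<theta> y)" if "y \<in> carrier S" for y
    using that
  proof (induction rule: star_induct)
    case one
    then show ?case using assms(2) theta_hom group_star by (simp add: hom_one)
  next
    case (central g x)
    then show ?case
      using assms(3)[of g "\<theta> x"] theta_hom cls_closed[OF central_word] by (auto simp: hom_def cen_def cls_def)
  next
    case (outer i t x)
    then show ?case
      using assms(4)[of i t "\<theta> x"] theta_hom cls_closed[OF outer_word] by (auto simp: hom_def out_def cls_def)
  qed
  moreover have "x \<in> \<theta> ` carrier S" using iso assms(1) by (simp add: iso_def bij_betw_def)
  ultimately show ?thesis by blast
qed

lemma copy_universal:
  assumes K: "group K" and f: "f \<in> hom G K" and h: "\<And>i. i \<in> I \<Longrightarrow> h i \<in> hom (H i) K"
    and fh: "\<And>i c. i \<in> I \<Longrightarrow> c \<in> C i \<Longrightarrow> f c = h i (\<phi> i c)"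
  shows "\<exists>F\<in>hom E K. (\<forall>g\<in>carrier G. F (cen g) = f g) \<and> (\<forall>i\<in>I. \<forall>t\<in>carrier (H i). F (out i t) = h i t)"
proof -
  obtain F where F: "F \<in> hom S K" "\<forall>g\<in>carrier G. F (cls [Inl g]) = f g"
    "\<forall>i\<in>I. \<forall>t\<in>carrier (H i). F (cls [Inr (i, t)]) = h i t" using star_universal[OF assms] by blast
  let ?\<theta>' = "inv_into (carrier S) \<theta>"
  have "?\<theta>' \<in> hom E S" using group.iso_set_sym[OF group_star iso] by (simp add: iso_def)
  then have "F \<circ> ?\<theta>' \<in> hom E K" using F(1) by (rule hom_compose)
  moreover have inv: "?\<theta>' (\<theta> x) = x" if "x \<in> carrier S" for x
    using iso that by (simp add: iso_def bij_betw_def)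
  ultimately show ?thesis
    using F(2,3) cls_closed[OF central_word] cls_closed[OF outer_word]
    by (intro bexI[of _ "F \<circ> ?\<theta>'"]) (auto simp: cen_def out_def cls_def[symmetric])
qed

end

text \<open>The subgroup itself is represented by 1, so that a syllable lying in the edge group can
  be recognized by its trivial representative. For the other cosets any choice will do.\<close>

definition coset_rep :: "('g, 'm) monoid_scheme \<Rightarrow> 'g set \<Rightarrow> 'g \<Rightarrow> 'g" where
  "coset_rep G C x = (if x \<in> C then \<one>\<^bsub>G\<^esub> else SOME y. y \<in> carrier G \<and> inv\<^bsub>G\<^esub> y \<otimes>\<^bsub>G\<^esub> x \<in> C)"

context group begin

lemma coset_rep:
  assumes C: "subgroup C G" and x: "x \<in> carrier G"
  shows "coset_rep G C x \<in> carrier G" "inv (coset_rep G C x) \<otimes> x \<in> C"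
proof -
  have "\<exists>y. y \<in> carrier G \<and> inv y \<otimes> x \<in> C" using x C by (intro exI[of _ x]) (simp add: subgroup.one_closed)
  then have "(SOME y. y \<in> carrier G \<and> inv y \<otimes> x \<in> C) \<in> carrier G \<and> inv (SOME y. y \<in> carrier G \<and> inv y \<otimes> x \<in> C) \<otimes> x \<in> C"
    by (rule someI_ex)
  then show "coset_rep G C x \<in> carrier G" "inv (coset_rep G C x) \<otimes> x \<in> C"
    using x by (auto simp: coset_rep_def)
qed

lemma subgroup_mult_right_iff:
  assumes "subgroup C G" "x \<in> carrier G" "c \<in> C" shows "x \<otimes> c \<in> C \<longleftrightarrow> x \<in> C"
proof
  assume "x \<otimes> c \<in> C"
  then have "x \<otimes> c \<otimes> inv c \<in> C" using assms by (auto intro: subgroup.m_closed subgroup.m_inv_closed)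
  then show "x \<in> C" using assms subgroup.mem_carrier by (fastforce simp: m_assoc)
qed (use assms in \<open>auto intro: subgroup.m_closed\<close>)

lemma coset_rep_mult:
  assumes C: "subgroup C G" and x: "x \<in> carrier G" and c: "c \<in> C"
  shows "coset_rep G C (x \<otimes> c) = coset_rep G C x"
proof -
  have cG: "c \<in> carrier G" using c C subgroup.mem_carrier by fast
  have "(y \<in> carrier G \<and> inv y \<otimes> (x \<otimes> c) \<in> C) = (y \<in> carrier G \<and> inv y \<otimes> x \<in> C)" for y
    using subgroup_mult_right_iff[OF C _ c, of "inv y \<otimes> x"] x cG by (auto simp: m_assoc)
  then show ?thesis using subgroup_mult_right_iff[OF C x c] unfolding coset_rep_def by presburger
qed

lemma coset_rep_eqI:
  assumes C: "subgroup C G" and x: "x \<in> carrier G" "y \<in> carrier G" and xy: "inv y \<otimes> x \<in> C"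
  shows "coset_rep G C x = coset_rep G C y"
  using coset_rep_mult[OF C x(2) xy] x by simp

lemma coset_rep_idem:
  assumes C: "subgroup C G" and x: "x \<in> carrier G"
  shows "coset_rep G C (coset_rep G C x) = coset_rep G C x"
  using coset_rep_eqI[OF C x, of "coset_rep G C x"] coset_rep[OF C x] by simp

lemma coset_rep_one [simp]: "subgroup C G \<Longrightarrow> coset_rep G C \<one> = \<one>"
  by (simp add: coset_rep_def subgroup.one_closed)

lemma coset_rep_eq_one_iff:
  assumes C: "subgroup C G" and x: "x \<in> carrier G"
  shows "coset_rep G C x = \<one> \<longleftrightarrow> x \<in> C"
proof
  assume "coset_rep G C x = \<one>"
  then show "x \<in> C" using coset_rep[OF C x] x by simp
qed (simp add: coset_rep_def)

end

section \<open>The action on normal forms\<close>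

lemma action_hom_BijGroup:
  assumes G: "group G" and cl: "\<And>g x. g \<in> carrier G \<Longrightarrow> x \<in> N \<Longrightarrow> a g x \<in> N"
    and one: "\<And>x. x \<in> N \<Longrightarrow> a \<one>\<^bsub>G\<^esub> x = x"
    and mult: "\<And>g h x. g \<in> carrier G \<Longrightarrow> h \<in> carrier G \<Longrightarrow> x \<in> N \<Longrightarrow> a g (a h x) = a (g \<otimes>\<^bsub>G\<^esub> h) x"
  shows "(\<lambda>g. restrict (a g) N) \<in> hom G (BijGroup N)"
proof -
  interpret group G by fact
  have bij: "restrict (a g) N \<in> Bij N" if g: "g \<in> carrier G" for g
  proof -
    have "bij_betw (a g) N N"
      by (rule bij_betw_byWitness[where f' = "a (inv\<^bsub>G\<^esub> g)"]) (use g in \<open>auto simp: cl one mult\<close>)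
    then show ?thesis by (simp add: Bij_def)
  qed
  show ?thesis
  proof (rule homI)
    fix g h assume gh: "g \<in> carrier G" "h \<in> carrier G"
    have "restrict (a (g \<otimes>\<^bsub>G\<^esub> h)) N = compose N (restrict (a g) N) (restrict (a h) N)"
      using gh cl mult by (auto simp: compose_def)
    then show "restrict (a (g \<otimes>\<^bsub>G\<^esub> h)) N = restrict (a g) N \<otimes>\<^bsub>BijGroup N\<^esub> restrict (a h) N"
      using bij[OF gh(1)] bij[OF gh(2)] by (simp add: BijGroup_def)
  qed (simp add: BijGroup_def bij)
qed

text \<open>\<open>Node x i s r\<close> stands for the product of \<open>x \<in> G\<close>, \<open>s \<in> H i\<close> and the element \<open>r\<close>. In a normal
  form \<open>x\<close> and \<open>s\<close> are representatives of left cosets of the edge group.\<close>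

datatype ('g, 'i, 'h) nform = Tail 'g | Node 'g 'i 'h "('g, 'i, 'h) nform"

primrec depth :: "('g, 'i, 'h) nform \<Rightarrow> nat" where
  "depth (Tail h) = 0"
| "depth (Node x i s r) = Suc (depth r)"

text \<open>The length of the common part of two paths from the base vertex in the Bass-Serre tree, in
  which every node accounts for two edges.\<close>

fun common :: "('g, 'i, 'h) nform \<Rightarrow> ('g, 'i, 'h) nform \<Rightarrow> nat" where
  "common (Node x i s r) (Node x' i' s' r') =
     (if x = x' \<and> i = i' then if s = s' then Suc (Suc (common r r')) else 1 else 0)"
| "common v w = 0"

lemma common_sym: "common v w = common w v"
  by (induction v w rule: common.induct) auto

lemma common_ultrametric: "min (common u v) (common v w) \<le> common u w"
proof (induction u arbitrary: v w)
  case (Node x i s r)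
  then show ?case by (cases v; cases w) (auto simp: min_le_iff_disj)
qed (auto simp: min_le_iff_disj)

locale abelian_star = star_copy G I H C \<phi> E \<theta>
  for G :: "('g, 'm) monoid_scheme" and I :: "'i set" and H :: "'i \<Rightarrow> ('h, 'k) monoid_scheme" and C \<phi>
    and E :: "('e, 'l) monoid_scheme" and \<theta> +
  assumes comm_outer: "i \<in> I \<Longrightarrow> comm_group (H i)"
    and edge_inj: "i \<in> I \<Longrightarrow> inj_on (\<phi> i) (C i)"
begin

definition rep where "rep i = coset_rep G (C i)"
definition srep where "srep i = coset_rep (H i) (\<phi> i ` C i)"
definition edge_inv where "edge_inv i = inv_into (C i) (\<phi> i)"

lemma subgroup_edge_image: "i \<in> I \<Longrightarrow> subgroup (\<phi> i ` C i) (H i)"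
  using group_hom.img_is_subgroup[of "G\<lparr>carrier := C i\<rparr>" "H i" "\<phi> i"]
    subgroup.subgroup_is_group[OF subgroup_edge G.is_group] group_outer edge_hom
  by (simp add: group_hom_def group_hom_axioms_def)

lemma edge_inv [simp]: "i \<in> I \<Longrightarrow> c \<in> C i \<Longrightarrow> edge_inv i (\<phi> i c) = c"
  using edge_inj by (simp add: edge_inv_def)

lemma edge_map_one [simp]: "i \<in> I \<Longrightarrow> \<phi> i \<one>\<^bsub>G\<^esub> = \<one>\<^bsub>H i\<^esub>"
  using hom_one[OF edge_hom subgroup.subgroup_is_group[OF subgroup_edge G.is_group] group_outer] by simp

lemma edge_inv_one [simp]: "i \<in> I \<Longrightarrow> edge_inv i \<one>\<^bsub>H i\<^esub> = \<one>\<^bsub>G\<^esub>"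
  using edge_inv[of i "\<one>\<^bsub>G\<^esub>"] subgroup.one_closed[OF subgroup_edge] by simp

lemma rep_closed [simp]: "i \<in> I \<Longrightarrow> x \<in> carrier G \<Longrightarrow> rep i x \<in> carrier G"
  and rep_edge: "i \<in> I \<Longrightarrow> x \<in> carrier G \<Longrightarrow> inv\<^bsub>G\<^esub> (rep i x) \<otimes>\<^bsub>G\<^esub> x \<in> C i"
  and rep_idem: "i \<in> I \<Longrightarrow> x \<in> carrier G \<Longrightarrow> rep i (rep i x) = rep i x"
  and rep_one [simp]: "i \<in> I \<Longrightarrow> rep i \<one>\<^bsub>G\<^esub> = \<one>\<^bsub>G\<^esub>"
  and rep_eq_one_iff: "i \<in> I \<Longrightarrow> x \<in> carrier G \<Longrightarrow> rep i x = \<one>\<^bsub>G\<^esub> \<longleftrightarrow> x \<in> C i"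
  and rep_eqI: "i \<in> I \<Longrightarrow> x \<in> carrier G \<Longrightarrow> y \<in> carrier G \<Longrightarrow> inv\<^bsub>G\<^esub> y \<otimes>\<^bsub>G\<^esub> x \<in> C i \<Longrightarrow> rep i x = rep i y"
  unfolding rep_def using subgroup_edge
  by (auto simp: G.coset_rep G.coset_rep_idem G.coset_rep_eq_one_iff intro: G.coset_rep_eqI)

lemma srep_closed [simp]: "i \<in> I \<Longrightarrow> s \<in> carrier (H i) \<Longrightarrow> srep i s \<in> carrier (H i)"
  and srep_edge: "i \<in> I \<Longrightarrow> s \<in> carrier (H i) \<Longrightarrow> inv\<^bsub>H i\<^esub> (srep i s) \<otimes>\<^bsub>H i\<^esub> s \<in> \<phi> i ` C i"
  and srep_idem: "i \<in> I \<Longrightarrow> s \<in> carrier (H i) \<Longrightarrow> srep i (srep i s) = srep i s"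
  and srep_one [simp]: "i \<in> I \<Longrightarrow> srep i \<one>\<^bsub>H i\<^esub> = \<one>\<^bsub>H i\<^esub>"
  and srep_eq_one_iff: "i \<in> I \<Longrightarrow> s \<in> carrier (H i) \<Longrightarrow> srep i s = \<one>\<^bsub>H i\<^esub> \<longleftrightarrow> s \<in> \<phi> i ` C i"
  and srep_eqI: "i \<in> I \<Longrightarrow> s \<in> carrier (H i) \<Longrightarrow> t \<in> carrier (H i) \<Longrightarrow> inv\<^bsub>H i\<^esub> t \<otimes>\<^bsub>H i\<^esub> s \<in> \<phi> i ` C i \<Longrightarrow> srep i s = srep i t"
  unfolding srep_def using subgroup_edge_image group_outer
  by (auto simp: group.coset_rep group.coset_rep_idem group.coset_rep_eq_one_iff group.coset_rep_one
      intro: group.coset_rep_eqI)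

text \<open>A rest headed by \<open>i\<close> could be merged with a preceding syllable of
  \<open>H i\<close>; excluding this makes a form reduced.\<close>

primrec headed where
  "headed i (Tail h) = False"
| "headed i (Node x j s r) = (j = i \<and> x = \<one>\<^bsub>G\<^esub>)"

primrec normal where
  "normal (Tail h) = (h \<in> carrier G)"
| "normal (Node x i s r) = (i \<in> I \<and> x \<in> carrier G \<and> rep i x = x \<and> s \<in> carrier (H i) \<and> srep i s = s \<and>
     s \<noteq> \<one>\<^bsub>H i\<^esub> \<and> normal r \<and> \<not> headed i r)"

text \<open>Write \<open>g x = y c\<close> with a representative \<open>y\<close> and
  \<open>c\<close> in the edge group. As the outer groups are abelian, \<open>c\<close> passes the
  syllable \<open>s\<close> without changing it and acts on the rest.\<close>

primrec gact where
  "gact (Tail h) g = Tail (g \<otimes>\<^bsub>G\<^esub> h)"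
| "gact (Node x i s r) g =
     Node (rep i (g \<otimes>\<^bsub>G\<^esub> x)) i s (gact r (inv\<^bsub>G\<^esub> (rep i (g \<otimes>\<^bsub>G\<^esub> x)) \<otimes>\<^bsub>G\<^esub> (g \<otimes>\<^bsub>G\<^esub> x)))"

lemma depth_gact [simp]: "depth (gact w g) = depth w"
  by (induction w arbitrary: g) auto

text \<open>Left multiplication by an element of \<open>C i\<close> cannot move the leading
  representative into or out of \<open>C i\<close>.\<close>

lemma headed_gact:
  assumes "i \<in> I" "c \<in> C i" "normal w" shows "headed i (gact w c) = headed i w"
proof (cases w)
  case (Node x j s r)
  show ?thesis
  proof (cases "j = i")
    case True
    then have x: "x \<in> carrier G" "rep i x = x" using assms Node by auto
    have "x \<in> C i \<longleftrightarrow> c \<otimes>\<^bsub>G\<^esub> x \<in> C i"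
      using G.subgroup_mult_right_iff[OF subgroup_edge[OF assms(1)]]
      by (metis G.inv_mult_cancel assms(1,2) edge_closed subgroup.m_closed subgroup.m_inv_closed subgroup_edge x(1))
    then show ?thesis using True Node x assms rep_eq_one_iff by (metis G.m_closed edge_closed gact.simps(2) headed.simps(2))
  qed (simp add: Node)
qed simp

lemma normal_gact: "normal w \<Longrightarrow> g \<in> carrier G \<Longrightarrow> normal (gact w g)"
proof (induction w arbitrary: g)
  case (Node x i s r)
  then have "inv\<^bsub>G\<^esub> (rep i (g \<otimes>\<^bsub>G\<^esub> x)) \<otimes>\<^bsub>G\<^esub> (g \<otimes>\<^bsub>G\<^esub> x) \<in> C i" by (intro rep_edge) auto
  then show ?case using Node headed_gact by (auto simp: rep_idem)
qed simp

lemma gact_one: "normal w \<Longrightarrow> gact w \<one>\<^bsub>G\<^esub> = w"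
  by (induction w) auto

lemma gact_gact: "normal w \<Longrightarrow> g \<in> carrier G \<Longrightarrow> h \<in> carrier G \<Longrightarrow> gact (gact w h) g = gact w (g \<otimes>\<^bsub>G\<^esub> h)"
proof (induction w arbitrary: g h)
  case (Tail k)
  then show ?case by (simp add: G.m_assoc)
next
  case (Node x i s r)
  then have i: "i \<in> I" and x: "x \<in> carrier G" by auto
  let ?y = "rep i (h \<otimes>\<^bsub>G\<^esub> x)" and ?c = "inv\<^bsub>G\<^esub> (rep i (h \<otimes>\<^bsub>G\<^esub> x)) \<otimes>\<^bsub>G\<^esub> (h \<otimes>\<^bsub>G\<^esub> x)"
  have y: "?y \<in> carrier G" and c: "?c \<in> C i" using i x Node by (auto intro: rep_edge)
  have "rep i (g \<otimes>\<^bsub>G\<^esub> ?y) = rep i (g \<otimes>\<^bsub>G\<^esub> h \<otimes>\<^bsub>G\<^esub> x)"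
  proof (rule HOL.sym, rule rep_eqI)
    show "inv\<^bsub>G\<^esub> (g \<otimes>\<^bsub>G\<^esub> ?y) \<otimes>\<^bsub>G\<^esub> (g \<otimes>\<^bsub>G\<^esub> h \<otimes>\<^bsub>G\<^esub> x) \<in> C i"
      using c y x Node.prems by (simp add: G.inv_mult_group G.m_assoc)
  qed (use i x y Node in auto)
  moreover define z where "z = rep i (g \<otimes>\<^bsub>G\<^esub> h \<otimes>\<^bsub>G\<^esub> x)"
  moreover have z: "z \<in> carrier G" using i x Node by (simp add: z_def)
  moreover have "gact (gact r ?c) (inv\<^bsub>G\<^esub> z \<otimes>\<^bsub>G\<^esub> (g \<otimes>\<^bsub>G\<^esub> ?y)) = gact r (inv\<^bsub>G\<^esub> z \<otimes>\<^bsub>G\<^esub> (g \<otimes>\<^bsub>G\<^esub> h \<otimes>\<^bsub>G\<^esub> x))"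
    using Node.IH[of "inv\<^bsub>G\<^esub> z \<otimes>\<^bsub>G\<^esub> (g \<otimes>\<^bsub>G\<^esub> ?y)" ?c] Node.prems i x y z c by (simp add: G.m_assoc)
  ultimately show ?case by simp
qed

text \<open>A form that does not begin in \<open>H i\<close> is given the trivial head. Then
  \<open>head\<close>, \<open>rest\<close> and \<open>join\<close> describe every normal form as an
  element of \<open>H i\<close> followed by a rest that is not headed by \<open>i\<close>, and the
  action of \<open>H i\<close> needs no case distinction.\<close>

fun head where
  "head i (Tail h) = \<one>\<^bsub>H i\<^esub>"
| "head i (Node x j s r) = (if j = i \<and> x = \<one>\<^bsub>G\<^esub> then s else \<one>\<^bsub>H i\<^esub>)"

fun rest where
  "rest i (Tail h) = Tail h"
| "rest i (Node x j s r) = (if j = i \<and> x = \<one>\<^bsub>G\<^esub> then r else Node x j s r)"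

definition join where "join i s r = (if s = \<one>\<^bsub>H i\<^esub> then r else Node \<one>\<^bsub>G\<^esub> i s r)"

text \<open>The new head \<open>t s\<close> is split into a representative \<open>y\<close> and an
  edge element, and the latter is handed over to the rest.\<close>

definition hact where
  "hact i w t = (let s = t \<otimes>\<^bsub>H i\<^esub> head i w; y = srep i s in
     join i y (gact (rest i w) (edge_inv i (inv\<^bsub>H i\<^esub> y \<otimes>\<^bsub>H i\<^esub> s))))"

lemma split_normal:
  assumes "normal w" "i \<in> I"
  shows "head i w \<in> carrier (H i)" "srep i (head i w) = head i w" "normal (rest i w)" "\<not> headed i (rest i w)"
    "w = join i (head i w) (rest i w)"
  using assms group.is_monoid[OF group_outer] by (cases w; auto simp: join_def monoid.one_closed)+

lemma head_join: "\<not> headed i r \<Longrightarrow> head i (join i s r) = s"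
  and rest_join: "\<not> headed i r \<Longrightarrow> rest i (join i s r) = r"
  by (cases r; auto simp: join_def)+

lemma normal_join:
  assumes "normal r" "\<not> headed i r" "i \<in> I" "s \<in> carrier (H i)" "srep i s = s"
  shows "normal (join i s r)"
  using assms by (simp add: join_def)

lemma edge_inv_srep:
  assumes "i \<in> I" "s \<in> carrier (H i)"
  shows "edge_inv i (inv\<^bsub>H i\<^esub> (srep i s) \<otimes>\<^bsub>H i\<^esub> s) \<in> C i"
    "\<phi> i (edge_inv i (inv\<^bsub>H i\<^esub> (srep i s) \<otimes>\<^bsub>H i\<^esub> s)) = inv\<^bsub>H i\<^esub> (srep i s) \<otimes>\<^bsub>H i\<^esub> s"
  using srep_edge[OF assms] assms by auto

lemma hact_join:
  assumes "normal r" "\<not> headed i r"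
  shows "hact i (join i s r) t =
    join i (srep i (t \<otimes>\<^bsub>H i\<^esub> s)) (gact r (edge_inv i (inv\<^bsub>H i\<^esub> (srep i (t \<otimes>\<^bsub>H i\<^esub> s)) \<otimes>\<^bsub>H i\<^esub> (t \<otimes>\<^bsub>H i\<^esub> s))))"
  using assms by (simp add: hact_def Let_def head_join rest_join)

lemma normal_hact:
  assumes "normal w" "i \<in> I" "t \<in> carrier (H i)" shows "normal (hact i w t)"
proof -
  interpret Hi: comm_group "H i" using comm_outer assms(2) .
  note sp = split_normal[OF assms(1,2)]
  let ?s = "t \<otimes>\<^bsub>H i\<^esub> head i w"
  have s: "?s \<in> carrier (H i)" using assms sp by simp
  note c = edge_inv_srep(1)[OF assms(2) s]
  show ?thesis
    unfolding hact_def Let_def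
    by (rule normal_join) (use s c sp assms headed_gact[OF assms(2) c sp(3)] in
        \<open>auto simp: srep_idem intro!: normal_gact\<close>)
qed

lemma hact_one:
  assumes "normal w" "i \<in> I" shows "hact i w \<one>\<^bsub>H i\<^esub> = w"
proof -
  interpret Hi: comm_group "H i" using comm_outer assms(2) .
  note sp = split_normal[OF assms(1,2)]
  show ?thesis using sp(1-4) assms(2) by (subst (2) sp(5)) (simp add: hact_def Let_def gact_one)
qed

lemma hact_hact:
  assumes w: "normal w" and i: "i \<in> I" and t: "t \<in> carrier (H i)" "u \<in> carrier (H i)"
  shows "hact i (hact i w u) t = hact i w (t \<otimes>\<^bsub>H i\<^esub> u)"
proof -
  interpret Hi: comm_group "H i" using comm_outer i .
  define s r where "s = head i w" and "r = rest i w"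
  have s: "s \<in> carrier (H i)" and r: "normal r" "\<not> headed i r" and wj: "w = join i s r"
    using split_normal[OF w i] by (auto simp: s_def r_def)
  define y where "y = srep i (u \<otimes>\<^bsub>H i\<^esub> s)"
  define c where "c = edge_inv i (inv\<^bsub>H i\<^esub> y \<otimes>\<^bsub>H i\<^esub> (u \<otimes>\<^bsub>H i\<^esub> s))"
  have y: "y \<in> carrier (H i)" and c: "c \<in> C i" "\<phi> i c = inv\<^bsub>H i\<^esub> y \<otimes>\<^bsub>H i\<^esub> (u \<otimes>\<^bsub>H i\<^esub> s)"
    using edge_inv_srep[OF i, of "u \<otimes>\<^bsub>H i\<^esub> s"] i s t by (auto simp: c_def y_def)
  have us: "u \<otimes>\<^bsub>H i\<^esub> s = y \<otimes>\<^bsub>H i\<^esub> \<phi> i c" using c y s t by simp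
  have r': "normal (gact r c)" "\<not> headed i (gact r c)"
    using r c i headed_gact by (auto intro: normal_gact)
  define z where "z = srep i (t \<otimes>\<^bsub>H i\<^esub> y)"
  define c' where "c' = edge_inv i (inv\<^bsub>H i\<^esub> z \<otimes>\<^bsub>H i\<^esub> (t \<otimes>\<^bsub>H i\<^esub> y))"
  have z: "z \<in> carrier (H i)" and c': "c' \<in> C i" "\<phi> i c' = inv\<^bsub>H i\<^esub> z \<otimes>\<^bsub>H i\<^esub> (t \<otimes>\<^bsub>H i\<^esub> y)"
    using edge_inv_srep[OF i, of "t \<otimes>\<^bsub>H i\<^esub> y"] i y t by (auto simp: c'_def z_def)
  have tus: "t \<otimes>\<^bsub>H i\<^esub> u \<otimes>\<^bsub>H i\<^esub> s = t \<otimes>\<^bsub>H i\<^esub> y \<otimes>\<^bsub>H i\<^esub> \<phi> i c"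
    using us t s y c i by (simp add: Hi.m_assoc)
  have "inv\<^bsub>H i\<^esub> (t \<otimes>\<^bsub>H i\<^esub> y) \<otimes>\<^bsub>H i\<^esub> (t \<otimes>\<^bsub>H i\<^esub> u \<otimes>\<^bsub>H i\<^esub> s) = \<phi> i c"
    unfolding tus using i t y c(1) by (metis Hi.inv_mult_cancel Hi.m_assoc Hi.m_closed edge_map_closed)
  then have ztus: "srep i (t \<otimes>\<^bsub>H i\<^esub> u \<otimes>\<^bsub>H i\<^esub> s) = z"
    unfolding z_def by (intro srep_eqI) (use i t s y c(1) in auto)
  have "inv\<^bsub>H i\<^esub> z \<otimes>\<^bsub>H i\<^esub> (t \<otimes>\<^bsub>H i\<^esub> u \<otimes>\<^bsub>H i\<^esub> s) = \<phi> i (c' \<otimes>\<^bsub>G\<^esub> c)"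
    using tus edge_map_mult[OF i c'(1) c(1)] c'(2) i t(1) y z edge_map_closed[OF i c(1)]
    by (simp add: Hi.m_assoc)
  then have "edge_inv i (inv\<^bsub>H i\<^esub> z \<otimes>\<^bsub>H i\<^esub> (t \<otimes>\<^bsub>H i\<^esub> u \<otimes>\<^bsub>H i\<^esub> s)) = c' \<otimes>\<^bsub>G\<^esub> c"
    using c c' i subgroup.m_closed[OF subgroup_edge] by simp
  then have "hact i w (t \<otimes>\<^bsub>H i\<^esub> u) = join i z (gact r (c' \<otimes>\<^bsub>G\<^esub> c))"
    using hact_join[OF r] wj ztus by simp
  moreover have "hact i (hact i w u) t = join i z (gact (gact r c) c')"
    using hact_join[OF r] hact_join[OF r'] wj by (simp add: y_def[symmetric] c_def[symmetric] z_def[symmetric] c'_def[symmetric])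
  ultimately show ?thesis using gact_gact[OF r(1)] c c' i by simp
qed

text \<open>The compatibility along the edges that \<open>copy_universal\<close> asks for. An edge
  element does not change the coset of the head, so in both actions it passes on to the
  rest.\<close>

lemma hact_edge:
  assumes w: "normal w" and i: "i \<in> I" and c: "c \<in> C i"
  shows "hact i w (\<phi> i c) = gact w c"
proof -
  interpret Hi: comm_group "H i" using comm_outer i .
  define s r where "s = head i w" and "r = rest i w"
  have s: "s \<in> carrier (H i)" "srep i s = s" and r: "normal r" "\<not> headed i r" and wj: "w = join i s r"
    using split_normal[OF w i] by (auto simp: s_def r_def)
  have "srep i (\<phi> i c \<otimes>\<^bsub>H i\<^esub> s) = srep i s"
    by (rule srep_eqI) (use i c s in \<open>auto simp: Hi.m_comm[of "\<phi> i c" s]\<close>)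
  then have y: "srep i (\<phi> i c \<otimes>\<^bsub>H i\<^esub> s) = s" using s by simp
  have "inv\<^bsub>H i\<^esub> s \<otimes>\<^bsub>H i\<^esub> (\<phi> i c \<otimes>\<^bsub>H i\<^esub> s) = \<phi> i c" using i c s by (simp add: Hi.m_comm[of "\<phi> i c" s])
  then have "hact i w (\<phi> i c) = join i s (gact r c)" using hact_join[OF r, of s "\<phi> i c"] wj y i c by simp
  moreover have "rep i c = \<one>\<^bsub>G\<^esub>" using rep_eq_one_iff i c by simp
  ultimately show ?thesis using wj i c by (simp add: join_def)
qed

definition NF where "NF = Collect normal"

text \<open>Van der Waerden's method: the permutations of the normal forms given by the vertex
  groups satisfy the defining relations, so the whole group acts. Uniqueness of normal forms is then
  read off from the action, without any confluence argument for rewriting words.\<close>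

lemma action_exists:
  "\<exists>F\<in>hom E (BijGroup NF). (\<forall>g\<in>carrier G. F (cen g) = restrict (\<lambda>w. gact w g) NF) \<and>
    (\<forall>i\<in>I. \<forall>t\<in>carrier (H i). F (out i t) = restrict (\<lambda>w. hact i w t) NF)"
proof (rule copy_universal)
  show "group (BijGroup NF)" by (rule group_BijGroup)
  show "(\<lambda>g. restrict (\<lambda>w. gact w g) NF) \<in> hom G (BijGroup NF)"
    by (rule action_hom_BijGroup) (auto simp: NF_def G.is_group normal_gact gact_one gact_gact)
  show "(\<lambda>t. restrict (\<lambda>w. hact i w t) NF) \<in> hom (H i) (BijGroup NF)" if "i \<in> I" for i
    by (rule action_hom_BijGroup) (use that in \<open>auto simp: NF_def group_outer normal_hact hact_one hact_hact\<close>)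
  show "restrict (\<lambda>w. gact w c) NF = restrict (\<lambda>w. hact i w (\<phi> i c)) NF" if "i \<in> I" "c \<in> C i" for i c
    using that hact_edge by (intro restrict_ext) (simp add: NF_def)
qed

definition act where
  "act = (SOME F. F \<in> hom E (BijGroup NF) \<and> (\<forall>g\<in>carrier G. F (cen g) = restrict (\<lambda>w. gact w g) NF) \<and>
    (\<forall>i\<in>I. \<forall>t\<in>carrier (H i). F (out i t) = restrict (\<lambda>w. hact i w t) NF))"

lemma act: "act \<in> hom E (BijGroup NF)"
  "g \<in> carrier G \<Longrightarrow> act (cen g) = restrict (\<lambda>w. gact w g) NF"
  "i \<in> I \<Longrightarrow> t \<in> carrier (H i) \<Longrightarrow> act (out i t) = restrict (\<lambda>w. hact i w t) NF"
  using someI_ex[OF action_exists[unfolded Bex_def], folded act_def] by blast+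

lemma act_cen [simp]: "g \<in> carrier G \<Longrightarrow> normal w \<Longrightarrow> act (cen g) w = gact w g"
  and act_out [simp]: "i \<in> I \<Longrightarrow> t \<in> carrier (H i) \<Longrightarrow> normal w \<Longrightarrow> act (out i t) w = hact i w t"
  by (simp_all add: act NF_def)

lemma act_closed [simp]: "e \<in> carrier E \<Longrightarrow> normal w \<Longrightarrow> normal (act e w)"
  using act(1) Bij_imp_funcset[of "act e" NF] by (auto simp: hom_def BijGroup_def NF_def)

lemma act_mult: "e \<in> carrier E \<Longrightarrow> f \<in> carrier E \<Longrightarrow> normal w \<Longrightarrow> act (e \<otimes>\<^bsub>E\<^esub> f) w = act e (act f w)"
  using act(1) by (auto simp: hom_def BijGroup_def NF_def compose_def Pi_iff)

lemma act_one: "normal w \<Longrightarrow> act \<one>\<^bsub>E\<^esub> w = w"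
  using act_cen[of "\<one>\<^bsub>G\<^esub>" w] gact_one by simp

primrec ev where
  "ev (Tail h) = cen h"
| "ev (Node x i s r) = cen x \<otimes>\<^bsub>E\<^esub> (out i s \<otimes>\<^bsub>E\<^esub> ev r)"

lemma ev_closed [simp]: "normal w \<Longrightarrow> ev w \<in> carrier E"
  by (induction w) auto

lemma ev_gact: "normal w \<Longrightarrow> g \<in> carrier G \<Longrightarrow> ev (gact w g) = cen g \<otimes>\<^bsub>E\<^esub> ev w"
proof (induction w arbitrary: g)
  case (Tail h)
  then show ?case by (simp add: cen_mult)
next
  case (Node x i s r)
  then have i: "i \<in> I" and x: "x \<in> carrier G" and s: "s \<in> carrier (H i)" and r: "normal r" by auto
  interpret Hi: comm_group "H i" using comm_outer i .
  let ?y = "rep i (g \<otimes>\<^bsub>G\<^esub> x)" and ?c = "inv\<^bsub>G\<^esub> (rep i (g \<otimes>\<^bsub>G\<^esub> x)) \<otimes>\<^bsub>G\<^esub> (g \<otimes>\<^bsub>G\<^esub> x)"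
  have y: "?y \<in> carrier G" and c: "?c \<in> C i" using i x Node by (auto intro: rep_edge)
  have cG: "?c \<in> carrier G" using c i by simp
  have "ev (gact (Node x i s r) g) = cen ?y \<otimes>\<^bsub>E\<^esub> (out i s \<otimes>\<^bsub>E\<^esub> (cen ?c \<otimes>\<^bsub>E\<^esub> ev r))"
    using Node.IH[OF r cG] by simp
  also have "out i s \<otimes>\<^bsub>E\<^esub> (cen ?c \<otimes>\<^bsub>E\<^esub> ev r) = out i (s \<otimes>\<^bsub>H i\<^esub> \<phi> i ?c) \<otimes>\<^bsub>E\<^esub> ev r"
    using cen_edge[OF i c] i s c r by (simp add: out_mult E.m_assoc)
  also have "\<dots> = cen ?c \<otimes>\<^bsub>E\<^esub> (out i s \<otimes>\<^bsub>E\<^esub> ev r)"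
    using cen_edge[OF i c] i s c r by (simp add: Hi.m_comm[of s] out_mult E.m_assoc)
  also have "cen ?y \<otimes>\<^bsub>E\<^esub> (cen ?c \<otimes>\<^bsub>E\<^esub> (out i s \<otimes>\<^bsub>E\<^esub> ev r)) = cen (?y \<otimes>\<^bsub>G\<^esub> ?c) \<otimes>\<^bsub>E\<^esub> (out i s \<otimes>\<^bsub>E\<^esub> ev r)"
    using y cG i s r by (simp only: cen_mult E.m_assoc cen_closed out_closed ev_closed E.m_closed)
  also have "?y \<otimes>\<^bsub>G\<^esub> ?c = g \<otimes>\<^bsub>G\<^esub> x" using y x Node by simp
  finally show ?case using Node x i s r by (simp add: cen_mult E.m_assoc)
qed

lemma ev_join: "i \<in> I \<Longrightarrow> s \<in> carrier (H i) \<Longrightarrow> normal r \<Longrightarrow> ev (join i s r) = out i s \<otimes>\<^bsub>E\<^esub> ev r"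
  by (auto simp: join_def)

lemma ev_hact:
  assumes w: "normal w" and i: "i \<in> I" and t: "t \<in> carrier (H i)"
  shows "ev (hact i w t) = out i t \<otimes>\<^bsub>E\<^esub> ev w"
proof -
  interpret Hi: comm_group "H i" using comm_outer i .
  define s r where "s = head i w" and "r = rest i w"
  have s: "s \<in> carrier (H i)" "srep i s = s" and r: "normal r" "\<not> headed i r" and wj: "w = join i s r"
    using split_normal[OF w i] by (auto simp: s_def r_def)
  define y where "y = srep i (t \<otimes>\<^bsub>H i\<^esub> s)"
  define c where "c = edge_inv i (inv\<^bsub>H i\<^esub> y \<otimes>\<^bsub>H i\<^esub> (t \<otimes>\<^bsub>H i\<^esub> s))"
  have y: "y \<in> carrier (H i)" and c: "c \<in> C i" "\<phi> i c = inv\<^bsub>H i\<^esub> y \<otimes>\<^bsub>H i\<^esub> (t \<otimes>\<^bsub>H i\<^esub> s)"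
    using edge_inv_srep[OF i, of "t \<otimes>\<^bsub>H i\<^esub> s"] i s t by (auto simp: c_def y_def)
  have "hact i w t = join i y (gact r c)" using hact_join[OF r] wj by (simp add: y_def c_def)
  then have "ev (hact i w t) = out i y \<otimes>\<^bsub>E\<^esub> (out i (\<phi> i c) \<otimes>\<^bsub>E\<^esub> ev r)"
    using y c i r cen_edge[OF i c(1)] by (simp add: ev_join normal_gact ev_gact)
  also have "\<dots> = out i (y \<otimes>\<^bsub>H i\<^esub> \<phi> i c) \<otimes>\<^bsub>E\<^esub> ev r" using y c(1) i r by (simp add: out_mult E.m_assoc)
  also have "y \<otimes>\<^bsub>H i\<^esub> \<phi> i c = t \<otimes>\<^bsub>H i\<^esub> s" using c y s t by simp
  finally show ?thesis using wj i s t r by (simp add: ev_join out_mult E.m_assoc)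
qed

lemma ev_act: "e \<in> carrier E \<Longrightarrow> normal w \<Longrightarrow> ev (act e w) = e \<otimes>\<^bsub>E\<^esub> ev w"
proof (induction rule: copy_induct)
  case one
  then show ?case by (simp add: act_one)
qed (simp_all add: act_mult ev_gact ev_hact E.m_assoc)

text \<open>The orbit of the empty form. On normal forms and elements of \<open>E\<close> this map
  and \<open>ev\<close> are inverse to each other (\<open>ev_nform_of\<close>,
  \<open>nform_of_ev\<close>).\<close>

definition nform_of where "nform_of e = act e (Tail \<one>\<^bsub>G\<^esub>)"

lemma normal_nform_of [simp]: "e \<in> carrier E \<Longrightarrow> normal (nform_of e)"
  by (simp add: nform_of_def)

lemma ev_nform_of: "e \<in> carrier E \<Longrightarrow> ev (nform_of e) = e"
  by (simp add: nform_of_def ev_act)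

lemma nform_of_mult: "e \<in> carrier E \<Longrightarrow> f \<in> carrier E \<Longrightarrow> nform_of (e \<otimes>\<^bsub>E\<^esub> f) = act e (nform_of f)"
  by (simp add: nform_of_def act_mult)

lemma hact_not_headed:
  assumes "normal r" "\<not> headed i r" "i \<in> I" "t \<in> carrier (H i)"
  shows "hact i r t = join i (srep i t) (gact r (edge_inv i (inv\<^bsub>H i\<^esub> (srep i t) \<otimes>\<^bsub>H i\<^esub> t)))"
  using hact_join[OF assms(1,2), of "\<one>\<^bsub>H i\<^esub>" t] assms group.is_monoid[OF group_outer]
  by (simp add: join_def[of _ "\<one>\<^bsub>H i\<^esub>"] monoid.r_one)

lemma nform_of_ev: "normal w \<Longrightarrow> nform_of (ev w) = w"
proof (induction w)
  case (Tail h)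
  then show ?case by (simp add: nform_of_def)
next
  case (Node x i s r)
  then have i: "i \<in> I" and x: "x \<in> carrier G" "rep i x = x" and s: "s \<in> carrier (H i)" "srep i s = s" "s \<noteq> \<one>\<^bsub>H i\<^esub>"
    and r: "normal r" "\<not> headed i r" by auto
  interpret Hi: comm_group "H i" using comm_outer i .
  have "hact i r s = Node \<one>\<^bsub>G\<^esub> i s r" using hact_not_headed[OF r i s(1)] s i r by (simp add: join_def gact_one)
  moreover have "normal (Node \<one>\<^bsub>G\<^esub> i s r)" using i s r by simp
  ultimately show ?case using Node i x s r by (simp add: nform_of_mult gact_one)
qed

section \<open>Length and cancellation\<close>

definition len where "len e = depth (nform_of e)"

text \<open>Where cancellation stops, the second form begins with a syllable of \<open>H i\<close>
  and central part 1, whereas \<open>p\<close>, which follows a syllable of \<open>H i\<close>,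
  cannot begin this way. So nothing more cancels.\<close>

lemma common_not_headed:
  "normal (Node x i s p) \<Longrightarrow> common p (Node \<one>\<^bsub>G\<^esub> i y q) = 0"
  by (cases p) auto

text \<open>Cancellation between the inverse of the first form and the second runs along their
  common initial part. Two equal nodes vanish, a loss of 2; two nodes that differ only in the outer
  syllable merge into one, a loss of 1, and end the process; any other pair ends it without loss.
  \<open>common\<close> is the total loss.\<close>

lemma depth_act_inv:
  "normal p \<Longrightarrow> normal q \<Longrightarrow> depth (act (inv\<^bsub>E\<^esub> (ev p)) q) + common p q = depth p + depth q"
proof (induction p arbitrary: q)
  case (Tail h)
  then have "act (inv\<^bsub>E\<^esub> (ev (Tail h))) q = gact q (inv\<^bsub>G\<^esub> h)" using cen_inv[of h] by (metis G.inv_closed act_cen ev.simps(1) normal.simps(1))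
  then show ?case by simp
next
  case (Node x i s p)
  then have i: "i \<in> I" and x: "x \<in> carrier G" "rep i x = x" and s: "s \<in> carrier (H i)" "srep i s = s" "s \<noteq> \<one>\<^bsub>H i\<^esub>"
    and p: "normal p" "\<not> headed i p" by auto
  interpret Hi: comm_group "H i" using comm_outer i .
  let ?q1 = "gact q (inv\<^bsub>G\<^esub> x)"
  let ?q2 = "hact i ?q1 (inv\<^bsub>H i\<^esub> s)"
  have q1: "normal ?q1" using Node x by (simp add: normal_gact)
  have q2: "normal ?q2" using q1 i s by (simp add: normal_hact)
  have "inv\<^bsub>E\<^esub> (ev (Node x i s p)) = inv\<^bsub>E\<^esub> (ev p) \<otimes>\<^bsub>E\<^esub> (out i (inv\<^bsub>H i\<^esub> s) \<otimes>\<^bsub>E\<^esub> cen (inv\<^bsub>G\<^esub> x))"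
    using i x s p by (simp add: E.inv_mult_group E.m_assoc out_inv cen_inv)
  then have eq: "act (inv\<^bsub>E\<^esub> (ev (Node x i s p))) q = act (inv\<^bsub>E\<^esub> (ev p)) ?q2"
    using i x s p Node.prems q1 by (simp add: act_mult)
  note IH = Node.IH[OF p(1) q2]
  show ?case
  proof (cases "\<exists>s' q'. q = Node x i s' q'")
    case True
    then obtain s' q' where q: "q = Node x i s' q'" by blast
    have s': "s' \<in> carrier (H i)" "srep i s' = s'" "s' \<noteq> \<one>\<^bsub>H i\<^esub>" and q': "normal q'" "\<not> headed i q'"
      using Node.prems q by auto
    have "?q1 = join i s' q'" using q x i q' s' by (simp add: gact_one join_def)
    note h = hact_join[OF q', of s' "inv\<^bsub>H i\<^esub> s", folded this]
    show ?thesis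
    proof (cases "s = s'")
      case True
      then have "?q2 = q'" using h i s q' by (simp add: join_def gact_one)
      then show ?thesis using eq IH q True by simp
    next
      case False
      have "inv\<^bsub>H i\<^esub> s \<otimes>\<^bsub>H i\<^esub> s' \<notin> \<phi> i ` C i"
        using srep_eqI[OF i s'(1) s(1)] s s' False by auto
      then have "srep i (inv\<^bsub>H i\<^esub> s \<otimes>\<^bsub>H i\<^esub> s') \<noteq> \<one>\<^bsub>H i\<^esub>" using srep_eq_one_iff i s s' by simp
      then obtain y c where "?q2 = Node \<one>\<^bsub>G\<^esub> i y (gact q' c)" using h by (simp add: join_def)
      then show ?thesis using eq IH q False common_not_headed[OF Node.prems(1)] by simp
    qed
  next
    case False
    have "\<not> headed i ?q1"
    proof (cases q)
      case q: (Node x' j s' q')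
      show ?thesis
      proof
        assume "headed i ?q1"
        then have j: "j = i" and "rep i (inv\<^bsub>G\<^esub> x \<otimes>\<^bsub>G\<^esub> x') = \<one>\<^bsub>G\<^esub>" using q by auto
        then have "inv\<^bsub>G\<^esub> x \<otimes>\<^bsub>G\<^esub> x' \<in> C i" using rep_eq_one_iff[OF i] x q Node.prems by simp
        then have "x' = x" using rep_eqI[OF i _ x(1)] x q j Node.prems by auto
        then show False using False q j by blast
      qed
    qed simp
    moreover have "inv\<^bsub>H i\<^esub> s \<notin> \<phi> i ` C i"
      using subgroup.m_inv_closed[OF subgroup_edge_image[OF i], of "inv\<^bsub>H i\<^esub> s"] srep_eq_one_iff[OF i s(1)] s by auto
    then have "srep i (inv\<^bsub>H i\<^esub> s) \<noteq> \<one>\<^bsub>H i\<^esub>" using srep_eq_one_iff i s by simp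
    ultimately obtain y c where "?q2 = Node \<one>\<^bsub>G\<^esub> i y (gact ?q1 c)"
      using hact_not_headed[OF q1 _ i, of "inv\<^bsub>H i\<^esub> s"] s by (simp add: join_def)
    moreover have "common (Node x i s p) q = 0" using False by (cases q) auto
    ultimately show ?thesis using eq IH common_not_headed[OF Node.prems(1)] by simp
  qed
qed

text \<open>In other words, \<open>common\<close> is twice the Gromov product at the base
  point.\<close>

lemma len_inv_mult:
  assumes "x \<in> carrier E" "y \<in> carrier E"
  shows "len (inv\<^bsub>E\<^esub> x \<otimes>\<^bsub>E\<^esub> y) + common (nform_of x) (nform_of y) = len x + len y"
  using depth_act_inv[of "nform_of x" "nform_of y"] assms by (simp add: len_def nform_of_mult ev_nform_of)

lemma nform_of_cen: "g \<in> carrier G \<Longrightarrow> nform_of (cen g) = Tail g"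
  by (simp add: nform_of_def)

lemma nform_of_out_Node:
  assumes "i \<in> I" "t \<in> carrier (H i)" "t \<notin> \<phi> i ` C i"
  obtains y c where "nform_of (out i t) = Node \<one>\<^bsub>G\<^esub> i y (Tail c)"
  using assms hact_not_headed[of "Tail \<one>\<^bsub>G\<^esub>" i t] srep_eq_one_iff[of i t] by (simp add: nform_of_def join_def)

lemma cen_inj: "inj_on cen (carrier G)"
  by (rule inj_onI) (metis nform_of_cen nform.inject(1))

text \<open>An outer element outside the edge group has a normal form with a node, while that of an
  element of \<open>G\<close> is a mere tail.\<close>

lemma out_in_cen_iff:
  assumes "i \<in> I" "t \<in> carrier (H i)" "g \<in> carrier G"
  shows "out i t = cen g \<longleftrightarrow> g \<in> C i \<and> t = \<phi> i g"
proof
  assume eq: "out i t = cen g"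
  then have "nform_of (out i t) = Tail g" using nform_of_cen assms by simp
  then have "t \<in> \<phi> i ` C i" using nform_of_out_Node[OF assms(1,2)] by (metis nform.distinct(1))
  then obtain c where c: "c \<in> C i" "t = \<phi> i c" by blast
  then have "cen c = cen g" using eq cen_edge assms by simp
  then have "c = g" by (rule inj_onD[OF cen_inj]) (use c assms in auto)
  then show "g \<in> C i \<and> t = \<phi> i g" using c by simp
qed (use assms cen_edge in auto)

lemma out_inj: "i \<in> I \<Longrightarrow> inj_on (out i) (carrier (H i))"
proof (rule inj_onI)
  fix s t assume i: "i \<in> I" and st: "s \<in> carrier (H i)" "t \<in> carrier (H i)" and eq: "out i s = out i t"
  interpret Hi: comm_group "H i" using comm_outer i .
  have "out i (inv\<^bsub>H i\<^esub> s \<otimes>\<^bsub>H i\<^esub> t) = cen \<one>\<^bsub>G\<^esub>" using st i eq by (simp add: out_mult out_inv)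
  then have "inv\<^bsub>H i\<^esub> s \<otimes>\<^bsub>H i\<^esub> t = \<phi> i \<one>\<^bsub>G\<^esub>" using out_in_cen_iff[OF i, of "inv\<^bsub>H i\<^esub> s \<otimes>\<^bsub>H i\<^esub> t" "\<one>\<^bsub>G\<^esub>"] st by simp
  then have "inv\<^bsub>H i\<^esub> s \<otimes>\<^bsub>H i\<^esub> t = \<one>\<^bsub>H i\<^esub>" using i by simp
  then show "s = t" using st by (metis Hi.inv_closed Hi.inv_equality Hi.inv_inv)
qed

sublocale L: star_length E len "cen ` carrier G" I "\<lambda>i. out i ` carrier (H i)"
proof (intro star_length.intro length_group.intro star_length_axioms.intro length_group_axioms.intro)
  show "group E" by (rule E.is_group)
  show "len \<one>\<^bsub>E\<^esub> = 0" using nform_of_cen[of "\<one>\<^bsub>G\<^esub>"] by (simp add: len_def)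
  then show "len (inv\<^bsub>E\<^esub> x) = len x" if "x \<in> carrier E" for x
    using len_inv_mult[OF that E.one_closed] that nform_of_cen[of "\<one>\<^bsub>G\<^esub>"] by simp
  show "len (inv\<^bsub>E\<^esub> w \<otimes>\<^bsub>E\<^esub> x) + len (inv\<^bsub>E\<^esub> y \<otimes>\<^bsub>E\<^esub> z) \<le>
      max (len (inv\<^bsub>E\<^esub> w \<otimes>\<^bsub>E\<^esub> y) + len (inv\<^bsub>E\<^esub> x \<otimes>\<^bsub>E\<^esub> z)) (len (inv\<^bsub>E\<^esub> w \<otimes>\<^bsub>E\<^esub> z) + len (inv\<^bsub>E\<^esub> x \<otimes>\<^bsub>E\<^esub> y))"
    if c: "w \<in> carrier E" "x \<in> carrier E" "y \<in> carrier E" "z \<in> carrier E" for w x y z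
  proof -
    \<comment> \<open>Expressing distances by \<open>k\<close> cancels the lengths of the four
      points. What remains compares sums over complementary pairs and follows from the ultrametric
      inequality for \<open>common\<close>.\<close>
    define k where "k a b = common (nform_of a) (nform_of b)" for a b
    have l: "len (inv\<^bsub>E\<^esub> a \<otimes>\<^bsub>E\<^esub> b) + k a b = len a + len b" if "a \<in> carrier E" "b \<in> carrier E" for a b
      using len_inv_mult that by (simp add: k_def)
    have u: "k a b \<le> k a c \<or> k b c \<le> k a c" for a b c
      using common_ultrametric[of "nform_of a" "nform_of b" "nform_of c"] by (auto simp: k_def min_le_iff_disj)
    have s: "k a b = k b a" for a b by (simp add: k_def common_sym)
    have "k w y + k x z \<le> k w x + k y z \<or> k w z + k x y \<le> k w x + k y z"
      using u[of w y x] u[of w z x] u[of y w z] u[of y x z] s[of x y] s[of x z] s[of y w] by linarith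
    then show ?thesis using l[OF c(1,2)] l[OF c(3,4)] l[OF c(1,3)] l[OF c(2,4)] l[OF c(1,4)] l[OF c(2,3)] by linarith
  qed
  show "subgroup (cen ` carrier G) E"
    using group_hom.img_is_subgroup[of G E cen] cen_hom by (simp add: group_hom_def group_hom_axioms_def)
  show "subgroup (out i ` carrier (H i)) E" if "i \<in> I" for i
    using group_hom.img_is_subgroup[of "H i" E "out i"] out_hom group_outer that
    by (simp add: group_hom_def group_hom_axioms_def)
  show "x \<otimes>\<^bsub>E\<^esub> y = y \<otimes>\<^bsub>E\<^esub> x" if i: "i \<in> I" and xy: "x \<in> out i ` carrier (H i)" "y \<in> out i ` carrier (H i)" for i x y
  proof -
    interpret Hi: comm_group "H i" using comm_outer i .
    obtain s t where st: "x = out i s" "y = out i t" "s \<in> carrier (H i)" "t \<in> carrier (H i)" using xy by blast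
    then have "out i (s \<otimes>\<^bsub>H i\<^esub> t) = out i (t \<otimes>\<^bsub>H i\<^esub> s)" using Hi.m_comm by metis
    then show ?thesis using st i by (simp add: out_mult)
  qed
  have len0: "len e = 0 \<longleftrightarrow> e \<in> cen ` carrier G" if e: "e \<in> carrier E" for e
  proof
    assume "len e = 0"
    then obtain h where "nform_of e = Tail h" by (cases "nform_of e") (auto simp: len_def)
    then show "e \<in> cen ` carrier G" using ev_nform_of[OF e] normal_nform_of[OF e] by auto
  qed (auto simp: len_def nform_of_cen)
  then show "len e = 0 \<longleftrightarrow> e \<in> cen ` carrier G" if "e \<in> carrier E" for e using that .
  have edge_out: "t \<notin> \<phi> i ` C i" if "i \<in> I" "out i t \<notin> cen ` carrier G" for i t
    using that by (auto simp: cen_edge[symmetric])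
  show len1: "len t = 1" if t: "i \<in> I" "t \<in> out i ` carrier (H i)" "t \<notin> cen ` carrier G" for i t
  proof -
    obtain t' where t': "t = out i t'" "t' \<in> carrier (H i)" "t' \<notin> \<phi> i ` C i" using t edge_out by blast
    obtain y c where "nform_of t = Node \<one>\<^bsub>G\<^esub> i y (Tail c)" using nform_of_out_Node[OF t(1) t'(2,3)] t'(1) by blast
    then show ?thesis by (simp add: len_def)
  qed
  show "\<exists>g\<in>cen ` carrier G. \<exists>i\<in>I. \<exists>t\<in>out i ` carrier (H i) - cen ` carrier G. \<exists>e'\<in>carrier E.
      e = g \<otimes>\<^bsub>E\<^esub> t \<otimes>\<^bsub>E\<^esub> e' \<and> len e = Suc (len e')" if e: "e \<in> carrier E" "0 < len e" for e
  proof -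
    obtain x i s r where n: "nform_of e = Node x i s r" using e(2) by (cases "nform_of e") (auto simp: len_def)
    then have nr: "i \<in> I" "x \<in> carrier G" "s \<in> carrier (H i)" "srep i s = s" "s \<noteq> \<one>\<^bsub>H i\<^esub>" "normal r"
      using normal_nform_of[OF e(1)] by auto
    have "s \<notin> \<phi> i ` C i" using srep_eq_one_iff[OF nr(1,3)] nr(4,5) by simp
    then have "out i s \<notin> cen ` carrier G" using out_in_cen_iff[OF nr(1,3)] by blast
    moreover have "e = cen x \<otimes>\<^bsub>E\<^esub> out i s \<otimes>\<^bsub>E\<^esub> ev r" using ev_nform_of[OF e(1)] n nr by (simp add: E.m_assoc)
    moreover have "len e = Suc (len (ev r))" using n nr by (simp add: len_def nform_of_ev)
    ultimately show ?thesis
      using nr by (intro bexI[of _ "cen x"] bexI[of _ i] bexI[of _ "out i s"] bexI[of _ "ev r"] conjI) auto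
  qed
  show "len (t \<otimes>\<^bsub>E\<^esub> a \<otimes>\<^bsub>E\<^esub> s) = 2"
    if i: "i \<in> I" and j: "j \<in> I" and t: "t \<in> out i ` carrier (H i)" "t \<notin> cen ` carrier G"
      and s: "s \<in> out j ` carrier (H j)" "s \<notin> cen ` carrier G" and a: "a \<in> cen ` carrier G"
      and ne: "i \<noteq> j \<or> a \<notin> out i ` carrier (H i)" for i j t s a
  proof -
    obtain t' where t': "t = out i t'" "t' \<in> carrier (H i)" "t' \<notin> \<phi> i ` C i" using i t edge_out by blast
    obtain s' where s': "s = out j s'" "s' \<in> carrier (H j)" "s' \<notin> \<phi> j ` C j" using j s edge_out by blast
    obtain a' where a': "a = cen a'" "a' \<in> carrier G" using a by blast
    obtain y c where n: "nform_of s = Node \<one>\<^bsub>G\<^esub> j y (Tail c)" using nform_of_out_Node[OF j s'(2,3)] s'(1) by blast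
    have sE: "s \<in> carrier E" using s' j by simp
    let ?w = "gact (nform_of s) a'"
    have w: "normal ?w" using a' sE by (simp add: normal_gact)
    have "\<not> headed i ?w"
    proof
      assume "headed i ?w"
      then have "j = i" "rep i a' = \<one>\<^bsub>G\<^esub>" using n a' by auto
      then have "a' \<in> C i" using rep_eq_one_iff[OF i a'(2)] by simp
      then have "a \<in> out i ` carrier (H i)" using a' cen_edge i by auto
      then show False using ne \<open>j = i\<close> by blast
    qed
    then have "depth (hact i ?w t') = 2"
      using hact_not_headed[OF w _ i t'(2)] srep_eq_one_iff[OF i t'(2)] t'(3) n by (simp add: join_def)
    moreover have "nform_of (t \<otimes>\<^bsub>E\<^esub> a \<otimes>\<^bsub>E\<^esub> s) = hact i ?w t'"
      using t' a' sE i w by (simp add: E.m_assoc nform_of_mult)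
    ultimately show ?thesis by (simp add: len_def)
  qed
qed

lemma out_edge_iff: "i \<in> I \<Longrightarrow> t \<in> carrier (H i) \<Longrightarrow> out i t \<in> cen ` carrier G \<longleftrightarrow> t \<in> \<phi> i ` C i"
  using out_in_cen_iff by (auto simp: image_iff)

lemma cen_edge_iff: "i \<in> I \<Longrightarrow> g \<in> carrier G \<Longrightarrow> cen g \<in> out i ` carrier (H i) \<longleftrightarrow> g \<in> C i"
  using out_in_cen_iff[of i _ g] cen_edge[of i g] edge_map_closed[of i g] by fastforce

end

section \<open>Tensor products\<close>

lemma partial_exp_groupI:
  fixes G :: "('g, 'r) exp_struct"
  assumes "ring A" "group G"
    and "\<And>g \<alpha> x. \<lbrakk>g \<in> carrier G; \<alpha> \<in> carrier A; expo G g \<alpha> = Some x\<rbrakk> \<Longrightarrow> x \<in> carrier G"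
    and "\<And>g. g \<in> carrier G \<Longrightarrow> expo G g \<one>\<^bsub>A\<^esub> = Some g"
    and "\<And>g. g \<in> carrier G \<Longrightarrow> expo G g \<zero>\<^bsub>A\<^esub> = Some \<one>\<^bsub>G\<^esub>"
    and "\<And>\<alpha>. \<alpha> \<in> carrier A \<Longrightarrow> expo G \<one>\<^bsub>G\<^esub> \<alpha> = Some \<one>\<^bsub>G\<^esub>"
    and "\<And>g \<alpha> \<beta> x y. \<lbrakk>g \<in> carrier G; \<alpha> \<in> carrier A; \<beta> \<in> carrier A; expo G g \<alpha> = Some x; expo G g \<beta> = Some y\<rbrakk>
        \<Longrightarrow> expo G g (\<alpha> \<oplus>\<^bsub>A\<^esub> \<beta>) = Some (x \<otimes>\<^bsub>G\<^esub> y)"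
    and "\<And>g \<alpha> \<beta> x y. \<lbrakk>g \<in> carrier G; \<alpha> \<in> carrier A; \<beta> \<in> carrier A; expo G g \<alpha> = Some x; expo G x \<beta> = Some y\<rbrakk>
        \<Longrightarrow> expo G g (\<alpha> \<otimes>\<^bsub>A\<^esub> \<beta>) = Some y"
    and "\<And>g h \<alpha>. \<lbrakk>g \<in> carrier G; h \<in> carrier G; \<alpha> \<in> carrier A\<rbrakk>
        \<Longrightarrow> expo G (conj_by G h g) \<alpha> = map_option (conj_by G h) (expo G g \<alpha>)"
    and "\<And>g h \<alpha> x y. \<lbrakk>g \<in> carrier G; h \<in> carrier G; \<alpha> \<in> carrier A; g \<otimes>\<^bsub>G\<^esub> h = h \<otimes>\<^bsub>G\<^esub> g;
        expo G g \<alpha> = Some x; expo G h \<alpha> = Some y\<rbrakk> \<Longrightarrow> expo G (g \<otimes>\<^bsub>G\<^esub> h) \<alpha> = Some (x \<otimes>\<^bsub>G\<^esub> y)"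
  shows "partial_exp_group A G"
  using assms by (simp add: partial_exp_group_def partial_exp_group_axioms_def)

locale tensor_data = A: ring A + C: comm_group C
  for A :: "('r, 'n) ring_scheme" and C :: "('g, 'r) exp_struct" +
  assumes expo_carrier: "\<lbrakk>x \<in> carrier C; \<alpha> \<in> carrier A; expo C x \<alpha> = Some y\<rbrakk> \<Longrightarrow> y \<in> carrier C"
begin

abbreviation "F \<equiv> tensor_free A C"
abbreviation "N \<equiv> tensor_null A C"
abbreviation "T \<equiv> tensor A C"

sublocale F: comm_group F
  unfolding tensor_free_def by (rule abelian_free_Abelian_group)

lemma carrier_F: "f \<in> carrier F \<longleftrightarrow> Poly_Mapping.keys f \<subseteq> carrier C \<times> carrier A"
  by (simp add: tensor_free_def)

lemma F_ops [simp]: "x \<otimes>\<^bsub>F\<^esub> y = x + y" "\<one>\<^bsub>F\<^esub> = 0"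
  by (simp_all add: tensor_free_def)

lemma F_inv [simp]: "x \<in> carrier F \<Longrightarrow> inv\<^bsub>F\<^esub> x = - x"
  by (simp add: tensor_free_def)

lemma frag_of_F [simp]: "frag_of p \<in> carrier F \<longleftrightarrow> p \<in> carrier C \<times> carrier A"
  by (simp add: tensor_free_def)

lemma F_add [simp]: "x \<in> carrier F \<Longrightarrow> y \<in> carrier F \<Longrightarrow> x + y \<in> carrier F"
  using F.m_closed by simp

lemma F_minus [simp]: "x \<in> carrier F \<Longrightarrow> - x \<in> carrier F"
  using F.inv_closed by simp

lemma F_diff [simp]: "x \<in> carrier F \<Longrightarrow> y \<in> carrier F \<Longrightarrow> x - y \<in> carrier F"
  using F_add[of x "- y"] by simp

lemma relators_F: "tensor_relators A C \<subseteq> carrier F"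
  unfolding tensor_relators_def using expo_carrier by auto

sublocale N: normal N F
  unfolding tensor_null_def by (intro F.subgroup_imp_normal F.generate_is_subgroup relators_F)

lemma tensor_eq: "carrier T = carrier (F Mod N)" "monoid.mult T = monoid.mult (F Mod N)" "one T = one (F Mod N)"
  by (simp_all add: tensor_def Let_def)

lemma comm_group_tensor: "comm_group T"
proof -
  interpret Q: comm_group "F Mod N"
    by (intro F.abelian_FactGroup N.is_subgroup)
  show ?thesis
    by (rule comm_groupI[of T, unfolded tensor_eq])
      (assumption | rule Q.m_closed Q.one_closed Q.m_assoc Q.m_comm Q.l_one Q.l_inv_ex)+
qed

sublocale T: comm_group T
  by (rule comm_group_tensor)

definition proj where "proj f = N #>\<^bsub>F\<^esub> f"

lemma proj_hom: "proj \<in> hom F T"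
  using N.r_coset_hom_Mod by (auto simp: hom_def tensor_eq proj_def)

lemma tensor_carrierE:
  assumes "X \<in> carrier T" obtains f where "f \<in> carrier F" "X = proj f"
  using assms by (auto simp: tensor_eq carrier_FactGroup proj_def)

lemma proj_closed [simp]: "f \<in> carrier F \<Longrightarrow> proj f \<in> carrier T"
  using proj_hom by (auto simp: hom_def)

lemma proj_add: "f \<in> carrier F \<Longrightarrow> g \<in> carrier F \<Longrightarrow> proj (f + g) = proj f \<otimes>\<^bsub>T\<^esub> proj g"
  using proj_hom by (auto simp: hom_def)

lemma proj_zero: "proj 0 = \<one>\<^bsub>T\<^esub>"
  using hom_one[OF proj_hom] by (simp add: F.is_group T.is_group)

lemma proj_null: "f \<in> N \<Longrightarrow> proj f = \<one>\<^bsub>T\<^esub>"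
  unfolding proj_def tensor_eq using N.is_subgroup
  by (simp add: F.coset_join2 subgroup.mem_carrier)

lemma proj_diff: "f \<in> carrier F \<Longrightarrow> g \<in> carrier F \<Longrightarrow> proj (f - g) = proj f \<otimes>\<^bsub>T\<^esub> inv\<^bsub>T\<^esub> (proj g)"
  using proj_add[of "f - g" g] T.inv_solve_right[of "proj (f - g)" "proj f" "proj g"] by simp

lemma proj_eqI: "f \<in> carrier F \<Longrightarrow> g \<in> carrier F \<Longrightarrow> f - g \<in> N \<Longrightarrow> proj f = proj g"
  using proj_add[of "f - g" g] proj_null[of "f - g"] by simp

lemma relator_null: "f \<in> tensor_relators A C \<Longrightarrow> f \<in> N"
  unfolding tensor_null_def by (rule generate.incl)

definition ts where "ts x \<alpha> = proj (frag_of (x, \<alpha>))"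

lemma tensor_map_eq: "tensor_map A C x = ts x \<one>\<^bsub>A\<^esub>"
  by (simp add: tensor_map_def ts_def proj_def)

lemma ts_closed [simp]: "x \<in> carrier C \<Longrightarrow> \<alpha> \<in> carrier A \<Longrightarrow> ts x \<alpha> \<in> carrier T"
  by (simp add: ts_def)

lemma ts_mult:
  assumes "x \<in> carrier C" "y \<in> carrier C" "\<alpha> \<in> carrier A"
  shows "ts (x \<otimes>\<^bsub>C\<^esub> y) \<alpha> = ts x \<alpha> \<otimes>\<^bsub>T\<^esub> ts y \<alpha>"
proof -
  have "frag_of (x \<otimes>\<^bsub>C\<^esub> y, \<alpha>) - (frag_of (x, \<alpha>) + frag_of (y, \<alpha>)) \<in> N"
    using assms by (intro relator_null) (auto simp: tensor_relators_def diff_diff_eq)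
  then have "ts (x \<otimes>\<^bsub>C\<^esub> y) \<alpha> = proj (frag_of (x, \<alpha>) + frag_of (y, \<alpha>))"
    unfolding ts_def using assms by (intro proj_eqI) auto
  then show ?thesis using assms by (simp add: proj_add ts_def)
qed

lemma ts_add:
  assumes "x \<in> carrier C" "\<alpha> \<in> carrier A" "\<beta> \<in> carrier A"
  shows "ts x (\<alpha> \<oplus>\<^bsub>A\<^esub> \<beta>) = ts x \<alpha> \<otimes>\<^bsub>T\<^esub> ts x \<beta>"
proof -
  have "frag_of (x, \<alpha> \<oplus>\<^bsub>A\<^esub> \<beta>) - (frag_of (x, \<alpha>) + frag_of (x, \<beta>)) \<in> N"
    using assms by (intro relator_null) (auto simp: tensor_relators_def diff_diff_eq)
  then have "ts x (\<alpha> \<oplus>\<^bsub>A\<^esub> \<beta>) = proj (frag_of (x, \<alpha>) + frag_of (x, \<beta>))"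
    unfolding ts_def using assms by (intro proj_eqI) auto
  then show ?thesis using assms by (simp add: proj_add ts_def)
qed

lemma ts_expo:
  assumes "x \<in> carrier C" "\<alpha> \<in> carrier A" "\<beta> \<in> carrier A" "expo C x \<alpha> = Some y"
  shows "ts y \<beta> = ts x (\<alpha> \<otimes>\<^bsub>A\<^esub> \<beta>)"
  unfolding ts_def
proof (rule proj_eqI)
  show "frag_of (y, \<beta>) - frag_of (x, \<alpha> \<otimes>\<^bsub>A\<^esub> \<beta>) \<in> N"
    using assms by (intro relator_null) (auto simp: tensor_relators_def)
qed (use assms expo_carrier in auto)

lemma tensor_induct [consumes 1, case_names one gen diff]:
  assumes "X \<in> carrier T" "P \<one>\<^bsub>T\<^esub>" "\<And>x \<alpha>. x \<in> carrier C \<Longrightarrow> \<alpha> \<in> carrier A \<Longrightarrow> P (ts x \<alpha>)"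
    "\<And>X Y. X \<in> carrier T \<Longrightarrow> Y \<in> carrier T \<Longrightarrow> P X \<Longrightarrow> P Y \<Longrightarrow> P (X \<otimes>\<^bsub>T\<^esub> inv\<^bsub>T\<^esub> Y)"
  shows "P X"
proof -
  obtain f where f: "f \<in> carrier F" "X = proj f" using assms(1) by (elim tensor_carrierE)
  have "P (proj f)"
  proof (rule free_Abelian_group_induct[of f _ "\<lambda>f. P (proj f)"])
    show "Poly_Mapping.keys f \<subseteq> carrier C \<times> carrier A" using f by (simp add: carrier_F)
    show "P (proj 0)" using assms(2) by (simp add: proj_zero)
    show "P (proj (x - y))" if "Poly_Mapping.keys x \<subseteq> carrier C \<times> carrier A"
      "Poly_Mapping.keys y \<subseteq> carrier C \<times> carrier A" "P (proj x)" "P (proj y)" for x y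
      using assms(4)[of "proj x" "proj y"] that by (simp add: carrier_F[symmetric] proj_diff)
    show "P (proj (frag_of a))" if "a \<in> carrier C \<times> carrier A" for a
      using assms(3) that by (auto simp: ts_def)
  qed
  then show ?thesis using f by simp
qed

lemma tensor_hom_eq:
  assumes "group K" "f \<in> hom T K" "g \<in> hom T K"
    "\<And>x \<alpha>. x \<in> carrier C \<Longrightarrow> \<alpha> \<in> carrier A \<Longrightarrow> f (ts x \<alpha>) = g (ts x \<alpha>)" "X \<in> carrier T"
  shows "f X = g X"
  using assms(5)
proof (induction rule: tensor_induct)
  case one
  then show ?case using assms T.is_group by (simp add: hom_one)
next
  case (diff X Y)
  have hd: "h (X \<otimes>\<^bsub>T\<^esub> inv\<^bsub>T\<^esub> Y) = h X \<otimes>\<^bsub>K\<^esub> inv\<^bsub>K\<^esub> (h Y)" if "h \<in> hom T K" for h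
  proof -
    interpret h: group_hom T K h using that assms(1) T.is_group by (simp add: group_hom_def group_hom_axioms_def)
    show ?thesis using diff by simp
  qed
  show ?case unfolding hd[OF assms(2)] hd[OF assms(3)] using diff by simp
qed (use assms in auto)

lemma tensor_lift:
  assumes K: "comm_group K" and b: "\<And>x \<alpha>. x \<in> carrier C \<Longrightarrow> \<alpha> \<in> carrier A \<Longrightarrow> b x \<alpha> \<in> carrier K"
    and b1: "\<And>x y \<alpha>. \<lbrakk>x \<in> carrier C; y \<in> carrier C; \<alpha> \<in> carrier A\<rbrakk> \<Longrightarrow> b (x \<otimes>\<^bsub>C\<^esub> y) \<alpha> = b x \<alpha> \<otimes>\<^bsub>K\<^esub> b y \<alpha>"
    and b2: "\<And>x \<alpha> \<beta>. \<lbrakk>x \<in> carrier C; \<alpha> \<in> carrier A; \<beta> \<in> carrier A\<rbrakk> \<Longrightarrow> b x (\<alpha> \<oplus>\<^bsub>A\<^esub> \<beta>) = b x \<alpha> \<otimes>\<^bsub>K\<^esub> b x \<beta>"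
    and b3: "\<And>x y \<alpha> \<beta>. \<lbrakk>x \<in> carrier C; \<alpha> \<in> carrier A; \<beta> \<in> carrier A; expo C x \<alpha> = Some y\<rbrakk> \<Longrightarrow> b y \<beta> = b x (\<alpha> \<otimes>\<^bsub>A\<^esub> \<beta>)"
  shows "\<exists>h\<in>hom T K. \<forall>x\<in>carrier C. \<forall>\<alpha>\<in>carrier A. h (ts x \<alpha>) = b x \<alpha>"
proof -
  interpret K: comm_group K by fact
  have "case_prod b ` (carrier C \<times> carrier A) \<subseteq> carrier K" using b by auto
  then obtain h where h: "h \<in> hom F K" "\<And>p. p \<in> carrier C \<times> carrier A \<Longrightarrow> h (frag_of p) = case_prod b p"
    unfolding tensor_free_def using K.free_Abelian_group_universal by metis
  interpret h: group_hom F K h using h(1) by (simp add: group_hom_def group_hom_axioms_def F.is_group K.is_group)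
  have hdiff: "h (f - g) = h f \<otimes>\<^bsub>K\<^esub> inv\<^bsub>K\<^esub> (h g)" if "f \<in> carrier F" "g \<in> carrier F" for f g
    using h.hom_mult[of f "- g"] h.hom_inv[of g] that by simp
  have "tensor_relators A C \<subseteq> kernel F K h"
  proof
    fix r assume r: "r \<in> tensor_relators A C"
    then have rF: "r \<in> carrier F" using relators_F by blast
    have canc: "u \<otimes>\<^bsub>K\<^esub> v \<otimes>\<^bsub>K\<^esub> inv\<^bsub>K\<^esub> u \<otimes>\<^bsub>K\<^esub> inv\<^bsub>K\<^esub> v = \<one>\<^bsub>K\<^esub>" if "u \<in> carrier K" "v \<in> carrier K" for u v
      using that by (simp add: K.m_comm[of u v] K.m_assoc)
    from r have "h r = \<one>\<^bsub>K\<^esub>"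
      unfolding tensor_relators_def
      by (elim UnE CollectE exE conjE)
        (simp_all add: hdiff h b b1 b2 b3 expo_carrier canc)
    then show "r \<in> kernel F K h" using rF by (simp add: kernel_def)
  qed
  then have "N \<subseteq> kernel F K h"
    unfolding tensor_null_def using h.subgroup_kernel by (rule F.generate_subgroup_incl)
  from h.FactGroup_universal_kernel[OF N.normal_axioms this]
  obtain g where g: "g \<in> hom (F Mod N) K" "\<And>x. x \<in> carrier F \<Longrightarrow> g (N #>\<^bsub>F\<^esub> x) = h x" by blast
  have "g \<in> hom T K" using g(1) by (simp add: hom_def tensor_eq)
  moreover have "g (ts x \<alpha>) = b x \<alpha>" if "x \<in> carrier C" "\<alpha> \<in> carrier A" for x \<alpha>
    using g(2)[of "frag_of (x, \<alpha>)"] h(2)[of "(x, \<alpha>)"] that by (simp add: ts_def proj_def)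
  ultimately show ?thesis by blast
qed

section \<open>The action on a tensor product\<close>

definition scal where "scal \<alpha> X = the (expo T X \<alpha>)"

lemma expo_tensor: "expo T X \<alpha> = Some (scal \<alpha> X)"
  by (simp add: scal_def tensor_def Let_def)

text \<open>The definition of the exponentiation acts on the representatives of a coset, and it is
  not obvious that the result is a coset again. The universal property supplies an endomorphism with
  the right values on generators, and the formula is identified with it.\<close>

lemma scal: assumes \<alpha>: "\<alpha> \<in> carrier A"
  shows "scal \<alpha> \<in> hom T T" "x \<in> carrier C \<Longrightarrow> \<beta> \<in> carrier A \<Longrightarrow> scal \<alpha> (ts x \<beta>) = ts x (\<beta> \<otimes>\<^bsub>A\<^esub> \<alpha>)"
proof -
  have "\<exists>h\<in>hom T T. \<forall>x\<in>carrier C. \<forall>\<beta>\<in>carrier A. h (ts x \<beta>) = ts x (\<beta> \<otimes>\<^bsub>A\<^esub> \<alpha>)"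
    by (rule tensor_lift) (use \<alpha> in \<open>auto simp: T.comm_group_axioms ts_mult ts_add A.l_distr A.m_assoc ts_expo\<close>)
  then obtain h where h: "h \<in> hom T T" "\<And>x \<beta>. x \<in> carrier C \<Longrightarrow> \<beta> \<in> carrier A \<Longrightarrow> h (ts x \<beta>) = ts x (\<beta> \<otimes>\<^bsub>A\<^esub> \<alpha>)"
    by blast
  define e where "e = frag_extend (\<lambda>(x::'g, \<beta>). frag_of (x, \<beta> \<otimes>\<^bsub>A\<^esub> \<alpha>))"
  have e: "e f \<in> carrier F \<and> proj (e f) = h (proj f)" if "f \<in> carrier F" for f
  proof -
    show ?thesis
    proof (rule free_Abelian_group_induct[of f _ "\<lambda>f. e f \<in> carrier F \<and> proj (e f) = h (proj f)"])
      show "Poly_Mapping.keys f \<subseteq> carrier C \<times> carrier A" using that by (simp add: carrier_F)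
      show "e 0 \<in> carrier F \<and> proj (e 0) = h (proj 0)"
        using h(1) F.one_closed by (simp add: e_def proj_zero hom_one T.is_group)
      show "e (x - y) \<in> carrier F \<and> proj (e (x - y)) = h (proj (x - y))"
        if "Poly_Mapping.keys x \<subseteq> carrier C \<times> carrier A" "Poly_Mapping.keys y \<subseteq> carrier C \<times> carrier A"
          "e x \<in> carrier F \<and> proj (e x) = h (proj x)" "e y \<in> carrier F \<and> proj (e y) = h (proj y)" for x y
      proof -
        interpret h: group_hom T T h using h(1) by (simp add: group_hom_def group_hom_axioms_def T.is_group)
        have "x \<in> carrier F" "y \<in> carrier F" using that by (simp_all add: carrier_F)
        moreover have "e (x - y) = e x - e y" by (simp add: e_def frag_extend_diff)
        ultimately show ?thesis using that(3,4) by (simp add: proj_diff)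
      qed
      show "e (frag_of a) \<in> carrier F \<and> proj (e (frag_of a)) = h (proj (frag_of a))"
        if "a \<in> carrier C \<times> carrier A" for a
        using that \<alpha> h(2) by (auto simp: e_def ts_def[symmetric])
    qed
  qed
  have sc: "scal \<alpha> X = h X" if "X \<in> carrier T" for X
  proof -
    from that obtain f where f: "f \<in> carrier F" "X = proj f" by (elim tensor_carrierE)
    have "h X \<in> carrier T" using h(1) that by (auto simp: hom_def)
    \<comment> \<open>All representatives have images in the same coset, so the union over them
      collapses.\<close>
    have eX: "e a \<in> carrier F \<and> proj (e a) = h X" if "a \<in> X" for a
    proof -
      have "X = proj a" "a \<in> carrier F"
        using that f F.repr_independence[of a N f] N.is_subgroup subgroup.mem_carrier[OF N.is_subgroup]
        unfolding proj_def r_coset_def by auto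
      then show ?thesis using e by simp
    qed
    have fX: "f \<in> X" using f F.rcos_self[OF f(1) N.is_subgroup] by (simp add: proj_def)
    have "scal \<alpha> X = N <#>\<^bsub>F\<^esub> (e ` X)" by (simp add: scal_def tensor_def Let_def e_def)
    also have "\<dots> = (\<Union>a\<in>X. N #>\<^bsub>F\<^esub> e a)" by (auto simp: set_mult_def r_coset_def)
    also have "\<dots> = (\<Union>a\<in>X. h X)" using eX by (simp add: proj_def)
    also have "\<dots> = h X" using fX by auto
    finally show ?thesis .
  qed
  then show "scal \<alpha> \<in> hom T T" using h(1) by (simp add: hom_def Pi_iff)
  show "x \<in> carrier C \<Longrightarrow> \<beta> \<in> carrier A \<Longrightarrow> scal \<alpha> (ts x \<beta>) = ts x (\<beta> \<otimes>\<^bsub>A\<^esub> \<alpha>)"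
    using sc h(2) by simp
qed

lemma scal_closed [simp]: "\<alpha> \<in> carrier A \<Longrightarrow> X \<in> carrier T \<Longrightarrow> scal \<alpha> X \<in> carrier T"
  using scal(1) by (auto simp: hom_def)

lemma scal_mult: "\<alpha> \<in> carrier A \<Longrightarrow> X \<in> carrier T \<Longrightarrow> Y \<in> carrier T \<Longrightarrow> scal \<alpha> (X \<otimes>\<^bsub>T\<^esub> Y) = scal \<alpha> X \<otimes>\<^bsub>T\<^esub> scal \<alpha> Y"
  using scal(1) by (auto simp: hom_def)

lemma id_hom: "id \<in> hom T T"
  by (simp add: hom_def)

lemma const_one_hom: "(\<lambda>_. \<one>\<^bsub>T\<^esub>) \<in> hom T T"
  by (rule homI) auto

lemma ts_zero: "x \<in> carrier C \<Longrightarrow> ts x \<zero>\<^bsub>A\<^esub> = \<one>\<^bsub>T\<^esub>"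
  using ts_add[of x "\<zero>\<^bsub>A\<^esub>" "\<zero>\<^bsub>A\<^esub>"] T.l_cancel_one[of "ts x \<zero>\<^bsub>A\<^esub>" "ts x \<zero>\<^bsub>A\<^esub>"] by simp

text \<open>The axioms on sums and products of exponents are equations between homomorphisms and are
  checked on generators by \<open>tensor_hom_eq\<close>; conjugation is trivial because the group is
  abelian.\<close>

lemma exp_group_tensor: "exp_group A T"
proof -
  have mult: "(\<lambda>X. scal \<alpha> X \<otimes>\<^bsub>T\<^esub> scal \<beta> X) \<in> hom T T" if "\<alpha> \<in> carrier A" "\<beta> \<in> carrier A" for \<alpha> \<beta>
    by (rule homI) (use that in \<open>auto simp: scal_mult T.m_ac\<close>)
  have "partial_exp_group A T"
  proof (rule partial_exp_groupI)
    show "ring A" by (rule A.ring_axioms)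
    show "group T" by (rule T.is_group)
    show "expo T g \<one>\<^bsub>A\<^esub> = Some g" if "g \<in> carrier T" for g
      using tensor_hom_eq[OF T.is_group scal(1) id_hom _ that] by (auto simp: expo_tensor scal)
    show "expo T g \<zero>\<^bsub>A\<^esub> = Some \<one>\<^bsub>T\<^esub>" if "g \<in> carrier T" for g
      using tensor_hom_eq[OF T.is_group scal(1) const_one_hom _ that] by (auto simp: expo_tensor scal ts_zero)
    show "expo T \<one>\<^bsub>T\<^esub> \<alpha> = Some \<one>\<^bsub>T\<^esub>" if "\<alpha> \<in> carrier A" for \<alpha>
      using scal(1)[OF that] by (simp add: expo_tensor hom_one T.is_group)
    show "expo T g (\<alpha> \<oplus>\<^bsub>A\<^esub> \<beta>) = Some (x \<otimes>\<^bsub>T\<^esub> y)" if "g \<in> carrier T" "\<alpha> \<in> carrier A" "\<beta> \<in> carrier A"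
      "expo T g \<alpha> = Some x" "expo T g \<beta> = Some y" for g \<alpha> \<beta> x y
      using tensor_hom_eq[OF T.is_group scal(1)[of "\<alpha> \<oplus>\<^bsub>A\<^esub> \<beta>"] mult[OF that(2,3)] _ that(1)] that
      by (auto simp: expo_tensor scal ts_add A.r_distr)
    show "expo T g (\<alpha> \<otimes>\<^bsub>A\<^esub> \<beta>) = Some y" if "g \<in> carrier T" "\<alpha> \<in> carrier A" "\<beta> \<in> carrier A"
      "expo T g \<alpha> = Some x" "expo T x \<beta> = Some y" for g \<alpha> \<beta> x y
      using tensor_hom_eq[OF T.is_group scal(1)[of "\<alpha> \<otimes>\<^bsub>A\<^esub> \<beta>"] hom_compose[OF scal(1)[OF that(2)] scal(1)[OF that(3)]] _ that(1)] that
      by (auto simp: expo_tensor scal A.m_assoc)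
    show "expo T (conj_by T h g) \<alpha> = map_option (conj_by T h) (expo T g \<alpha>)"
      if "g \<in> carrier T" "h \<in> carrier T" "\<alpha> \<in> carrier A" for g h \<alpha>
    proof -
      have "conj_by T h k = k" if "k \<in> carrier T" for k
        using T.conj_by_fixed_iff[OF \<open>h \<in> carrier T\<close> that] T.m_comm[OF \<open>h \<in> carrier T\<close> that] by simp
      then show ?thesis using that by (simp add: expo_tensor)
    qed
    show "expo T (g \<otimes>\<^bsub>T\<^esub> h) \<alpha> = Some (x \<otimes>\<^bsub>T\<^esub> y)" if "g \<in> carrier T" "h \<in> carrier T" "\<alpha> \<in> carrier A"
      "g \<otimes>\<^bsub>T\<^esub> h = h \<otimes>\<^bsub>T\<^esub> g" "expo T g \<alpha> = Some x" "expo T h \<alpha> = Some y" for g h \<alpha> x y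
      using scal_mult[OF that(3,1,2)] that(5,6) by (simp add: expo_tensor)
  qed (auto simp: expo_tensor)
  then show ?thesis by (simp add: exp_group_def exp_group_axioms_def expo_tensor)
qed

lemma tensor_map_hom: "tensor_map A C \<in> hom C T"
  by (rule homI) (auto simp: tensor_map_eq ts_mult)

lemma tensor_map_expo:
  assumes "x \<in> carrier C" "\<alpha> \<in> carrier A" "expo C x \<alpha> = Some y"
  shows "expo T (tensor_map A C x) \<alpha> = Some (tensor_map A C y)"
  using ts_expo[OF assms(1,2) A.one_closed assms(3)] assms by (simp add: expo_tensor tensor_map_eq scal)

lemma expo_tensor_map: "x \<in> carrier C \<Longrightarrow> \<alpha> \<in> carrier A \<Longrightarrow> expo T (tensor_map A C x) \<alpha> = Some (ts x \<alpha>)"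
  by (simp add: expo_tensor tensor_map_eq scal)

end

text \<open>An abelian group with total exponentiation is a retract of, hence equal to, its tensor completion.\<close>

lemma exp_module_tensor:
  assumes "exp_group A C" "comm_group C"
  shows "abelian_faithful A C" "no_involutions C \<Longrightarrow> no_involutions (tensor A C)"
proof -
  interpret e: exp_group A C by fact
  interpret C: comm_group C by fact
  interpret t: tensor_data A C by unfold_locales (rule e.expo_closed)
  define b where "b x \<alpha> = the (expo C x \<alpha>)" for x \<alpha>
  have b: "expo C x \<alpha> = Some (b x \<alpha>)" "b x \<alpha> \<in> carrier C" if "x \<in> carrier C" "\<alpha> \<in> carrier A" for x \<alpha>
    using e.expo_total[OF that] e.expo_closed[OF that] by (auto simp: b_def)
  have "\<exists>h\<in>hom (tensor A C) C. \<forall>x\<in>carrier C. \<forall>\<alpha>\<in>carrier A. h (t.ts x \<alpha>) = b x \<alpha>"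
  proof (rule t.tensor_lift)
    show "b (x \<otimes>\<^bsub>C\<^esub> y) \<alpha> = b x \<alpha> \<otimes>\<^bsub>C\<^esub> b y \<alpha>" if "x \<in> carrier C" "y \<in> carrier C" "\<alpha> \<in> carrier A" for x y \<alpha>
      using e.expo_commute[OF that C.m_comm[OF that(1,2)] b(1)[OF that(1,3)] b(1)[OF that(2,3)]] by (simp add: b_def[of "_ \<otimes>\<^bsub>C\<^esub> _"])
    show "b x (\<alpha> \<oplus>\<^bsub>A\<^esub> \<beta>) = b x \<alpha> \<otimes>\<^bsub>C\<^esub> b x \<beta>" if "x \<in> carrier C" "\<alpha> \<in> carrier A" "\<beta> \<in> carrier A" for x \<alpha> \<beta>
      using e.expo_add[OF that b(1)[OF that(1,2)] b(1)[OF that(1,3)]] by (simp add: b_def[of _ "_ \<oplus>\<^bsub>A\<^esub> _"])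
    show "b y \<beta> = b x (\<alpha> \<otimes>\<^bsub>A\<^esub> \<beta>)" if "x \<in> carrier C" "\<alpha> \<in> carrier A" "\<beta> \<in> carrier A" "expo C x \<alpha> = Some y" for x y \<alpha> \<beta>
      using e.expo_mult[OF that b(1)[OF e.expo_closed[OF that(1,2,4)] that(3)]] by (simp add: b_def[of _ "_ \<otimes>\<^bsub>A\<^esub> _"])
  qed (use b C.comm_group_axioms in auto)
  then obtain h where h: "h \<in> hom (tensor A C) C" "\<And>x \<alpha>. x \<in> carrier C \<Longrightarrow> \<alpha> \<in> carrier A \<Longrightarrow> h (t.ts x \<alpha>) = b x \<alpha>" by blast
  have h1: "h (tensor_map A C x) = x" if "x \<in> carrier C" for x
    using h(2)[OF that e.A.one_closed] e.expo_one[OF that] by (simp add: t.tensor_map_eq b_def)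
  show "abelian_faithful A C"
    unfolding abelian_faithful_def by (rule inj_on_inverseI[of _ h]) (rule h1)
  have surj: "X = tensor_map A C (h X)" if "X \<in> carrier (tensor A C)" for X
  proof -
    have "tensor_map A C \<circ> h \<in> hom (tensor A C) (tensor A C)" using h(1) t.tensor_map_hom by (rule hom_compose)
    moreover have "(tensor_map A C \<circ> h) (t.ts x \<alpha>) = id (t.ts x \<alpha>)" if "x \<in> carrier C" "\<alpha> \<in> carrier A" for x \<alpha>
      using t.ts_expo[OF that e.A.one_closed b(1)[OF that]] that h(2) by (simp add: t.tensor_map_eq)
    ultimately have "(tensor_map A C \<circ> h) X = id X"
      by (intro t.tensor_hom_eq[OF t.T.is_group _ t.id_hom _ that])
    then show ?thesis by simp
  qed
  show "no_involutions (tensor A C)" if ni: "no_involutions C"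
    unfolding no_involutions_def
  proof (intro ballI impI)
    fix X assume X: "X \<in> carrier (tensor A C)" "X \<otimes>\<^bsub>tensor A C\<^esub> X = \<one>\<^bsub>tensor A C\<^esub>"
    have "h X \<in> carrier C" "h X \<otimes>\<^bsub>C\<^esub> h X = \<one>\<^bsub>C\<^esub>"
      using hom_mult[OF h(1) X(1,1)] hom_in_carrier[OF h(1) X(1)] X(2) hom_one[OF h(1) t.T.is_group e.G.is_group] by simp_all
    then have "h X = \<one>\<^bsub>C\<^esub>" using ni unfolding no_involutions_def by blast
    then show "X = \<one>\<^bsub>tensor A C\<^esub>" using surj[OF X(1)] hom_one[OF t.tensor_map_hom e.G.is_group t.T.is_group] by simp
  qed
qed

section \<open>Functoriality and the cyclic case\<close>

lemma tensor_functorial: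
  assumes "tensor_data A C" "tensor_data A D" "f \<in> exp_hom A C D"
  shows "\<exists>h\<in>hom (tensor A C) (tensor A D). \<forall>x\<in>carrier C. \<forall>\<alpha>\<in>carrier A.
    h (tensor_data.ts A C x \<alpha>) = tensor_data.ts A D (f x) \<alpha>"
proof -
  interpret C: tensor_data A C by fact
  interpret D: tensor_data A D by fact
  have f: "f x \<in> carrier D" "f (x \<otimes>\<^bsub>C\<^esub> y) = f x \<otimes>\<^bsub>D\<^esub> f y" if "x \<in> carrier C" "y \<in> carrier C" for x y
    using assms(3) that by (auto simp: exp_hom_def hom_def)
  have fe: "expo D (f x) \<alpha> = Some (f y)" if "x \<in> carrier C" "\<alpha> \<in> carrier A" "expo C x \<alpha> = Some y" for x y \<alpha>
    using assms(3) that by (auto simp: exp_hom_def)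
  show ?thesis
  proof (rule C.tensor_lift)
    show "D.ts (f y) \<beta> = D.ts (f x) (\<alpha> \<otimes>\<^bsub>A\<^esub> \<beta>)"
      if "x \<in> carrier C" "\<alpha> \<in> carrier A" "\<beta> \<in> carrier A" "expo C x \<alpha> = Some y" for x y \<alpha> \<beta>
      using that f fe by (intro D.ts_expo) auto
  qed (simp_all add: D.T.comm_group_axioms f D.ts_mult D.ts_add)
qed

text \<open>Serves to carry faithfulness and the absence of involutions between isomorphic copies. A
  left inverse of the induced map on tensor products suffices.\<close>

lemma tensor_iso:
  assumes C: "tensor_data A C" and D: "tensor_data A D" and f: "f \<in> exp_hom A C D" and g: "g \<in> exp_hom A D C"
    and gf: "\<And>x. x \<in> carrier C \<Longrightarrow> g (f x) = x"
  shows "abelian_faithful A D \<Longrightarrow> abelian_faithful A C"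
    "no_involutions (tensor A D) \<Longrightarrow> no_involutions (tensor A C)"
proof -
  interpret C: tensor_data A C by fact
  interpret D: tensor_data A D by fact
  have fx: "f x \<in> carrier D" if "x \<in> carrier C" for x using f that by (auto simp: exp_hom_def hom_def)
  obtain h where h: "h \<in> hom (tensor A C) (tensor A D)" "\<And>x \<alpha>. x \<in> carrier C \<Longrightarrow> \<alpha> \<in> carrier A \<Longrightarrow> h (C.ts x \<alpha>) = D.ts (f x) \<alpha>"
    using tensor_functorial[OF C D f] by blast
  obtain k where k: "k \<in> hom (tensor A D) (tensor A C)" "\<And>x \<alpha>. x \<in> carrier D \<Longrightarrow> \<alpha> \<in> carrier A \<Longrightarrow> k (D.ts x \<alpha>) = C.ts (g x) \<alpha>"
    using tensor_functorial[OF D C g] by blast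
  have kh: "k (h X) = X" if "X \<in> carrier (tensor A C)" for X
    using C.tensor_hom_eq[OF C.T.is_group hom_compose[OF h(1) k(1)] C.id_hom _ that] h k gf fx by simp
  show "abelian_faithful A C" if "abelian_faithful A D"
    unfolding abelian_faithful_def
  proof (rule inj_onI)
    fix x y assume xy: "x \<in> carrier C" "y \<in> carrier C" "tensor_map A C x = tensor_map A C y"
    then have "tensor_map A D (f x) = tensor_map A D (f y)"
      using h(2)[OF _ C.A.one_closed] by (simp add: C.tensor_map_eq D.tensor_map_eq) metis
    then have "f x = f y" using that xy fx by (auto simp: abelian_faithful_def dest: inj_onD)
    then show "x = y" using gf xy by metis
  qed
  show "no_involutions (tensor A C)" if ni: "no_involutions (tensor A D)"
    unfolding no_involutions_def
  proof (intro ballI impI)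
    fix X assume X: "X \<in> carrier (tensor A C)" "X \<otimes>\<^bsub>tensor A C\<^esub> X = \<one>\<^bsub>tensor A C\<^esub>"
    have h1: "h \<one>\<^bsub>tensor A C\<^esub> = \<one>\<^bsub>tensor A D\<^esub>" using hom_one[OF h(1)] C.T.is_group D.T.is_group by blast
    have k1: "k \<one>\<^bsub>tensor A D\<^esub> = \<one>\<^bsub>tensor A C\<^esub>" using hom_one[OF k(1)] C.T.is_group D.T.is_group by blast
    have "h X \<in> carrier (tensor A D)" "h X \<otimes>\<^bsub>tensor A D\<^esub> h X = \<one>\<^bsub>tensor A D\<^esub>"
      using hom_mult[OF h(1) X(1,1)] hom_in_carrier[OF h(1) X(1)] X(2) h1 by simp_all
    then have "h X = \<one>\<^bsub>tensor A D\<^esub>" using ni unfolding no_involutions_def by blast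
    then show "X = \<one>\<^bsub>tensor A C\<^esub>" using kh[OF X(1)] k1 by metis
  qed
qed

text \<open>If only integer powers are defined on the infinite cyclic group \<open>\<langle>z\<rangle>\<close>, then \<open>z \<otimes> \<alpha> \<mapsto> \<alpha>\<close> is an
  isomorphism from \<open>\<langle>z\<rangle> \<otimes> A\<close> onto the additive group of \<open>A\<close>.\<close>

lemma cyclic_tensor:
  fixes C :: "('g, 'r) exp_struct" and A :: "('r, 'n) ring_scheme"
  assumes C: "tensor_data A C" and z: "z \<in> carrier C" "carrier C = range (\<lambda>k::int. z [^]\<^bsub>C\<^esub> k)"
    and inj: "\<And>k l :: int. z [^]\<^bsub>C\<^esub> k = z [^]\<^bsub>C\<^esub> l \<Longrightarrow> k = l"
    and int: "\<And>k \<alpha> y. \<alpha> \<in> carrier A \<Longrightarrow> expo C (z [^]\<^bsub>C\<^esub> (k::int)) \<alpha> = Some y \<Longrightarrow> k \<noteq> 0 \<Longrightarrow>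
      \<exists>n::int. \<alpha> = [n] \<cdot>\<^bsub>A\<^esub> \<one>\<^bsub>A\<^esub> \<and> y = (z [^]\<^bsub>C\<^esub> k) [^]\<^bsub>C\<^esub> n"
    and one: "\<And>\<alpha>. \<alpha> \<in> carrier A \<Longrightarrow> expo C \<one>\<^bsub>C\<^esub> \<alpha> = Some \<one>\<^bsub>C\<^esub>"
  shows "\<exists>h\<in>hom (tensor A C) (add_monoid A).
      (\<forall>k::int. \<forall>\<alpha>\<in>carrier A. h (tensor_data.ts A C (z [^]\<^bsub>C\<^esub> k) \<alpha>) = [k] \<cdot>\<^bsub>A\<^esub> \<alpha>) \<and>
      (\<forall>X\<in>carrier (tensor A C). X = tensor_data.ts A C z (h X))"
proof -
  interpret t: tensor_data A C by fact
  have ia: "[(k + l)] \<cdot>\<^bsub>A\<^esub> \<alpha> = ([k] \<cdot>\<^bsub>A\<^esub> \<alpha>) \<oplus>\<^bsub>A\<^esub> ([l] \<cdot>\<^bsub>A\<^esub> \<alpha>)" if "\<alpha> \<in> carrier A" for k l :: int and \<alpha>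
    using that by (simp add: t.A.add.int_pow_mult)
  \<comment> \<open>The exponent of \<open>x\<close> to the base \<open>z\<close>, well defined
    because the powers of \<open>z\<close> are distinct.\<close>
  define e where "e x = (THE k::int. x = z [^]\<^bsub>C\<^esub> k)" for x
  have e: "e (z [^]\<^bsub>C\<^esub> k) = k" for k :: int
    unfolding e_def by (rule the_equality) (auto dest: inj)
  have rep: "\<exists>k::int. x = z [^]\<^bsub>C\<^esub> k" if "x \<in> carrier C" for x using that z(2) by auto
  have "\<exists>h\<in>hom (tensor A C) (add_monoid A). \<forall>x\<in>carrier C. \<forall>\<alpha>\<in>carrier A. h (t.ts x \<alpha>) = [(e x)] \<cdot>\<^bsub>A\<^esub> \<alpha>"
  proof (rule t.tensor_lift)
    show "comm_group (add_monoid A)" by (rule t.A.a_comm_group)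
    show "[(e x)] \<cdot>\<^bsub>A\<^esub> \<alpha> \<in> carrier (add_monoid A)" if "x \<in> carrier C" "\<alpha> \<in> carrier A" for x \<alpha>
      using that by simp
    show "[(e (x \<otimes>\<^bsub>C\<^esub> y))] \<cdot>\<^bsub>A\<^esub> \<alpha> = ([(e x)] \<cdot>\<^bsub>A\<^esub> \<alpha>) \<otimes>\<^bsub>add_monoid A\<^esub> ([(e y)] \<cdot>\<^bsub>A\<^esub> \<alpha>)"
      if xy: "x \<in> carrier C" "y \<in> carrier C" "\<alpha> \<in> carrier A" for x y \<alpha>
    proof -
      obtain k l :: int where "x = z [^]\<^bsub>C\<^esub> k" "y = z [^]\<^bsub>C\<^esub> l"
        using rep[OF xy(1)] rep[OF xy(2)] by metis
      then show ?thesis using xy z(1) by (simp add: t.C.int_pow_mult[symmetric] e ia)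
    qed
    show "[(e x)] \<cdot>\<^bsub>A\<^esub> (\<alpha> \<oplus>\<^bsub>A\<^esub> \<beta>) = ([(e x)] \<cdot>\<^bsub>A\<^esub> \<alpha>) \<otimes>\<^bsub>add_monoid A\<^esub> ([(e x)] \<cdot>\<^bsub>A\<^esub> \<beta>)"
      if "x \<in> carrier C" "\<alpha> \<in> carrier A" "\<beta> \<in> carrier A" for x \<alpha> \<beta>
      using that t.A.add.int_pow_distrib[of \<alpha> \<beta> "e x"] by simp
    show "[(e y)] \<cdot>\<^bsub>A\<^esub> \<beta> = [(e x)] \<cdot>\<^bsub>A\<^esub> (\<alpha> \<otimes>\<^bsub>A\<^esub> \<beta>)"
      if x: "x \<in> carrier C" "\<alpha> \<in> carrier A" "\<beta> \<in> carrier A" "expo C x \<alpha> = Some y" for x y \<alpha> \<beta>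
    proof -
      obtain k :: int where k: "x = z [^]\<^bsub>C\<^esub> k" using rep[OF x(1)] by metis
      show ?thesis
      proof (cases "k = 0")
        case True
        then have "x = \<one>\<^bsub>C\<^esub>" using k by simp
        then have "y = \<one>\<^bsub>C\<^esub>" using one[OF x(2)] x(4) by simp
        then show ?thesis using e[of 0] x \<open>x = \<one>\<^bsub>C\<^esub>\<close> by (simp add: add_pow_def)
      next
        case False
        \<comment> \<open>Relators that come from defined powers: on nontrivial elements these
          powers are integral, so both sides are the multiple of \<open>\<beta>\<close> by k
          n.\<close>
        then obtain n :: int where n: "\<alpha> = [n] \<cdot>\<^bsub>A\<^esub> \<one>\<^bsub>A\<^esub>" "y = (z [^]\<^bsub>C\<^esub> k) [^]\<^bsub>C\<^esub> n"
          using int[OF x(2), of k y] x(4) k by auto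
        have "e y = k * n" using n z(1) by (simp add: t.C.int_pow_pow e)
        moreover have "\<alpha> \<otimes>\<^bsub>A\<^esub> \<beta> = [n] \<cdot>\<^bsub>A\<^esub> \<beta>" using n x t.A.add_pow_ldistr_int[of "\<one>\<^bsub>A\<^esub>" \<beta> n] by simp
        ultimately show ?thesis using x k by (simp add: e t.A.add.int_pow_pow mult.commute)
      qed
    qed
  qed
  then obtain h where h: "h \<in> hom (tensor A C) (add_monoid A)"
    "\<And>x \<alpha>. x \<in> carrier C \<Longrightarrow> \<alpha> \<in> carrier A \<Longrightarrow> h (t.ts x \<alpha>) = [(e x)] \<cdot>\<^bsub>A\<^esub> \<alpha>" by blast
  \<comment> \<open>Integers move across the tensor sign, so every generator has the form z
    \<otimes> \<alpha>.\<close>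
  have zk: "t.ts (z [^]\<^bsub>C\<^esub> k) \<alpha> = t.ts z ([k] \<cdot>\<^bsub>A\<^esub> \<alpha>)" if \<alpha>: "\<alpha> \<in> carrier A" for k :: int and \<alpha>
  proof -
    interpret a: group_hom C t.T "\<lambda>x. t.ts x \<alpha>"
      using \<alpha> by unfold_locales (auto simp: hom_def t.ts_mult)
    interpret b: group_hom "add_monoid A" t.T "\<lambda>\<alpha>. t.ts z \<alpha>"
      using z by unfold_locales (auto simp: hom_def t.ts_add)
    show ?thesis using a.hom_int_pow[OF z(1), of k] b.hom_int_pow[of \<alpha> k] \<alpha> by (simp add: add_pow_def)
  qed
  have "(\<lambda>\<alpha>. t.ts z \<alpha>) \<in> hom (add_monoid A) t.T" using z by (auto simp: hom_def t.ts_add)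
  then have hom: "(\<lambda>\<alpha>. t.ts z \<alpha>) \<circ> h \<in> hom t.T t.T" using h(1) by (rule hom_compose[rotated])
  have "X = t.ts z (h X)" if "X \<in> carrier t.T" for X
  proof -
    have "((\<lambda>\<alpha>. t.ts z \<alpha>) \<circ> h) (t.ts x \<alpha>) = id (t.ts x \<alpha>)" if "x \<in> carrier C" "\<alpha> \<in> carrier A" for x \<alpha>
      using rep[OF that(1)] that h(2) zk by (auto simp: e)
    from t.tensor_hom_eq[OF t.T.is_group hom t.id_hom this that] show ?thesis by simp
  qed
  moreover have "h (t.ts (z [^]\<^bsub>C\<^esub> k) \<alpha>) = [k] \<cdot>\<^bsub>A\<^esub> \<alpha>" if "\<alpha> \<in> carrier A" for k :: int and \<alpha>
    using h(2)[of "z [^]\<^bsub>C\<^esub> k"] that z(1) by (simp add: e)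
  ultimately show ?thesis using h(1) by blast
qed

section \<open>The partial action on an extension of centralizers\<close>

lemma sub_exp_simps [simp]:
  "carrier (sub_exp G H) = H" "monoid.mult (sub_exp G H) = monoid.mult G" "one (sub_exp G H) = one G"
  by (simp_all add: sub_exp_def)

lemma sub_exp_expo:
  assumes "\<And>y. expo G x \<alpha> = Some y \<Longrightarrow> y \<in> H" shows "expo (sub_exp G H) x \<alpha> = expo G x \<alpha>"
  using assms by (auto simp: sub_exp_def split: option.split)

lemma group_cong:
  assumes "carrier G = carrier H" "monoid.mult G = monoid.mult H" "one G = one H"
  shows "group G \<longleftrightarrow> group H" "comm_group G \<longleftrightarrow> comm_group H"
  by (simp_all only: comm_group_def comm_monoid_def comm_monoid_axioms_def group_def group_axioms_def monoid_def
      Units_def assms)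

lemma comm_group_sub_exp_iff: "comm_group (sub_exp G H) \<longleftrightarrow> comm_group (G\<lparr>carrier := H\<rparr>)"
  by (rule group_cong) simp_all

lemma sub_exp_int_pow:
  assumes "group G" "subgroup H G" "x \<in> H" shows "x [^]\<^bsub>sub_exp G H\<^esub> (k::int) = x [^]\<^bsub>G\<^esub> k"
proof -
  have "m_inv (sub_exp G H) = m_inv (G\<lparr>carrier := H\<rparr>)" by (simp add: m_inv_def fun_eq_iff)
  then have "x [^]\<^bsub>sub_exp G H\<^esub> k = x [^]\<^bsub>G\<lparr>carrier := H\<rparr>\<^esub> k" by (simp add: int_pow_def nat_pow_def Let_def)
  then show ?thesis using group.int_pow_consistent[OF assms] by simp
qed

text \<open>\<open>h\<close> fixes \<open>g\<close> under conjugation, hence also its powers, by the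
  conjugation axiom.\<close>

lemma (in partial_exp_group) expo_commutes:
  assumes "g \<in> carrier G" "h \<in> carrier G" "\<alpha> \<in> carrier A" "expo G g \<alpha> = Some x" "h \<otimes>\<^bsub>G\<^esub> g = g \<otimes>\<^bsub>G\<^esub> h"
  shows "h \<otimes>\<^bsub>G\<^esub> x = x \<otimes>\<^bsub>G\<^esub> h"
proof -
  have "conj_by G h g = g" using assms G.conj_by_fixed_iff by simp
  then have "conj_by G h x = x" using expo_conj[OF assms(1-3)] assms(4) by simp
  then show ?thesis using G.conj_by_fixed_iff expo_closed assms by metis
qed

text \<open>The natural powers are forced by repeated addition of exponents. If the power with
  exponent -1 is defined, then 1 + (-1) = 0 makes it the inverse, and repeated addition gives the
  negative powers as well.\<close>

lemma (in partial_exp_group) expo_int: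
  assumes x: "x \<in> carrier G" and m: "expo G x (\<ominus>\<^bsub>A\<^esub> \<one>\<^bsub>A\<^esub>) \<noteq> None"
  shows "expo G x ([(n::int)] \<cdot>\<^bsub>A\<^esub> \<one>\<^bsub>A\<^esub>) = Some (x [^]\<^bsub>G\<^esub> n)"
proof -
  obtain y where y: "expo G x (\<ominus>\<^bsub>A\<^esub> \<one>\<^bsub>A\<^esub>) = Some y" using m by blast
  have yG: "y \<in> carrier G" using expo_closed[OF x _ y] by simp
  have "expo G x (\<one>\<^bsub>A\<^esub> \<oplus>\<^bsub>A\<^esub> \<ominus>\<^bsub>A\<^esub> \<one>\<^bsub>A\<^esub>) = Some (x \<otimes>\<^bsub>G\<^esub> y)"
    using x y by (intro expo_add expo_one) auto
  then have "x \<otimes>\<^bsub>G\<^esub> y = \<one>\<^bsub>G\<^esub>" using expo_zero[OF x] by (simp add: A.r_neg)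
  then have yx: "y = inv\<^bsub>G\<^esub> x" using x yG by (metis G.inv_equality G.inv_inv)
  have pos: "expo G x ([k] \<cdot>\<^bsub>A\<^esub> \<one>\<^bsub>A\<^esub>) = Some (x [^]\<^bsub>G\<^esub> k)" for k :: nat
  proof (induction k)
    case 0
    then show ?case using expo_zero[OF x] by simp
  next
    case (Suc k)
    have "expo G x ([k] \<cdot>\<^bsub>A\<^esub> \<one>\<^bsub>A\<^esub> \<oplus>\<^bsub>A\<^esub> \<one>\<^bsub>A\<^esub>) = Some (x [^]\<^bsub>G\<^esub> k \<otimes>\<^bsub>G\<^esub> x)"
      using x Suc by (intro expo_add expo_one) auto
    then show ?case by simp
  qed
  have neg: "expo G x ([k] \<cdot>\<^bsub>A\<^esub> (\<ominus>\<^bsub>A\<^esub> \<one>\<^bsub>A\<^esub>)) = Some (y [^]\<^bsub>G\<^esub> k)" for k :: nat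
  proof (induction k)
    case 0
    then show ?case using expo_zero[OF x] by simp
  next
    case (Suc k)
    have "expo G x ([k] \<cdot>\<^bsub>A\<^esub> (\<ominus>\<^bsub>A\<^esub> \<one>\<^bsub>A\<^esub>) \<oplus>\<^bsub>A\<^esub> \<ominus>\<^bsub>A\<^esub> \<one>\<^bsub>A\<^esub>) = Some (y [^]\<^bsub>G\<^esub> k \<otimes>\<^bsub>G\<^esub> y)"
      using x y Suc by (intro expo_add) auto
    then show ?case by simp
  qed
  show ?thesis
  proof (cases n rule: int_cases2)
    case (nonneg k)
    then show ?thesis using pos[of k] add_pow_int_ge[of "int k" A "\<one>\<^bsub>A\<^esub>"] by (simp only: int_pow_int of_nat_0_le_iff nat_int simp_thms)
  next
    case (nonpos k)
    have "[n] \<cdot>\<^bsub>A\<^esub> \<one>\<^bsub>A\<^esub> = [k] \<cdot>\<^bsub>A\<^esub> (\<ominus>\<^bsub>A\<^esub> \<one>\<^bsub>A\<^esub>)"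
      unfolding nonpos using A.add.int_pow_neg_int[of "\<one>\<^bsub>A\<^esub>" k] A.add.nat_pow_inv[of "\<one>\<^bsub>A\<^esub>" k] A.one_closed by metis
    moreover have "x [^]\<^bsub>G\<^esub> n = y [^]\<^bsub>G\<^esub> k"
      unfolding nonpos yx using G.int_pow_neg_int[OF x, of k] G.nat_pow_inv[OF x, of k] by metis
    ultimately show ?thesis using neg[of k] by metis
  qed
qed

lemma (in exp_group) expo_int_total: "x \<in> carrier G \<Longrightarrow> expo G x ([(n::int)] \<cdot>\<^bsub>A\<^esub> \<one>\<^bsub>A\<^esub>) = Some (x [^]\<^bsub>G\<^esub> n)"
  using expo_int expo_total by simp

section \<open>Centralizers as partial modules\<close>

locale ct_exp_group = partial_exp_group A G for A :: "('r, 'n) ring_scheme" and G :: "('g, 'r) exp_struct" +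
  assumes ct: "commutation_transitive G"
begin

lemma expo_centralizer:
  assumes v: "v \<in> carrier G" "v \<noteq> \<one>\<^bsub>G\<^esub>" and a: "a \<in> centralizer G v" "\<alpha> \<in> carrier A" "expo G a \<alpha> = Some b"
  shows "b \<in> centralizer G v"
proof -
  note aG = G.centralizerD[OF a(1)]
  show ?thesis
    by (rule G.centralizerI[OF expo_closed[OF aG(1) a(2,3)] expo_commutes[OF aG(1) v(1) a(2,3) aG(2)[symmetric], symmetric]])
qed

text \<open>Powers never leave a centralizer, so the restriction made in \<open>sub_exp\<close>
  discards nothing.\<close>

lemma expo_sub_centralizer:
  assumes "v \<in> carrier G" "v \<noteq> \<one>\<^bsub>G\<^esub>" "a \<in> centralizer G v" "\<alpha> \<in> carrier A"
  shows "expo (sub_exp G (centralizer G v)) a \<alpha> = expo G a \<alpha>"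
  by (rule sub_exp_expo) (rule expo_centralizer[OF assms])

lemma comm_group_centralizer:
  assumes "v \<in> carrier G" "v \<noteq> \<one>\<^bsub>G\<^esub>" shows "comm_group (sub_exp G (centralizer G v))"
  using G.commutation_transitive_maximal_abelian_centralizer[OF ct assms]
  by (simp add: comm_group_sub_exp_iff maximal_abelian_def)

lemma partial_exp_group_centralizer:
  assumes v: "v \<in> carrier G" "v \<noteq> \<one>\<^bsub>G\<^esub>" shows "partial_exp_group A (sub_exp G (centralizer G v))"
proof -
  interpret C: comm_group "sub_exp G (centralizer G v)" using comm_group_centralizer[OF v] .
  let ?C = "sub_exp G (centralizer G v)"
  have C: "a \<in> carrier G" if "a \<in> centralizer G v" for a using that by (rule G.centralizerD)
  note e = expo_sub_centralizer[OF v]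
  have sub: "subgroup (centralizer G v) G" using v G.subgroup_centralizer by blast
  show ?thesis
  proof (rule partial_exp_groupI)
    show "ring A" by (rule A.ring_axioms)
    show "group ?C" by (rule C.is_group)
    fix g h \<alpha> \<beta> x y
    assume g: "g \<in> carrier ?C"
    note gC = g[simplified]
    show "x \<in> carrier ?C" if "\<alpha> \<in> carrier A" "expo ?C g \<alpha> = Some x"
      using that gC expo_centralizer[OF v gC] by (simp add: e)
    show "expo ?C g \<one>\<^bsub>A\<^esub> = Some g" "expo ?C g \<zero>\<^bsub>A\<^esub> = Some \<one>\<^bsub>?C\<^esub>"
      using gC C by (simp_all add: e expo_one expo_zero)
    show "expo ?C g (\<alpha> \<oplus>\<^bsub>A\<^esub> \<beta>) = Some (x \<otimes>\<^bsub>?C\<^esub> y)"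
      if "\<alpha> \<in> carrier A" "\<beta> \<in> carrier A" "expo ?C g \<alpha> = Some x" "expo ?C g \<beta> = Some y"
      using that gC C by (simp add: e expo_add)
    show "expo ?C g (\<alpha> \<otimes>\<^bsub>A\<^esub> \<beta>) = Some y"
      if "\<alpha> \<in> carrier A" "\<beta> \<in> carrier A" "expo ?C g \<alpha> = Some x" "expo ?C x \<beta> = Some y"
    proof -
      have "expo G g \<alpha> = Some x" using that gC by (simp add: e)
      moreover from this have "x \<in> centralizer G v" using expo_centralizer[OF v gC that(1)] by simp
      ultimately show ?thesis using that gC C by (simp add: e expo_mult)
    qed
    assume h: "h \<in> carrier ?C"
    note hC = h[simplified]
    show "expo ?C (conj_by ?C h g) \<alpha> = map_option (conj_by ?C h) (expo ?C g \<alpha>)" if "\<alpha> \<in> carrier A"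
    proof -
      have "conj_by ?C h k = k" if "k \<in> centralizer G v" for k
        using that hC C.conj_by_fixed_iff[of h k] C.m_comm[of h k] by simp
      then show ?thesis
        using gC that expo_centralizer[OF v gC that] by (cases "expo G g \<alpha>") (auto simp: e)
    qed
    show "expo ?C (g \<otimes>\<^bsub>?C\<^esub> h) \<alpha> = Some (x \<otimes>\<^bsub>?C\<^esub> y)"
      if "\<alpha> \<in> carrier A" "g \<otimes>\<^bsub>?C\<^esub> h = h \<otimes>\<^bsub>?C\<^esub> g" "expo ?C g \<alpha> = Some x" "expo ?C h \<alpha> = Some y"
      using expo_commute[of g h \<alpha> x y] that gC hC C subgroup.m_closed[OF sub] by (simp add: e)
  next
    show "expo ?C \<one>\<^bsub>?C\<^esub> \<alpha> = Some \<one>\<^bsub>?C\<^esub>" if "\<alpha> \<in> carrier A" for \<alpha>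
      using that subgroup.one_closed[OF sub] by (simp add: e one_expo)
  qed
qed

lemma tensor_data_centralizer:
  assumes v: "v \<in> carrier G" "v \<noteq> \<one>\<^bsub>G\<^esub>" shows "tensor_data A (sub_exp G (centralizer G v))"
proof -
  interpret p: partial_exp_group A "sub_exp G (centralizer G v)" using partial_exp_group_centralizer[OF v] .
  show ?thesis
    using p.expo_closed A.ring_axioms comm_group_centralizer[OF v]
    by (simp add: tensor_data_def tensor_data_axioms_def)
qed

lemma module_centralizer_iff:
  assumes v: "v \<in> carrier G" "v \<noteq> \<one>\<^bsub>G\<^esub>"
  shows "is_exp_module A G (centralizer G v) \<longleftrightarrow> (\<forall>a\<in>centralizer G v. \<forall>\<alpha>\<in>carrier A. expo G a \<alpha> \<noteq> None)"
  unfolding is_exp_module_def exp_group_def exp_group_axioms_def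
  using partial_exp_group_centralizer[OF v] comm_group_centralizer[OF v] expo_sub_centralizer[OF v] by auto

lemma module_centralizer_conj:
  assumes v: "v \<in> carrier G" "v \<noteq> \<one>\<^bsub>G\<^esub>" and g: "g \<in> carrier G"
  shows "is_exp_module A G (centralizer G (conj_by G g v)) \<longleftrightarrow> is_exp_module A G (centralizer G v)"
proof -
  have "is_exp_module A G (centralizer G (conj_by G g v))"
    if v: "v \<in> carrier G" "v \<noteq> \<one>\<^bsub>G\<^esub>" and g: "g \<in> carrier G" and m: "is_exp_module A G (centralizer G v)" for v g
  proof -
    have "expo G a \<alpha> \<noteq> None" if a: "a \<in> centralizer G (conj_by G g v)" and \<alpha>: "\<alpha> \<in> carrier A" for a \<alpha>
    proof -
      obtain b where b: "b \<in> centralizer G v" "a = conj_by G g b" using a G.centralizer_conj_by[OF g v(1)] by auto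
      then show ?thesis using m v g \<alpha> module_centralizer_iff[OF v] expo_conj[OF _ g \<alpha>, of b] G.centralizerD(1)[OF b(1)] by simp
    qed
    then show ?thesis using module_centralizer_iff[of "conj_by G g v"] v g by simp
  qed
  from this[OF v g] this[of "conj_by G g v" "inv\<^bsub>G\<^esub> g"] show ?thesis using v g by auto
qed

end

locale faithful_exp_group = ct_exp_group +
  assumes faithful: "maximal_abelian G M \<Longrightarrow> abelian_faithful A (sub_exp G M)"
begin

lemma star_of_groups_centralizers:
  assumes "\<C> \<subseteq> centralizers G"
  shows "star_of_groups G \<C> (\<lambda>C. tensor A (sub_exp G C)) (\<lambda>C. C) (\<lambda>C. tensor_map A (sub_exp G C))"
proof (intro star_of_groups.intro star_of_groups_axioms.intro)
  show "group G" by (rule G.is_group)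
  fix C assume "C \<in> \<C>"
  then obtain v where v: "v \<in> carrier G" "v \<noteq> \<one>\<^bsub>G\<^esub>" "C = centralizer G v" using assms by (auto simp: centralizers_def)
  interpret t: tensor_data A "sub_exp G C" using tensor_data_centralizer v by simp
  show "group (tensor A (sub_exp G C))" by (rule t.T.is_group)
  show "subgroup C G" using G.subgroup_centralizer v by simp
  show "tensor_map A (sub_exp G C) \<in> hom (G\<lparr>carrier := C\<rparr>) (tensor A (sub_exp G C))"
    using t.tensor_map_hom by (simp add: hom_def)
qed

lemma group_ext_group: "\<C> \<subseteq> centralizers G \<Longrightarrow> group (ext_group A G \<C>)"
  using star_of_groups.group_star[OF star_of_groups_centralizers] by (simp add: ext_group_def)

end

section \<open>The extension in a copy\<close>

locale ext_copy = faithful_exp_group A G + E: group E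
  for A :: "('r, 'n) ring_scheme" and G :: "('g, 'r) exp_struct" and E :: "('u, 'r) exp_struct" +
  fixes \<C> \<theta>
  assumes \<C>: "\<C> \<subseteq> centralizers G"
    and ext_iso: "\<theta> \<in> iso (ext_group A G \<C>) E"
begin

abbreviation tens where "tens C \<equiv> tensor A (sub_exp G C)"

lemma \<C>_cases:
  assumes "C \<in> \<C>" obtains v where "v \<in> carrier G" "v \<noteq> \<one>\<^bsub>G\<^esub>" "C = centralizer G v"
  using assms \<C> by (auto simp: centralizers_def)

lemma tensor_data_\<C>: "C \<in> \<C> \<Longrightarrow> tensor_data A (sub_exp G C)"
  by (elim \<C>_cases) (simp add: tensor_data_centralizer)

sublocale S: abelian_star G \<C> "\<lambda>C. tensor A (sub_exp G C)" "\<lambda>C. C" "\<lambda>C. tensor_map A (sub_exp G C)" E \<theta>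
proof (intro abelian_star.intro star_copy.intro star_of_groups_centralizers star_copy_axioms.intro
    abelian_star_axioms.intro \<C>)
  show "group E" by (rule E.is_group)
  show "\<theta> \<in> iso (star_group G \<C> (\<lambda>C. tens C) (\<lambda>C. C) (\<lambda>C. tensor_map A (sub_exp G C))) E"
    using ext_iso by (simp add: ext_group_def)
  fix C assume C: "C \<in> \<C>"
  show "comm_group (tens C)" by (rule tensor_data.comm_group_tensor[OF tensor_data_\<C>[OF C]])
  from C obtain v where "v \<in> carrier G" "v \<noteq> \<one>\<^bsub>G\<^esub>" "C = centralizer G v" by (rule \<C>_cases)
  then have "maximal_abelian G C"
    using G.commutation_transitive_maximal_abelian_centralizer[OF ct] by simp
  then show "inj_on (tensor_map A (sub_exp G C)) C"
    using faithful[of C] by (simp add: abelian_faithful_def)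
qed

lemma cen_eq: "S.cen g = \<theta> (ext_central A G \<C> g)"
  by (simp add: S.cen_def ext_central_def ext_rel_def)

lemma out_eq: "S.out C t = \<theta> (ext_outer A G \<C> C t)"
  by (simp add: S.out_def ext_outer_def ext_rel_def)

lemma group_ext: "group (ext_group A G \<C>)"
  by (rule group_ext_group[OF \<C>])

lemma ext_central_closed: "g \<in> carrier G \<Longrightarrow> ext_central A G \<C> g \<in> carrier (ext_group A G \<C>)"
  using S.cls_closed[OF S.central_word] by (simp add: ext_central_def ext_rel_def ext_group_def S.cls_def)

lemma ext_outer_closed: "C \<in> \<C> \<Longrightarrow> t \<in> carrier (tens C) \<Longrightarrow> ext_outer A G \<C> C t \<in> carrier (ext_group A G \<C>)"
  using S.cls_closed[OF S.outer_word] by (simp add: ext_outer_def ext_rel_def ext_group_def S.cls_def)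

text \<open>The powers in the vertex groups, before they are spread by conjugation.\<close>

definition base_pow :: "'u \<Rightarrow> 'r \<Rightarrow> 'u \<Rightarrow> bool" where
  "base_pow a \<alpha> b \<longleftrightarrow> \<alpha> \<in> carrier A \<and>
     ((\<exists>g a' b'. g \<in> carrier G \<and> g \<noteq> \<one>\<^bsub>G\<^esub> \<and> is_exp_module A G (centralizer G g) \<and> a' \<in> centralizer G g \<and>
         expo G a' \<alpha> = Some b' \<and> a = S.cen a' \<and> b = S.cen b') \<or>
      (\<exists>C t s. C \<in> \<C> \<and> t \<in> carrier (tens C) \<and> expo (tens C) t \<alpha> = Some s \<and> a = S.out C t \<and> b = S.out C s))"

definition ext_pow :: "'u \<Rightarrow> 'r \<Rightarrow> 'u \<Rightarrow> bool" where
  "ext_pow x \<alpha> y \<longleftrightarrow>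
     (\<exists>z a b. z \<in> carrier E \<and> base_pow a \<alpha> b \<and> x = conj_by E z a \<and> y = conj_by E z b) \<or>
     (\<exists>n::int. x \<in> carrier E \<and> \<alpha> = [n] \<cdot>\<^bsub>A\<^esub> \<one>\<^bsub>A\<^esub> \<and> y = x [^]\<^bsub>E\<^esub> n)"

lemma theta: "\<theta> \<in> hom (ext_group A G \<C>) E" "\<theta> ` carrier (ext_group A G \<C>) = carrier E"
  "inj_on \<theta> (carrier (ext_group A G \<C>))"
  using ext_iso by (auto simp: iso_def bij_betw_def)

lemma exp_group_tens: "C \<in> \<C> \<Longrightarrow> exp_group A (tens C)"
  by (rule tensor_data.exp_group_tensor[OF tensor_data_\<C>])

lemma tens_expo_closed:
  assumes "C \<in> \<C>" "t \<in> carrier (tens C)" "\<alpha> \<in> carrier A" "expo (tens C) t \<alpha> = Some s"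
  shows "s \<in> carrier (tens C)"
proof -
  interpret e: exp_group A "tens C" by (rule exp_group_tens[OF assms(1)])
  show ?thesis by (rule e.expo_closed[OF assms(2-4)])
qed

lemma base_pow_closed:
  assumes "base_pow a \<alpha> b" shows "a \<in> carrier E \<and> b \<in> carrier E"
  using assms unfolding base_pow_def
proof (elim conjE disjE exE)
  fix g a' b' assume *: "\<alpha> \<in> carrier A" "a' \<in> centralizer G g" "expo G a' \<alpha> = Some b'" "a = S.cen a'" "b = S.cen b'"
  have "a' \<in> carrier G" using *(2) by (rule G.centralizerD)
  moreover from this have "b' \<in> carrier G" using *(1,3) by (rule expo_closed)
  ultimately show ?thesis using * by simp
next
  fix C t s assume *: "\<alpha> \<in> carrier A" "C \<in> \<C>" "t \<in> carrier (tens C)" "expo (tens C) t \<alpha> = Some s"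
    "a = S.out C t" "b = S.out C s"
  then show ?thesis using tens_expo_closed[OF *(2,3,1,4)] by simp
qed

text \<open>Carries the powers prescribed on classes of words over to the copy, where the geometry
  of the star is available.\<close>

lemma ext_pow_iff:
  assumes x: "x \<in> carrier (ext_group A G \<C>)" and \<alpha>: "\<alpha> \<in> carrier A"
  shows "ext_pow (\<theta> x) \<alpha> z \<longleftrightarrow> (\<exists>y. ext_expo A G \<C> x \<alpha> y \<and> z = \<theta> y)"
proof -
  interpret X: group "ext_group A G \<C>" by (rule group_ext)
  interpret h: group_hom "ext_group A G \<C>" E \<theta>
    using theta(1) X.is_group E.is_group by (simp add: group_hom_def group_hom_axioms_def)
  have conj: "\<theta> (conj_by (ext_group A G \<C>) u w) = conj_by E (\<theta> u) (\<theta> w)"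
    if "u \<in> carrier (ext_group A G \<C>)" "w \<in> carrier (ext_group A G \<C>)" for u w
    using that by (simp add: conj_by_def)
  note cl = ext_central_closed ext_outer_closed
  have inj: "u = w" if "\<theta> u = \<theta> w" "u \<in> carrier (ext_group A G \<C>)" "w \<in> carrier (ext_group A G \<C>)" for u w
    using theta(3) that by (auto dest: inj_onD)
  have bc: "b \<in> carrier G" if "a \<in> centralizer G g" "\<alpha> \<in> carrier A" "expo G a \<alpha> = Some b" for a b g \<alpha>
    using that expo_closed G.centralizerD(1) by blast
  show ?thesis
  proof
    assume "ext_pow (\<theta> x) \<alpha> z"
    then show "\<exists>y. ext_expo A G \<C> x \<alpha> y \<and> z = \<theta> y"
      unfolding ext_pow_def
    proof (elim disjE exE conjE)
      fix u a b assume u: "u \<in> carrier E" "base_pow a \<alpha> b" "\<theta> x = conj_by E u a" "z = conj_by E u b"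
      obtain w where w: "w \<in> carrier (ext_group A G \<C>)" "u = \<theta> w" using u(1) theta(2) by blast
      from u(2) show ?thesis
        unfolding base_pow_def
      proof (elim conjE disjE exE)
        fix g a' b' assume *: "g \<in> carrier G" "g \<noteq> \<one>\<^bsub>G\<^esub>" "is_exp_module A G (centralizer G g)" "a' \<in> centralizer G g"
          "expo G a' \<alpha> = Some b'" "a = S.cen a'" "b = S.cen b'"
        then have G: "a' \<in> carrier G" "b' \<in> carrier G" using bc \<alpha> G.centralizerD(1) by auto
        then have "x = conj_by (ext_group A G \<C>) w (ext_central A G \<C> a')"
          using * u w x by (intro inj) (simp_all add: conj cl cen_eq)
        moreover have "z = \<theta> (conj_by (ext_group A G \<C>) w (ext_central A G \<C> b'))"
          using * u w G by (simp add: conj cl cen_eq)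
        ultimately show ?thesis using ext_expo.module[OF *(1-4) \<alpha> *(5) w(1)] by blast
      next
        fix C t s assume *: "C \<in> \<C>" "t \<in> carrier (tens C)" "expo (tens C) t \<alpha> = Some s" "a = S.out C t" "b = S.out C s"
        then have s: "s \<in> carrier (tens C)" using tens_expo_closed \<alpha> by blast
        then have "x = conj_by (ext_group A G \<C>) w (ext_outer A G \<C> C t)"
          using * u w x by (intro inj) (simp_all add: conj cl out_eq)
        moreover have "z = \<theta> (conj_by (ext_group A G \<C>) w (ext_outer A G \<C> C s))"
          using * u w s by (simp add: conj cl out_eq)
        ultimately show ?thesis using ext_expo.tensor[OF *(1,2) \<alpha> *(3) w(1)] by blast
      qed
    next
      fix n :: int assume "\<alpha> = [n] \<cdot>\<^bsub>A\<^esub> \<one>\<^bsub>A\<^esub>" "z = \<theta> x [^]\<^bsub>E\<^esub> n"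
      then show ?thesis using ext_expo.int[OF x, of n] h.hom_int_pow[OF x, of n] by auto
    qed
  next
    assume "\<exists>y. ext_expo A G \<C> x \<alpha> y \<and> z = \<theta> y"
    then obtain y where "ext_expo A G \<C> x \<alpha> y" "z = \<theta> y" by blast
    then show "ext_pow (\<theta> x) \<alpha> z"
    proof (cases rule: ext_expo.cases)
      case (module g a b w)
      have "base_pow (S.cen a) \<alpha> (S.cen b)" using module unfolding base_pow_def by blast
      moreover have "a \<in> carrier G" "b \<in> carrier G" using module bc \<alpha> G.centralizerD(1) by auto
      then have "\<theta> x = conj_by E (\<theta> w) (S.cen a)" "z = conj_by E (\<theta> w) (S.cen b)"
        using module \<open>z = \<theta> y\<close> by (simp_all add: conj cl cen_eq)
      moreover have "\<theta> w \<in> carrier E" using module by simp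
      ultimately show ?thesis unfolding ext_pow_def by blast
    next
      case (tensor C t s w)
      have "base_pow (S.out C t) \<alpha> (S.out C s)" using tensor unfolding base_pow_def by blast
      moreover have "s \<in> carrier (tens C)" using tensor tens_expo_closed by blast
      then have "\<theta> x = conj_by E (\<theta> w) (S.out C t)" "z = conj_by E (\<theta> w) (S.out C s)"
        using tensor \<open>z = \<theta> y\<close> by (simp_all add: conj cl out_eq)
      moreover have "\<theta> w \<in> carrier E" using tensor by simp
      ultimately show ?thesis unfolding ext_pow_def by blast
    next
      case (int n)
      then show ?thesis using \<open>z = \<theta> y\<close> x h.hom_int_pow[OF x, of n] unfolding ext_pow_def by auto
    qed
  qed
qed

end

section \<open>Consistency of the prescribed powers\<close>

locale ext_step = ext_copy A G E \<C> \<theta>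
  for A :: "('r, 'n) ring_scheme" and G :: "('g, 'r) exp_struct" and E :: "('u, 'r) exp_struct" and \<C> \<theta> +
  assumes char_zero: "\<And>n::int. [n] \<cdot>\<^bsub>A\<^esub> \<one>\<^bsub>A\<^esub> = \<zero>\<^bsub>A\<^esub> \<Longrightarrow> n = 0"
    and nonabelian: "\<not> comm_group G"
    and cc: "commuting_conj_trivial G"
    and condition_S: "condition_S A G \<C>"
begin

lemma int_inj: "[(n::int)] \<cdot>\<^bsub>A\<^esub> \<one>\<^bsub>A\<^esub> = [m] \<cdot>\<^bsub>A\<^esub> \<one>\<^bsub>A\<^esub> \<Longrightarrow> n = m"
proof -
  assume eq: "[n] \<cdot>\<^bsub>A\<^esub> \<one>\<^bsub>A\<^esub> = [m] \<cdot>\<^bsub>A\<^esub> \<one>\<^bsub>A\<^esub>"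
  have "[(n - m)] \<cdot>\<^bsub>A\<^esub> \<one>\<^bsub>A\<^esub> = ([n] \<cdot>\<^bsub>A\<^esub> \<one>\<^bsub>A\<^esub>) \<ominus>\<^bsub>A\<^esub> ([m] \<cdot>\<^bsub>A\<^esub> \<one>\<^bsub>A\<^esub>)"
    using A.add.int_pow_diff[OF A.one_closed, of n m] by (simp add: a_minus_def)
  then have "[(n - m)] \<cdot>\<^bsub>A\<^esub> \<one>\<^bsub>A\<^esub> = \<zero>\<^bsub>A\<^esub>" using eq by (simp add: A.r_neg a_minus_def)
  then show "n = m" using char_zero by fastforce
qed

lemma \<C>_eq_centralizer:
  assumes "C \<in> \<C>" "c \<in> C" "c \<noteq> \<one>\<^bsub>G\<^esub>" shows "C = centralizer G c"
  using assms(1)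
proof (rule \<C>_cases)
  fix v assume "v \<in> carrier G" "v \<noteq> \<one>\<^bsub>G\<^esub>" "C = centralizer G v"
  then show ?thesis using G.commutation_transitive_centralizer_eq[OF ct, of v c] assms(2,3) by metis
qed

lemma \<C>_not_module: "C \<in> \<C> \<Longrightarrow> \<not> is_exp_module A G C"
  using condition_S by (auto simp: condition_S_def)

lemma cen_conj: "g \<in> carrier G \<Longrightarrow> x \<in> carrier G \<Longrightarrow> S.cen (conj_by G g x) = conj_by E (S.cen g) (S.cen x)"
  by (simp add: conj_by_def S.cen_mult S.cen_inv)

lemma cen_eq_iff: "g \<in> carrier G \<Longrightarrow> x \<in> carrier G \<Longrightarrow> S.cen g = S.cen x \<longleftrightarrow> g = x"
  using S.cen_inj by (auto dest: inj_onD)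

lemma cen_eq_one_iff: "g \<in> carrier G \<Longrightarrow> S.cen g = \<one>\<^bsub>E\<^esub> \<longleftrightarrow> g = \<one>\<^bsub>G\<^esub>"
  using cen_eq_iff[of g "\<one>\<^bsub>G\<^esub>"] by simp

text \<open>\<open>C\<close> is the centralizer of \<open>c\<close> and \<open>D\<close> that of its
  conjugate, so they are conjugate. Condition (S) makes them equal, and the CSA property of
  \<open>G\<close> puts \<open>g\<close> into the centralizer of \<open>c\<close>.\<close>

lemma malnormal_\<C>:
  assumes C: "C \<in> \<C>" "D \<in> \<C>" and c: "c \<in> C" "c \<noteq> \<one>\<^bsub>G\<^esub>" and g: "g \<in> carrier G" "conj_by G g c \<in> D"
  shows "C = D \<and> g \<in> C"
proof -
  have cG: "c \<in> carrier G" using S.edge_closed C c by blast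
  have Cc: "C = centralizer G c" by (rule \<C>_eq_centralizer[OF C(1) c])
  have D: "D = centralizer G (conj_by G g c)" using \<C>_eq_centralizer[OF C(2) g(2)] c cG g by simp
  then have "D = conj_by G g ` C" using G.centralizer_conj_by[OF g(1) cG] Cc by simp
  then have "conjugate_in G C D" using g(1) by (auto simp: conjugate_in_def)
  then have CD: "C = D" using condition_S C unfolding condition_S_def by blast
  then have "g \<in> centralizer G c" using cc cG c g Cc unfolding commuting_conj_trivial_def by blast
  then show ?thesis using CD Cc by blast
qed

sublocale K: csa_star E S.len "S.cen ` carrier G" \<C> "\<lambda>C. S.out C ` carrier (tensor A (sub_exp G C))"
proof (intro csa_star.intro malnormal_star.intro S.L.star_length_axioms malnormal_star_axioms.intro csa_star_axioms.intro)
  fix C D c g assume C: "C \<in> \<C>" "D \<in> \<C>" and c: "c \<in> S.out C ` carrier (tens C)" "c \<in> S.cen ` carrier G" "c \<noteq> \<one>\<^bsub>E\<^esub>"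
    and g: "g \<in> S.cen ` carrier G" "conj_by E g c \<in> S.out D ` carrier (tens D)"
  obtain c0 g0 where 0: "c = S.cen c0" "c0 \<in> carrier G" "g = S.cen g0" "g0 \<in> carrier G" using c g by blast
  have "c0 \<in> C" using S.cen_edge_iff[OF C(1) 0(2)] 0 c by simp
  moreover have "conj_by G g0 c0 \<in> D" using S.cen_edge_iff[OF C(2), of "conj_by G g0 c0"] 0 g by (simp add: cen_conj)
  moreover have "c0 \<noteq> \<one>\<^bsub>G\<^esub>" using 0 c by auto
  ultimately have "C = D" "g0 \<in> C" using malnormal_\<C>[OF C] 0 by auto
  then show "C = D \<and> g \<in> S.out C ` carrier (tens C)" using S.cen_edge_iff[OF C(1) 0(4)] 0 by simp
next
  fix v x y assume v: "v \<in> S.cen ` carrier G" "v \<noteq> \<one>\<^bsub>E\<^esub>" and xy: "x \<in> S.cen ` carrier G" "y \<in> S.cen ` carrier G"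
    "x \<otimes>\<^bsub>E\<^esub> v = v \<otimes>\<^bsub>E\<^esub> x" "y \<otimes>\<^bsub>E\<^esub> v = v \<otimes>\<^bsub>E\<^esub> y"
  obtain v0 x0 y0 where 0: "v = S.cen v0" "v0 \<in> carrier G" "x = S.cen x0" "x0 \<in> carrier G" "y = S.cen y0" "y0 \<in> carrier G"
    using v xy by blast
  have "S.cen (x0 \<otimes>\<^bsub>G\<^esub> v0) = S.cen (v0 \<otimes>\<^bsub>G\<^esub> x0)" "S.cen (y0 \<otimes>\<^bsub>G\<^esub> v0) = S.cen (v0 \<otimes>\<^bsub>G\<^esub> y0)"
    using 0 xy by (simp_all add: S.cen_mult)
  then have "x0 \<in> centralizer G v0" "y0 \<in> centralizer G v0"
    using 0 by (auto simp: cen_eq_iff intro!: G.centralizerI)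
  moreover have "v0 \<in> carrier G - {\<one>\<^bsub>G\<^esub>}" using 0 v by auto
  ultimately have "x0 \<otimes>\<^bsub>G\<^esub> y0 = y0 \<otimes>\<^bsub>G\<^esub> x0" using ct unfolding commutation_transitive_def by blast
  then show "x \<otimes>\<^bsub>E\<^esub> y = y \<otimes>\<^bsub>E\<^esub> x" using 0 S.cen_mult by metis
next
  fix v x assume v: "v \<in> S.cen ` carrier G" "v \<noteq> \<one>\<^bsub>E\<^esub>" and x: "x \<in> S.cen ` carrier G"
    "conj_by E x v \<otimes>\<^bsub>E\<^esub> v = v \<otimes>\<^bsub>E\<^esub> conj_by E x v"
  obtain v0 x0 where 0: "v = S.cen v0" "v0 \<in> carrier G" "x = S.cen x0" "x0 \<in> carrier G" using v x by blast
  have "S.cen (conj_by G x0 v0 \<otimes>\<^bsub>G\<^esub> v0) = S.cen (v0 \<otimes>\<^bsub>G\<^esub> conj_by G x0 v0)"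
    using 0 x by (simp add: S.cen_mult cen_conj)
  then have "conj_by G x0 v0 \<in> centralizer G v0" using 0 by (auto simp: cen_eq_iff intro!: G.centralizerI)
  moreover have "v0 \<in> carrier G - {\<one>\<^bsub>G\<^esub>}" using 0 v by auto
  ultimately have "x0 \<in> centralizer G v0" using cc 0 unfolding commuting_conj_trivial_def by blast
  then have "x0 \<otimes>\<^bsub>G\<^esub> v0 = v0 \<otimes>\<^bsub>G\<^esub> x0" by (rule G.centralizerD)
  then show "x \<otimes>\<^bsub>E\<^esub> v = v \<otimes>\<^bsub>E\<^esub> x" using 0 S.cen_mult by metis
qed

text \<open>Being a module is invariant under conjugation, and no member of \<open>\<C>\<close> is a
  module. This keeps the two kinds of prescribed powers apart.\<close>

lemma module_not_conj_outer:
  assumes g: "g \<in> carrier G" "g \<noteq> \<one>\<^bsub>G\<^esub>" "is_exp_module A G (centralizer G g)" and a: "a \<in> centralizer G g" "a \<noteq> \<one>\<^bsub>G\<^esub>"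
    and C: "C \<in> \<C>" and h: "h \<in> S.cen ` carrier G"
  shows "conj_by E h (S.cen a) \<notin> S.out C ` carrier (tens C)"
proof
  assume c: "conj_by E h (S.cen a) \<in> S.out C ` carrier (tens C)"
  have aG: "a \<in> carrier G" using a G.centralizerD by blast
  obtain h0 where h0: "h = S.cen h0" "h0 \<in> carrier G" using h by blast
  have "conj_by G h0 a \<in> C" using S.cen_edge_iff[OF C, of "conj_by G h0 a"] c h0 aG by (simp add: cen_conj)
  then have "C = centralizer G (conj_by G h0 a)" using \<C>_eq_centralizer[OF C] a h0 aG by simp
  moreover have "centralizer G a = centralizer G g"
    using G.commutation_transitive_centralizer_eq[OF ct g(1,2) a] .
  ultimately have "is_exp_module A G C" using module_centralizer_conj[OF aG a(2) h0(2)] g by simp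
  then show False using \<C>_not_module[OF C] by blast
qed

text \<open>The fact that makes powers well defined. Nontrivial conjugate elements with prescribed
  powers are of the same kind by \<open>module_not_conj_outer\<close>. Then the conjugating element
  lies in \<open>G\<close>, whose action respects conjugation, or in the outer vertex group itself,
  where conjugation is trivial.\<close>

lemma base_pow_conj:
  assumes ab: "base_pow a \<alpha> b" and ab': "base_pow (conj_by E z a) \<alpha> b'" and z: "z \<in> carrier E"
  shows "b' = conj_by E z b"
proof (cases "a = \<one>\<^bsub>E\<^esub>")
  case True
  \<comment> \<open>The identity belongs to all vertex groups and is treated separately.\<close>
  have one: "b = \<one>\<^bsub>E\<^esub>" if "base_pow \<one>\<^bsub>E\<^esub> \<alpha> b" for b
    using that unfolding base_pow_def
  proof (elim conjE disjE exE)
    fix g a' b' assume *: "\<alpha> \<in> carrier A" "a' \<in> centralizer G g" "expo G a' \<alpha> = Some b'" "\<one>\<^bsub>E\<^esub> = S.cen a'" "b = S.cen b'"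
    then have "a' = \<one>\<^bsub>G\<^esub>" using G.centralizerD(1)[OF *(2)] cen_eq_one_iff by metis
    then show ?thesis using one_expo[OF *(1)] * by simp
  next
    fix C t s assume *: "\<alpha> \<in> carrier A" "C \<in> \<C>" "t \<in> carrier (tens C)" "expo (tens C) t \<alpha> = Some s"
      "\<one>\<^bsub>E\<^esub> = S.out C t" "b = S.out C s"
    interpret e: exp_group A "tens C" by (rule exp_group_tens[OF *(2)])
    have "t = \<one>\<^bsub>tens C\<^esub>" 
      by (rule inj_onD[OF S.out_inj[OF *(2)]]) (use * S.out_one[OF *(2)] in simp_all)
    then show ?thesis using e.one_expo[OF *(1)] * by simp
  qed
  have "b = \<one>\<^bsub>E\<^esub>" using one ab True by simp
  moreover have "b' = \<one>\<^bsub>E\<^esub>" using one ab' True z by simp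
  ultimately show ?thesis using z by simp
next
  case False
  have mixed: False
    if "g \<in> carrier G" "g \<noteq> \<one>\<^bsub>G\<^esub>" "is_exp_module A G (centralizer G g)" "a0 \<in> centralizer G g" "S.cen a0 \<noteq> \<one>\<^bsub>E\<^esub>"
      "C \<in> \<C>" "conj_by E z (S.cen a0) \<in> S.out C ` carrier (tens C)" "z \<in> carrier E" for g a0 C z
  proof -
    have a0: "a0 \<in> carrier G" using that(4) by (rule G.centralizerD)
    then have n1: "a0 \<noteq> \<one>\<^bsub>G\<^esub>" using that by auto
    show False
      using K.central_conj_not_in_outer[of "S.cen a0" z C] module_not_conj_outer[OF that(1-4) n1] that a0 by blast
  qed
  have aE: "a \<in> carrier E" using base_pow_closed[OF ab] by simp
  from ab have \<alpha>: "\<alpha> \<in> carrier A" by (simp add: base_pow_def)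
  from ab consider (m) g a0 b0 where "g \<in> carrier G" "g \<noteq> \<one>\<^bsub>G\<^esub>" "is_exp_module A G (centralizer G g)"
      "a0 \<in> centralizer G g" "expo G a0 \<alpha> = Some b0" "a = S.cen a0" "b = S.cen b0"
    | (t) C t s where "C \<in> \<C>" "t \<in> carrier (tens C)" "expo (tens C) t \<alpha> = Some s" "a = S.out C t" "b = S.out C s"
    unfolding base_pow_def by blast
  then show ?thesis
  proof cases
    case m
    have a0: "a0 \<in> carrier G" using m(4) by (rule G.centralizerD)
    have n1: "a0 \<noteq> \<one>\<^bsub>G\<^esub>" using False m by auto
    have b0: "b0 \<in> carrier G" using a0 \<alpha> m(5) by (rule expo_closed)
    from ab' consider (m') g' a1 b1 where "g' \<in> carrier G" "g' \<noteq> \<one>\<^bsub>G\<^esub>" "is_exp_module A G (centralizer G g')"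
        "a1 \<in> centralizer G g'" "expo G a1 \<alpha> = Some b1" "conj_by E z a = S.cen a1" "b' = S.cen b1"
      | (t') C t s where "C \<in> \<C>" "t \<in> carrier (tens C)" "expo (tens C) t \<alpha> = Some s" "conj_by E z a = S.out C t" "b' = S.out C s"
      unfolding base_pow_def by blast
    then show ?thesis
    proof cases
      case m'
      have a1: "a1 \<in> carrier G" using m'(4) by (rule G.centralizerD)
      have "z \<in> S.cen ` carrier G"
        using K.central_conj_in_central[of a z] module_not_conj_outer[OF m(1-4) n1] m(6) m'(6) a0 a1 z False by blast
      then obtain z0 where z0: "z = S.cen z0" "z0 \<in> carrier G" by blast
      then have "S.cen a1 = S.cen (conj_by G z0 a0)" using m(6) m'(6) a0 by (simp add: cen_conj)
      then have "a1 = conj_by G z0 a0" using a0 a1 z0 by (simp add: cen_eq_iff)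
      then have "b1 = conj_by G z0 b0" using expo_conj[OF a0 z0(2) \<alpha>] m(5) m'(5) by simp
      then show ?thesis using m(7) m'(7) z0 b0 by (simp add: cen_conj)
    next
      case t'
      then show ?thesis using mixed[OF m(1-4) _ t'(1) _ z] False m by auto
    qed
  next
    case t
    from ab' consider (m') g' a1 b1 where "g' \<in> carrier G" "g' \<noteq> \<one>\<^bsub>G\<^esub>" "is_exp_module A G (centralizer G g')"
        "a1 \<in> centralizer G g'" "expo G a1 \<alpha> = Some b1" "conj_by E z a = S.cen a1" "b' = S.cen b1"
      | (t') D t' s' where "D \<in> \<C>" "t' \<in> carrier (tens D)" "expo (tens D) t' \<alpha> = Some s'" "conj_by E z a = S.out D t'" "b' = S.out D s'"
      unfolding base_pow_def by blast
    then show ?thesis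
    proof cases
      case m'
      have "S.cen a1 \<noteq> \<one>\<^bsub>E\<^esub>" using m'(6)[symmetric] False z aE by simp
      moreover have "conj_by E (inv\<^bsub>E\<^esub> z) (S.cen a1) = S.out C t" using m'(6)[symmetric] z aE t by simp
      ultimately show ?thesis using mixed[OF m'(1-4) _ t(1), of "inv\<^bsub>E\<^esub> z"] z t by auto
    next
      case t'
      have "C = D \<and> z \<in> S.out C ` carrier (tens C)"
        by (rule K.outer_conj_in_outer[OF t(1) t'(1) _ False z]) (use t t' in auto)
      then have CD: "C = D" and zC: "z \<in> S.out C ` carrier (tens C)" by auto
      have s: "s \<in> carrier (tens C)" using tens_expo_closed[OF t(1,2) \<alpha> t(3)] .
      have "conj_by E z a = a" by (rule S.L.conj_outer[OF t(1) zC]) (use t in auto)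
      then have "t' = t" using t t' CD inj_onD[OF S.out_inj[OF t(1)]] by metis
      then have "b' = b" using t t' CD by simp
      moreover have "conj_by E z b = b" by (rule S.L.conj_outer[OF t(1) zC]) (use t s in auto)
      ultimately show ?thesis by simp
    qed
  qed
qed

lemma base_pow_unique: "base_pow a \<alpha> b \<Longrightarrow> base_pow a \<alpha> b' \<Longrightarrow> b' = b"
  using base_pow_conj[of a \<alpha> b "\<one>\<^bsub>E\<^esub>" b'] base_pow_closed[of a \<alpha> b] by simp

text \<open>A common name for the two kinds of subgroups on which all powers are prescribed, so that
  the axioms have to be verified only once.\<close>

definition piece :: "'u set \<Rightarrow> bool" where
  "piece K \<longleftrightarrow> (\<exists>g\<in>carrier G - {\<one>\<^bsub>G\<^esub>}. is_exp_module A G (centralizer G g) \<and> K = S.cen ` centralizer G g) \<or>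
     (\<exists>C\<in>\<C>. K = S.out C ` carrier (tens C))"

lemma piece_cases:
  assumes "piece K"
  obtains (module) g where "g \<in> carrier G" "g \<noteq> \<one>\<^bsub>G\<^esub>" "is_exp_module A G (centralizer G g)" "K = S.cen ` centralizer G g"
  | (tensor) C where "C \<in> \<C>" "K = S.out C ` carrier (tens C)"
  using assms unfolding piece_def by blast

lemma base_pow_piece: "base_pow a \<alpha> b \<Longrightarrow> \<exists>K. piece K \<and> a \<in> K"
  unfolding base_pow_def piece_def by blast

text \<open>All vertex groups that carry an action are isomorphic images of \<open>A\<close>-modules.\<close>

definition piece_axioms :: "'u set \<Rightarrow> bool" where
  "piece_axioms K \<longleftrightarrow> subgroup K E \<and>
     (\<forall>a\<in>K. \<forall>\<alpha>\<in>carrier A. \<exists>b\<in>K. base_pow a \<alpha> b) \<and>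
     (\<forall>a\<in>K. \<forall>n::int. base_pow a ([n] \<cdot>\<^bsub>A\<^esub> \<one>\<^bsub>A\<^esub>) (a [^]\<^bsub>E\<^esub> n)) \<and>
     (\<forall>a\<in>K. \<forall>\<alpha> \<beta> b c. base_pow a \<alpha> b \<longrightarrow> base_pow a \<beta> c \<longrightarrow> base_pow a (\<alpha> \<oplus>\<^bsub>A\<^esub> \<beta>) (b \<otimes>\<^bsub>E\<^esub> c)) \<and>
     (\<forall>a\<in>K. \<forall>\<alpha> \<beta> b c. base_pow a \<alpha> b \<longrightarrow> base_pow b \<beta> c \<longrightarrow> base_pow a (\<alpha> \<otimes>\<^bsub>A\<^esub> \<beta>) c) \<and>
     (\<forall>a\<in>K. \<forall>a'\<in>K. \<forall>\<alpha> b b'. base_pow a \<alpha> b \<longrightarrow> base_pow a' \<alpha> b' \<longrightarrow> base_pow (a \<otimes>\<^bsub>E\<^esub> a') \<alpha> (b \<otimes>\<^bsub>E\<^esub> b'))"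

lemma piece_axioms_image:
  fixes M :: "('m, 'r) exp_struct"
  assumes M: "exp_group A M" "comm_group M" and f: "f \<in> hom M E"
    and pow: "\<And>m \<alpha> m'. m \<in> carrier M \<Longrightarrow> \<alpha> \<in> carrier A \<Longrightarrow> expo M m \<alpha> = Some m' \<Longrightarrow> base_pow (f m) \<alpha> (f m')"
  shows "piece_axioms (f ` carrier M)"
proof -
  interpret M: exp_group A M by fact
  interpret C: comm_group M by fact
  interpret f: group_hom M E f using f by (simp add: group_hom_def group_hom_axioms_def M.G.is_group E.is_group)
  have ex: "\<exists>m'. expo M m \<alpha> = Some m' \<and> m' \<in> carrier M" if "m \<in> carrier M" "\<alpha> \<in> carrier A" for m \<alpha>
    using M.expo_total[OF that] M.expo_closed[OF that] by auto
  have inA: "\<alpha> \<in> carrier A" if "base_pow a \<alpha> b" for a \<alpha> b using that by (simp add: base_pow_def)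
  \<comment> \<open>By uniqueness of the prescribed powers, every one at \<open>f m\<close> comes
    from a power in \<open>M\<close>.\<close>
  have get: "\<exists>m'\<in>carrier M. expo M m \<alpha> = Some m' \<and> b = f m'" if "m \<in> carrier M" "base_pow (f m) \<alpha> b" for m \<alpha> b
    using ex[OF that(1) inA[OF that(2)]] pow[OF that(1) inA[OF that(2)]] base_pow_unique[OF _ that(2)] by metis
  show ?thesis
    unfolding piece_axioms_def
  proof (intro conjI ballI allI impI)
    show "subgroup (f ` carrier M) E" by (rule f.img_is_subgroup)
    fix a assume "a \<in> f ` carrier M"
    then obtain m where m: "m \<in> carrier M" "a = f m" by blast
    show "\<exists>b\<in>f ` carrier M. base_pow a \<alpha> b" if "\<alpha> \<in> carrier A" for \<alpha>
      using ex[OF m(1) that] pow[OF m(1) that] m by blast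
    show "base_pow a ([n] \<cdot>\<^bsub>A\<^esub> \<one>\<^bsub>A\<^esub>) (a [^]\<^bsub>E\<^esub> n)" for n :: int
      using pow[OF m(1) _ M.expo_int_total[OF m(1)], of n] m by (simp add: f.hom_int_pow)
    show "base_pow a (\<alpha> \<oplus>\<^bsub>A\<^esub> \<beta>) (b \<otimes>\<^bsub>E\<^esub> c)" if "base_pow a \<alpha> b" "base_pow a \<beta> c" for \<alpha> \<beta> b c
    proof -
      obtain m1 where 1: "m1 \<in> carrier M" "expo M m \<alpha> = Some m1" "b = f m1"
        using get[OF m(1) \<open>base_pow a \<alpha> b\<close>[unfolded m(2)]] by blast
      obtain m2 where 2: "m2 \<in> carrier M" "expo M m \<beta> = Some m2" "c = f m2"
        using get[OF m(1) \<open>base_pow a \<beta> c\<close>[unfolded m(2)]] by blast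
      show ?thesis using pow[OF m(1) _ M.expo_add[OF m(1) inA[OF that(1)] inA[OF that(2)] 1(2) 2(2)]] inA that 1 2 m by simp
    qed
    show "base_pow a (\<alpha> \<otimes>\<^bsub>A\<^esub> \<beta>) c" if "base_pow a \<alpha> b" "base_pow b \<beta> c" for \<alpha> \<beta> b c
    proof -
      obtain m1 where 1: "m1 \<in> carrier M" "expo M m \<alpha> = Some m1" "b = f m1"
        using get[OF m(1) \<open>base_pow a \<alpha> b\<close>[unfolded m(2)]] by blast
      obtain m2 where 2: "m2 \<in> carrier M" "expo M m1 \<beta> = Some m2" "c = f m2"
        using get[OF 1(1) \<open>base_pow b \<beta> c\<close>[unfolded 1(3)]] by blast
      show ?thesis using pow[OF m(1) _ M.expo_mult[OF m(1) inA[OF that(1)] inA[OF that(2)] 1(2) 2(2)]] inA that 2 m by simp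
    qed
    fix a' assume "a' \<in> f ` carrier M"
    then obtain m' where m': "m' \<in> carrier M" "a' = f m'" by blast
    show "base_pow (a \<otimes>\<^bsub>E\<^esub> a') \<alpha> (b \<otimes>\<^bsub>E\<^esub> b')" if "base_pow a \<alpha> b" "base_pow a' \<alpha> b'" for \<alpha> b b'
    proof -
      obtain m1 where 1: "m1 \<in> carrier M" "expo M m \<alpha> = Some m1" "b = f m1"
        using get[OF m(1) \<open>base_pow a \<alpha> b\<close>[unfolded m(2)]] by blast
      obtain m2 where 2: "m2 \<in> carrier M" "expo M m' \<alpha> = Some m2" "b' = f m2"
        using get[OF m'(1) \<open>base_pow a' \<alpha> b'\<close>[unfolded m'(2)]] by blast
      show ?thesis
        using pow[OF _ inA[OF that(1)] M.expo_commute[OF m(1) m'(1) inA[OF that(1)] C.m_comm[OF m(1) m'(1)] 1(2) 2(2)]] 1 2 m m' by simp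
    qed
  qed
qed

lemma piece_piece_axioms:
  assumes "piece K" shows "piece_axioms K"
  using assms
proof (cases rule: piece_cases)
  case (module g)
  let ?M = "sub_exp G (centralizer G g)"
  have "piece_axioms (S.cen ` carrier ?M)"
  proof (rule piece_axioms_image)
    show "exp_group A ?M" "comm_group ?M" using module(3) by (auto simp: is_exp_module_def)
    show "S.cen \<in> hom ?M E"
      by (rule homI) (simp_all add: S.cen_mult G.centralizerD(1))
    show "base_pow (S.cen m) \<alpha> (S.cen m')" if "m \<in> carrier ?M" "\<alpha> \<in> carrier A" "expo ?M m \<alpha> = Some m'" for m \<alpha> m'
      using that module expo_sub_centralizer[OF module(1,2)] unfolding base_pow_def by auto
  qed
  then show ?thesis using module by simp
next
  case (tensor C)
  interpret t: tensor_data A "sub_exp G C" using tensor_data_\<C>[OF tensor(1)] .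
  have "piece_axioms (S.out C ` carrier (tens C))"
  proof (rule piece_axioms_image)
    show "exp_group A (tens C)" "comm_group (tens C)" "S.out C \<in> hom (tens C) E"
      using tensor exp_group_tens t.T.comm_group_axioms S.out_hom by auto
    show "base_pow (S.out C m) \<alpha> (S.out C m')" if "m \<in> carrier (tens C)" "\<alpha> \<in> carrier A" "expo (tens C) m \<alpha> = Some m'" for m \<alpha> m'
      using that tensor(1) unfolding base_pow_def by blast
  qed
  then show ?thesis using tensor by simp
qed

lemma piece_subgroup: "piece K \<Longrightarrow> subgroup K E"
  and piece_total [rule_format]: "piece K \<Longrightarrow> \<forall>a\<in>K. \<forall>\<alpha>\<in>carrier A. \<exists>b\<in>K. base_pow a \<alpha> b"
  and piece_int [rule_format]: "piece K \<Longrightarrow> \<forall>a\<in>K. \<forall>n::int. base_pow a ([n] \<cdot>\<^bsub>A\<^esub> \<one>\<^bsub>A\<^esub>) (a [^]\<^bsub>E\<^esub> n)"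
  and piece_add [rule_format]: "piece K \<Longrightarrow> \<forall>a\<in>K. \<forall>\<alpha> \<beta> b c. base_pow a \<alpha> b \<longrightarrow> base_pow a \<beta> c \<longrightarrow> base_pow a (\<alpha> \<oplus>\<^bsub>A\<^esub> \<beta>) (b \<otimes>\<^bsub>E\<^esub> c)"
  and piece_mult [rule_format]: "piece K \<Longrightarrow> \<forall>a\<in>K. \<forall>\<alpha> \<beta> b c. base_pow a \<alpha> b \<longrightarrow> base_pow b \<beta> c \<longrightarrow> base_pow a (\<alpha> \<otimes>\<^bsub>A\<^esub> \<beta>) c"
  and piece_commute [rule_format]: "piece K \<Longrightarrow>
    \<forall>a\<in>K. \<forall>a'\<in>K. \<forall>\<alpha> b b'. base_pow a \<alpha> b \<longrightarrow> base_pow a' \<alpha> b' \<longrightarrow> base_pow (a \<otimes>\<^bsub>E\<^esub> a') \<alpha> (b \<otimes>\<^bsub>E\<^esub> b')"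
  by (drule piece_piece_axioms, unfold piece_axioms_def, elim conjE, assumption)+


lemma piece_closed: "piece K \<Longrightarrow> a \<in> K \<Longrightarrow> a \<in> carrier E"
  using piece_subgroup subgroup.mem_carrier by fast

text \<open>For a module, no conjugate of \<open>a\<close> meets an outer group, so the centralizer
  stays inside \<open>G\<close>, where it is known.\<close>

lemma piece_centralizer:
  assumes "piece K" "a \<in> K" "a \<noteq> \<one>\<^bsub>E\<^esub>" shows "centralizer E a = K"
  using assms(1)
proof (cases rule: piece_cases)
  case (module g)
  then obtain a0 where a0: "a0 \<in> centralizer G g" "a = S.cen a0" using assms by blast
  have a0G: "a0 \<in> carrier G" using a0(1) by (rule G.centralizerD)
  have n1: "a0 \<noteq> \<one>\<^bsub>G\<^esub>" using a0 assms by auto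
  have "centralizer G a0 = centralizer G g"
    using G.commutation_transitive_centralizer_eq[OF ct module(1,2) a0(1) n1] .
  have "conj_by E h a \<notin> S.out C ` carrier (tens C)" if "C \<in> \<C>" "h \<in> carrier E" for C h
    using K.central_conj_not_in_outer[of a h C] module_not_conj_outer[OF module(1-3) a0(1) n1] that a0 a0G assms by blast
  then have sub: "centralizer E a \<subseteq> S.cen ` carrier G" using K.centralizer_central[of a] a0 a0G assms by blast
  show ?thesis
  proof
    show "centralizer E a \<subseteq> K"
    proof
      fix x assume x: "x \<in> centralizer E a"
      then obtain x0 where x0: "x = S.cen x0" "x0 \<in> carrier G" using sub by blast
      have "S.cen (x0 \<otimes>\<^bsub>G\<^esub> a0) = S.cen (a0 \<otimes>\<^bsub>G\<^esub> x0)"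
        using E.centralizerD(2)[OF x] x0 a0 a0G by (simp add: S.cen_mult)
      then have "x0 \<in> centralizer G a0" using x0 a0G by (auto simp: cen_eq_iff intro!: G.centralizerI)
      then show "x \<in> K" using x0 module(4) \<open>centralizer G a0 = centralizer G g\<close> by blast
    qed
    show "K \<subseteq> centralizer E a"
    proof
      fix x assume "x \<in> K"
      then obtain x0 where x0: "x = S.cen x0" "x0 \<in> centralizer G a0"
        using module(4) \<open>centralizer G a0 = centralizer G g\<close> by blast
      note xd = G.centralizerD[OF x0(2)]
      have "x \<otimes>\<^bsub>E\<^esub> a = a \<otimes>\<^bsub>E\<^esub> x" using S.cen_mult[OF xd(1) a0G] S.cen_mult[OF a0G xd(1)] xd(2) x0 a0 by simp
      then show "x \<in> centralizer E a" using x0 xd by (intro E.centralizerI) auto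
    qed
  qed
next
  case (tensor C)
  then show ?thesis using K.centralizer_outer[of C a] assms by simp
qed

lemma piece_exists: "\<exists>K. piece K"
proof -
  obtain g where g: "g \<in> carrier G" "g \<noteq> \<one>\<^bsub>G\<^esub>"
    using nonabelian G.group_comm_groupI by (metis G.l_one G.r_one)
  show ?thesis
  proof (cases "is_exp_module A G (centralizer G g)")
    case True
    then show ?thesis using g unfolding piece_def by blast
  next
    case False
    then obtain D where "D \<in> \<C>" using condition_S g unfolding condition_S_def centralizers_def by blast
    then show ?thesis unfolding piece_def by blast
  qed
qed

text \<open>Here the completeness clause of condition (S) is used: a centralizer that is not a
  module has a conjugate in \<open>\<C>\<close>.\<close>

lemma central_conj_piece:
  assumes x: "x \<in> carrier G"
  shows "\<exists>K g. piece K \<and> g \<in> carrier G \<and> conj_by E (S.cen g) (S.cen x) \<in> K"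
proof (cases "x = \<one>\<^bsub>G\<^esub>")
  case True
  obtain K where "piece K" using piece_exists by blast
  then show ?thesis using True subgroup.one_closed[OF piece_subgroup] by (intro exI[of _ K] exI[of _ "\<one>\<^bsub>G\<^esub>"]) simp
next
  case False
  have xx: "x \<in> centralizer G x" using x by (rule G.centralizerI) simp
  show ?thesis
  proof (cases "is_exp_module A G (centralizer G x)")
    case True
    then have "piece (S.cen ` centralizer G x)" using x False unfolding piece_def by blast
    moreover have "conj_by E (S.cen \<one>\<^bsub>G\<^esub>) (S.cen x) \<in> S.cen ` centralizer G x" using xx x by simp
    ultimately show ?thesis by blast
  next
    case nm: False
    then obtain D where D: "D \<in> \<C>" "conjugate_in G (centralizer G x) D"
      using condition_S x False unfolding condition_S_def centralizers_def by blast
    then obtain g where g: "g \<in> carrier G" "D = conj_by G g ` centralizer G x" by (auto simp: conjugate_in_def)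
    then have "conj_by G g x \<in> D" using xx by blast
    then have "S.cen (conj_by G g x) \<in> S.out D ` carrier (tens D)" using S.cen_edge_iff[OF D(1)] g x by simp
    then have "conj_by E (S.cen g) (S.cen x) \<in> S.out D ` carrier (tens D)" using g x by (simp add: cen_conj)
    then show ?thesis using D g unfolding piece_def by blast
  qed
qed

text \<open>For this reason elliptic elements receive all powers, and the others only the integer
  ones.\<close>

lemma elliptic_iff_piece:
  assumes x: "x \<in> carrier E"
  shows "K.elliptic x \<longleftrightarrow> (\<exists>K z a. piece K \<and> z \<in> carrier E \<and> a \<in> K \<and> x = conj_by E z a)"
proof
  assume "K.elliptic x"
  then obtain y where y: "y \<in> carrier E" "conj_by E y x \<in> S.cen ` carrier G \<or> (\<exists>C\<in>\<C>. conj_by E y x \<in> S.out C ` carrier (tens C))"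
    by (auto simp: K.elliptic_def)
  have "\<exists>K w. piece K \<and> w \<in> carrier E \<and> conj_by E w x \<in> K"
    using y(2)
  proof
    assume "conj_by E y x \<in> S.cen ` carrier G"
    then obtain x0 where x0: "conj_by E y x = S.cen x0" "x0 \<in> carrier G" by blast
    from central_conj_piece[OF x0(2)] obtain K g where *: "piece K" "g \<in> carrier G" "conj_by E (S.cen g) (S.cen x0) \<in> K" by blast
    then have "conj_by E (y \<otimes>\<^bsub>E\<^esub> S.cen g) x \<in> K" using x0 y x by (simp add: E.conj_by_conj_by[symmetric])
    then show ?thesis using * y by (intro exI[of _ K] exI[of _ "y \<otimes>\<^bsub>E\<^esub> S.cen g"]) simp
  next
    assume "\<exists>C\<in>\<C>. conj_by E y x \<in> S.out C ` carrier (tens C)"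
    then show ?thesis using y(1) unfolding piece_def by blast
  qed
  then obtain K w where *: "piece K" "w \<in> carrier E" "conj_by E w x \<in> K" by blast
  moreover have "x = conj_by E (inv\<^bsub>E\<^esub> w) (conj_by E w x)" using * x by simp
  ultimately show "\<exists>K z a. piece K \<and> z \<in> carrier E \<and> a \<in> K \<and> x = conj_by E z a" by blast
next
  assume "\<exists>K z a. piece K \<and> z \<in> carrier E \<and> a \<in> K \<and> x = conj_by E z a"
  then obtain K z a where *: "piece K" "z \<in> carrier E" "a \<in> K" "x = conj_by E z a" by blast
  have aE: "a \<in> carrier E" using piece_closed * by blast
  have "a \<in> S.cen ` carrier G \<or> (\<exists>C\<in>\<C>. a \<in> S.out C ` carrier (tens C))"
    using *(1,3) by (cases rule: piece_cases) (auto dest: G.centralizerD(1))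
  moreover have "conj_by E (inv\<^bsub>E\<^esub> z) x = a" using * aE by simp
  ultimately show "K.elliptic x" using x * by (auto simp: K.elliptic_def)
qed

lemma ext_pow_elliptic:
  assumes K: "piece K" "a \<in> K" and z: "z \<in> carrier E" and \<alpha>: "\<alpha> \<in> carrier A"
  shows "ext_pow (conj_by E z a) \<alpha> y \<longleftrightarrow> (\<exists>b. base_pow a \<alpha> b \<and> y = conj_by E z b)"
proof
  have aE: "a \<in> carrier E" using piece_closed K by blast
  assume "ext_pow (conj_by E z a) \<alpha> y"
  then show "\<exists>b. base_pow a \<alpha> b \<and> y = conj_by E z b"
    unfolding ext_pow_def
  proof (elim disjE exE conjE)
    fix z' a' b' assume *: "z' \<in> carrier E" "base_pow a' \<alpha> b'" "conj_by E z a = conj_by E z' a'" "y = conj_by E z' b'"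
    obtain b where b: "base_pow a \<alpha> b" using piece_total[OF K \<alpha>] by blast
    have cl: "a' \<in> carrier E" "b' \<in> carrier E" "b \<in> carrier E" using base_pow_closed * b by auto
    have "conj_by E (z \<otimes>\<^bsub>E\<^esub> inv\<^bsub>E\<^esub> z') a = a'"
      using *(1,3) z aE cl by (simp add: E.conj_by_conj_by[symmetric])
    then have "b' = conj_by E (z \<otimes>\<^bsub>E\<^esub> inv\<^bsub>E\<^esub> z') b" using base_pow_conj[OF b] *(1,2) z by simp
    then have "y = conj_by E z b" using *(1,4) z cl by (simp add: E.conj_by_conj_by[symmetric])
    then show ?thesis using b by blast
  next
    \<comment> \<open>The rule for integer powers may also apply to an elliptic element; it agrees
      with the action on the piece.\<close>
    fix n :: int assume "\<alpha> = [n] \<cdot>\<^bsub>A\<^esub> \<one>\<^bsub>A\<^esub>" "y = conj_by E z a [^]\<^bsub>E\<^esub> n"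
    then have "base_pow a \<alpha> (a [^]\<^bsub>E\<^esub> n)" "y = conj_by E z (a [^]\<^bsub>E\<^esub> n)"
      using piece_int[OF K, of n] z aE by (auto simp: E.conj_by_int_pow)
    then show ?thesis by blast
  qed
next
  assume "\<exists>b. base_pow a \<alpha> b \<and> y = conj_by E z b"
  then show "ext_pow (conj_by E z a) \<alpha> y" using z unfolding ext_pow_def by blast
qed

lemma ext_pow_not_elliptic:
  assumes "x \<in> carrier E" "\<not> K.elliptic x"
  shows "ext_pow x \<alpha> y \<longleftrightarrow> (\<exists>n::int. \<alpha> = [n] \<cdot>\<^bsub>A\<^esub> \<one>\<^bsub>A\<^esub> \<and> y = x [^]\<^bsub>E\<^esub> n)"
  using assms base_pow_piece unfolding ext_pow_def elliptic_iff_piece[OF assms(1)] by blast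

lemma ellipticE:
  assumes "K.elliptic x" obtains K z a where "piece K" "z \<in> carrier E" "a \<in> K" "a \<in> carrier E" "x = conj_by E z a"
  using elliptic_iff_piece[of x] assms piece_closed unfolding K.elliptic_def by metis

lemma elliptic_one: "K.elliptic \<one>\<^bsub>E\<^esub>"
proof -
  have "conj_by E \<one>\<^bsub>E\<^esub> \<one>\<^bsub>E\<^esub> \<in> S.cen ` carrier G" using S.cen_one[symmetric] by (metis E.conj_by_one E.one_closed G.one_closed imageI)
  then show ?thesis unfolding K.elliptic_def using E.one_closed by blast
qed

lemma elliptic_commute:
  assumes x: "K.elliptic x" "x \<noteq> \<one>\<^bsub>E\<^esub>" and y: "y \<in> centralizer E x"
  obtains K z a b where "piece K" "z \<in> carrier E" "a \<in> K" "b \<in> K" "x = conj_by E z a" "y = conj_by E z b"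
proof -
  obtain K z a where *: "piece K" "z \<in> carrier E" "a \<in> K" "a \<in> carrier E" "x = conj_by E z a" using x by (elim ellipticE)
  then have "a \<noteq> \<one>\<^bsub>E\<^esub>" using x by auto
  then have "centralizer E x = conj_by E z ` K" using piece_centralizer * E.centralizer_conj_by by metis
  then show ?thesis using y * that by blast
qed

lemma elliptic_centralizer:
  assumes "K.elliptic x" "x \<noteq> \<one>\<^bsub>E\<^esub>" "y \<in> centralizer E x" shows "K.elliptic y"
proof -
  obtain K z a b where *: "piece K" "z \<in> carrier E" "b \<in> K" "y = conj_by E z b"
    using elliptic_commute[OF assms] by metis
  then show ?thesis using elliptic_iff_piece E.centralizerD(1)[OF assms(3)] by blast
qed

section \<open>The axioms of a partial A-group\<close>

lemma ext_pow_unique: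
  assumes "x \<in> carrier E" "\<alpha> \<in> carrier A" "ext_pow x \<alpha> y" "ext_pow x \<alpha> y'" shows "y = y'"
proof (cases "K.elliptic x")
  case True
  then obtain K z a where *: "piece K" "z \<in> carrier E" "a \<in> K" "x = conj_by E z a" by (elim ellipticE)
  then obtain b b' where "base_pow a \<alpha> b" "y = conj_by E z b" "base_pow a \<alpha> b'" "y' = conj_by E z b'"
    using ext_pow_elliptic[OF *(1,3,2) assms(2)] assms(3,4) by metis
  then show ?thesis using base_pow_unique by metis
next
  case False
  then show ?thesis using ext_pow_not_elliptic[OF assms(1)] assms(3,4) int_inj by metis
qed

lemma ext_pow_elliptic_total:
  assumes "K.elliptic x" "\<alpha> \<in> carrier A" shows "\<exists>y. ext_pow x \<alpha> y"
proof -
  obtain K z a where *: "piece K" "z \<in> carrier E" "a \<in> K" "x = conj_by E z a" using assms(1) by (elim ellipticE)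
  moreover from * obtain b where "base_pow a \<alpha> b"
    using piece_total[OF *(1,3) assms(2)] by blast
  ultimately show ?thesis using ext_pow_elliptic[OF *(1,3,2) assms(2)] by blast
qed

lemma ext_pow_closed: "ext_pow x \<alpha> y \<Longrightarrow> y \<in> carrier E"
  unfolding ext_pow_def using base_pow_closed by auto

lemma ext_pow_add:
  assumes x: "x \<in> carrier E" and \<alpha>: "\<alpha> \<in> carrier A" and \<beta>: "\<beta> \<in> carrier A" and y: "ext_pow x \<alpha> y" and w: "ext_pow x \<beta> w"
  shows "ext_pow x (\<alpha> \<oplus>\<^bsub>A\<^esub> \<beta>) (y \<otimes>\<^bsub>E\<^esub> w)"
proof (cases "K.elliptic x")
  case True
  then obtain K z a where *: "piece K" "z \<in> carrier E" "a \<in> K" "x = conj_by E z a" by (elim ellipticE)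
  obtain b where b: "base_pow a \<alpha> b" "y = conj_by E z b" using y ext_pow_elliptic[OF *(1,3,2) \<alpha>] * by blast
  obtain c where c: "base_pow a \<beta> c" "w = conj_by E z c" using w ext_pow_elliptic[OF *(1,3,2) \<beta>] * by blast
  have "base_pow a (\<alpha> \<oplus>\<^bsub>A\<^esub> \<beta>) (b \<otimes>\<^bsub>E\<^esub> c)" by (rule piece_add[OF *(1,3) b(1) c(1)])
  moreover have "y \<otimes>\<^bsub>E\<^esub> w = conj_by E z (b \<otimes>\<^bsub>E\<^esub> c)" using base_pow_closed b c * by (simp add: E.conj_by_mult)
  ultimately show ?thesis using ext_pow_elliptic[OF *(1,3,2)] \<alpha> \<beta> * by auto
next
  case False
  then obtain n m :: int where "\<alpha> = [n] \<cdot>\<^bsub>A\<^esub> \<one>\<^bsub>A\<^esub>" "y = x [^]\<^bsub>E\<^esub> n" "\<beta> = [m] \<cdot>\<^bsub>A\<^esub> \<one>\<^bsub>A\<^esub>" "w = x [^]\<^bsub>E\<^esub> m"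
    using ext_pow_not_elliptic[OF x] y w by blast
  moreover have "\<alpha> \<oplus>\<^bsub>A\<^esub> \<beta> = [(n + m)] \<cdot>\<^bsub>A\<^esub> \<one>\<^bsub>A\<^esub>" "y \<otimes>\<^bsub>E\<^esub> w = x [^]\<^bsub>E\<^esub> (n + m)"
    using calculation A.add.int_pow_mult[of "\<one>\<^bsub>A\<^esub>" n m] x by (simp_all add: E.int_pow_mult)
  ultimately show ?thesis using ext_pow_not_elliptic[OF x False] by blast
qed

lemma ext_pow_mult:
  assumes x: "x \<in> carrier E" and \<alpha>: "\<alpha> \<in> carrier A" and \<beta>: "\<beta> \<in> carrier A" and y: "ext_pow x \<alpha> y" and w: "ext_pow y \<beta> w"
  shows "ext_pow x (\<alpha> \<otimes>\<^bsub>A\<^esub> \<beta>) w"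
proof (cases "K.elliptic x")
  case True
  then obtain K z a where *: "piece K" "z \<in> carrier E" "a \<in> K" "x = conj_by E z a" by (elim ellipticE)
  obtain b where b: "base_pow a \<alpha> b" "y = conj_by E z b" using y ext_pow_elliptic[OF *(1,3,2) \<alpha>] * by blast
  have "b \<in> K" using piece_total[OF *(1,3) \<alpha>] base_pow_unique[OF b(1)] by blast
  then obtain c where c: "base_pow b \<beta> c" "w = conj_by E z c" using w ext_pow_elliptic[OF *(1) _ *(2) \<beta>] b by blast
  have "base_pow a (\<alpha> \<otimes>\<^bsub>A\<^esub> \<beta>) c" by (rule piece_mult[OF *(1,3) b(1) c(1)])
  then show ?thesis using ext_pow_elliptic[OF *(1,3,2)] \<alpha> \<beta> * c by auto
next
  case False
  then obtain n :: int where n: "\<alpha> = [n] \<cdot>\<^bsub>A\<^esub> \<one>\<^bsub>A\<^esub>" "y = x [^]\<^bsub>E\<^esub> n" using ext_pow_not_elliptic[OF x] y by blast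
  have yE: "y \<in> carrier E" using n x by simp
  have h: "S.L.hyperbolic x" using False K.elliptic_or_hyperbolic x by blast
  have hy: "S.L.hyperbolic y" if "n \<noteq> 0" using S.L.hyperbolic_int_pow[OF h that] n by simp
  have "\<exists>m::int. \<alpha> \<otimes>\<^bsub>A\<^esub> \<beta> = [(n * m)] \<cdot>\<^bsub>A\<^esub> \<one>\<^bsub>A\<^esub> \<and> w = x [^]\<^bsub>E\<^esub> (n * m)"
  proof (cases "n = 0")
    case True
    \<comment> \<open>The zeroth power of a hyperbolic element is the identity, which is elliptic
      and has powers with all exponents. They are trivial because 1^\<beta> = 1^(0 \<beta>) =
      1^0.\<close>
    then have "y = \<one>\<^bsub>E\<^esub>" "\<alpha> = \<zero>\<^bsub>A\<^esub>" using n by (simp_all add: add_pow_def)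
    obtain K where K: "piece K" using piece_exists by blast
    have one: "\<one>\<^bsub>E\<^esub> \<in> K" using subgroup.one_closed[OF piece_subgroup[OF K]] .
    obtain b where b: "base_pow \<one>\<^bsub>E\<^esub> \<beta> b" using piece_total[OF K one \<beta>] by blast
    have zero: "base_pow \<one>\<^bsub>E\<^esub> \<zero>\<^bsub>A\<^esub> \<one>\<^bsub>E\<^esub>" using piece_int[OF K one, of 0] by (simp add: add_pow_def)
    then have "base_pow \<one>\<^bsub>E\<^esub> (\<zero>\<^bsub>A\<^esub> \<otimes>\<^bsub>A\<^esub> \<beta>) b" using piece_mult[OF K one _ b] by blast
    then have "b = \<one>\<^bsub>E\<^esub>" using base_pow_unique[OF zero] \<beta> by simp
    then have "w = \<one>\<^bsub>E\<^esub>"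
      using ext_pow_elliptic[OF K one E.one_closed \<beta>, of w] w \<open>y = \<one>\<^bsub>E\<^esub>\<close> base_pow_unique[OF b]
      by (metis E.conj_by_one E.one_closed)
    then show ?thesis using True \<open>\<alpha> = \<zero>\<^bsub>A\<^esub>\<close> \<beta> by (intro exI[of _ 0]) (simp add: add_pow_def)
  next
    case False
    have "\<not> K.elliptic y" using hy[OF False] K.elliptic_not_hyperbolic by blast
    then obtain m :: int where m: "\<beta> = [m] \<cdot>\<^bsub>A\<^esub> \<one>\<^bsub>A\<^esub>" "w = y [^]\<^bsub>E\<^esub> m" using ext_pow_not_elliptic[OF yE] w by blast
    have "\<alpha> \<otimes>\<^bsub>A\<^esub> \<beta> = [n] \<cdot>\<^bsub>A\<^esub> \<beta>" using A.add_pow_ldistr_int[OF A.one_closed \<beta>, of n] \<beta> n by simp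
    also have "\<dots> = [(n * m)] \<cdot>\<^bsub>A\<^esub> \<one>\<^bsub>A\<^esub>" using m A.add.int_pow_pow[OF A.one_closed, of n m] by (simp add: mult.commute)
    finally show ?thesis using m n x by (auto simp: E.int_pow_pow)
  qed
  then show ?thesis using ext_pow_not_elliptic[OF x False] by blast
qed

lemma ext_pow_conj:
  assumes "x \<in> carrier E" "h \<in> carrier E" "ext_pow x \<alpha> y"
  shows "ext_pow (conj_by E h x) \<alpha> (conj_by E h y)"
  using assms(3) unfolding ext_pow_def
proof (elim disjE exE conjE)
  fix z a b assume *: "z \<in> carrier E" "base_pow a \<alpha> b" "x = conj_by E z a" "y = conj_by E z b"
  then have "conj_by E h x = conj_by E (z \<otimes>\<^bsub>E\<^esub> h) a" "conj_by E h y = conj_by E (z \<otimes>\<^bsub>E\<^esub> h) b"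
    using base_pow_closed assms(2) by (auto simp: E.conj_by_conj_by)
  then show "(\<exists>z a b. z \<in> carrier E \<and> base_pow a \<alpha> b \<and> conj_by E h x = conj_by E z a \<and> conj_by E h y = conj_by E z b) \<or>
    (\<exists>n::int. conj_by E h x \<in> carrier E \<and> \<alpha> = [n] \<cdot>\<^bsub>A\<^esub> \<one>\<^bsub>A\<^esub> \<and> conj_by E h y = conj_by E h x [^]\<^bsub>E\<^esub> n)"
    using * assms(2) E.m_closed by blast
qed (use assms in \<open>auto simp: E.conj_by_int_pow\<close>)

text \<open>As 1^0 = 1, the product law gives 1^\<alpha> = 1^(0 \<alpha>) = 1^0.\<close>

lemma ext_pow_one_base: "\<alpha> \<in> carrier A \<Longrightarrow> ext_pow \<one>\<^bsub>E\<^esub> \<alpha> \<one>\<^bsub>E\<^esub>"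
proof -
  assume \<alpha>: "\<alpha> \<in> carrier A"
  obtain y where y: "ext_pow \<one>\<^bsub>E\<^esub> \<alpha> y" using ext_pow_elliptic_total[OF elliptic_one \<alpha>] by blast
  have z: "ext_pow \<one>\<^bsub>E\<^esub> \<zero>\<^bsub>A\<^esub> \<one>\<^bsub>E\<^esub>" unfolding ext_pow_def by (auto simp: add_pow_def intro!: disjI2 exI[of _ 0])
  have "ext_pow \<one>\<^bsub>E\<^esub> (\<zero>\<^bsub>A\<^esub> \<otimes>\<^bsub>A\<^esub> \<alpha>) y" using ext_pow_mult[OF _ _ \<alpha> z y] by simp
  then have "y = \<one>\<^bsub>E\<^esub>" using ext_pow_unique[OF _ _ _ z] \<alpha> by simp
  then show ?thesis using y by simp
qed

text \<open>Commuting nontrivial elements are of the same kind. Elliptic ones lie in a common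
  conjugate of a piece. For hyperbolic ones, the two integers representing the same exponent
  coincide because Z embeds in the ring.\<close>

lemma ext_pow_commute:
  assumes x: "x \<in> carrier E" and y: "y \<in> carrier E" and \<alpha>: "\<alpha> \<in> carrier A" and xy: "x \<otimes>\<^bsub>E\<^esub> y = y \<otimes>\<^bsub>E\<^esub> x"
    and x': "ext_pow x \<alpha> x'" and y': "ext_pow y \<alpha> y'"
  shows "ext_pow (x \<otimes>\<^bsub>E\<^esub> y) \<alpha> (x' \<otimes>\<^bsub>E\<^esub> y')"
proof -
  note cl = ext_pow_closed[OF x'] ext_pow_closed[OF y']
  consider "x = \<one>\<^bsub>E\<^esub>" | "y = \<one>\<^bsub>E\<^esub>" | (e) "x \<noteq> \<one>\<^bsub>E\<^esub>" "y \<noteq> \<one>\<^bsub>E\<^esub>" "K.elliptic x" | (h) "x \<noteq> \<one>\<^bsub>E\<^esub>" "y \<noteq> \<one>\<^bsub>E\<^esub>" "\<not> K.elliptic x" by blast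
  then show ?thesis
  proof cases
    case 1
    then have "x' = \<one>\<^bsub>E\<^esub>" using ext_pow_unique[OF E.one_closed \<alpha> _ ext_pow_one_base[OF \<alpha>]] x' by simp
    then show ?thesis using 1 y y' cl by simp
  next
    case 2
    then have "y' = \<one>\<^bsub>E\<^esub>" using ext_pow_unique[OF E.one_closed \<alpha> _ ext_pow_one_base[OF \<alpha>]] y' by simp
    then show ?thesis using 2 x x' cl by simp
  next
    case e
    have "y \<in> centralizer E x" using y xy[symmetric] by (rule E.centralizerI)
    then obtain K z a b where *: "piece K" "z \<in> carrier E" "a \<in> K" "b \<in> K" "x = conj_by E z a" "y = conj_by E z b"
      using elliptic_commute[OF e(3,1)] by metis
    obtain a' where a': "base_pow a \<alpha> a'" "x' = conj_by E z a'" using x' ext_pow_elliptic[OF *(1,3,2) \<alpha>] * by blast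
    obtain b' where b': "base_pow b \<alpha> b'" "y' = conj_by E z b'" using y' ext_pow_elliptic[OF *(1,4,2) \<alpha>] * by blast
    have "base_pow (a \<otimes>\<^bsub>E\<^esub> b) \<alpha> (a' \<otimes>\<^bsub>E\<^esub> b')"
      by (rule piece_commute[OF *(1,3,4) a'(1) b'(1)])
    moreover have "x \<otimes>\<^bsub>E\<^esub> y = conj_by E z (a \<otimes>\<^bsub>E\<^esub> b)" "x' \<otimes>\<^bsub>E\<^esub> y' = conj_by E z (a' \<otimes>\<^bsub>E\<^esub> b')"
      using base_pow_closed a' b' * by (simp_all add: E.conj_by_mult)
    ultimately show ?thesis unfolding ext_pow_def using *(2) by blast
  next
    case h
    have "\<not> K.elliptic y"
    proof
      assume "K.elliptic y"
      moreover have "x \<in> centralizer E y" using x xy by (rule E.centralizerI)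
      ultimately show False using elliptic_centralizer h by blast
    qed
    then obtain n m :: int where nm: "\<alpha> = [n] \<cdot>\<^bsub>A\<^esub> \<one>\<^bsub>A\<^esub>" "x' = x [^]\<^bsub>E\<^esub> n" "\<alpha> = [m] \<cdot>\<^bsub>A\<^esub> \<one>\<^bsub>A\<^esub>" "y' = y [^]\<^bsub>E\<^esub> m"
      using ext_pow_not_elliptic x y h x' y' by blast
    then have "n = m" using int_inj by metis
    then have "x' \<otimes>\<^bsub>E\<^esub> y' = (x \<otimes>\<^bsub>E\<^esub> y) [^]\<^bsub>E\<^esub> n" using nm E.int_pow_mult_distrib[OF xy x y, of n] by simp
    then show ?thesis unfolding ext_pow_def using nm x y by blast
  qed
qed

lemma partial_exp_group_ext:
  assumes expo: "\<And>x \<alpha> z. x \<in> carrier E \<Longrightarrow> \<alpha> \<in> carrier A \<Longrightarrow> expo E x \<alpha> = Some z \<longleftrightarrow> ext_pow x \<alpha> z"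
  shows "partial_exp_group A E"
proof (rule partial_exp_groupI)
  show "ring A" by (rule A.ring_axioms)
  show "group E" by (rule E.is_group)
  have int: "ext_pow x ([n] \<cdot>\<^bsub>A\<^esub> \<one>\<^bsub>A\<^esub>) (x [^]\<^bsub>E\<^esub> n)" if "x \<in> carrier E" for x and n :: int
    using that unfolding ext_pow_def by blast
  fix g assume g: "g \<in> carrier E"
  show "x \<in> carrier E" if "\<alpha> \<in> carrier A" "expo E g \<alpha> = Some x" for \<alpha> x
    using that expo[OF g] ext_pow_closed by blast
  show "expo E g \<one>\<^bsub>A\<^esub> = Some g" using int[OF g, of 1] expo[OF g, of "\<one>\<^bsub>A\<^esub>"] g by simp
  show "expo E g \<zero>\<^bsub>A\<^esub> = Some \<one>\<^bsub>E\<^esub>" using int[OF g, of 0] expo[OF g, of "\<zero>\<^bsub>A\<^esub>"] by (simp add: add_pow_def)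
  show "expo E g (\<alpha> \<oplus>\<^bsub>A\<^esub> \<beta>) = Some (x \<otimes>\<^bsub>E\<^esub> y)"
    if "\<alpha> \<in> carrier A" "\<beta> \<in> carrier A" "expo E g \<alpha> = Some x" "expo E g \<beta> = Some y" for \<alpha> \<beta> x y
    using that ext_pow_add[OF g] by (simp add: expo g)
  show "expo E g (\<alpha> \<otimes>\<^bsub>A\<^esub> \<beta>) = Some y"
    if "\<alpha> \<in> carrier A" "\<beta> \<in> carrier A" "expo E g \<alpha> = Some x" "expo E x \<beta> = Some y" for \<alpha> \<beta> x y
  proof -
    have "ext_pow g \<alpha> x" using that expo[OF g] by blast
    moreover from this have "ext_pow x \<beta> y" using that expo ext_pow_closed by blast
    ultimately show ?thesis using that ext_pow_mult[OF g] by (simp add: expo g)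
  qed
  fix h assume h: "h \<in> carrier E"
  show "expo E (conj_by E h g) \<alpha> = map_option (conj_by E h) (expo E g \<alpha>)" if \<alpha>: "\<alpha> \<in> carrier A" for \<alpha>
  proof (cases "expo E g \<alpha>")
    case (Some y)
    then have "ext_pow (conj_by E h g) \<alpha> (conj_by E h y)" using ext_pow_conj[OF g h] expo[OF g \<alpha>] by blast
    then show ?thesis using Some expo[of "conj_by E h g" \<alpha>] \<alpha> g h by simp
  next
    case None
    have "expo E (conj_by E h g) \<alpha> = None"
    proof (rule ccontr)
      assume "\<not> ?thesis"
      then obtain y where "expo E (conj_by E h g) \<alpha> = Some y" by blast
      then have "ext_pow (conj_by E h g) \<alpha> y" using expo[of "conj_by E h g" \<alpha>] \<alpha> g h by simp
      then have "ext_pow (conj_by E (inv\<^bsub>E\<^esub> h) (conj_by E h g)) \<alpha> (conj_by E (inv\<^bsub>E\<^esub> h) y)"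
        by (intro ext_pow_conj) (use g h in auto)
      then have "ext_pow g \<alpha> (conj_by E (inv\<^bsub>E\<^esub> h) y)" using g h by simp
      then show False using expo[OF g \<alpha>] None by simp
    qed
    then show ?thesis using None by simp
  qed
  show "expo E (g \<otimes>\<^bsub>E\<^esub> h) \<alpha> = Some (x \<otimes>\<^bsub>E\<^esub> y)" if \<alpha>: "\<alpha> \<in> carrier A" and c: "g \<otimes>\<^bsub>E\<^esub> h = h \<otimes>\<^bsub>E\<^esub> g"
      and "expo E g \<alpha> = Some x" "expo E h \<alpha> = Some y" for \<alpha> x y
  proof -
    have "ext_pow (g \<otimes>\<^bsub>E\<^esub> h) \<alpha> (x \<otimes>\<^bsub>E\<^esub> y)"
      using that expo[OF g \<alpha>] expo[OF h \<alpha>] by (intro ext_pow_commute[OF g h \<alpha> c]) auto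
    then show ?thesis using expo[OF E.m_closed[OF g h] \<alpha>] by blast
  qed
next
  show "expo E \<one>\<^bsub>E\<^esub> \<alpha> = Some \<one>\<^bsub>E\<^esub>" if "\<alpha> \<in> carrier A" for \<alpha>
    using that ext_pow_one_base expo by simp
qed

end

section \<open>Extensions of centralizers as partial exponential groups\<close>

locale ext_exp = ext_step A G E \<C> \<theta>
  for A :: "('r, 'n) ring_scheme" and G :: "('g, 'r) exp_struct" and E :: "('u, 'r) exp_struct" and \<C> \<theta> +
  assumes expo_ext: "\<And>x \<alpha> z. x \<in> carrier E \<Longrightarrow> \<alpha> \<in> carrier A \<Longrightarrow> expo E x \<alpha> = Some z \<longleftrightarrow> ext_pow x \<alpha> z"
begin

lemma ct_exp_group_ext: "ct_exp_group A E"
  using partial_exp_group_ext[OF expo_ext] K.commutation_transitive_star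
  by (simp add: ct_exp_group_def ct_exp_group_axioms_def)

sublocale XE: ct_exp_group A E
  by (rule ct_exp_group_ext)

lemma nonabelian_ext: "\<not> comm_group E"
proof
  assume "comm_group E"
  then interpret C: comm_group E .
  have "x \<otimes>\<^bsub>G\<^esub> y = y \<otimes>\<^bsub>G\<^esub> x" if "x \<in> carrier G" "y \<in> carrier G" for x y
  proof -
    have "S.cen (x \<otimes>\<^bsub>G\<^esub> y) = S.cen (y \<otimes>\<^bsub>G\<^esub> x)"
      using S.cen_mult[OF that] S.cen_mult[OF that(2,1)] C.m_comm[of "S.cen x" "S.cen y"] that by simp
    then show ?thesis using cen_eq_iff that by simp
  qed
  then show False using nonabelian G.group_comm_groupI by blast
qed

lemma expo_elliptic_total: "K.elliptic x \<Longrightarrow> \<alpha> \<in> carrier A \<Longrightarrow> expo E x \<alpha> \<noteq> None"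
  using ext_pow_elliptic_total[of x \<alpha>] expo_ext[of x \<alpha>] by (auto simp: K.elliptic_def)

text \<open>A nontrivial elliptic element commutes only with elliptic elements, and these have all
  powers. After one step only infinite cyclic centralizers can lack powers.\<close>

lemma module_elliptic:
  assumes "K.elliptic v" "v \<noteq> \<one>\<^bsub>E\<^esub>" shows "is_exp_module A E (centralizer E v)"
proof -
  have "v \<in> carrier E" using assms(1) by (simp add: K.elliptic_def)
  then show ?thesis
    using XE.module_centralizer_iff[of v] assms elliptic_centralizer[OF assms] expo_elliptic_total by blast
qed

lemma hyperbolic_pow_inj:
  assumes "S.L.hyperbolic z" "z [^]\<^bsub>E\<^esub> (k::int) = z [^]\<^bsub>E\<^esub> l" shows "k = l"
proof (rule ccontr)
  assume "k \<noteq> l"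
  then have "S.L.hyperbolic (z [^]\<^bsub>E\<^esub> (k - l))" using S.L.hyperbolic_int_pow[OF assms(1)] by simp
  moreover have "z \<in> carrier E" using assms(1) by (simp add: S.L.hyperbolic_def)
  then have "z [^]\<^bsub>E\<^esub> (k - l) = \<one>\<^bsub>E\<^esub>" using assms(2) by (simp add: E.int_pow_diff)
  ultimately show False using S.L.hyperbolic_not_one by blast
qed

lemma hyperbolic_expo:
  assumes "S.L.hyperbolic z" "\<alpha> \<in> carrier A" "expo E z \<alpha> = Some y"
  shows "\<exists>n::int. \<alpha> = [n] \<cdot>\<^bsub>A\<^esub> \<one>\<^bsub>A\<^esub> \<and> y = z [^]\<^bsub>E\<^esub> n"
proof -
  have "z \<in> carrier E" using assms(1) by (simp add: S.L.hyperbolic_def)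
  moreover have "\<not> K.elliptic z" using assms(1) K.elliptic_not_hyperbolic by blast
  ultimately show ?thesis using expo_ext[of z \<alpha> y] ext_pow_not_elliptic[of z \<alpha> y] assms by blast
qed

text \<open>\<open>cyclic_tensor\<close> applies because nonzero powers of a hyperbolic element are
  hyperbolic and so have integer powers only.\<close>

lemma hyperbolic_tensor:
  assumes z: "S.L.hyperbolic z" "centralizer E z = range (\<lambda>k::int. z [^]\<^bsub>E\<^esub> k)"
  shows "\<exists>h\<in>hom (tensor A (sub_exp E (centralizer E z))) (add_monoid A).
      (\<forall>k::int. \<forall>\<alpha>\<in>carrier A. h (tensor_data.ts A (sub_exp E (centralizer E z)) (z [^]\<^bsub>E\<^esub> k) \<alpha>) = [k] \<cdot>\<^bsub>A\<^esub> \<alpha>) \<and>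
      (\<forall>X\<in>carrier (tensor A (sub_exp E (centralizer E z))). X = tensor_data.ts A (sub_exp E (centralizer E z)) z (h X))"
proof -
  let ?C = "sub_exp E (centralizer E z)"
  have zE: "z \<in> carrier E" and z1: "z \<noteq> \<one>\<^bsub>E\<^esub>" using z S.L.hyperbolic_not_one by (auto simp: S.L.hyperbolic_def)
  have zC: "z \<in> centralizer E z" by (rule E.centralizerI[OF zE]) simp
  have pow: "z [^]\<^bsub>?C\<^esub> (k::int) = z [^]\<^bsub>E\<^esub> k" for k
    by (rule sub_exp_int_pow[OF E.is_group E.subgroup_centralizer[OF zE] zC])
  have pow2: "x [^]\<^bsub>?C\<^esub> (k::int) = x [^]\<^bsub>E\<^esub> k" if "x \<in> centralizer E z" for k x
    by (rule sub_exp_int_pow[OF E.is_group E.subgroup_centralizer[OF zE] that])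
  have zk: "z [^]\<^bsub>E\<^esub> (k::int) \<in> centralizer E z" for k using z(2) by blast
  have "\<exists>h\<in>hom (tensor A ?C) (add_monoid A).
      (\<forall>k::int. \<forall>\<alpha>\<in>carrier A. h (tensor_data.ts A ?C (z [^]\<^bsub>?C\<^esub> k) \<alpha>) = [k] \<cdot>\<^bsub>A\<^esub> \<alpha>) \<and>
      (\<forall>X\<in>carrier (tensor A ?C). X = tensor_data.ts A ?C z (h X))"
  proof (rule cyclic_tensor)
    show "tensor_data A ?C" by (rule XE.tensor_data_centralizer[OF zE z1])
    show "z \<in> carrier ?C" using zC by simp
    show "carrier ?C = range (\<lambda>k::int. z [^]\<^bsub>?C\<^esub> k)" unfolding pow sub_exp_simps by (rule z(2))
    show "k = l" if "z [^]\<^bsub>?C\<^esub> k = z [^]\<^bsub>?C\<^esub> l" for k l :: int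
      using that hyperbolic_pow_inj[OF z(1)] by (simp add: pow)
    show "\<exists>n::int. \<alpha> = [n] \<cdot>\<^bsub>A\<^esub> \<one>\<^bsub>A\<^esub> \<and> y = (z [^]\<^bsub>?C\<^esub> k) [^]\<^bsub>?C\<^esub> n"
      if \<alpha>: "\<alpha> \<in> carrier A" and e: "expo ?C (z [^]\<^bsub>?C\<^esub> k) \<alpha> = Some y" and k: "k \<noteq> 0" for k :: int and \<alpha> y
    proof -
      have "expo E (z [^]\<^bsub>E\<^esub> k) \<alpha> = Some y"
        using e XE.expo_sub_centralizer[OF zE z1 zk[of k] \<alpha>] by (simp add: pow)
      then obtain n :: int where "\<alpha> = [n] \<cdot>\<^bsub>A\<^esub> \<one>\<^bsub>A\<^esub>" "y = (z [^]\<^bsub>E\<^esub> k) [^]\<^bsub>E\<^esub> n"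
        using hyperbolic_expo[OF S.L.hyperbolic_int_pow[OF z(1) k] \<alpha>] by blast
      then show ?thesis using pow2[OF zk[of k], of n] by (auto simp: pow)
    qed
    show "expo ?C \<one>\<^bsub>?C\<^esub> \<alpha> = Some \<one>\<^bsub>?C\<^esub>" if "\<alpha> \<in> carrier A" for \<alpha>
      using XE.expo_sub_centralizer[OF zE z1 zk[of 0] that] XE.one_expo[OF that] by simp
  qed
  then show ?thesis by (simp only: pow)
qed

section \<open>Maximal abelian subgroups of the extension\<close>

lemma maximal_abelian_ext_cases:
  assumes "maximal_abelian E M"
  obtains (elliptic) v where "v \<noteq> \<one>\<^bsub>E\<^esub>" "K.elliptic v" "M = centralizer E v"
  | (hyperbolic) z where "S.L.hyperbolic z" "M = centralizer E z" "centralizer E z = range (\<lambda>k::int. z [^]\<^bsub>E\<^esub> k)"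
proof -
  obtain v where v: "v \<in> carrier E" "v \<noteq> \<one>\<^bsub>E\<^esub>" "M = centralizer E v"
    using E.maximal_abelian_is_centralizer[OF assms nonabelian_ext XE.ct] by blast
  show ?thesis
  proof (cases "K.elliptic v")
    case True
    then show ?thesis using elliptic v by blast
  next
    case False
    then have h: "S.L.hyperbolic v" using K.elliptic_or_hyperbolic v by blast
    then obtain z where z: "z \<in> carrier E" "centralizer E v = range (\<lambda>k::int. z [^]\<^bsub>E\<^esub> k)"
      using K.hyperbolic_centralizer_cyclic by blast
    have "z \<in> centralizer E v" using z E.int_pow_1[OF z(1)] by (metis rangeI)
    moreover have "z \<noteq> \<one>\<^bsub>E\<^esub>"
    proof
      assume "z = \<one>\<^bsub>E\<^esub>"
      then have "centralizer E v = {\<one>\<^bsub>E\<^esub>}" using z(2) by (auto simp: E.int_pow_one)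
      moreover have "v \<in> centralizer E v" by (rule E.centralizerI[OF v(1)]) simp
      ultimately show False using v by blast
    qed
    ultimately have "S.L.hyperbolic z \<and> centralizer E z = centralizer E v" using K.hyperbolic_centralizer_eq[OF h] by blast
    then show ?thesis using hyperbolic[of z] v z by simp
  qed
qed

text \<open>A module is a retract of its tensor product. For an infinite cyclic centralizer, the
  image of z^k in the additive group of the ring is k, so injectivity is the embedding of Z into the
  ring.\<close>

lemma faithful_ext:
  assumes "maximal_abelian E M" shows "abelian_faithful A (sub_exp E M)"
  using assms
proof (cases rule: maximal_abelian_ext_cases)
  case (elliptic v)
  then show ?thesis using module_elliptic[OF elliptic(2,1)] exp_module_tensor(1) unfolding is_exp_module_def by blast
next
  case (hyperbolic z)
  let ?C = "sub_exp E (centralizer E z)"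
  have zE: "z \<in> carrier E" and z1: "z \<noteq> \<one>\<^bsub>E\<^esub>"
    using hyperbolic S.L.hyperbolic_not_one by (auto simp: S.L.hyperbolic_def)
  interpret t: tensor_data A ?C by (rule XE.tensor_data_centralizer[OF zE z1])
  obtain h where h: "\<And>(k::int) \<alpha>. \<alpha> \<in> carrier A \<Longrightarrow> h (t.ts (z [^]\<^bsub>E\<^esub> k) \<alpha>) = [k] \<cdot>\<^bsub>A\<^esub> \<alpha>"
    using hyperbolic_tensor[OF hyperbolic(1,3)] by blast
  have "inj_on (tensor_map A ?C) (centralizer E z)"
  proof (rule inj_onI)
    fix x y assume "x \<in> centralizer E z" "y \<in> centralizer E z" and eq: "tensor_map A ?C x = tensor_map A ?C y"
    then obtain k l :: int where kl: "x = z [^]\<^bsub>E\<^esub> k" "y = z [^]\<^bsub>E\<^esub> l" using hyperbolic(3) by auto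
    have "[k] \<cdot>\<^bsub>A\<^esub> \<one>\<^bsub>A\<^esub> = [l] \<cdot>\<^bsub>A\<^esub> \<one>\<^bsub>A\<^esub>"
      using h[of "\<one>\<^bsub>A\<^esub>" k] h[of "\<one>\<^bsub>A\<^esub>" l] eq kl by (simp add: t.tensor_map_eq)
    then show "x = y" using int_inj kl by metis
  qed
  then show ?thesis using hyperbolic by (simp add: abelian_faithful_def)
qed

lemma faithful_exp_group_ext: "faithful_exp_group A E"
  using ct_exp_group_ext faithful_ext by (simp add: faithful_exp_group_def faithful_exp_group_axioms_def)

text \<open>In the hyperbolic case the tensor product is embedded in the additive group of the ring,
  which is where elements of additive order 2 are excluded. In the elliptic case it is the
  centralizer itself.\<close>

lemma no_involutions_tensor_ext:
  assumes A: "no_involutions (add_monoid A)" and E: "no_involutions E" and M: "maximal_abelian E M"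
  shows "no_involutions (tensor A (sub_exp E M))"
  using M
proof (cases rule: maximal_abelian_ext_cases)
  case (elliptic v)
  have "M \<subseteq> carrier E" using elliptic E.centralizerD(1) by blast
  then have "no_involutions (sub_exp E M)" using E unfolding no_involutions_def by auto
  then show ?thesis
    using module_elliptic[OF elliptic(2,1)] exp_module_tensor(2) elliptic unfolding is_exp_module_def by blast
next
  case (hyperbolic z)
  let ?C = "sub_exp E (centralizer E z)"
  have zE: "z \<in> carrier E" and z1: "z \<noteq> \<one>\<^bsub>E\<^esub>"
    using hyperbolic S.L.hyperbolic_not_one by (auto simp: S.L.hyperbolic_def)
  have zC: "z \<in> centralizer E z" by (rule E.centralizerI[OF zE]) simp
  interpret t: tensor_data A ?C by (rule XE.tensor_data_centralizer[OF zE z1])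
  from hyperbolic_tensor[OF hyperbolic(1,3)]
  obtain h where h: "h \<in> hom t.T (add_monoid A)" and hX: "\<forall>X\<in>carrier t.T. X = t.ts z (h X)"
    by (elim bexE conjE) (rule that)
  have "no_involutions t.T"
    unfolding no_involutions_def
  proof (intro ballI impI)
    fix X assume X: "X \<in> carrier t.T" "X \<otimes>\<^bsub>t.T\<^esub> X = \<one>\<^bsub>t.T\<^esub>"
    have "h X \<in> carrier (add_monoid A)" by (rule hom_in_carrier[OF h X(1)])
    moreover have "h X \<otimes>\<^bsub>add_monoid A\<^esub> h X = \<one>\<^bsub>add_monoid A\<^esub>"
      using hom_mult[OF h X(1,1)] X(2) hom_one[OF h t.T.is_group A.add.is_group] by simp
    ultimately have "h X = \<zero>\<^bsub>A\<^esub>" using A unfolding no_involutions_def by fastforce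
    then have "t.ts z (h X) = \<one>\<^bsub>t.T\<^esub>" using t.ts_zero[of z] zC by simp
    then show "X = \<one>\<^bsub>t.T\<^esub>" using hX[rule_format, OF X(1)] by argo
  qed
  then show ?thesis using hyperbolic by simp
qed

lemma CSA_ext_of_no_involutions:
  assumes "no_involutions E" shows "CSA E"
  using E.CSA_I[OF nonabelian_ext XE.ct] K.commuting_conj_trivial_star[OF assms] by blast

lemma no_involutions_ext:
  assumes "no_involutions G" "\<And>C. C \<in> \<C> \<Longrightarrow> no_involutions (tens C)"
  shows "no_involutions E"
proof (rule K.no_involutions_star)
  show "g = \<one>\<^bsub>E\<^esub>" if g: "g \<in> S.cen ` carrier G" "g \<otimes>\<^bsub>E\<^esub> g = \<one>\<^bsub>E\<^esub>" for g
  proof -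
    obtain x where x: "x \<in> carrier G" "g = S.cen x" using g by blast
    then have "x \<otimes>\<^bsub>G\<^esub> x = \<one>\<^bsub>G\<^esub>" using g cen_eq_one_iff[of "x \<otimes>\<^bsub>G\<^esub> x"] by (simp add: S.cen_mult)
    then have "x = \<one>\<^bsub>G\<^esub>" using assms(1) x(1) unfolding no_involutions_def by blast
    then show ?thesis using x by simp
  qed
  show "t = \<one>\<^bsub>E\<^esub>" if C: "C \<in> \<C>" and t: "t \<in> S.out C ` carrier (tens C)" "t \<otimes>\<^bsub>E\<^esub> t = \<one>\<^bsub>E\<^esub>" for C t
  proof -
    interpret d: tensor_data A "sub_exp G C" by (rule tensor_data_\<C>[OF C])
    obtain x where x: "x \<in> carrier (tens C)" "t = S.out C x" using t by blast
    then have "S.out C (x \<otimes>\<^bsub>tens C\<^esub> x) = S.out C \<one>\<^bsub>tens C\<^esub>" using t C by (simp add: S.out_mult)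
    then have "x \<otimes>\<^bsub>tens C\<^esub> x = \<one>\<^bsub>tens C\<^esub>" by (rule inj_onD[OF S.out_inj[OF C]]) (use x in simp_all)
    then have "x = \<one>\<^bsub>tens C\<^esub>" using assms(2)[OF C] x unfolding no_involutions_def by blast
    then show ?thesis using x C by simp
  qed
qed

text \<open>If the ring contains only integers, x \<otimes> n is the image of x^n. So the tensor
  product of \<open>C\<close> is \<open>C\<close> itself and brings no new involutions.\<close>

lemma no_involutions_ext_of_integers:
  assumes G: "no_involutions G" and int: "\<And>\<alpha>. \<alpha> \<in> carrier A \<Longrightarrow> \<exists>n::int. \<alpha> = [n] \<cdot>\<^bsub>A\<^esub> \<one>\<^bsub>A\<^esub>"
  shows "no_involutions E"
proof (rule no_involutions_ext[OF G])
  fix C assume C: "C \<in> \<C>"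
  interpret t: tensor_data A "sub_exp G C" by (rule tensor_data_\<C>[OF C])
  interpret m: group_hom "sub_exp G C" "tens C" "tensor_map A (sub_exp G C)"
    using t.tensor_map_hom t.C.is_group t.T.is_group by (simp add: group_hom_def group_hom_axioms_def)
  have CG: "C \<subseteq> carrier G" using S.edge_closed[OF C] by blast
  have gen_ts: "t.ts x \<alpha> \<in> tensor_map A (sub_exp G C) ` C" if x: "x \<in> C" "\<alpha> \<in> carrier A" for x \<alpha>
  proof -
    obtain n :: int where n: "\<alpha> = [n] \<cdot>\<^bsub>A\<^esub> \<one>\<^bsub>A\<^esub>" using int[OF x(2)] by blast
    interpret a: group_hom "add_monoid A" "tens C" "\<lambda>\<alpha>. t.ts x \<alpha>"
      using x by unfold_locales (auto simp: hom_def t.ts_add)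
    have "t.ts x \<alpha> = tensor_map A (sub_exp G C) x [^]\<^bsub>tens C\<^esub> n"
      using a.hom_int_pow[of "\<one>\<^bsub>A\<^esub>" n] n by (simp add: add_pow_def t.tensor_map_eq)
    also have "\<dots> = tensor_map A (sub_exp G C) (x [^]\<^bsub>sub_exp G C\<^esub> n)"
      using m.hom_int_pow[of x n] x by simp
    finally show ?thesis using t.C.int_pow_closed[of x n] x by (metis image_eqI sub_exp_simps(1))
  qed
  have surj: "X \<in> tensor_map A (sub_exp G C) ` C" if "X \<in> carrier (tens C)" for X
    using that
  proof (induction rule: t.tensor_induct)
    case one
    then show ?case using m.hom_one t.C.one_closed by (metis image_eqI sub_exp_simps(1))
  next
    case (gen x \<alpha>)
    then show ?case using gen_ts by simp
  next
    case (diff X Y)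
    have "subgroup (tensor_map A (sub_exp G C) ` carrier (sub_exp G C)) (tens C)" by (rule m.img_is_subgroup)
    then show ?case using diff by (simp add: subgroup.m_closed subgroup.m_inv_closed)
  qed
  show "no_involutions (tens C)"
    unfolding no_involutions_def
  proof (intro ballI impI)
    fix X assume X: "X \<in> carrier (tens C)" "X \<otimes>\<^bsub>tens C\<^esub> X = \<one>\<^bsub>tens C\<^esub>"
    obtain x where x: "x \<in> C" "X = tensor_map A (sub_exp G C) x" using surj[OF X(1)] by blast
    have xx: "x \<otimes>\<^bsub>G\<^esub> x \<in> C" using subgroup.m_closed[OF S.subgroup_edge[OF C] x(1,1)] .
    have "tensor_map A (sub_exp G C) (x \<otimes>\<^bsub>G\<^esub> x) = tensor_map A (sub_exp G C) \<one>\<^bsub>G\<^esub>"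
      using m.hom_mult[of x x] X x m.hom_one by simp
    then have "x \<otimes>\<^bsub>G\<^esub> x = \<one>\<^bsub>G\<^esub>"
      by (rule inj_onD[OF S.edge_inj[OF C]]) (use xx subgroup.one_closed[OF S.subgroup_edge[OF C]] in simp_all)
    then have "x = \<one>\<^bsub>G\<^esub>" using G x CG unfolding no_involutions_def by blast
    then show "X = \<one>\<^bsub>tens C\<^esub>" using x m.hom_one by simp
  qed
qed

section \<open>Embedding, generation and the universal property\<close>

lemma cen_exp_hom: "S.cen \<in> exp_hom A G E"
  unfolding exp_hom_def
proof (intro CollectI conjI ballI allI impI S.cen_hom)
  fix g \<alpha> b assume g: "g \<in> carrier G" and \<alpha>: "\<alpha> \<in> carrier A" and b: "expo G g \<alpha> = Some b"
  have bG: "b \<in> carrier G" by (rule expo_closed[OF g \<alpha> b])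
  have gg: "g \<in> centralizer G g" by (rule G.centralizerI[OF g]) simp
  have "ext_pow (S.cen g) \<alpha> (S.cen b)"
  proof (cases "g = \<one>\<^bsub>G\<^esub>")
    case True
    then have "b = \<one>\<^bsub>G\<^esub>" using one_expo[OF \<alpha>] b by simp
    then show ?thesis using True ext_pow_one_base[OF \<alpha>] by simp
  next
    case g1: False
    show ?thesis
    proof (cases "is_exp_module A G (centralizer G g)")
      case True
      then have "base_pow (S.cen g) \<alpha> (S.cen b)" using g g1 gg \<alpha> b unfolding base_pow_def by blast
      moreover have "S.cen g = conj_by E \<one>\<^bsub>E\<^esub> (S.cen g)" "S.cen b = conj_by E \<one>\<^bsub>E\<^esub> (S.cen b)" using g bG by simp_all
      ultimately show ?thesis unfolding ext_pow_def using E.one_closed by blast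
    next
      case False
      \<comment> \<open>The centralizer of \<open>g\<close> is replaced by its conjugate in
        \<open>\<C>\<close>; the power is computed in the tensor product of the latter and
        conjugated back.\<close>
      then obtain D where D: "D \<in> \<C>" "conjugate_in G (centralizer G g) D"
        using condition_S g g1 unfolding condition_S_def centralizers_def by blast
      then obtain h where h: "h \<in> carrier G" "D = conj_by G h ` centralizer G g" by (auto simp: conjugate_in_def)
      interpret t: tensor_data A "sub_exp G D" by (rule tensor_data_\<C>[OF D(1)])
      have DC: "D = centralizer G (conj_by G h g)" using G.centralizer_conj_by[OF h(1) g] h by simp
      have hg: "conj_by G h g \<in> carrier G" "conj_by G h g \<noteq> \<one>\<^bsub>G\<^esub>" using h g g1 by simp_all
      have d: "conj_by G h g \<in> D" using h gg by blast
      have e: "expo G (conj_by G h g) \<alpha> = Some (conj_by G h b)" using expo_conj[OF g h(1) \<alpha>] b by simp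
      have hb: "conj_by G h b \<in> D" using expo_centralizer[OF hg d[unfolded DC] \<alpha> e] DC by simp
      have "expo (sub_exp G D) (conj_by G h g) \<alpha> = Some (conj_by G h b)"
        using expo_sub_centralizer[OF hg d[unfolded DC] \<alpha>] e DC by simp
      then have "expo (tens D) (tensor_map A (sub_exp G D) (conj_by G h g)) \<alpha> = Some (tensor_map A (sub_exp G D) (conj_by G h b))"
        using d \<alpha> by (intro t.tensor_map_expo) simp_all
      then have "base_pow (S.cen (conj_by G h g)) \<alpha> (S.cen (conj_by G h b))"
        unfolding base_pow_def using \<alpha> D d hb S.cen_edge[OF D(1)] S.edge_map_closed[OF D(1) d] by metis
      moreover have "S.cen g = conj_by E (S.cen (inv\<^bsub>G\<^esub> h)) (S.cen (conj_by G h g))"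
        "S.cen b = conj_by E (S.cen (inv\<^bsub>G\<^esub> h)) (S.cen (conj_by G h b))"
        using h g bG by (simp_all add: cen_conj[symmetric])
      moreover have "S.cen (inv\<^bsub>G\<^esub> h) \<in> carrier E" using h by simp
      ultimately show ?thesis unfolding ext_pow_def by blast
    qed
  qed
  then show "expo E (S.cen g) \<alpha> = Some (S.cen b)" using expo_ext g \<alpha> by simp
qed

text \<open>This makes the union of the chain total: a stage may lack powers, but never of elements
  of the preceding stage.\<close>

lemma cen_expo_total: "g \<in> carrier G \<Longrightarrow> \<alpha> \<in> carrier A \<Longrightarrow> expo E (S.cen g) \<alpha> \<noteq> None"
proof (rule expo_elliptic_total)
  assume g: "g \<in> carrier G"
  then have "conj_by E \<one>\<^bsub>E\<^esub> (S.cen g) \<in> S.cen ` carrier G" by simp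
  then show "K.elliptic (S.cen g)" using g unfolding K.elliptic_def by (metis E.one_closed S.cen_closed)
qed

lemma expo_out:
  assumes "C \<in> \<C>" "t \<in> carrier (tens C)" "\<alpha> \<in> carrier A" "expo (tens C) t \<alpha> = Some s"
  shows "expo E (S.out C t) \<alpha> = Some (S.out C s)"
proof -
  have "base_pow (S.out C t) \<alpha> (S.out C s)" using assms unfolding base_pow_def by blast
  moreover have "S.out C t = conj_by E \<one>\<^bsub>E\<^esub> (S.out C t)" "S.out C s = conj_by E \<one>\<^bsub>E\<^esub> (S.out C s)"
    using assms tens_expo_closed[OF assms] by simp_all
  ultimately have "ext_pow (S.out C t) \<alpha> (S.out C s)" unfolding ext_pow_def using E.one_closed by blast
  then show ?thesis using expo_ext assms by simp
qed

text \<open>x \<otimes> \<alpha> is the power of \<open>x\<close> with exponent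
  \<open>\<alpha>\<close>, and these elements generate the outer groups.\<close>

lemma carrier_generated: "carrier E \<subseteq> exp_generate A E (S.cen ` carrier G)"
proof
  let ?X = "exp_generate A E (S.cen ` carrier G)"
  have out: "S.out C t \<in> ?X" if C: "C \<in> \<C>" and t: "t \<in> carrier (tens C)" for C t
  proof -
    interpret d: tensor_data A "sub_exp G C" by (rule tensor_data_\<C>[OF C])
    show ?thesis using t
    proof (induction rule: d.tensor_induct)
      case one
      then show ?case using C by (simp add: exp_generate.one)
    next
      case (gen x \<alpha>)
      have xC: "x \<in> C" using gen by simp
      have "S.cen x \<in> ?X" using S.edge_closed[OF C xC] by (intro exp_generate.incl) simp
      moreover have "expo E (S.cen x) \<alpha> = Some (S.out C (d.ts x \<alpha>))"
        unfolding S.cen_edge[OF C xC]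
        by (rule expo_out[OF C S.edge_map_closed[OF C xC] gen(2) d.expo_tensor_map[OF gen]])
      ultimately show ?case by (rule exp_generate.expo[OF _ gen(2)])
    next
      case (diff X Y)
      then show ?case using C by (simp add: S.out_mult S.out_inv exp_generate.mult exp_generate.inv)
    qed
  qed
  fix x assume "x \<in> carrier E"
  then show "x \<in> ?X"
  proof (induction rule: S.copy_induct)
    case one
    then show ?case by (rule exp_generate.one)
  next
    case (central g x)
    then show ?case by (intro exp_generate.mult[OF exp_generate.incl[OF imageI]])
  next
    case (outer C t x)
    then show ?case by (intro exp_generate.mult[OF out])
  qed
qed

text \<open>The universal property of the star reduces the task to extending \<open>f\<close> from
  each \<open>C\<close> to its tensor product. The lifting property of the tensor product asks for
  an abelian target, while \<open>Q\<close> is arbitrary, so a suitable abelian subgroup of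
  \<open>Q\<close> has to be found first.\<close>

lemma ext_universal:
  fixes Q :: "('q, 'r) exp_struct"
  assumes Q: "exp_group A Q" and f: "f \<in> exp_hom A G Q"
  shows "\<exists>F\<in>exp_hom A E Q. \<forall>g\<in>carrier G. F (S.cen g) = f g"
proof -
  interpret Q: exp_group A Q by fact
  have fh: "f \<in> hom G Q" and fe: "\<And>g \<alpha> x. g \<in> carrier G \<Longrightarrow> \<alpha> \<in> carrier A \<Longrightarrow> expo G g \<alpha> = Some x \<Longrightarrow> expo Q (f g) \<alpha> = Some (f x)"
    using f by (auto simp: exp_hom_def)
  have fc: "f g \<in> carrier Q" if "g \<in> carrier G" for g using hom_in_carrier[OF fh that] .
  define p where "p q \<alpha> = the (expo Q q \<alpha>)" for q \<alpha>
  have p: "expo Q q \<alpha> = Some (p q \<alpha>)" "p q \<alpha> \<in> carrier Q" if "q \<in> carrier Q" "\<alpha> \<in> carrier A" for q \<alpha>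
    using Q.expo_total[OF that] Q.expo_closed[OF that] by (auto simp: p_def)
  have pcom: "p q \<alpha> \<otimes>\<^bsub>Q\<^esub> r = r \<otimes>\<^bsub>Q\<^esub> p q \<alpha>" if "q \<in> carrier Q" "r \<in> carrier Q" "\<alpha> \<in> carrier A" "q \<otimes>\<^bsub>Q\<^esub> r = r \<otimes>\<^bsub>Q\<^esub> q" for q r \<alpha>
    using Q.expo_commutes[OF that(1,2,3) p(1)[OF that(1,3)] that(4)[symmetric]] by (rule HOL.sym)
  have outer: "\<exists>h\<in>hom (tens C) Q. (\<forall>c\<in>C. h (tensor_map A (sub_exp G C) c) = f c) \<and>
      (\<forall>t\<in>carrier (tens C). \<forall>\<alpha>\<in>carrier A. \<forall>s. expo (tens C) t \<alpha> = Some s \<longrightarrow> expo Q (h t) \<alpha> = Some (h s))"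
    if C: "C \<in> \<C>" for C
  proof -
    interpret t: tensor_data A "sub_exp G C" by (rule tensor_data_\<C>[OF C])
    have CG: "c \<in> carrier G" if "c \<in> C" for c using S.edge_closed[OF C that] .
    have Cc: "f c \<otimes>\<^bsub>Q\<^esub> f d = f d \<otimes>\<^bsub>Q\<^esub> f c" if "c \<in> C" "d \<in> C" for c d
      using hom_mult[OF fh CG[OF that(1)] CG[OF that(2)]] hom_mult[OF fh CG[OF that(2)] CG[OF that(1)]]
        t.C.m_comm[of c d] that by simp
    \<comment> \<open>The elements to which the x \<otimes> \<alpha> have to be mapped. They commute
      because powers of commuting elements commute.\<close>
    define B where "B = {p (f c) \<alpha> | c \<alpha>. c \<in> C \<and> \<alpha> \<in> carrier A}"
    have BQ: "B \<subseteq> carrier Q" using p fc CG by (auto simp: B_def)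
    have Bc: "b \<otimes>\<^bsub>Q\<^esub> b' = b' \<otimes>\<^bsub>Q\<^esub> b" if b: "b \<in> B" and b': "b' \<in> B" for b b'
    proof -
      obtain c \<alpha> where c: "b = p (f c) \<alpha>" "c \<in> C" "\<alpha> \<in> carrier A" using b unfolding B_def by blast
      obtain d \<beta> where d: "b' = p (f d) \<beta>" "d \<in> C" "\<beta> \<in> carrier A" using b' unfolding B_def by blast
      note Q' = fc[OF CG[OF c(2)]] fc[OF CG[OF d(2)]]
      have "p (f d) \<beta> \<otimes>\<^bsub>Q\<^esub> f c = f c \<otimes>\<^bsub>Q\<^esub> p (f d) \<beta>" by (rule pcom[OF Q'(2,1) d(3) Cc[OF d(2) c(2)]])
      from pcom[OF Q'(1) p(2)[OF Q'(2) d(3)] c(3) this[symmetric]] show ?thesis using c d by simp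
    qed
    \<comment> \<open>The double centralizer of the commuting set \<open>B\<close> is an abelian subgroup containing \<open>B\<close>.\<close>
    define W where "W = {r \<in> carrier Q. \<forall>b\<in>B. r \<otimes>\<^bsub>Q\<^esub> b = b \<otimes>\<^bsub>Q\<^esub> r}"
    define Z where "Z = {q \<in> carrier Q. \<forall>r\<in>W. q \<otimes>\<^bsub>Q\<^esub> r = r \<otimes>\<^bsub>Q\<^esub> q}"
    have WQ: "W \<subseteq> carrier Q" and BW: "B \<subseteq> W" using BQ Bc unfolding W_def by blast+
    have Zsub: "subgroup Z Q"
    proof (rule Q.G.subgroupI)
      show "Z \<subseteq> carrier Q" unfolding Z_def by blast
      show "Z \<noteq> {}" using WQ unfolding Z_def by (auto intro!: exI[of _ "\<one>\<^bsub>Q\<^esub>"])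
      show "inv\<^bsub>Q\<^esub> a \<in> Z" if "a \<in> Z" for a
        unfolding Z_def
      proof (intro CollectI conjI ballI)
        have a: "a \<in> carrier Q" "\<And>r. r \<in> W \<Longrightarrow> a \<otimes>\<^bsub>Q\<^esub> r = r \<otimes>\<^bsub>Q\<^esub> a" using that unfolding Z_def by blast+
        show "inv\<^bsub>Q\<^esub> a \<in> carrier Q" using a by simp
        show "inv\<^bsub>Q\<^esub> a \<otimes>\<^bsub>Q\<^esub> r = r \<otimes>\<^bsub>Q\<^esub> inv\<^bsub>Q\<^esub> a" if "r \<in> W" for r
          by (rule Q.G.commute_inv[OF a(1) subsetD[OF WQ that] a(2)[OF that]])
      qed
      show "a \<otimes>\<^bsub>Q\<^esub> b \<in> Z" if "a \<in> Z" "b \<in> Z" for a b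
        unfolding Z_def
      proof (intro CollectI conjI ballI)
        have a: "a \<in> carrier Q" "\<And>r. r \<in> W \<Longrightarrow> a \<otimes>\<^bsub>Q\<^esub> r = r \<otimes>\<^bsub>Q\<^esub> a" using that(1) unfolding Z_def by blast+
        have b: "b \<in> carrier Q" "\<And>r. r \<in> W \<Longrightarrow> b \<otimes>\<^bsub>Q\<^esub> r = r \<otimes>\<^bsub>Q\<^esub> b" using that(2) unfolding Z_def by blast+
        show "a \<otimes>\<^bsub>Q\<^esub> b \<in> carrier Q" using a b by simp
        show "a \<otimes>\<^bsub>Q\<^esub> b \<otimes>\<^bsub>Q\<^esub> r = r \<otimes>\<^bsub>Q\<^esub> (a \<otimes>\<^bsub>Q\<^esub> b)" if "r \<in> W" for r
          by (rule Q.G.commute_mult[OF a(1) b(1) subsetD[OF WQ that] a(2)[OF that] b(2)[OF that]])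
      qed
    qed
    have BZ: "B \<subseteq> Z"
    proof
      fix b assume b: "b \<in> B"
      have "b \<otimes>\<^bsub>Q\<^esub> r = r \<otimes>\<^bsub>Q\<^esub> b" if r: "r \<in> W" for r
      proof (rule HOL.sym)
        show "r \<otimes>\<^bsub>Q\<^esub> b = b \<otimes>\<^bsub>Q\<^esub> r" using r b unfolding W_def by blast
      qed
      then show "b \<in> Z" using subsetD[OF BQ b] unfolding Z_def by blast
    qed
    have ZW: "Z \<subseteq> W" using BW unfolding Z_def W_def by blast
    have Zc: "a \<otimes>\<^bsub>Q\<^esub> b = b \<otimes>\<^bsub>Q\<^esub> a" if "a \<in> Z" "b \<in> Z" for a b
      using that(1) subsetD[OF ZW that(2)] unfolding Z_def by blast
    have Zcomm: "comm_group (Q\<lparr>carrier := Z\<rparr>)"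
      by (rule Q.G.abelian_subgroup_imp_comm_group[OF Zsub Zc])
    have "\<exists>h\<in>hom (tens C) (Q\<lparr>carrier := Z\<rparr>). \<forall>x\<in>carrier (sub_exp G C). \<forall>\<alpha>\<in>carrier A. h (t.ts x \<alpha>) = p (f x) \<alpha>"
    proof (rule t.tensor_lift[OF Zcomm])
      show "p (f x) \<alpha> \<in> carrier (Q\<lparr>carrier := Z\<rparr>)" if "x \<in> carrier (sub_exp G C)" "\<alpha> \<in> carrier A" for x \<alpha>
        using that BZ by (auto simp: B_def)
      show "p (f (x \<otimes>\<^bsub>sub_exp G C\<^esub> y)) \<alpha> = p (f x) \<alpha> \<otimes>\<^bsub>Q\<lparr>carrier := Z\<rparr>\<^esub> p (f y) \<alpha>"
        if xy: "x \<in> carrier (sub_exp G C)" "y \<in> carrier (sub_exp G C)" "\<alpha> \<in> carrier A" for x y \<alpha>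
      proof -
        have xC: "x \<in> C" "y \<in> C" using xy by simp_all
        note Q' = fc[OF CG[OF xC(1)]] fc[OF CG[OF xC(2)]]
        have "expo Q (f x \<otimes>\<^bsub>Q\<^esub> f y) \<alpha> = Some (p (f x) \<alpha> \<otimes>\<^bsub>Q\<^esub> p (f y) \<alpha>)"
          by (rule Q.expo_commute[OF Q' xy(3) Cc[OF xC] p(1)[OF Q'(1) xy(3)] p(1)[OF Q'(2) xy(3)]])
        then show ?thesis using hom_mult[OF fh CG[OF xC(1)] CG[OF xC(2)]] by (simp add: p_def[of "f x \<otimes>\<^bsub>Q\<^esub> f y"])
      qed
      show "p (f x) (\<alpha> \<oplus>\<^bsub>A\<^esub> \<beta>) = p (f x) \<alpha> \<otimes>\<^bsub>Q\<lparr>carrier := Z\<rparr>\<^esub> p (f x) \<beta>"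
        if xy: "x \<in> carrier (sub_exp G C)" "\<alpha> \<in> carrier A" "\<beta> \<in> carrier A" for x \<alpha> \<beta>
      proof -
        have Q': "f x \<in> carrier Q" using fc CG xy by simp
        show ?thesis using Q.expo_add[OF Q' xy(2,3) p(1)[OF Q' xy(2)] p(1)[OF Q' xy(3)]] by (simp add: p_def[of _ "\<alpha> \<oplus>\<^bsub>A\<^esub> \<beta>"])
      qed
      show "p (f y) \<beta> = p (f x) (\<alpha> \<otimes>\<^bsub>A\<^esub> \<beta>)"
        if xy: "x \<in> carrier (sub_exp G C)" "\<alpha> \<in> carrier A" "\<beta> \<in> carrier A" "expo (sub_exp G C) x \<alpha> = Some y" for x y \<alpha> \<beta>
      proof -
        have xG: "x \<in> carrier G" using CG xy by simp
        have e: "expo G x \<alpha> = Some y" using xy(4) by (auto simp: sub_exp_def split: option.splits if_splits)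
        have yG: "y \<in> carrier G" by (rule expo_closed[OF xG xy(2) e])
        show ?thesis
          using Q.expo_mult[OF fc[OF xG] xy(2,3) fe[OF xG xy(2) e] p(1)[OF fc[OF yG] xy(3)]] by (simp add: p_def[of _ "\<alpha> \<otimes>\<^bsub>A\<^esub> \<beta>"])
      qed
    qed
    then obtain h where h: "h \<in> hom (tens C) (Q\<lparr>carrier := Z\<rparr>)"
      "\<And>x \<alpha>. x \<in> C \<Longrightarrow> \<alpha> \<in> carrier A \<Longrightarrow> h (t.ts x \<alpha>) = p (f x) \<alpha>" by auto
    have hQ: "h \<in> hom (tens C) Q" using h(1) Zsub subgroup.subset by (fastforce simp: hom_def)
    have hZ: "h t \<in> Z" if "t \<in> carrier (tens C)" for t using hom_in_carrier[OF h(1) that] by simp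
    interpret h: group_hom "tens C" Q h using hQ t.T.is_group Q.G.is_group by (simp add: group_hom_def group_hom_axioms_def)
    interpret e: exp_group A "tens C" by (rule exp_group_tens[OF C])
    \<comment> \<open>The induction over the tensor product runs through quotients, so powers of
      inverses are needed.\<close>
    have pinv: "expo Q (inv\<^bsub>Q\<^esub> q) \<alpha> = Some (inv\<^bsub>Q\<^esub> (p q \<alpha>))" if "q \<in> carrier Q" "\<alpha> \<in> carrier A" for q \<alpha>
    proof -
      have "expo Q (q \<otimes>\<^bsub>Q\<^esub> inv\<^bsub>Q\<^esub> q) \<alpha> = Some (p q \<alpha> \<otimes>\<^bsub>Q\<^esub> p (inv\<^bsub>Q\<^esub> q) \<alpha>)"
        using that p by (intro Q.expo_commute) auto
      then have "p q \<alpha> \<otimes>\<^bsub>Q\<^esub> p (inv\<^bsub>Q\<^esub> q) \<alpha> = \<one>\<^bsub>Q\<^esub>" using that Q.one_expo by simp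
      then have "p (inv\<^bsub>Q\<^esub> q) \<alpha> = inv\<^bsub>Q\<^esub> (p q \<alpha>)"
        using that p(2) Q.G.inv_closed by (metis Q.G.inv_equality Q.G.inv_inv)
      then show ?thesis using p(1)[of "inv\<^bsub>Q\<^esub> q" \<alpha>] that by simp
    qed
    have he: "expo Q (h u) \<alpha> = Some (h (t.scal \<alpha> u))" if u: "u \<in> carrier (tens C)" and \<alpha>: "\<alpha> \<in> carrier A" for u \<alpha>
      using u
    proof (induction rule: t.tensor_induct)
      case one
      have "t.scal \<alpha> \<one>\<^bsub>tens C\<^esub> = \<one>\<^bsub>tens C\<^esub>" using e.one_expo[OF \<alpha>] by (simp add: t.expo_tensor)
      then show ?case using Q.one_expo[OF \<alpha>] by simp
    next
      case (gen x \<beta>)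
      then have xC: "x \<in> C" by simp
      have xQ: "f x \<in> carrier Q" using fc[OF CG[OF xC]] .
      have "expo Q (f x) (\<beta> \<otimes>\<^bsub>A\<^esub> \<alpha>) = Some (p (p (f x) \<beta>) \<alpha>)"
        by (rule Q.expo_mult[OF xQ gen(2) \<alpha> p(1)[OF xQ gen(2)] p(1)[OF p(2)[OF xQ gen(2)] \<alpha>]])
      then have "p (f x) (\<beta> \<otimes>\<^bsub>A\<^esub> \<alpha>) = p (p (f x) \<beta>) \<alpha>" by (simp add: p_def[of _ "\<beta> \<otimes>\<^bsub>A\<^esub> \<alpha>"])
      then show ?case using h(2)[OF xC gen(2)] h(2)[OF xC, of "\<beta> \<otimes>\<^bsub>A\<^esub> \<alpha>"] t.scal(2)[OF \<alpha> gen] gen \<alpha> p(1)[OF p(2)[OF xQ gen(2)] \<alpha>] by simp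
    next
      case (diff X Y)
      have XQ: "h X \<in> carrier Q" "h Y \<in> carrier Q" using diff by simp_all
      have "expo Q (h X \<otimes>\<^bsub>Q\<^esub> inv\<^bsub>Q\<^esub> (h Y)) \<alpha> = Some (h (t.scal \<alpha> X) \<otimes>\<^bsub>Q\<^esub> inv\<^bsub>Q\<^esub> (h (t.scal \<alpha> Y)))"
      proof (rule Q.expo_commute)
        show "h X \<otimes>\<^bsub>Q\<^esub> inv\<^bsub>Q\<^esub> h Y = inv\<^bsub>Q\<^esub> h Y \<otimes>\<^bsub>Q\<^esub> h X"
          by (rule Zc[OF hZ subgroup.m_inv_closed[OF Zsub hZ]]) (use diff in auto)
        have "p (h Y) \<alpha> = h (t.scal \<alpha> Y)" using diff(4) by (simp add: p_def)
        then show "expo Q (inv\<^bsub>Q\<^esub> h Y) \<alpha> = Some (inv\<^bsub>Q\<^esub> h (t.scal \<alpha> Y))" using pinv[OF XQ(2) \<alpha>] by simp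
      qed (use diff XQ \<alpha> in auto)
      moreover have "t.scal \<alpha> (X \<otimes>\<^bsub>tens C\<^esub> inv\<^bsub>tens C\<^esub> Y) = t.scal \<alpha> X \<otimes>\<^bsub>tens C\<^esub> inv\<^bsub>tens C\<^esub> (t.scal \<alpha> Y)"
      proof -
        interpret s: group_hom "tens C" "tens C" "t.scal \<alpha>"
          using t.scal(1)[OF \<alpha>] t.T.is_group by (simp add: group_hom_def group_hom_axioms_def)
        show ?thesis using diff by simp
      qed
      ultimately show ?case using diff \<alpha> by simp
    qed
    have "h (tensor_map A (sub_exp G C) c) = f c" if "c \<in> C" for c
      using h(2)[OF that A.one_closed] Q.expo_one[OF fc[OF CG[OF that]]] by (simp add: t.tensor_map_eq p_def)
    then show ?thesis using hQ he by (intro bexI[of _ h]) (auto simp: t.expo_tensor)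
  qed
  define h where "h C = (SOME h. h \<in> hom (tens C) Q \<and> (\<forall>c\<in>C. h (tensor_map A (sub_exp G C) c) = f c) \<and>
      (\<forall>t\<in>carrier (tens C). \<forall>\<alpha>\<in>carrier A. \<forall>s. expo (tens C) t \<alpha> = Some s \<longrightarrow> expo Q (h t) \<alpha> = Some (h s)))" for C
  have h: "h C \<in> hom (tens C) Q" "\<And>c. c \<in> C \<Longrightarrow> h C (tensor_map A (sub_exp G C) c) = f c"
    "\<And>t \<alpha> s. t \<in> carrier (tens C) \<Longrightarrow> \<alpha> \<in> carrier A \<Longrightarrow> expo (tens C) t \<alpha> = Some s \<Longrightarrow> expo Q (h C t) \<alpha> = Some (h C s)"
    if "C \<in> \<C>" for C
    using someI_ex[OF outer[OF that, unfolded Bex_def], folded h_def] by blast+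
  obtain F where F: "F \<in> hom E Q" "\<And>g. g \<in> carrier G \<Longrightarrow> F (S.cen g) = f g"
    "\<And>C t. C \<in> \<C> \<Longrightarrow> t \<in> carrier (tens C) \<Longrightarrow> F (S.out C t) = h C t"
    using S.copy_universal[OF Q.G.is_group fh h(1)] h(2) by metis
  interpret F: group_hom E Q F using F(1) E.is_group Q.G.is_group by (simp add: group_hom_def group_hom_axioms_def)
  have Fb: "expo Q (F a) \<alpha> = Some (F b)" if "base_pow a \<alpha> b" for a \<alpha> b
    using that unfolding base_pow_def
  proof (elim conjE disjE exE)
    fix g a' b' assume *: "\<alpha> \<in> carrier A" "a' \<in> centralizer G g" "expo G a' \<alpha> = Some b'" "a = S.cen a'" "b = S.cen b'"
    have a': "a' \<in> carrier G" using *(2) by (rule G.centralizerD)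
    show ?thesis using F(2)[OF a'] F(2)[OF expo_closed[OF a' *(1,3)]] fe[OF a' *(1,3)] * by simp
  next
    fix C t s assume *: "\<alpha> \<in> carrier A" "C \<in> \<C>" "t \<in> carrier (tens C)" "expo (tens C) t \<alpha> = Some s"
      "a = S.out C t" "b = S.out C s"
    show ?thesis using F(3)[OF *(2,3)] F(3)[OF *(2) tens_expo_closed[OF *(2,3,1,4)]] h(3)[OF *(2,3,1,4)] * by simp
  qed
  have "expo Q (F x) \<alpha> = Some (F y)" if x: "x \<in> carrier E" and \<alpha>: "\<alpha> \<in> carrier A" and e: "expo E x \<alpha> = Some y" for x \<alpha> y
  proof -
    have "ext_pow x \<alpha> y" using expo_ext[OF x \<alpha>] e by blast
    then show ?thesis
      unfolding ext_pow_def
    proof (elim disjE exE conjE)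
      fix z a b assume *: "z \<in> carrier E" "base_pow a \<alpha> b" "x = conj_by E z a" "y = conj_by E z b"
      have cl: "a \<in> carrier E" "b \<in> carrier E" using base_pow_closed[OF *(2)] by auto
      have Fc: "F (conj_by E z w) = conj_by Q (F z) (F w)" if "w \<in> carrier E" for w
        using that *(1) by (simp add: conj_by_def)
      show ?thesis using Q.expo_conj[of "F a" "F z" \<alpha>] Fb[OF *(2)] *(1,3,4) cl \<alpha> by (simp add: Fc)
    next
      fix n :: int assume "\<alpha> = [n] \<cdot>\<^bsub>A\<^esub> \<one>\<^bsub>A\<^esub>" "y = x [^]\<^bsub>E\<^esub> n"
      then show ?thesis using Q.expo_int_total[of "F x" n] x by (simp add: F.hom_int_pow)
    qed
  qed
  then have "F \<in> exp_hom A E Q" using F(1) by (simp add: exp_hom_def)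
  then show ?thesis using F(2) by blast
qed

text \<open>If \<open>E\<close> is not CSA, some involution \<open>x\<close> inverts a generator \<open>z\<close> of a hyperbolic centralizer. In the
  next extension \<open>z\<^sup>-\<^sup>1\<close> then has two different powers with a non-integral exponent \<open>\<alpha>\<close>, namely
  \<open>z\<^sup>-\<^sup>1 \<otimes> \<alpha>\<close> and the conjugate of \<open>z \<otimes> \<alpha>\<close> by \<open>x\<close>.\<close>

lemma CSA_ext_of_next:
  fixes E' :: "('v, 'r) exp_struct"
  assumes CSA_G: "CSA G" and S': "condition_S A E \<C>'" and E': "group E'" and iso': "\<theta>' \<in> iso (ext_group A E \<C>') E'"
    and expo': "\<And>x \<alpha> z. x \<in> carrier (ext_group A E \<C>') \<Longrightarrow> \<alpha> \<in> carrier A \<Longrightarrow>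
      expo E' (\<theta>' x) \<alpha> = Some z \<longleftrightarrow> (\<exists>y. ext_expo A E \<C>' x \<alpha> y \<and> z = \<theta>' y)"
  shows "CSA E"
proof (rule E.CSA_I[OF nonabelian_ext XE.ct], unfold commuting_conj_trivial_def, intro ballI impI, rule ccontr)
  fix v x assume v: "v \<in> carrier E - {\<one>\<^bsub>E\<^esub>}" and x: "x \<in> carrier E" "conj_by E x v \<in> centralizer E v" "x \<notin> centralizer E v"
  have "S.L.hyperbolic v" using K.elliptic_commuting_conj K.elliptic_or_hyperbolic v x by blast
  then obtain z where z: "S.L.hyperbolic z" "centralizer E v = range (\<lambda>k::int. z [^]\<^bsub>E\<^esub> k)" "conj_by E x z = inv\<^bsub>E\<^esub> z"
    "x \<noteq> \<one>\<^bsub>E\<^esub>" "x \<otimes>\<^bsub>E\<^esub> x = \<one>\<^bsub>E\<^esub>" using K.hyperbolic_commuting_conj[OF _ x] by metis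
  have zE: "z \<in> carrier E" and z1: "z \<noteq> \<one>\<^bsub>E\<^esub>" using z(1) S.L.hyperbolic_not_one by (auto simp: S.L.hyperbolic_def)
  have zv: "z \<in> centralizer E v" using z(2) E.int_pow_1[OF zE] by (metis rangeI)
  have Cz: "centralizer E z = range (\<lambda>k::int. z [^]\<^bsub>E\<^esub> k)"
    using E.commutation_transitive_centralizer_eq[OF XE.ct _ _ zv z1] v z(2) by simp
  \<comment> \<open>If the ring contained only integers,
    \<open>no_involutions_ext_of_integers\<close> would contradict the involution
    \<open>x\<close>.\<close>
  have "\<exists>\<alpha>\<in>carrier A. \<forall>n::int. \<alpha> \<noteq> [n] \<cdot>\<^bsub>A\<^esub> \<one>\<^bsub>A\<^esub>"
  proof (rule ccontr)
    assume "\<not> ?thesis"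
    then have "no_involutions E"
      using no_involutions_ext_of_integers[OF G.CSA_no_involutions[OF CSA_G nonabelian]] by blast
    then show False using x z unfolding no_involutions_def by blast
  qed
  then obtain \<alpha> where \<alpha>: "\<alpha> \<in> carrier A" "\<And>n::int. \<alpha> \<noteq> [n] \<cdot>\<^bsub>A\<^esub> \<one>\<^bsub>A\<^esub>" by blast
  have "\<not> is_exp_module A E (centralizer E z)"
  proof
    assume "is_exp_module A E (centralizer E z)"
    moreover have "z \<in> centralizer E z" by (rule E.centralizerI[OF zE]) simp
    ultimately obtain y where "expo E z \<alpha> = Some y" using XE.module_centralizer_iff[OF zE z1] \<alpha> by blast
    then show False using hyperbolic_expo[OF z(1) \<alpha>(1)] \<alpha>(2) by blast
  qed
  then obtain D where D: "D \<in> \<C>'" "conjugate_in E (centralizer E z) D"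
    using S' zE z1 unfolding condition_S_def centralizers_def by blast
  then obtain g where g: "g \<in> carrier E" "D = conj_by E g ` centralizer E z" by (auto simp: conjugate_in_def)
  \<comment> \<open>Only a conjugate of the centralizer of \<open>z\<close> belongs to
    \<open>\<C>'\<close>, so \<open>z\<close> and \<open>x\<close> are conjugated
    accordingly.\<close>
  define d y where "d = conj_by E g z" and "y = conj_by E g x"
  have dE: "d \<in> carrier E" and yE: "y \<in> carrier E" using g zE x by (auto simp: d_def y_def)
  have hd: "S.L.hyperbolic d" using S.L.hyperbolic_conj[OF g(1) zE] z(1) by (simp add: d_def)
  have DC: "D = centralizer E d" using g E.centralizer_conj_by[OF g(1) zE] by (simp add: d_def)
  have Cd: "centralizer E d = range (\<lambda>k::int. d [^]\<^bsub>E\<^esub> k)"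
  proof -
    have "centralizer E d = conj_by E g ` range (\<lambda>k::int. z [^]\<^bsub>E\<^esub> k)" using DC g Cz by simp
    also have "\<dots> = range (\<lambda>k::int. d [^]\<^bsub>E\<^esub> k)" using g zE by (simp add: image_image E.conj_by_int_pow d_def)
    finally show ?thesis .
  qed
  have yd: "conj_by E y d = inv\<^bsub>E\<^esub> d"
  proof -
    have "conj_by E y d = conj_by E g (conj_by E x z)"
      using g x zE by (simp add: d_def y_def conj_by_def E.m_assoc E.inv_mult_group)
    then show ?thesis using z(3) g zE by (simp add: d_def E.conj_by_inv)
  qed
  have yD: "y \<notin> D"
  proof
    assume "y \<in> D"
    then have "conj_by E y d = d" using DC E.centralizerD(2) E.conj_by_fixed_iff[OF yE dE] by blast
    then have "d [^]\<^bsub>E\<^esub> (1::int) = d [^]\<^bsub>E\<^esub> (-1::int)" using yd dE by (simp add: E.int_pow_neg)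
    then show False using hyperbolic_pow_inj[OF hd] by fastforce
  qed
  have \<C>': "\<C>' \<subseteq> centralizers E" using S' by (simp add: condition_S_def)
  interpret X: ext_copy A E E' \<C>' \<theta>'
    using faithful_exp_group_ext E' iso' \<C>' by (simp add: ext_copy_def ext_copy_axioms_def)
  interpret t: tensor_data A "sub_exp E D" by (rule X.tensor_data_\<C>[OF D(1)])
  \<comment> \<open>Here the given \<open>E'\<close> enters: its exponentiation is a function, so
    two prescribed values of one power must agree.\<close>
  have uniq: "b = b'" if a: "X.ext_pow a \<alpha> b" "X.ext_pow a \<alpha> b'" "a \<in> carrier E'" for a b b'
  proof -
    obtain a0 where a0: "a0 \<in> carrier (ext_group A E \<C>')" "a = \<theta>' a0" using X.theta(2) a(3) by blast
    have "expo E' a \<alpha> = Some b" "expo E' a \<alpha> = Some b'"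
      using X.ext_pow_iff[OF a0(1) \<alpha>(1)] expo'[OF a0(1) \<alpha>(1)] a a0 by auto
    then show ?thesis by simp
  qed
  let ?m = "tensor_map A (sub_exp E D)"
  have dD: "d \<in> D" "inv\<^bsub>E\<^esub> d \<in> D"
  proof -
    show "d \<in> D" unfolding DC by (rule E.centralizerI[OF dE]) simp
    then show "inv\<^bsub>E\<^esub> d \<in> D" using subgroup.m_inv_closed[OF X.S.subgroup_edge[OF D(1)]] by blast
  qed
  have ts: "t.ts d \<alpha> \<in> carrier t.T" "t.ts (inv\<^bsub>E\<^esub> d) \<alpha> \<in> carrier t.T" using dD \<alpha> by simp_all
  have bp: "X.base_pow (X.S.cen c) \<alpha> (X.S.out D (t.ts c \<alpha>))" if "c \<in> D" for c
  proof -
    have "expo t.T (?m c) \<alpha> = Some (t.ts c \<alpha>)" using t.expo_tensor_map[of c \<alpha>] that \<alpha>(1) by simp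
    then show ?thesis
      using X.S.cen_edge[OF D(1) that] X.S.edge_map_closed[OF D(1) that] \<alpha>(1) D(1) unfolding X.base_pow_def by blast
  qed
  \<comment> \<open>The two values prescribed for the power of \<open>inv d\<close>: one inside the
    tensor product, the other by conjugating the power of \<open>d\<close> with
    \<open>y\<close>.\<close>
  have "X.ext_pow (X.S.cen (inv\<^bsub>E\<^esub> d)) \<alpha> (X.S.out D (t.ts (inv\<^bsub>E\<^esub> d) \<alpha>))"
    unfolding X.ext_pow_def using bp[OF dD(2)] X.E.one_closed dE ts D(1)
    by (intro disjI1 exI[of _ "\<one>\<^bsub>E'\<^esub>"] exI[of _ "X.S.cen (inv\<^bsub>E\<^esub> d)"] exI[of _ "X.S.out D (t.ts (inv\<^bsub>E\<^esub> d) \<alpha>)"]) simp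
  moreover have "X.S.cen (inv\<^bsub>E\<^esub> d) = conj_by E' (X.S.cen y) (X.S.cen d)"
    using yd[symmetric] yE dE by (simp add: conj_by_def X.S.cen_mult X.S.cen_inv)
  then have "X.ext_pow (X.S.cen (inv\<^bsub>E\<^esub> d)) \<alpha> (conj_by E' (X.S.cen y) (X.S.out D (t.ts d \<alpha>)))"
    unfolding X.ext_pow_def using bp[OF dD(1)] X.S.cen_closed[OF yE] by blast
  ultimately have eq: "conj_by E' (X.S.cen y) (X.S.out D (t.ts d \<alpha>)) = X.S.out D (t.ts (inv\<^bsub>E\<^esub> d) \<alpha>)"
    using uniq dE by (metis E.inv_closed X.S.cen_closed)
  obtain h where h: "\<And>(k::int) \<alpha>. \<alpha> \<in> carrier A \<Longrightarrow> h (t.ts (d [^]\<^bsub>E\<^esub> k) \<alpha>) = [k] \<cdot>\<^bsub>A\<^esub> \<alpha>"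
    using hyperbolic_tensor[OF hd Cd] unfolding DC by blast
  \<comment> \<open>If the element came from \<open>D\<close>, its image in the additive group of
    the ring would make \<open>\<alpha>\<close> an integer. The exponents 1 and -1 stand for
    \<open>d\<close> and \<open>inv d\<close>.\<close>
  have notin: "t.ts (d [^]\<^bsub>E\<^esub> k) \<alpha> \<notin> ?m ` D" if "k = 1 \<or> k = -1" for k :: int
  proof
    assume "t.ts (d [^]\<^bsub>E\<^esub> k) \<alpha> \<in> ?m ` D"
    then obtain c where c: "c \<in> D" "t.ts (d [^]\<^bsub>E\<^esub> k) \<alpha> = ?m c" by blast
    have "c \<in> range (\<lambda>k::int. d [^]\<^bsub>E\<^esub> k)" using c(1) unfolding DC Cd .
    then obtain l :: int where "c = d [^]\<^bsub>E\<^esub> l" by blast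
    then have "t.ts (d [^]\<^bsub>E\<^esub> k) \<alpha> = t.ts (d [^]\<^bsub>E\<^esub> l) \<one>\<^bsub>A\<^esub>" using c(2) by (simp only: t.tensor_map_eq)
    then have "[k] \<cdot>\<^bsub>A\<^esub> \<alpha> = [l] \<cdot>\<^bsub>A\<^esub> \<one>\<^bsub>A\<^esub>" using h[OF \<alpha>(1), of k] h[OF A.one_closed, of l] by simp
    then have "[k] \<cdot>\<^bsub>A\<^esub> ([k] \<cdot>\<^bsub>A\<^esub> \<alpha>) = [(l * k)] \<cdot>\<^bsub>A\<^esub> \<one>\<^bsub>A\<^esub>" by (simp add: A.add.int_pow_pow mult.commute)
    then have "\<alpha> = [(l * k)] \<cdot>\<^bsub>A\<^esub> \<one>\<^bsub>A\<^esub>" using that \<alpha>(1) by (auto simp: A.add.int_pow_pow)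
    then show False using \<alpha>(2) by blast
  qed
  have "t.ts d \<alpha> \<notin> ?m ` D" "t.ts (inv\<^bsub>E\<^esub> d) \<alpha> \<notin> ?m ` D"
    using notin[of 1] notin[of "-1"] dE by (simp_all add: E.int_pow_neg)
  then have o: "X.S.out D (t.ts d \<alpha>) \<notin> X.S.cen ` carrier E" "X.S.out D (t.ts (inv\<^bsub>E\<^esub> d) \<alpha>) \<notin> X.S.cen ` carrier E"
    using X.S.out_edge_iff[OF D(1)] ts by simp_all
  let ?s = "X.S.out D (t.ts d \<alpha>)" and ?s' = "X.S.out D (t.ts (inv\<^bsub>E\<^esub> d) \<alpha>)"
  have sE: "?s \<in> carrier E'" "?s' \<in> carrier E'" "X.S.cen y \<in> carrier E'" using D(1) ts yE by simp_all
  \<comment> \<open>The word is reduced because \<open>y\<close> is not in \<open>D\<close>, yet by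
    \<open>eq\<close> it equals the image of \<open>y\<close>, which has length 0.\<close>
  have "X.S.len (?s \<otimes>\<^bsub>E'\<^esub> X.S.cen y \<otimes>\<^bsub>E'\<^esub> inv\<^bsub>E'\<^esub> ?s') = 2"
  proof (rule X.S.L.L_outer_central_outer[OF D(1) D(1)])
    show "?s \<in> X.S.out D ` carrier t.T" "?s \<notin> X.S.cen ` carrier E" using ts o by auto
    show "inv\<^bsub>E'\<^esub> ?s' \<in> X.S.out D ` carrier t.T" using ts by (intro X.S.L.outer_inv[OF D(1)]) auto
    show "inv\<^bsub>E'\<^esub> ?s' \<notin> X.S.cen ` carrier E" using o(2) X.S.L.inv_in_central_iff[OF sE(2)] by blast
    show "X.S.cen y \<in> X.S.cen ` carrier E" using yE by simp
    show "D \<noteq> D \<or> X.S.cen y \<notin> X.S.out D ` carrier t.T" using X.S.cen_edge_iff[OF D(1) yE] yD by blast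
  qed
  moreover have "?s \<otimes>\<^bsub>E'\<^esub> X.S.cen y \<otimes>\<^bsub>E'\<^esub> inv\<^bsub>E'\<^esub> ?s' = X.S.cen y"
    unfolding eq[symmetric] using sE by (simp add: conj_by_def X.E.m_assoc X.E.inv_mult_group)
  ultimately show False using yE by simp
qed

end

text \<open>The invariant that is passed along the chain. All clauses but CSA are inherited by every
  extension; CSA is obtained either from the next stage or from the absence of involutions.\<close>

definition faithful_CSA :: "('r, 'n) ring_scheme \<Rightarrow> ('g, 'r) exp_struct \<Rightarrow> bool" where
  "faithful_CSA A G \<longleftrightarrow> partial_exp_group A G \<and> \<not> comm_group G \<and> CSA G \<and>
     (\<forall>M. maximal_abelian G M \<longrightarrow> abelian_faithful A (sub_exp G M))"

lemma faithful_CSA_imp_faithful_exp_group: "faithful_CSA A G \<Longrightarrow> faithful_exp_group A G"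
  unfolding faithful_CSA_def faithful_exp_group_def ct_exp_group_def ct_exp_group_axioms_def faithful_exp_group_axioms_def
  using group.CSA_imp_commutation_transitive[of G] by (auto simp: partial_exp_group_def)

lemma centralizer_extension_ext_exp:
  assumes char_zero: "\<And>n :: int. [n] \<cdot>\<^bsub>A\<^esub> \<one>\<^bsub>A\<^esub> = \<zero>\<^bsub>A\<^esub> \<Longrightarrow> n = 0"
    and G: "faithful_CSA A G" and S: "condition_S A G \<C>" and H: "is_centralizer_extension A G \<C> H"
  obtains \<theta> where "ext_exp A G H \<C> \<theta>" "\<And>g. g \<in> carrier G \<Longrightarrow> \<theta> (ext_central A G \<C> g) = g"
    "\<theta> \<in> iso (ext_group A G \<C>) H"
    "\<And>x \<alpha> z. x \<in> carrier (ext_group A G \<C>) \<Longrightarrow> \<alpha> \<in> carrier A \<Longrightarrow>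
      expo H (\<theta> x) \<alpha> = Some z \<longleftrightarrow> (\<exists>y. ext_expo A G \<C> x \<alpha> y \<and> z = \<theta> y)"
proof -
  obtain \<theta> where \<theta>: "\<theta> \<in> iso (ext_group A G \<C>) H" "\<And>g. g \<in> carrier G \<Longrightarrow> \<theta> (ext_central A G \<C> g) = g"
    "\<And>x \<alpha> z. x \<in> carrier (ext_group A G \<C>) \<Longrightarrow> \<alpha> \<in> carrier A \<Longrightarrow>
      expo H (\<theta> x) \<alpha> = Some z \<longleftrightarrow> (\<exists>y. ext_expo A G \<C> x \<alpha> y \<and> z = \<theta> y)" and gH: "group H"
    using H unfolding is_centralizer_extension_def by blast
  interpret ext_copy A G H \<C> \<theta>
    using faithful_CSA_imp_faithful_exp_group[OF G] gH \<theta>(1) S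
    by (simp add: ext_copy_def ext_copy_axioms_def condition_S_def)
  have cc: "commuting_conj_trivial G" using G.CSA_imp_commuting_conj_trivial G by (simp add: faithful_CSA_def)
  have "ext_exp A G H \<C> \<theta>"
  proof (unfold_locales)
    show "\<not> comm_group G" using G by (simp add: faithful_CSA_def)
    show "expo H x \<alpha> = Some z \<longleftrightarrow> ext_pow x \<alpha> z" if x: "x \<in> carrier H" and \<alpha>: "\<alpha> \<in> carrier A" for x \<alpha> z
    proof -
      obtain x0 where "x0 \<in> carrier (ext_group A G \<C>)" "x = \<theta> x0" using x theta(2) by blast
      then show ?thesis using \<theta>(3)[of x0 \<alpha> z] ext_pow_iff[of x0 \<alpha> z] \<alpha> by simp
    qed
  qed (use char_zero cc S in auto)
  then show ?thesis using that \<theta> by blast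
qed

section \<open>Transport along isomorphisms\<close>

locale exp_group_iso = partial_exp_group A G + H: group H
  for A :: "('r, 'n) ring_scheme" and G :: "('g, 'r) exp_struct" and H :: "('h, 'r) exp_struct" +
  fixes f
  assumes f: "f \<in> exp_iso A G H"
begin

lemma f_hom: "f \<in> hom G H" and f_inj: "inj_on f (carrier G)" and f_surj: "f ` carrier G = carrier H"
  using f by (auto simp: exp_iso_def iso_def bij_betw_def)

sublocale f: group_hom G H f
  using f_hom G.is_group H.is_group by (simp add: group_hom_def group_hom_axioms_def)

lemma f_eq_iff: "x \<in> carrier G \<Longrightarrow> y \<in> carrier G \<Longrightarrow> f x = f y \<longleftrightarrow> x = y"
  using f_inj by (auto dest: inj_onD)

lemma f_expo: "x \<in> carrier G \<Longrightarrow> \<alpha> \<in> carrier A \<Longrightarrow> expo H (f x) \<alpha> = map_option f (expo G x \<alpha>)"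
  using f by (auto simp: exp_iso_def)

lemma f_conj: "x \<in> carrier G \<Longrightarrow> y \<in> carrier G \<Longrightarrow> f (conj_by G x y) = conj_by H (f x) (f y)"
  by (simp add: conj_by_def)

lemma H_cases: assumes "y \<in> carrier H" obtains x where "x \<in> carrier G" "y = f x"
  using assms f_surj by blast

lemma f_commute_iff:
  assumes "x \<in> carrier G" "y \<in> carrier G" shows "f x \<otimes>\<^bsub>H\<^esub> f y = f y \<otimes>\<^bsub>H\<^esub> f x \<longleftrightarrow> x \<otimes>\<^bsub>G\<^esub> y = y \<otimes>\<^bsub>G\<^esub> x"
  using f_eq_iff[of "x \<otimes>\<^bsub>G\<^esub> y" "y \<otimes>\<^bsub>G\<^esub> x"] assms by simp

lemma f_centralizer: "v \<in> carrier G \<Longrightarrow> x \<in> carrier G \<Longrightarrow> f x \<in> centralizer H (f v) \<longleftrightarrow> x \<in> centralizer G v"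
  using f_commute_iff unfolding centralizer_def by auto

lemma partial_exp_group_H: "partial_exp_group A H"
proof (rule partial_exp_groupI)
  show "ring A" "group H" by (rule A.ring_axioms H.is_group)+
  have e: "\<exists>x. expo G g \<alpha> = Some x \<and> x \<in> carrier G \<and> y = f x"
    if "g \<in> carrier G" "\<alpha> \<in> carrier A" "expo H (f g) \<alpha> = Some y" for g \<alpha> y
    using that f_expo[OF that(1,2)] expo_closed[OF that(1,2)] by auto
  show "expo H \<one>\<^bsub>H\<^esub> \<alpha> = Some \<one>\<^bsub>H\<^esub>" if "\<alpha> \<in> carrier A" for \<alpha>
    using f_expo[OF G.one_closed that] one_expo[OF that] by simp
  fix g assume "g \<in> carrier H"
  then obtain a where a: "a \<in> carrier G" "g = f a" by (rule H_cases)
  show "x \<in> carrier H" if "\<alpha> \<in> carrier A" "expo H g \<alpha> = Some x" for \<alpha> x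
    using e[OF a(1) that(1)] that(2) a by auto
  show "expo H g \<one>\<^bsub>A\<^esub> = Some g" "expo H g \<zero>\<^bsub>A\<^esub> = Some \<one>\<^bsub>H\<^esub>"
    using f_expo[OF a(1)] expo_one[OF a(1)] expo_zero[OF a(1)] a by simp_all
  show "expo H g (\<alpha> \<oplus>\<^bsub>A\<^esub> \<beta>) = Some (x \<otimes>\<^bsub>H\<^esub> y)"
    if \<alpha>: "\<alpha> \<in> carrier A" "\<beta> \<in> carrier A" "expo H g \<alpha> = Some x" "expo H g \<beta> = Some y" for \<alpha> \<beta> x y
  proof -
    obtain x0 where x0: "expo G a \<alpha> = Some x0" "x0 \<in> carrier G" "x = f x0" using e[OF a(1) \<alpha>(1)] \<alpha>(3) a by blast
    obtain y0 where y0: "expo G a \<beta> = Some y0" "y0 \<in> carrier G" "y = f y0" using e[OF a(1) \<alpha>(2)] \<alpha>(4) a by blast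
    show ?thesis using expo_add[OF a(1) \<alpha>(1,2) x0(1) y0(1)] f_expo[OF a(1)] \<alpha> a x0 y0 by simp
  qed
  show "expo H g (\<alpha> \<otimes>\<^bsub>A\<^esub> \<beta>) = Some y"
    if \<alpha>: "\<alpha> \<in> carrier A" "\<beta> \<in> carrier A" "expo H g \<alpha> = Some x" "expo H x \<beta> = Some y" for \<alpha> \<beta> x y
  proof -
    obtain x0 where x0: "expo G a \<alpha> = Some x0" "x0 \<in> carrier G" "x = f x0" using e[OF a(1) \<alpha>(1)] \<alpha>(3) a by blast
    obtain y0 where y0: "expo G x0 \<beta> = Some y0" "y0 \<in> carrier G" "y = f y0" using e[OF x0(2) \<alpha>(2)] \<alpha>(4) x0 by blast
    show ?thesis using expo_mult[OF a(1) \<alpha>(1,2) x0(1) y0(1)] f_expo[OF a(1)] \<alpha> a y0 by simp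
  qed
  fix h assume "h \<in> carrier H"
  then obtain b where b: "b \<in> carrier G" "h = f b" by (rule H_cases)
  show "expo H (conj_by H h g) \<alpha> = map_option (conj_by H h) (expo H g \<alpha>)" if \<alpha>: "\<alpha> \<in> carrier A" for \<alpha>
  proof -
    have "conj_by H h g = f (conj_by G b a)" using a b by (simp add: f_conj)
    then have "expo H (conj_by H h g) \<alpha> = map_option f (map_option (conj_by G b) (expo G a \<alpha>))"
      using f_expo[of "conj_by G b a" \<alpha>] expo_conj[OF a(1) b(1) \<alpha>] a b \<alpha> by simp
    also have "\<dots> = map_option (conj_by H h) (map_option f (expo G a \<alpha>))"
      using expo_closed[OF a(1) \<alpha>] b by (cases "expo G a \<alpha>") (auto simp: f_conj)
    finally show ?thesis using f_expo[OF a(1) \<alpha>] a by simp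
  qed
  show "expo H (g \<otimes>\<^bsub>H\<^esub> h) \<alpha> = Some (x \<otimes>\<^bsub>H\<^esub> y)"
    if \<alpha>: "\<alpha> \<in> carrier A" and c: "g \<otimes>\<^bsub>H\<^esub> h = h \<otimes>\<^bsub>H\<^esub> g" and xy: "expo H g \<alpha> = Some x" "expo H h \<alpha> = Some y" for \<alpha> x y
  proof -
    obtain x0 where x0: "expo G a \<alpha> = Some x0" "x0 \<in> carrier G" "x = f x0" using e[OF a(1) \<alpha>] xy a by blast
    obtain y0 where y0: "expo G b \<alpha> = Some y0" "y0 \<in> carrier G" "y = f y0" using e[OF b(1) \<alpha>] xy b by blast
    have "a \<otimes>\<^bsub>G\<^esub> b = b \<otimes>\<^bsub>G\<^esub> a" using c f_commute_iff[OF a(1) b(1)] a b by simp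
    from expo_commute[OF a(1) b(1) \<alpha> this x0(1) y0(1)] show ?thesis
      using f_expo[of "a \<otimes>\<^bsub>G\<^esub> b" \<alpha>] \<alpha> a b x0 y0 by simp
  qed
qed

lemma nonabelian_H: "\<not> comm_group G \<Longrightarrow> \<not> comm_group H"
proof
  assume n: "\<not> comm_group G" and "comm_group H"
  then interpret C: comm_group H by simp
  have "x \<otimes>\<^bsub>G\<^esub> y = y \<otimes>\<^bsub>G\<^esub> x" if "x \<in> carrier G" "y \<in> carrier G" for x y
    using f_commute_iff[OF that] C.m_comm[of "f x" "f y"] that by simp
  then show False using n G.group_comm_groupI by blast
qed

lemma commutation_transitive_H:
  assumes ct: "commutation_transitive G" shows "commutation_transitive H"
  unfolding commutation_transitive_def
proof (intro ballI)
  fix v x y assume v: "v \<in> carrier H - {\<one>\<^bsub>H\<^esub>}" and xy: "x \<in> centralizer H v" "y \<in> centralizer H v"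
  obtain v0 where v0: "v0 \<in> carrier G" "v = f v0" using v by (elim DiffE H_cases)
  obtain x0 where x0: "x0 \<in> carrier G" "x = f x0" using H.centralizerD(1)[OF xy(1)] by (rule H_cases)
  obtain y0 where y0: "y0 \<in> carrier G" "y = f y0" using H.centralizerD(1)[OF xy(2)] by (rule H_cases)
  have "v0 \<in> carrier G - {\<one>\<^bsub>G\<^esub>}" using v v0 by auto
  moreover have "x0 \<in> centralizer G v0" "y0 \<in> centralizer G v0" using xy v0 x0 y0 f_centralizer by auto
  ultimately have "x0 \<otimes>\<^bsub>G\<^esub> y0 = y0 \<otimes>\<^bsub>G\<^esub> x0" using ct unfolding commutation_transitive_def by blast
  then show "x \<otimes>\<^bsub>H\<^esub> y = y \<otimes>\<^bsub>H\<^esub> x" using f_commute_iff[OF x0(1) y0(1)] x0 y0 by simp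
qed

lemma commuting_conj_trivial_H:
  assumes cc: "commuting_conj_trivial G" shows "commuting_conj_trivial H"
  unfolding commuting_conj_trivial_def
proof (intro ballI impI)
  fix v x assume v: "v \<in> carrier H - {\<one>\<^bsub>H\<^esub>}" and x: "x \<in> carrier H" and c: "conj_by H x v \<in> centralizer H v"
  obtain v0 where v0: "v0 \<in> carrier G" "v = f v0" using v by (elim DiffE H_cases)
  obtain x0 where x0: "x0 \<in> carrier G" "x = f x0" using x by (rule H_cases)
  have "v0 \<in> carrier G - {\<one>\<^bsub>G\<^esub>}" using v v0 by auto
  moreover have "conj_by G x0 v0 \<in> centralizer G v0" using c v0 x0 f_centralizer[of v0 "conj_by G x0 v0"] by (simp add: f_conj)
  ultimately have "x0 \<in> centralizer G v0" using cc x0 unfolding commuting_conj_trivial_def by blast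
  then show "x \<in> centralizer H v" using v0 x0 f_centralizer by simp
qed

lemma CSA_H: "\<not> comm_group G \<Longrightarrow> CSA G \<Longrightarrow> CSA H"
  using H.CSA_I nonabelian_H commutation_transitive_H commuting_conj_trivial_H
    G.CSA_imp_commutation_transitive G.CSA_imp_commuting_conj_trivial by blast

text \<open>\<open>N\<close> is the preimage of \<open>M\<close>. Powers stay inside both
  centralizers, so \<open>f\<close> restricts to an isomorphism of partial modules and
  \<open>tensor_iso\<close> applies.\<close>

lemma maximal_abelian_H:
  assumes nc: "\<not> comm_group G" and CSA: "CSA G" and M: "maximal_abelian H M"
  obtains N where "maximal_abelian G N" "abelian_faithful A (sub_exp G N) \<Longrightarrow> abelian_faithful A (sub_exp H M)"
    "no_involutions (tensor A (sub_exp G N)) \<Longrightarrow> no_involutions (tensor A (sub_exp H M))"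
proof -
  have ct: "commutation_transitive G" using G.CSA_imp_commutation_transitive CSA by blast
  obtain v where v: "v \<in> carrier H" "v \<noteq> \<one>\<^bsub>H\<^esub>" "M = centralizer H v"
    using H.maximal_abelian_is_centralizer[OF M nonabelian_H[OF nc] commutation_transitive_H[OF ct]] by blast
  obtain v0 where v0: "v0 \<in> carrier G" "v = f v0" using v(1) by (rule H_cases)
  have v01: "v0 \<noteq> \<one>\<^bsub>G\<^esub>" using v v0 by auto
  let ?N = "centralizer G v0"
  interpret cG: ct_exp_group A G using ct by unfold_locales
  interpret cH: ct_exp_group A H
    using partial_exp_group_H commutation_transitive_H[OF ct] by (simp add: ct_exp_group_def ct_exp_group_axioms_def)
  define k where "k = inv_into (carrier G) f"
  have kf: "k (f x) = x" if "x \<in> carrier G" for x using f_inj that by (simp add: k_def)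
  have fk: "f (k y) = y" "k y \<in> carrier G" if "y \<in> carrier H" for y
    using that f_surj by (auto simp: k_def f_inv_into_f inv_into_into)
  have kM: "k y \<in> ?N" if "y \<in> M" for y
    using that f_centralizer[OF v0(1) fk(2)[of y]] fk(1)[of y] v v0 H.centralizerD(1) by auto
  have MH: "M \<subseteq> carrier H" using v H.centralizerD(1) by blast
  have fN: "f x \<in> M" if "x \<in> ?N" for x using that f_centralizer[OF v0(1)] v v0 G.centralizerD(1) by blast
  have NG: "?N \<subseteq> carrier G" using G.centralizerD(1) by blast
  have kH: "k \<in> exp_hom A (sub_exp H M) (sub_exp G ?N)"
    unfolding exp_hom_def
  proof (intro CollectI conjI ballI allI impI homI)
    show "k y \<in> carrier (sub_exp G ?N)" if "y \<in> carrier (sub_exp H M)" for y using kM that by simp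
    show "k (y \<otimes>\<^bsub>sub_exp H M\<^esub> y') = k y \<otimes>\<^bsub>sub_exp G ?N\<^esub> k y'" if "y \<in> carrier (sub_exp H M)" "y' \<in> carrier (sub_exp H M)" for y y'
    proof -
      have y: "y \<in> carrier H" "y' \<in> carrier H" using that MH by auto
      have "f (k y \<otimes>\<^bsub>G\<^esub> k y') = y \<otimes>\<^bsub>H\<^esub> y'" using fk[OF y(1)] fk[OF y(2)] by simp
      then show ?thesis using kf[of "k y \<otimes>\<^bsub>G\<^esub> k y'"] fk(2)[OF y(1)] fk(2)[OF y(2)] by simp
    qed
    fix y \<alpha> z assume y: "y \<in> carrier (sub_exp H M)" and \<alpha>: "\<alpha> \<in> carrier A" and e: "expo (sub_exp H M) y \<alpha> = Some z"
    have yM: "y \<in> M" and yH: "y \<in> carrier H" using y MH by auto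
    have "expo H y \<alpha> = Some z" using e cH.expo_sub_centralizer[OF v(1,2), of y \<alpha>] yM v(3) \<alpha> by simp
    then have "map_option f (expo G (k y) \<alpha>) = Some z" using f_expo[OF fk(2)[OF yH] \<alpha>] fk(1)[OF yH] by simp
    then obtain z0 where z0: "expo G (k y) \<alpha> = Some z0" "z = f z0" by auto
    then have "k z = z0" using kf expo_closed[OF fk(2)[OF yH] \<alpha>] by simp
    then show "expo (sub_exp G ?N) (k y) \<alpha> = Some (k z)"
      using cG.expo_sub_centralizer[OF v0(1) v01 kM[OF yM] \<alpha>] z0 by simp
  qed
  have fH: "f \<in> exp_hom A (sub_exp G ?N) (sub_exp H M)"
    unfolding exp_hom_def
  proof (intro CollectI conjI ballI allI impI homI)
    show "f x \<in> carrier (sub_exp H M)" if "x \<in> carrier (sub_exp G ?N)" for x using fN that by simp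
    show "f (x \<otimes>\<^bsub>sub_exp G ?N\<^esub> y) = f x \<otimes>\<^bsub>sub_exp H M\<^esub> f y" if "x \<in> carrier (sub_exp G ?N)" "y \<in> carrier (sub_exp G ?N)" for x y
      using that NG by (simp add: subset_iff)
    fix x \<alpha> z assume x: "x \<in> carrier (sub_exp G ?N)" and \<alpha>: "\<alpha> \<in> carrier A" and e: "expo (sub_exp G ?N) x \<alpha> = Some z"
    have xN: "x \<in> ?N" and xG: "x \<in> carrier G" using x NG by auto
    have "expo G x \<alpha> = Some z" using e cG.expo_sub_centralizer[OF v0(1) v01 xN \<alpha>] by simp
    then show "expo (sub_exp H M) (f x) \<alpha> = Some (f z)"
      using cH.expo_sub_centralizer[OF v(1,2), of "f x" \<alpha>] fN[OF xN] v(3) \<alpha> f_expo[OF xG \<alpha>] by simp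
  qed
  have tG: "tensor_data A (sub_exp G ?N)" by (rule cG.tensor_data_centralizer[OF v0(1) v01])
  have tH: "tensor_data A (sub_exp H M)" using cH.tensor_data_centralizer[OF v(1,2)] v(3) by simp
  have fkM: "f (k y) = y" if "y \<in> carrier (sub_exp H M)" for y using fk(1) that MH by auto
  have "maximal_abelian G ?N" by (rule G.commutation_transitive_maximal_abelian_centralizer[OF ct v0(1) v01])
  then show ?thesis
    using that[of ?N] tensor_iso[OF tH tG kH fH fkM] by blast
qed

lemma faithful_CSA_H: "faithful_CSA A G \<Longrightarrow> faithful_CSA A H"
  using partial_exp_group_H nonabelian_H CSA_H maximal_abelian_H unfolding faithful_CSA_def by metis

end

section \<open>The union of the chain\<close>

text \<open>The properties of a single step that the union needs, freed from trees of groups: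
  \<open>total_Suc\<close> makes the union total, and \<open>generate_Suc\<close> makes it generated
  by the first stage.\<close>

locale exp_chain = A: ring A for A :: "('r, 'n) ring_scheme" +
  fixes Gs :: "nat \<Rightarrow> ('u, 'r) exp_struct"
  assumes stage: "partial_exp_group A (Gs n)"
    and carrier_Suc: "carrier (Gs n) \<subseteq> carrier (Gs (Suc n))"
    and mult_Suc: "\<lbrakk>x \<in> carrier (Gs n); y \<in> carrier (Gs n)\<rbrakk> \<Longrightarrow> x \<otimes>\<^bsub>Gs (Suc n)\<^esub> y = x \<otimes>\<^bsub>Gs n\<^esub> y"
    and one_Suc: "\<one>\<^bsub>Gs (Suc n)\<^esub> = \<one>\<^bsub>Gs n\<^esub>"
    and expo_Suc: "\<lbrakk>x \<in> carrier (Gs n); \<alpha> \<in> carrier A; expo (Gs n) x \<alpha> = Some y\<rbrakk> \<Longrightarrow> expo (Gs (Suc n)) x \<alpha> = Some y"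
    and total_Suc: "\<lbrakk>x \<in> carrier (Gs n); \<alpha> \<in> carrier A\<rbrakk> \<Longrightarrow> expo (Gs (Suc n)) x \<alpha> \<noteq> None"
    and generate_Suc: "carrier (Gs (Suc n)) \<subseteq> exp_generate A (Gs (Suc n)) (carrier (Gs n))"
begin

abbreviation "U \<equiv> chain_union Gs"

lemma group_stage: "group (Gs n)"
  using stage by (simp add: partial_exp_group_def)

lemma carrier_mono: "m \<le> n \<Longrightarrow> carrier (Gs m) \<subseteq> carrier (Gs n)"
  using lift_Suc_mono_le[of "\<lambda>n. carrier (Gs n)" m n] carrier_Suc by blast

lemma carrier_mem: "m \<le> n \<Longrightarrow> x \<in> carrier (Gs m) \<Longrightarrow> x \<in> carrier (Gs n)"
  using carrier_mono by blast

lemma one_eq: "\<one>\<^bsub>Gs n\<^esub> = \<one>\<^bsub>Gs 0\<^esub>"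
  by (induction n) (auto simp: one_Suc)

lemma mult_mono: "m \<le> n \<Longrightarrow> x \<in> carrier (Gs m) \<Longrightarrow> y \<in> carrier (Gs m) \<Longrightarrow> x \<otimes>\<^bsub>Gs n\<^esub> y = x \<otimes>\<^bsub>Gs m\<^esub> y"
proof (induction n rule: dec_induct)
  case (step n)
  then show ?case using mult_Suc[of x n y] carrier_mem[of m n] by simp
qed simp

lemma expo_mono: "m \<le> n \<Longrightarrow> x \<in> carrier (Gs m) \<Longrightarrow> \<alpha> \<in> carrier A \<Longrightarrow> expo (Gs m) x \<alpha> = Some y \<Longrightarrow> expo (Gs n) x \<alpha> = Some y"
proof (induction n rule: dec_induct)
  case (step n)
  then show ?case using expo_Suc[of x n \<alpha> y] carrier_mem[of m n] by simp
qed simp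

lemma carrier_U: "carrier U = (\<Union>n. carrier (Gs n))"
  by (simp add: chain_union_def)

lemma U_mem: "x \<in> carrier (Gs n) \<Longrightarrow> x \<in> carrier U"
  by (auto simp: carrier_U)

lemma U_one: "\<one>\<^bsub>U\<^esub> = \<one>\<^bsub>Gs n\<^esub>"
  by (simp add: chain_union_def one_eq[of n])

lemma U_mult: "x \<in> carrier (Gs n) \<Longrightarrow> y \<in> carrier (Gs n) \<Longrightarrow> x \<otimes>\<^bsub>U\<^esub> y = x \<otimes>\<^bsub>Gs n\<^esub> y"
proof -
  assume xy: "x \<in> carrier (Gs n)" "y \<in> carrier (Gs n)"
  let ?P = "\<lambda>n. x \<in> carrier (Gs n) \<and> y \<in> carrier (Gs n)"
  have "?P (LEAST n. ?P n)" "(LEAST n. ?P n) \<le> n" using xy by (auto intro: LeastI2 Least_le)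
  then show ?thesis using mult_mono[of "LEAST n. ?P n" n x y] by (simp add: chain_union_def)
qed

text \<open>By \<open>expo_mono\<close> all stages in which a power is defined agree, so it does not
  matter that the union consults the least one.\<close>

lemma U_expo_iff:
  assumes x: "x \<in> carrier U" and \<alpha>: "\<alpha> \<in> carrier A"
  shows "expo U x \<alpha> = Some y \<longleftrightarrow> (\<exists>n. x \<in> carrier (Gs n) \<and> expo (Gs n) x \<alpha> = Some y)"
proof -
  let ?P = "\<lambda>n. x \<in> carrier (Gs n) \<and> expo (Gs n) x \<alpha> \<noteq> None"
  have uniq: "y = z" if "x \<in> carrier (Gs n)" "expo (Gs n) x \<alpha> = Some y" "x \<in> carrier (Gs m)" "expo (Gs m) x \<alpha> = Some z" for n m y z
    using expo_mono[of n "max n m" x \<alpha> y] expo_mono[of m "max n m" x \<alpha> z] that \<alpha> by simp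
  define l where "l = (LEAST n. ?P n)"
  have e: "expo U x \<alpha> = (if \<exists>n. ?P n then expo (Gs l) x \<alpha> else None)"
    unfolding l_def by (simp only: chain_union_def exp_struct.simps)
  have l: "?P l" if "\<exists>n. ?P n" unfolding l_def using that by (rule LeastI_ex)
  show ?thesis
  proof
    assume y: "expo U x \<alpha> = Some y"
    then have ex: "\<exists>n. ?P n" using e by (metis option.distinct(1))
    then have "expo (Gs l) x \<alpha> = Some y" using y e by simp
    then show "\<exists>n. x \<in> carrier (Gs n) \<and> expo (Gs n) x \<alpha> = Some y" using l[OF ex] by blast
  next
    assume "\<exists>n. x \<in> carrier (Gs n) \<and> expo (Gs n) x \<alpha> = Some y"
    then obtain n where n: "x \<in> carrier (Gs n)" "expo (Gs n) x \<alpha> = Some y" by blast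
    then have ex: "\<exists>n. ?P n" by auto
    from l[OF this] obtain z where z: "x \<in> carrier (Gs l)" "expo (Gs l) x \<alpha> = Some z" by blast
    have "expo U x \<alpha> = expo (Gs l) x \<alpha>" unfolding e using ex by (rule if_P)
    then show "expo U x \<alpha> = Some y" using z uniq[OF n z] by simp
  qed
qed

lemma two_stages:
  assumes "x \<in> carrier U" "y \<in> carrier U" obtains n where "x \<in> carrier (Gs n)" "y \<in> carrier (Gs n)"
proof -
  obtain i j where "x \<in> carrier (Gs i)" "y \<in> carrier (Gs j)" using assms by (auto simp: carrier_U)
  then show ?thesis using that[of "max i j"] carrier_mem[of i "max i j" x] carrier_mem[of j "max i j" y] by simp
qed

lemma group_U: "group U"
proof (rule groupI)
  show "x \<otimes>\<^bsub>U\<^esub> y \<in> carrier U" if xy: "x \<in> carrier U" "y \<in> carrier U" for x y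
  proof -
    obtain n where n: "x \<in> carrier (Gs n)" "y \<in> carrier (Gs n)" using two_stages[OF xy] .
    interpret group "Gs n" by (rule group_stage)
    show ?thesis using n U_mult[OF n] U_mem[of "x \<otimes>\<^bsub>Gs n\<^esub> y" n] by simp
  qed
  show "\<one>\<^bsub>U\<^esub> \<in> carrier U" using U_one[of 0] U_mem[of _ 0] group.is_monoid[OF group_stage] monoid.one_closed by metis
  show "x \<otimes>\<^bsub>U\<^esub> y \<otimes>\<^bsub>U\<^esub> z = x \<otimes>\<^bsub>U\<^esub> (y \<otimes>\<^bsub>U\<^esub> z)" if xyz: "x \<in> carrier U" "y \<in> carrier U" "z \<in> carrier U" for x y z
  proof -
    obtain i where i: "x \<in> carrier (Gs i)" "y \<in> carrier (Gs i)" using two_stages[OF xyz(1,2)] .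
    obtain j where j: "z \<in> carrier (Gs j)" using xyz(3) by (auto simp: carrier_U)
    define n where "n = max i j"
    have n: "x \<in> carrier (Gs n)" "y \<in> carrier (Gs n)" "z \<in> carrier (Gs n)"
      using i j carrier_mem[of i n] carrier_mem[of j n] by (auto simp: n_def)
    interpret group "Gs n" by (rule group_stage)
    show ?thesis using n by (simp add: U_mult[of _ n] m_assoc)
  qed
  fix x assume x: "x \<in> carrier U"
  obtain n where n: "x \<in> carrier (Gs n)" using x by (auto simp: carrier_U)
  interpret group "Gs n" by (rule group_stage)
  show "\<one>\<^bsub>U\<^esub> \<otimes>\<^bsub>U\<^esub> x = x" using n by (simp add: U_one[of n] U_mult[of _ n])
  show "\<exists>y\<in>carrier U. y \<otimes>\<^bsub>U\<^esub> x = \<one>\<^bsub>U\<^esub>"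
    using n U_mem[of "inv\<^bsub>Gs n\<^esub> x" n] by (intro bexI[of _ "inv\<^bsub>Gs n\<^esub> x"]) (simp_all add: U_one[of n] U_mult[of _ n])
qed

lemma U_inv: "x \<in> carrier (Gs n) \<Longrightarrow> inv\<^bsub>U\<^esub> x = inv\<^bsub>Gs n\<^esub> x"
proof -
  assume x: "x \<in> carrier (Gs n)"
  interpret group "Gs n" by (rule group_stage)
  interpret U: group U by (rule group_U)
  show ?thesis using x U_mem[of _ n] by (intro U.inv_equality) (simp_all add: U_one[of n] U_mult[of _ n])
qed

lemma U_conj: "x \<in> carrier (Gs n) \<Longrightarrow> y \<in> carrier (Gs n) \<Longrightarrow> conj_by U x y = conj_by (Gs n) x y"
proof -
  assume xy: "x \<in> carrier (Gs n)" "y \<in> carrier (Gs n)"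
  interpret group "Gs n" by (rule group_stage)
  show ?thesis using xy by (simp add: conj_by_def U_inv[of _ n] U_mult[of _ n])
qed

lemma U_expo_total: "x \<in> carrier U \<Longrightarrow> \<alpha> \<in> carrier A \<Longrightarrow> expo U x \<alpha> \<noteq> None"
proof -
  assume x: "x \<in> carrier U" and \<alpha>: "\<alpha> \<in> carrier A"
  obtain n where n: "x \<in> carrier (Gs n)" using x by (auto simp: carrier_U)
  obtain y where "expo (Gs (Suc n)) x \<alpha> = Some y" using total_Suc[OF n \<alpha>] by blast
  then show ?thesis using U_expo_iff[OF x \<alpha>, of y] n carrier_Suc[of n] by auto
qed

lemma U_expo_stage:
  assumes x: "x \<in> carrier (Gs n)" and \<alpha>: "\<alpha> \<in> carrier A"
  shows "expo U x \<alpha> = expo (Gs (Suc n)) x \<alpha>"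
proof -
  obtain y where "expo (Gs (Suc n)) x \<alpha> = Some y" using total_Suc[OF x \<alpha>] by blast
  moreover from this have "expo U x \<alpha> = Some y"
    using U_expo_iff[OF U_mem[OF x] \<alpha>] carrier_mem[of n "Suc n" x] x by auto
  ultimately show ?thesis by simp
qed

lemma exp_group_U: "exp_group A U"
proof -
  have "partial_exp_group A U"
  proof (rule partial_exp_groupI)
    show "ring A" "group U" by (rule A.ring_axioms group_U)+
    \<comment> \<open>The powers of an element of stage n are all defined from stage n + 1 on and no
      longer change.\<close>
    have ex: "expo U x \<alpha> = expo (Gs m) x \<alpha>" if x: "x \<in> carrier (Gs n)" "\<alpha> \<in> carrier A" "n < m" for x \<alpha> n m
    proof -
      obtain y where y: "expo (Gs (Suc n)) x \<alpha> = Some y" using total_Suc[OF x(1,2)] by blast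
      have "expo (Gs m) x \<alpha> = Some y"
        using expo_mono[of "Suc n" m x \<alpha> y] y x carrier_mem[of n "Suc n" x] by simp
      then show ?thesis using U_expo_stage[OF x(1,2)] y by simp
    qed
    show "expo U \<one>\<^bsub>U\<^esub> \<alpha> = Some \<one>\<^bsub>U\<^esub>" if "\<alpha> \<in> carrier A" for \<alpha>
    proof -
      interpret P: partial_exp_group A "Gs (Suc 0)" by (rule stage)
      interpret P0: partial_exp_group A "Gs 0" by (rule stage)
      show ?thesis using ex[OF P0.G.one_closed that, of "Suc 0"] P.one_expo[OF that] by (simp add: U_one[of 0] one_Suc)
    qed
    fix g assume g: "g \<in> carrier U"
    obtain n where n: "g \<in> carrier (Gs n)" using g by (auto simp: carrier_U)
    interpret P: partial_exp_group A "Gs (Suc n)" by (rule stage)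
    interpret PP: partial_exp_group A "Gs (Suc (Suc n))" by (rule stage)
    have n': "g \<in> carrier (Gs (Suc n))" "g \<in> carrier (Gs (Suc (Suc n)))"
      using n carrier_mem[of n "Suc n"] carrier_mem[of n "Suc (Suc n)"] by simp_all
    note eg = ex[OF n]
    show "x \<in> carrier U" if "\<alpha> \<in> carrier A" "expo U g \<alpha> = Some x" for \<alpha> x
      using that eg[OF that(1), of "Suc n"] P.expo_closed[OF n'(1) that(1), of x] U_mem by simp
    show "expo U g \<one>\<^bsub>A\<^esub> = Some g" using eg[of "\<one>\<^bsub>A\<^esub>" "Suc n"] P.expo_one[OF n'(1)] by simp
    show "expo U g \<zero>\<^bsub>A\<^esub> = Some \<one>\<^bsub>U\<^esub>" using eg[of "\<zero>\<^bsub>A\<^esub>" "Suc n"] P.expo_zero[OF n'(1)] by (simp add: U_one[of "Suc n"])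
    show "expo U g (\<alpha> \<oplus>\<^bsub>A\<^esub> \<beta>) = Some (x \<otimes>\<^bsub>U\<^esub> y)"
      if a: "\<alpha> \<in> carrier A" "\<beta> \<in> carrier A" "expo U g \<alpha> = Some x" "expo U g \<beta> = Some y" for \<alpha> \<beta> x y
    proof -
      have e: "expo (Gs (Suc n)) g \<alpha> = Some x" "expo (Gs (Suc n)) g \<beta> = Some y" using a eg[of _ "Suc n"] by simp_all
      have "x \<otimes>\<^bsub>U\<^esub> y = x \<otimes>\<^bsub>Gs (Suc n)\<^esub> y"
        using P.expo_closed[OF n'(1) a(1) e(1)] P.expo_closed[OF n'(1) a(2) e(2)] by (rule U_mult)
      then show ?thesis using P.expo_add[OF n'(1) a(1,2) e] eg[of "\<alpha> \<oplus>\<^bsub>A\<^esub> \<beta>" "Suc n"] a by simp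
    qed
    show "expo U g (\<alpha> \<otimes>\<^bsub>A\<^esub> \<beta>) = Some y"
      if a: "\<alpha> \<in> carrier A" "\<beta> \<in> carrier A" "expo U g \<alpha> = Some x" "expo U x \<beta> = Some y" for \<alpha> \<beta> x y
    proof -
      \<comment> \<open>The power \<open>x\<close> is known to lie in stage n + 1, so its own powers
        are taken from stage n + 2.\<close>
      have "expo (Gs (Suc n)) g \<alpha> = Some x" using a eg[of \<alpha> "Suc n"] by simp
      then have "x \<in> carrier (Gs (Suc n))" using P.expo_closed[OF n'(1) a(1)] by simp
      then have "expo (Gs (Suc (Suc n))) x \<beta> = Some y" using ex[of x "Suc n" \<beta> "Suc (Suc n)"] a by simp
      moreover have "expo (Gs (Suc (Suc n))) g \<alpha> = Some x" using a eg[of \<alpha> "Suc (Suc n)"] by simp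
      ultimately show ?thesis
        using PP.expo_mult[OF n'(2) a(1,2)] eg[of "\<alpha> \<otimes>\<^bsub>A\<^esub> \<beta>" "Suc (Suc n)"] a by simp
    qed
    fix h assume h: "h \<in> carrier U"
    obtain m where m: "g \<in> carrier (Gs m)" "h \<in> carrier (Gs m)" using two_stages[OF g h] .
    interpret Q0: partial_exp_group A "Gs m" by (rule stage)
    interpret Q: partial_exp_group A "Gs (Suc m)" by (rule stage)
    have m': "g \<in> carrier (Gs (Suc m))" "h \<in> carrier (Gs (Suc m))" using m carrier_mem[of m "Suc m"] by simp_all
    show "expo U (conj_by U h g) \<alpha> = map_option (conj_by U h) (expo U g \<alpha>)" if \<alpha>: "\<alpha> \<in> carrier A" for \<alpha>
    proof -
      have c: "conj_by U h g \<in> carrier (Gs m)" using m U_conj[OF m(2,1)] by simp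
      obtain y where y: "expo (Gs (Suc m)) g \<alpha> = Some y" using total_Suc[OF m(1) \<alpha>] by blast
      have "y \<in> carrier (Gs (Suc m))" by (rule Q.expo_closed[OF m'(1) \<alpha> y])
      then have "conj_by U h y = conj_by (Gs (Suc m)) h y" by (rule U_conj[OF m'(2)])
      then show ?thesis
        using Q.expo_conj[OF m' \<alpha>] y ex[OF c \<alpha>, of "Suc m"] ex[OF m(1) \<alpha>, of "Suc m"] U_conj[OF m'(2,1)] by simp
    qed
    show "expo U (g \<otimes>\<^bsub>U\<^esub> h) \<alpha> = Some (x \<otimes>\<^bsub>U\<^esub> y)"
      if \<alpha>: "\<alpha> \<in> carrier A" and c: "g \<otimes>\<^bsub>U\<^esub> h = h \<otimes>\<^bsub>U\<^esub> g" and xy: "expo U g \<alpha> = Some x" "expo U h \<alpha> = Some y" for \<alpha> x y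
    proof -
      have e: "expo (Gs (Suc m)) g \<alpha> = Some x" "expo (Gs (Suc m)) h \<alpha> = Some y"
        using xy ex[OF m(1) \<alpha>, of "Suc m"] ex[OF m(2) \<alpha>, of "Suc m"] by simp_all
      have "x \<otimes>\<^bsub>U\<^esub> y = x \<otimes>\<^bsub>Gs (Suc m)\<^esub> y"
        using Q.expo_closed[OF m'(1) \<alpha> e(1)] Q.expo_closed[OF m'(2) \<alpha> e(2)] by (rule U_mult)
      moreover have "g \<otimes>\<^bsub>U\<^esub> h = g \<otimes>\<^bsub>Gs (Suc m)\<^esub> h" "h \<otimes>\<^bsub>U\<^esub> g = h \<otimes>\<^bsub>Gs (Suc m)\<^esub> g" using U_mult m' by blast+
      moreover have "g \<otimes>\<^bsub>U\<^esub> h \<in> carrier (Gs m)" using U_mult[OF m] m by simp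
      ultimately show ?thesis using Q.expo_commute[OF m' \<alpha> _ e] c ex[of "g \<otimes>\<^bsub>U\<^esub> h" m \<alpha> "Suc m"] \<alpha> by simp
    qed
  qed
  then show ?thesis using U_expo_total by (simp add: exp_group_def exp_group_axioms_def)
qed

lemma generated_stage: "carrier (Gs n) \<subseteq> exp_generate A U (carrier (Gs 0))"
proof (induction n)
  case 0
  then show ?case by (auto intro: exp_generate.incl)
next
  case (Suc n)
  interpret P: partial_exp_group A "Gs (Suc n)" by (rule stage)
  have "x \<in> carrier (Gs (Suc n)) \<and> x \<in> exp_generate A U (carrier (Gs 0))"
    if "x \<in> exp_generate A (Gs (Suc n)) (carrier (Gs n))" for x
    using that
  proof (induction rule: exp_generate.induct)
    case one
    then show ?case using exp_generate.one[of U A] by (simp add: U_one[of "Suc n"])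
  next
    case (incl s)
    then show ?case using Suc carrier_Suc by blast
  next
    case (inv x)
    then show ?case using exp_generate.inv[of x A U] U_inv[of x "Suc n"] by auto
  next
    case (mult x y)
    then show ?case using exp_generate.mult[of x A U _ y] U_mult[of x "Suc n" y] by auto
  next
    case (expo x \<alpha> y)
    have "expo U x \<alpha> = Some y" using U_expo_iff[of x \<alpha> y] U_mem expo by blast
    then show ?case using expo exp_generate.expo[of x A U _ \<alpha> y] P.expo_closed by blast
  qed
  then show ?case using generate_Suc by blast
qed

lemma U_generated: "exp_generate A U (carrier (Gs 0)) = carrier U"
proof
  interpret U: exp_group A U by (rule exp_group_U)
  show "carrier U \<subseteq> exp_generate A U (carrier (Gs 0))" using generated_stage by (auto simp: carrier_U)
  show "exp_generate A U (carrier (Gs 0)) \<subseteq> carrier U"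
  proof
    fix x assume "x \<in> exp_generate A U (carrier (Gs 0))"
    then show "x \<in> carrier U"
    proof (induction rule: exp_generate.induct)
      case (expo x \<alpha> y)
      then show ?case using U.expo_closed by blast
    qed (auto intro: U_mem U.G.one_closed U.G.inv_closed U.G.m_closed)
  qed
qed

text \<open>Extensions over single steps are chosen successively, each prolonging the preceding one,
  so that they glue.\<close>

lemma U_extend:
  assumes "\<And>n f. f \<in> exp_hom A (Gs n) Q \<Longrightarrow> \<exists>F\<in>exp_hom A (Gs (Suc n)) Q. \<forall>g\<in>carrier (Gs n). F g = f g"
    and f: "f \<in> exp_hom A (Gs 0) Q"
  shows "\<exists>F\<in>exp_hom A U Q. \<forall>g\<in>carrier (Gs 0). F g = f g"
proof -
  have "\<exists>Fs. \<forall>n. (Fs n \<in> exp_hom A (Gs n) Q \<and> (n = 0 \<longrightarrow> Fs n = f)) \<and> (\<forall>g\<in>carrier (Gs n). Fs (Suc n) g = Fs n g)"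
    by (rule dependent_nat_choice) (use assms in \<open>auto simp: Bex_def\<close>)
  then obtain Fs where Fs: "\<And>n. Fs n \<in> exp_hom A (Gs n) Q" "Fs 0 = f" "\<And>n g. g \<in> carrier (Gs n) \<Longrightarrow> Fs (Suc n) g = Fs n g"
    by metis
  have mono: "Fs n g = Fs m g" if "m \<le> n" "g \<in> carrier (Gs m)" for m n g
    using that
  proof (induction n rule: dec_induct)
    case (step n)
    then show ?case using Fs(3)[of g n] carrier_mem[of m n] by simp
  qed simp
  define F where "F x = Fs (LEAST n. x \<in> carrier (Gs n)) x" for x
  have F: "F x = Fs n x" if "x \<in> carrier (Gs n)" for x n
  proof -
    have "x \<in> carrier (Gs (LEAST n. x \<in> carrier (Gs n)))" "(LEAST n. x \<in> carrier (Gs n)) \<le> n"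
      using that by (auto intro: LeastI Least_le)
    then show ?thesis using mono[of "LEAST n. x \<in> carrier (Gs n)" n x] by (simp add: F_def)
  qed
  have hom: "Fs n \<in> hom (Gs n) Q" for n using Fs(1) by (auto simp: exp_hom_def)
  have "F \<in> exp_hom A U Q"
    unfolding exp_hom_def
  proof (intro CollectI conjI homI ballI allI impI)
    show "F x \<in> carrier Q" if x: "x \<in> carrier U" for x
    proof -
      obtain n where n: "x \<in> carrier (Gs n)" using x by (auto simp: carrier_U)
      then show ?thesis using F[OF n] hom_in_carrier[OF hom n] by simp
    qed
    show "F (x \<otimes>\<^bsub>U\<^esub> y) = F x \<otimes>\<^bsub>Q\<^esub> F y" if xy: "x \<in> carrier U" "y \<in> carrier U" for x y
    proof -
      obtain n where n: "x \<in> carrier (Gs n)" "y \<in> carrier (Gs n)" using two_stages[OF xy] .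
      interpret group "Gs n" by (rule group_stage)
      show ?thesis using hom_mult[OF hom n] F[OF n(1)] F[OF n(2)] F[of "x \<otimes>\<^bsub>Gs n\<^esub> y" n] U_mult[OF n] n by simp
    qed
    fix x \<alpha> y assume x: "x \<in> carrier U" and \<alpha>: "\<alpha> \<in> carrier A" and e: "expo U x \<alpha> = Some y"
    then obtain n where n: "x \<in> carrier (Gs n)" "expo (Gs n) x \<alpha> = Some y" using U_expo_iff by blast
    interpret P: partial_exp_group A "Gs n" by (rule stage)
    show "expo Q (F x) \<alpha> = Some (F y)"
      using Fs(1)[of n] n \<alpha> F[OF n(1)] F[OF P.expo_closed[OF n(1) \<alpha> n(2)]] by (auto simp: exp_hom_def)
  qed
  then show ?thesis using F[of _ 0] Fs(2) by auto
qed

end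

section \<open>Universal property of the union\<close>

lemma exp_hom_eq_on_generate:
  assumes U: "exp_group A U" and Q: "exp_group A Q" and f: "f \<in> exp_hom A U Q" and g: "g \<in> exp_hom A U Q"
    and S: "S \<subseteq> carrier U" "\<And>s. s \<in> S \<Longrightarrow> f s = g s" and x: "x \<in> exp_generate A U S"
  shows "x \<in> carrier U \<and> f x = g x"
proof -
  interpret U: exp_group A U by fact
  interpret Q: exp_group A Q by fact
  interpret f: group_hom U Q f using f U.G.is_group Q.G.is_group by (simp add: exp_hom_def group_hom_def group_hom_axioms_def)
  interpret g: group_hom U Q g using g U.G.is_group Q.G.is_group by (simp add: exp_hom_def group_hom_def group_hom_axioms_def)
  show ?thesis using x
  proof (induction rule: exp_generate.induct)
    case (incl s)
    then show ?case using S by blast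
  next
    case (expo x \<alpha> y)
    then have "expo Q (f x) \<alpha> = Some (f y)" "expo Q (g x) \<alpha> = Some (g y)" using f g by (auto simp: exp_hom_def)
    then show ?case using expo U.expo_closed by auto
  qed auto
qed

lemma chain_union_tensor_completion:
  fixes A :: "('r, 'n) ring_scheme" and G :: "('g, 'r) exp_struct" and Gs :: "nat \<Rightarrow> ('u, 'r) exp_struct"
  assumes A: "ring A" and char_zero: "\<And>n :: int. [n] \<cdot>\<^bsub>A\<^esub> \<one>\<^bsub>A\<^esub> = \<zero>\<^bsub>A\<^esub> \<Longrightarrow> n = 0"
    and G: "faithful_CSA A G" and chain: "centralizer_chain A G Gs \<iota>"
  shows "is_tensor_completion TYPE('h) A G (chain_union Gs) \<iota>"
proof -
  have ch: "group (Gs 0)" "\<iota> \<in> exp_iso A G (Gs 0)"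
    "\<And>n. \<exists>\<C>. condition_S A (Gs n) \<C> \<and> is_centralizer_extension A (Gs n) \<C> (Gs (Suc n))"
    using chain by (auto simp: centralizer_chain_def)
  have good: "faithful_CSA A (Gs n)" for n
  proof (induction n)
    case 0
    interpret exp_group_iso A G "Gs 0" \<iota>
      using G ch by (simp add: exp_group_iso_def exp_group_iso_axioms_def faithful_CSA_def)
    show ?case by (rule faithful_CSA_H[OF G])
  next
    case (Suc n)
    obtain \<C> where \<C>: "condition_S A (Gs n) \<C>" "is_centralizer_extension A (Gs n) \<C> (Gs (Suc n))" using ch(3) by blast
    obtain \<theta> where "ext_exp A (Gs n) (Gs (Suc n)) \<C> \<theta>"
      using centralizer_extension_ext_exp[OF char_zero Suc \<C>] by metis
    then interpret X: ext_exp A "Gs n" "Gs (Suc n)" \<C> \<theta> .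
    \<comment> \<open>That stage n + 1 is CSA is extracted from stage n + 2, which the chain
      provides as well.\<close>
    obtain \<C>' where \<C>': "condition_S A (Gs (Suc n)) \<C>'" "is_centralizer_extension A (Gs (Suc n)) \<C>' (Gs (Suc (Suc n)))"
      using ch(3) by blast
    obtain \<theta>' where \<theta>': "\<theta>' \<in> iso (ext_group A (Gs (Suc n)) \<C>') (Gs (Suc (Suc n)))"
      "\<And>x \<alpha> z. x \<in> carrier (ext_group A (Gs (Suc n)) \<C>') \<Longrightarrow> \<alpha> \<in> carrier A \<Longrightarrow>
        expo (Gs (Suc (Suc n))) (\<theta>' x) \<alpha> = Some z \<longleftrightarrow> (\<exists>y. ext_expo A (Gs (Suc n)) \<C>' x \<alpha> y \<and> z = \<theta>' y)"
      and g': "group (Gs (Suc (Suc n)))"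
      using \<C>'(2) unfolding is_centralizer_extension_def by blast
    have "CSA (Gs n)" using Suc by (simp add: faithful_CSA_def)
    then have "CSA (Gs (Suc n))" using \<C>'(1) g' \<theta>' by (rule X.CSA_ext_of_next)
    then show ?case
      unfolding faithful_CSA_def
      using X.XE.partial_exp_group_axioms X.nonabelian_ext X.faithful_ext by blast
  qed
  have step: "carrier (Gs n) \<subseteq> carrier (Gs (Suc n)) \<and>
      (\<forall>x\<in>carrier (Gs n). \<forall>y\<in>carrier (Gs n). x \<otimes>\<^bsub>Gs (Suc n)\<^esub> y = x \<otimes>\<^bsub>Gs n\<^esub> y) \<and>
      \<one>\<^bsub>Gs (Suc n)\<^esub> = \<one>\<^bsub>Gs n\<^esub> \<and>
      (\<forall>x\<in>carrier (Gs n). \<forall>\<alpha>\<in>carrier A. \<forall>y. expo (Gs n) x \<alpha> = Some y \<longrightarrow> expo (Gs (Suc n)) x \<alpha> = Some y) \<and>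
      (\<forall>x\<in>carrier (Gs n). \<forall>\<alpha>\<in>carrier A. expo (Gs (Suc n)) x \<alpha> \<noteq> None) \<and>
      carrier (Gs (Suc n)) \<subseteq> exp_generate A (Gs (Suc n)) (carrier (Gs n)) \<and>
      (\<forall>Q :: ('h, 'r) exp_struct. \<forall>f. exp_group A Q \<longrightarrow> f \<in> exp_hom A (Gs n) Q \<longrightarrow>
        (\<exists>F\<in>exp_hom A (Gs (Suc n)) Q. \<forall>g\<in>carrier (Gs n). F g = f g))" for n
  proof -
    obtain \<C> where \<C>: "condition_S A (Gs n) \<C>" "is_centralizer_extension A (Gs n) \<C> (Gs (Suc n))" using ch(3) by blast
    obtain \<theta> where \<theta>: "ext_exp A (Gs n) (Gs (Suc n)) \<C> \<theta>" "\<And>g. g \<in> carrier (Gs n) \<Longrightarrow> \<theta> (ext_central A (Gs n) \<C> g) = g"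
      using centralizer_extension_ext_exp[OF char_zero good \<C>] by metis
    from \<theta>(1) interpret X: ext_exp A "Gs n" "Gs (Suc n)" \<C> \<theta> .
    \<comment> \<open>The isomorphism is the identity on stage n, so the embedding of the central
      vertex group is an inclusion.\<close>
    have cen: "X.S.cen g = g" if "g \<in> carrier (Gs n)" for g using \<theta>(2)[OF that] by (simp add: X.cen_eq)
    have im: "X.S.cen ` carrier (Gs n) = carrier (Gs n)" using cen by simp
    show ?thesis
    proof (intro conjI ballI allI impI)
      show "carrier (Gs n) \<subseteq> carrier (Gs (Suc n))" using X.S.cen_closed cen by (metis subsetI)
      show "x \<otimes>\<^bsub>Gs (Suc n)\<^esub> y = x \<otimes>\<^bsub>Gs n\<^esub> y" if "x \<in> carrier (Gs n)" "y \<in> carrier (Gs n)" for x y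
        using X.S.cen_mult[OF that] that by (simp add: cen)
      show "\<one>\<^bsub>Gs (Suc n)\<^esub> = \<one>\<^bsub>Gs n\<^esub>" using X.S.cen_one cen[OF X.G.one_closed] by simp
      show "expo (Gs (Suc n)) x \<alpha> = Some y" if "x \<in> carrier (Gs n)" "\<alpha> \<in> carrier A" "expo (Gs n) x \<alpha> = Some y" for x \<alpha> y
      proof -
        have "expo (Gs (Suc n)) (X.S.cen x) \<alpha> = Some (X.S.cen y)" using X.cen_exp_hom that unfolding exp_hom_def by blast
        then show ?thesis using cen[OF that(1)] cen[OF X.expo_closed[OF that]] by simp
      qed
      show "expo (Gs (Suc n)) x \<alpha> \<noteq> None" if "x \<in> carrier (Gs n)" "\<alpha> \<in> carrier A" for x \<alpha>
        using X.cen_expo_total[OF that] cen[OF that(1)] by simp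
      show "carrier (Gs (Suc n)) \<subseteq> exp_generate A (Gs (Suc n)) (carrier (Gs n))" using X.carrier_generated im by simp
      show "\<exists>F\<in>exp_hom A (Gs (Suc n)) Q. \<forall>g\<in>carrier (Gs n). F g = f g"
        if "exp_group A Q" "f \<in> exp_hom A (Gs n) Q" for Q :: "('h, 'r) exp_struct" and f
        using X.ext_universal[OF that] cen by simp
    qed
  qed
  interpret exp_chain A Gs
  proof (intro exp_chain.intro exp_chain_axioms.intro A)
    show "partial_exp_group A (Gs n)" for n using good by (simp add: faithful_CSA_def)
  qed (use step in blast)+
  interpret U: exp_group A U by (rule exp_group_U)
  interpret i: exp_group_iso A G "Gs 0" \<iota>
    using G ch by (simp add: exp_group_iso_def exp_group_iso_axioms_def faithful_CSA_def)
  have \<iota>: "\<iota> \<in> exp_hom A G U"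
    unfolding exp_hom_def
  proof (intro CollectI conjI homI ballI allI impI)
    show "\<iota> x \<in> carrier U" if "x \<in> carrier G" for x using U_mem[of "\<iota> x" 0] that by simp
    show "\<iota> (x \<otimes>\<^bsub>G\<^esub> y) = \<iota> x \<otimes>\<^bsub>U\<^esub> \<iota> y" if "x \<in> carrier G" "y \<in> carrier G" for x y
      using U_mult[of "\<iota> x" 0 "\<iota> y"] that by simp
    show "expo U (\<iota> x) \<alpha> = Some (\<iota> y)" if "x \<in> carrier G" "\<alpha> \<in> carrier A" "expo G x \<alpha> = Some y" for x \<alpha> y
    proof -
      have "expo (Gs 0) (\<iota> x) \<alpha> = Some (\<iota> y)" using i.f_expo[OF that(1,2)] that(3) by simp
      moreover have "\<iota> x \<in> carrier (Gs 0)" using that by simp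
      ultimately show ?thesis using U_expo_iff[OF U_mem that(2)] by blast
    qed
  qed
  show ?thesis
    unfolding is_tensor_completion_def
  proof (intro conjI allI impI)
    show "exp_group A U" by (rule exp_group_U)
    show "\<iota> \<in> exp_hom A G U" by (rule \<iota>)
    show "exp_generate A U (\<iota> ` carrier G) = carrier U" using U_generated i.f_surj by simp
    fix Q :: "('h, 'r) exp_struct" and \<phi> assume Q: "exp_group A Q" and \<phi>: "\<phi> \<in> exp_hom A G Q"
    interpret Q: exp_group A Q by fact
    \<comment> \<open>The map \<open>\<phi>\<close> is moved to the copy of \<open>G\<close> with
      which the chain starts.\<close>
    let ?k = "inv_into (carrier G) \<iota>"
    have ki: "?k (\<iota> x) = x" if "x \<in> carrier G" for x using i.f_inj that by simp
    have "\<phi> \<circ> ?k \<in> exp_hom A (Gs 0) Q"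
      unfolding exp_hom_def
    proof (intro CollectI conjI homI ballI allI impI)
      have h: "\<phi> \<in> hom G Q" using \<phi> by (simp add: exp_hom_def)
      fix x assume "x \<in> carrier (Gs 0)"
      then obtain a where a: "a \<in> carrier G" "x = \<iota> a" by (rule i.H_cases)
      show "(\<phi> \<circ> ?k) x \<in> carrier Q" using a ki hom_in_carrier[OF h] by simp
      show "(\<phi> \<circ> ?k) (x \<otimes>\<^bsub>Gs 0\<^esub> y) = (\<phi> \<circ> ?k) x \<otimes>\<^bsub>Q\<^esub> (\<phi> \<circ> ?k) y" if "y \<in> carrier (Gs 0)" for y
      proof -
        obtain b where b: "b \<in> carrier G" "y = \<iota> b" using \<open>y \<in> carrier (Gs 0)\<close> by (rule i.H_cases)
        have "x \<otimes>\<^bsub>Gs 0\<^esub> y = \<iota> (a \<otimes>\<^bsub>G\<^esub> b)" using a b by simp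
        then have "?k (x \<otimes>\<^bsub>Gs 0\<^esub> y) = a \<otimes>\<^bsub>G\<^esub> b" using ki[of "a \<otimes>\<^bsub>G\<^esub> b"] a b by simp
        then show ?thesis using a b ki hom_mult[OF h] by simp
      qed
      show "expo Q ((\<phi> \<circ> ?k) x) \<alpha> = Some ((\<phi> \<circ> ?k) y)" if \<alpha>: "\<alpha> \<in> carrier A" "expo (Gs 0) x \<alpha> = Some y" for \<alpha> y
      proof -
        obtain b where b: "expo G a \<alpha> = Some b" "y = \<iota> b" using i.f_expo[OF a(1) \<alpha>(1)] \<alpha>(2) a by auto
        have "b \<in> carrier G" using i.expo_closed[OF a(1) \<alpha>(1) b(1)] .
        then show ?thesis using \<phi> a b \<alpha>(1) ki by (simp add: exp_hom_def)
      qed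
    qed
    then obtain F where F: "F \<in> exp_hom A U Q" "\<And>g. g \<in> carrier (Gs 0) \<Longrightarrow> F g = (\<phi> \<circ> ?k) g"
      using U_extend[of Q "\<phi> \<circ> ?k"] step Q by metis
    \<comment> \<open>Outside the carrier the values are arbitrary; the restriction provides the
      extensional representative for which uniqueness is claimed.\<close>
    let ?F = "restrict F (carrier U)"
    have FU: "?F \<in> exp_hom A U Q"
      using F(1) U.expo_closed by (simp add: exp_hom_def hom_def Pi_iff)
    show "\<exists>!\<psi>. \<psi> \<in> exp_hom A U Q \<and> \<psi> \<in> extensional (carrier U) \<and> (\<forall>g\<in>carrier G. \<psi> (\<iota> g) = \<phi> g)"
    proof (rule ex1I[of _ ?F], intro conjI ballI)
      show "?F (\<iota> g) = \<phi> g" if "g \<in> carrier G" for g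
        using that F(2)[of "\<iota> g"] ki U_mem[of "\<iota> g" 0] by simp
      fix \<psi> assume \<psi>: "\<psi> \<in> exp_hom A U Q \<and> \<psi> \<in> extensional (carrier U) \<and> (\<forall>g\<in>carrier G. \<psi> (\<iota> g) = \<phi> g)"
      show "\<psi> = ?F"
      proof (rule extensionalityI[of _ "carrier U"])
        show "\<psi> x = ?F x" if x: "x \<in> carrier U" for x
        proof -
          have "\<psi> s = ?F s" if "s \<in> carrier (Gs 0)" for s
          proof -
            obtain a where a: "a \<in> carrier G" "s = \<iota> a" using \<open>s \<in> carrier (Gs 0)\<close> by (rule i.H_cases)
            then show ?thesis using \<psi> F(2)[of s] ki U_mem[OF that] that by simp
          qed
          moreover have "x \<in> exp_generate A U (carrier (Gs 0))" using U_generated x by simp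
          ultimately show ?thesis
            using exp_hom_eq_on_generate[OF exp_group_U Q _ FU, of \<psi> "carrier (Gs 0)" x] \<psi> U_mem by blast
        qed
      qed (use \<psi> in auto)
    qed (use FU in auto)
  qed
qed

section \<open>Existence\<close>

context group begin

lemma conjugate_in_refl: "C \<subseteq> carrier G \<Longrightarrow> conjugate_in G C C"
  unfolding conjugate_in_def by (intro bexI[of _ \<one>]) (force simp: subset_iff)+

lemma conjugate_in_sym:
  assumes "C \<subseteq> carrier G" "conjugate_in G C D" shows "conjugate_in G D C"
proof -
  obtain x where x: "x \<in> carrier G" "D = conj_by G x ` C" using assms(2) by (auto simp: conjugate_in_def)
  have "conj_by G (inv x) ` conj_by G x ` C = (\<lambda>c. c) ` C"
    unfolding image_image using assms(1) x(1) by (intro image_cong) auto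
  then have "C = conj_by G (inv x) ` D" using x(2) by simp
  then show ?thesis using x by (auto simp: conjugate_in_def)
qed

lemma conjugate_in_trans:
  assumes "B \<subseteq> carrier G" "conjugate_in G B C" "conjugate_in G C D" shows "conjugate_in G B D"
proof -
  obtain x where x: "x \<in> carrier G" "C = conj_by G x ` B" using assms(2) by (auto simp: conjugate_in_def)
  obtain y where y: "y \<in> carrier G" "D = conj_by G y ` C" using assms(3) by (auto simp: conjugate_in_def)
  have "D = conj_by G (x \<otimes> y) ` B"
    unfolding y(2) x(2) image_image using assms(1) x(1) y(1) by (intro image_cong) (auto simp: conj_by_conj_by)
  then show ?thesis using x y by (auto simp: conjugate_in_def)
qed

end

text \<open>One member is chosen from every conjugacy class of centralizers that are not modules.
  Conjugate centralizers define the same predicate under \<open>SOME\<close>, hence yield the same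
  choice.\<close>

lemma condition_S_exists:
  assumes "group G" shows "\<exists>\<C>. condition_S A G \<C>"
proof -
  interpret group G by fact
  define N where "N = {C \<in> centralizers G. \<not> is_exp_module A G C}"
  have NG: "C \<subseteq> carrier G" if "C \<in> N" for C using that centralizerD(1) by (auto simp: N_def centralizers_def)
  define r where "r C = (SOME D. D \<in> N \<and> conjugate_in G C D)" for C
  have r: "r C \<in> N \<and> conjugate_in G C (r C)" if "C \<in> N" for C
    unfolding r_def by (rule someI[of _ C]) (use that conjugate_in_refl NG in blast)
  have r_eq: "r C = r D" if "C \<in> N" "D \<in> N" "conjugate_in G C D" for C D
  proof -
    have "conjugate_in G C B \<longleftrightarrow> conjugate_in G D B" for B
      using that NG conjugate_in_sym conjugate_in_trans by metis
    then show ?thesis by (simp add: r_def)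
  qed
  have "condition_S A G (r ` N)"
    unfolding condition_S_def
  proof (intro conjI ballI impI)
    show "r ` N \<subseteq> centralizers G" using r by (auto simp: N_def)
    show "\<not> is_exp_module A G C" if "C \<in> r ` N" for C using that r by (auto simp: N_def)
    show "\<not> conjugate_in G C D" if CD: "C \<in> r ` N" "D \<in> r ` N" "C \<noteq> D" for C D
    proof
      assume con: "conjugate_in G C D"
      obtain C0 D0 where 0: "C0 \<in> N" "C = r C0" "D0 \<in> N" "D = r D0" using CD by blast
      have "conjugate_in G C0 D" using conjugate_in_trans[OF NG[OF 0(1)]] r[OF 0(1)] con 0(2) by metis
      moreover have "conjugate_in G D D0" using conjugate_in_sym[OF NG[OF 0(3)]] r[OF 0(3)] 0(4) by metis
      ultimately have "conjugate_in G C0 D0" using conjugate_in_trans[OF NG[OF 0(1)]] by metis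
      then show False using r_eq[OF 0(1,3)] 0 CD(3) by simp
    qed
    show "\<exists>D\<in>r ` N. conjugate_in G C D" if "C \<in> centralizers G" "\<not> is_exp_module A G C" for C
      using that r[of C] by (auto simp: N_def)
  qed
  then show ?thesis by blast
qed

section \<open>Coding into a single type\<close>

primrec interleave :: "'a \<Rightarrow> 'a \<Rightarrow> 'a list list \<Rightarrow> 'a list" where
  "interleave a b [] = []"
| "interleave a b (xs # xss) = concat (map (\<lambda>x. [a, x]) xs) @ b # interleave a b xss"

text \<open>The marker \<open>a\<close> precedes every entry and \<open>b\<close> ends every list.
  Reading from the left, the next letter always tells whether an entry or an end follows, even if
  the entries themselves are markers.\<close>

lemma interleave_inj:
  assumes "a \<noteq> b" shows "inj (interleave a b)"
proof (rule injI)
  have cancel: "xs = ys \<and> r = s"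
    if "concat (map (\<lambda>x. [a, x]) xs) @ b # r = concat (map (\<lambda>x. [a, x]) ys) @ b # s" for xs ys r s
    using that
  proof (induction xs arbitrary: ys)
    case Nil
    then show ?case using assms by (cases ys) auto
  next
    case (Cons x xs)
    then show ?case using assms by (cases ys) auto
  qed
  show "v = w" if "interleave a b v = interleave a b w" for v w
    using that
  proof (induction v arbitrary: w)
    case Nil
    then show ?case by (cases w) auto
  next
    case (Cons xs xss)
    then show ?case by (cases w) (auto dest!: cancel)
  qed
qed

text \<open>The two summands of the type supply the two distinct markers, so lists of lists are
  coded without enlarging the type.\<close>

definition code_list :: "('g + 'r) list list \<Rightarrow> ('g + 'r) list" where
  "code_list = interleave (Inl undefined) (Inr undefined)"

lemma code_list_inj: "inj code_list"
  unfolding code_list_def by (rule interleave_inj) simp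

text \<open>The tag records the stage at which an element first appears, so that the new elements of an extension
  do not clash with the old ones.\<close>

definition tag :: "nat \<Rightarrow> ('g + 'r) list \<Rightarrow> ('g + 'r) list" where
  "tag n w = replicate n (Inl undefined) @ Inr undefined # w"

lemma tag_eq_iff [simp]: "tag n w = tag m v \<longleftrightarrow> n = m \<and> w = v"
proof (induction n arbitrary: m)
  case 0
  then show ?case by (cases m) (auto simp: tag_def)
next
  case (Suc n)
  show ?case
  proof (cases m)
    case (Suc k)
    then show ?thesis using Suc.IH[of k] by (simp add: tag_def)
  qed (simp add: tag_def)
qed

text \<open>The lengths 1 and 3 of the lists keep the two kinds of letters apart.\<close>

fun code_letter :: "('g + 'r) list + ('g + 'r) list \<times> ('g + 'r) list \<times> 'r \<Rightarrow> ('g + 'r) list list" where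
  "code_letter (Inl g) = [g]"
| "code_letter (Inr (v, x, \<alpha>)) = [v, x, [Inr \<alpha>]]"

lemma code_letter_inj: "inj code_letter"
proof (rule injI)
  fix a b :: "('g + 'r) list + ('g + 'r) list \<times> ('g + 'r) list \<times> 'r" assume "code_letter a = code_letter b"
  then show "a = b" by (cases a rule: code_letter.cases; cases b rule: code_letter.cases) auto
qed

text \<open>The letter \<open>(v, x, \<alpha>)\<close> stands for \<open>x \<otimes> \<alpha>\<close> in the vertex group of the centralizer of \<open>v\<close>.\<close>

lemma (in ext_copy) carrier_covered:
  "\<exists>val :: ('g + 'g \<times> 'g \<times> 'r) list \<Rightarrow> 'u. carrier E \<subseteq> range val"
proof -
  define let_val :: "'g + 'g \<times> 'g \<times> 'r \<Rightarrow> 'u" where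
    "let_val = case_sum S.cen (\<lambda>(v, x, \<alpha>). S.out (centralizer G v) (tensor_data.ts A (sub_exp G (centralizer G v)) x \<alpha>))"
  \<comment> \<open>Letters of the type need not stand for elements of \<open>E\<close>; those that
    do not are skipped, so that every word has a value in \<open>E\<close>.\<close>
  define ok where "ok l \<longleftrightarrow> let_val l \<in> carrier E" for l
  define val where "val w = foldr (\<lambda>l y. if ok l then let_val l \<otimes>\<^bsub>E\<^esub> y else y) w \<one>\<^bsub>E\<^esub>" for w
  have val_closed: "val w \<in> carrier E" for w
    by (induction w) (simp_all add: val_def ok_def)
  have val_append: "val (v @ w) = val v \<otimes>\<^bsub>E\<^esub> val w" for v w
  proof (induction v)
    case (Cons l v)
    then show ?case using val_closed[of v] val_closed[of w] by (simp add: val_def ok_def E.m_assoc)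
  qed (use val_closed in \<open>simp add: val_def\<close>)
  have letter: "let_val l \<in> range val" if "let_val l \<in> carrier E" for l
    using that by (intro range_eqI[of _ _ "[l]"]) (simp add: val_def ok_def)
  have mult: "x \<otimes>\<^bsub>E\<^esub> y \<in> range val" if "x \<in> range val" "y \<in> range val" for x y
    using that val_append[symmetric] by (elim rangeE) (simp only: rangeI)
  have one: "\<one>\<^bsub>E\<^esub> \<in> range val" by (rule range_eqI[of _ _ "[]"]) (simp add: val_def)
  have cen: "S.cen g \<in> range val" if "g \<in> carrier G" for g
    using letter[of "Inl g"] that by (simp add: let_val_def)
  have out: "S.out C t \<in> range val" if C: "C \<in> \<C>" and t: "t \<in> carrier (tens C)" for C t
  proof -
    interpret T: tensor_data A "sub_exp G C" by (rule tensor_data_\<C>[OF C])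
    obtain v where v: "C = centralizer G v" using C by (elim \<C>_cases)
    have ts: "S.out C (T.ts x \<alpha>) \<in> range val" if "x \<in> carrier (sub_exp G C)" "\<alpha> \<in> carrier A" for x \<alpha>
      using letter[of "Inr (v, x, \<alpha>)"] S.out_closed[OF C T.ts_closed[OF that]] v by (simp add: let_val_def)
    \<comment> \<open>The inverse of x \<otimes> \<alpha> is x \<otimes> (-\<alpha>), which is a
      letter again, so products of letters suffice.\<close>
    have inv: "inv\<^bsub>tens C\<^esub> (T.ts x \<alpha>) = T.ts x (\<ominus>\<^bsub>A\<^esub> \<alpha>)" if "x \<in> carrier (sub_exp G C)" "\<alpha> \<in> carrier A" for x \<alpha>
      using T.ts_add[OF that(1), of "\<ominus>\<^bsub>A\<^esub> \<alpha>" \<alpha>] that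
      by (intro T.T.inv_equality) (simp_all add: A.l_neg T.ts_zero)
    have "S.out C t \<in> range val \<and> S.out C (inv\<^bsub>tens C\<^esub> t) \<in> range val"
      using t
    proof (induction rule: T.tensor_induct)
      case one
      then show ?case using S.out_one[OF C] \<open>\<one>\<^bsub>E\<^esub> \<in> range val\<close> by simp
    next
      case (gen x \<alpha>)
      then show ?case using ts[OF gen(1)] inv[OF gen] by simp
    next
      case (diff X Y)
      then show ?case
        using mult S.out_mult[OF C diff(1), of "inv\<^bsub>tens C\<^esub> Y"] S.out_mult[OF C diff(2), of "inv\<^bsub>tens C\<^esub> X"]
        by (simp add: T.T.inv_mult_group)
    qed
    then show ?thesis ..
  qed
  have "x \<in> range val" if "x \<in> carrier E" for x
    using that
  proof (induction rule: S.copy_induct)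
    case one
    show ?case by (rule \<open>\<one>\<^bsub>E\<^esub> \<in> range val\<close>)
  next
    case (central g x)
    show ?case by (rule mult[OF cen[OF central(1)] central(3)])
  next
    case (outer C t x)
    show ?case by (rule mult[OF out[OF outer(1,2)] outer(4)])
  qed
  then show ?thesis by blast
qed

text \<open>An extension consists of classes of words over a larger type than that of
  \<open>G\<close>, but each of its elements is the value of a word over \<open>G\<close> and the
  ring. Choosing such a word and coding it brings the extension back into the type of
  \<open>G\<close>, so that the chain can go on within one type.\<close>

lemma ext_copy_coded:
  fixes G :: "(('a + 'r) list, 'r) exp_struct" and E :: "('u, 'r) exp_struct"
  assumes "ext_copy A G E \<C> \<theta>"
  obtains J :: "'u \<Rightarrow> ('a + 'r) list" where "inj_on J (carrier E)"
proof -
  interpret ext_copy A G E \<C> \<theta> by fact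
  obtain val :: "(('a + 'r) list + ('a + 'r) list \<times> ('a + 'r) list \<times> 'r) list \<Rightarrow> 'u"
    where "carrier E \<subseteq> range val" using carrier_covered by blast
  then have "inj_on (inv_into UNIV val) (carrier E)" by (rule inj_on_inv_into)
  moreover have "inj (\<lambda>w. code_list (map (\<lambda>l. code_list (code_letter l)) w))"
    by (intro injI) (auto dest!: injD[OF code_list_inj] intro!: map_injective[OF _ inj_compose[OF code_list_inj code_letter_inj], unfolded comp_def])
  ultimately have "inj_on ((\<lambda>w. code_list (map (\<lambda>l. code_list (code_letter l)) w)) \<circ> inv_into UNIV val) (carrier E)"
    by (intro comp_inj_on) (auto intro: inj_on_subset)
  then show ?thesis using that by blast
qed

section \<open>Building the chain\<close>

definition image_exp :: "('g \<Rightarrow> 'h) \<Rightarrow> ('g, 'r) exp_struct \<Rightarrow> ('h, 'r) exp_struct" where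
  "image_exp f X = \<lparr>carrier = f ` carrier X,
     monoid.mult = (\<lambda>x y. f (inv_into (carrier X) f x \<otimes>\<^bsub>X\<^esub> inv_into (carrier X) f y)),
     one = f \<one>\<^bsub>X\<^esub>,
     expo = (\<lambda>x \<alpha>. map_option f (expo X (inv_into (carrier X) f x) \<alpha>))\<rparr>"

lemma image_exp_iso:
  assumes X: "group X" and f: "inj_on f (carrier X)"
  shows "group (image_exp f X)" "f \<in> exp_iso A X (image_exp f X)"
proof -
  interpret group X by fact
  have iso: "f \<in> iso X (image_exp f X)"
    using f unfolding iso_def by (auto simp: image_exp_def hom_def bij_betw_def)
  have "image_exp f X\<lparr>one := f \<one>\<^bsub>X\<^esub>\<rparr> = image_exp f X" by (simp add: image_exp_def)
  then show "group (image_exp f X)" using iso_imp_img_group[OF iso] by simp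
  show "f \<in> exp_iso A X (image_exp f X)"
    using iso f by (simp add: exp_iso_def) (simp add: image_exp_def)
qed

text \<open>The group of classes of words carries an exponentiation because
  \<open>ext_pow_unique\<close> excludes two values for one power.\<close>

lemma ext_exp_exists:
  assumes char_zero: "\<And>n :: int. [n] \<cdot>\<^bsub>A\<^esub> \<one>\<^bsub>A\<^esub> = \<zero>\<^bsub>A\<^esub> \<Longrightarrow> n = 0"
    and G: "faithful_CSA A G" and S: "condition_S A G \<C>"
  obtains E :: "(('g, 'r) ext_word set, 'r) exp_struct" where "ext_exp A G E \<C> id" "ext_group A G \<C> = monoid.truncate E"
proof -
  interpret faithful_exp_group A G by (rule faithful_CSA_imp_faithful_exp_group[OF G])
  let ?X = "ext_group A G \<C>"
  define E where "E = \<lparr>carrier = carrier ?X, monoid.mult = mult ?X, one = one ?X,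
    expo = (\<lambda>x \<alpha>. if \<exists>y. ext_expo A G \<C> x \<alpha> y then Some (SOME y. ext_expo A G \<C> x \<alpha> y) else None)\<rparr>"
  have E_simps: "carrier E = carrier ?X" "monoid.mult E = mult ?X" "one E = one ?X"
    by (simp_all add: E_def)
  have C: "\<C> \<subseteq> centralizers G" using S by (simp add: condition_S_def)
  have "group E" using group_ext_group[OF C] group_cong(1)[OF E_simps] by simp
  moreover have "id \<in> iso ?X E" by (auto simp: iso_def hom_def E_simps)
  moreover have "commuting_conj_trivial G" "\<not> comm_group G"
    using G G.CSA_imp_commuting_conj_trivial by (auto simp: faithful_CSA_def)
  ultimately interpret ext_step A G E \<C> id
    using faithful_exp_group_axioms C S char_zero
    by (simp add: ext_step_def ext_copy_def ext_copy_axioms_def ext_step_axioms_def)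
  have "ext_exp A G E \<C> id"
  proof unfold_locales
    fix x \<alpha> z assume x: "x \<in> carrier E" and \<alpha>: "\<alpha> \<in> carrier A"
    have iff: "ext_pow x \<alpha> y \<longleftrightarrow> ext_expo A G \<C> x \<alpha> y" for y
      using ext_pow_iff[of x \<alpha> y] x \<alpha> by (simp add: E_simps)
    have uniq: "y = y'" if "ext_expo A G \<C> x \<alpha> y" "ext_expo A G \<C> x \<alpha> y'" for y y'
      using ext_pow_unique[OF x \<alpha>] that iff by blast
    have "expo E x \<alpha> = Some z \<longleftrightarrow> ext_expo A G \<C> x \<alpha> z"
    proof (cases "\<exists>y. ext_expo A G \<C> x \<alpha> y")
      case True
      then have "ext_expo A G \<C> x \<alpha> (SOME y. ext_expo A G \<C> x \<alpha> y)" by (rule someI_ex)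
      then show ?thesis using True uniq by (auto simp: E_def)
    qed (auto simp: E_def)
    then show "expo E x \<alpha> = Some z \<longleftrightarrow> ext_pow x \<alpha> z" using iff by simp
  qed
  moreover have "?X = monoid.truncate E" by (simp add: monoid.defs E_simps)
  ultimately show ?thesis using that by blast
qed

text \<open>The clause on involutions keeps the next stage CSA, and the bound on the tags leaves tag
  n + 1 free for its new elements.\<close>

definition tagged_stage :: "('r, 'n) ring_scheme \<Rightarrow> nat \<Rightarrow> (('a + 'r) list, 'r) exp_struct \<Rightarrow> bool" where
  "tagged_stage A n G \<longleftrightarrow> faithful_CSA A G \<and>
     (\<forall>M. maximal_abelian G M \<longrightarrow> no_involutions (tensor A (sub_exp G M))) \<and>
     (\<forall>g\<in>carrier G. \<exists>m\<le>n. \<exists>w. g = tag m w)"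

lemma image_exp_tagged_stage:
  assumes G: "faithful_CSA A G" "\<And>M. maximal_abelian G M \<Longrightarrow> no_involutions (tensor A (sub_exp G M))"
    and f: "inj_on f (carrier G)" and tag: "\<And>g. g \<in> carrier G \<Longrightarrow> \<exists>m\<le>n. \<exists>w. f g = tag m w"
  shows "tagged_stage A n (image_exp f G)"
proof -
  interpret partial_exp_group A G using G(1) by (simp add: faithful_CSA_def)
  interpret exp_group_iso A G "image_exp f G" f
    using partial_exp_group_axioms image_exp_iso[OF G.is_group f]
    by (simp add: exp_group_iso_def exp_group_iso_axioms_def)
  have "no_involutions (tensor A (sub_exp (image_exp f G) M))" if "maximal_abelian (image_exp f G) M" for M
    using G maximal_abelian_H[OF _ _ that] unfolding faithful_CSA_def by metis
  then show ?thesis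
    using faithful_CSA_H[OF G(1)] tag f_surj unfolding tagged_stage_def by (metis imageE)
qed

lemma tagged_stage_Suc:
  fixes A :: "('r, 'n) ring_scheme" and G :: "(('a + 'r) list, 'r) exp_struct"
  assumes char_zero: "\<And>n :: int. [n] \<cdot>\<^bsub>A\<^esub> \<one>\<^bsub>A\<^esub> = \<zero>\<^bsub>A\<^esub> \<Longrightarrow> n = 0" and A: "no_involutions (add_monoid A)"
    and G: "tagged_stage A n G"
  obtains H \<C> where "tagged_stage A (Suc n) H" "condition_S A G \<C>" "is_centralizer_extension A G \<C> H"
proof -
  have F: "faithful_CSA A G" using G by (simp add: tagged_stage_def)
  have gG: "group G" using F by (simp add: faithful_CSA_def partial_exp_group_def)
  obtain \<C> where S: "condition_S A G \<C>" using condition_S_exists[OF gG] by blast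
  obtain E where E: "ext_exp A G E \<C> id" "ext_group A G \<C> = monoid.truncate E"
    using ext_exp_exists[OF char_zero F S] .
  interpret ext_exp A G E \<C> id by (rule E(1))
  have X: "carrier (ext_group A G \<C>) = carrier E" "mult (ext_group A G \<C>) = mult E"
    unfolding E(2) by (simp_all add: monoid.defs)
  have "no_involutions (tens C)" if "C \<in> \<C>" for C
    using that G G.commutation_transitive_maximal_abelian_centralizer[OF ct]
    by (elim \<C>_cases) (auto simp: tagged_stage_def)
  moreover have "no_involutions G" using G.CSA_no_involutions F by (simp add: faithful_CSA_def)
  ultimately have inv: "no_involutions E" using no_involutions_ext by blast
  have FE: "faithful_CSA A E"
    using XE.partial_exp_group_axioms nonabelian_ext CSA_ext_of_no_involutions[OF inv] faithful_ext
    by (simp add: faithful_CSA_def)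
  obtain J :: "_ \<Rightarrow> ('a + 'r) list" where J: "inj_on J (carrier E)"
    using ext_copy_coded[OF ext_copy_axioms] .
  define k where "k = inv_into (carrier G) S.cen"
  \<comment> \<open>Elements of \<open>G\<close> keep their names and new ones receive the fresh
    tag, so the extension contains \<open>G\<close> itself.\<close>
  define f where "f e = (if e \<in> S.cen ` carrier G then k e else tag (Suc n) (J e))" for e
  have k: "k (S.cen g) = g" if "g \<in> carrier G" for g using S.cen_inj that by (simp add: k_def)
  have f_cen: "f (S.cen g) = g" if "g \<in> carrier G" for g using k that by (simp add: f_def)
  have tagG: "\<exists>m\<le>n. \<exists>w. g = tag m w" if "g \<in> carrier G" for g using G that by (simp add: tagged_stage_def)
  have ne: "g \<noteq> tag (Suc n) w" if "g \<in> carrier G" for g w using tagG[OF that] by auto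
  have f_inj: "inj_on f (carrier E)"
  proof (rule inj_onI)
    fix x y assume xy: "x \<in> carrier E" "y \<in> carrier E" "f x = f y"
    show "x = y"
    proof (cases "x \<in> S.cen ` carrier G"; cases "y \<in> S.cen ` carrier G")
      assume "x \<in> S.cen ` carrier G" "y \<in> S.cen ` carrier G"
      then show ?thesis using xy(3) f_cen by (elim imageE) simp
    next
      assume *: "x \<in> S.cen ` carrier G" "y \<notin> S.cen ` carrier G"
      have "f x \<in> carrier G" using *(1) f_cen by (elim imageE) simp
      moreover have "f y = tag (Suc n) (J y)" using *(2) by (simp add: f_def)
      ultimately show ?thesis using ne xy(3) by metis
    next
      assume *: "x \<notin> S.cen ` carrier G" "y \<in> S.cen ` carrier G"
      have "f y \<in> carrier G" using *(2) f_cen by (elim imageE) simp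
      moreover have "f x = tag (Suc n) (J x)" using *(1) by (simp add: f_def)
      ultimately show ?thesis using ne xy(3) by metis
    next
      assume *: "x \<notin> S.cen ` carrier G" "y \<notin> S.cen ` carrier G"
      then have "J x = J y" using xy(3) by (simp add: f_def)
      then show ?thesis using inj_onD[OF J] xy by blast
    qed
  qed
  have f_tag: "\<exists>m\<le>Suc n. \<exists>w. f e = tag m w" for e
  proof (cases "e \<in> S.cen ` carrier G")
    case True
    then obtain g where g: "g \<in> carrier G" "e = S.cen g" by blast
    then obtain m w where "m \<le> n" "f e = tag m w" using tagG[OF g(1)] f_cen[OF g(1)] by auto
    then show ?thesis by (intro exI[of _ m]) simp
  qed (auto simp: f_def)
  define H where "H = image_exp f E"
  have H: "group H" "f \<in> exp_iso A E H" unfolding H_def using image_exp_iso[OF E.is_group f_inj] by auto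
  have "is_centralizer_extension A G \<C> H"
    unfolding is_centralizer_extension_def
  proof (intro conjI bexI[of _ f] ballI allI)
    show "group H" by (rule H(1))
    show "f \<in> iso (ext_group A G \<C>) H" using H(2) X by (simp add: exp_iso_def iso_def hom_def)
    show "f (ext_central A G \<C> g) = g" if "g \<in> carrier G" for g using f_cen[OF that] by (simp add: cen_eq)
    fix x \<alpha> z assume x: "x \<in> carrier (ext_group A G \<C>)" and \<alpha>: "\<alpha> \<in> carrier A"
    have "expo E x \<alpha> = Some y \<longleftrightarrow> ext_expo A G \<C> x \<alpha> y" for y
      using expo_ext[of x \<alpha> y] ext_pow_iff[OF x \<alpha>, of y] x \<alpha> X by simp
    moreover have "expo H (f x) \<alpha> = map_option f (expo E x \<alpha>)" using H(2) x \<alpha> X by (simp add: exp_iso_def)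
    ultimately show "expo H (f x) \<alpha> = Some z \<longleftrightarrow> (\<exists>y. ext_expo A G \<C> x \<alpha> y \<and> z = f y)" by auto
  qed
  moreover have "tagged_stage A (Suc n) H"
    unfolding H_def using FE no_involutions_tensor_ext[OF A inv] f_inj f_tag by (intro image_exp_tagged_stage)
  ultimately show ?thesis using that S by blast
qed

lemma complete_tensor_extension_exists:
  fixes A :: "('r, 'n) ring_scheme" and G :: "('g, 'r) exp_struct"
  assumes char_zero: "\<And>n :: int. [n] \<cdot>\<^bsub>A\<^esub> \<one>\<^bsub>A\<^esub> = \<zero>\<^bsub>A\<^esub> \<Longrightarrow> n = 0" and A: "no_involutions (add_monoid A)"
    and G: "faithful_CSA A G" "\<And>M. maximal_abelian G M \<Longrightarrow> no_involutions (tensor A (sub_exp G M))"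
  shows "\<exists>(U :: (('g + 'r) list, 'r) exp_struct) \<iota>. is_complete_tensor_extension A G U \<iota>"
proof -
  define \<iota> :: "'g \<Rightarrow> ('g + 'r) list" where "\<iota> g = tag 0 [Inl g]" for g
  have inj: "inj_on \<iota> (carrier G)" by (rule inj_onI) (simp add: \<iota>_def)
  have gG: "group G" using G by (simp add: faithful_CSA_def partial_exp_group_def)
  have base: "tagged_stage A 0 (image_exp \<iota> G)"
    using G inj by (intro image_exp_tagged_stage) (auto simp: \<iota>_def)
  have "\<exists>Gs. \<forall>n. (tagged_stage A n (Gs n) \<and> (n = 0 \<longrightarrow> Gs n = image_exp \<iota> G)) \<and>
    (\<exists>\<C>. condition_S A (Gs n) \<C> \<and> is_centralizer_extension A (Gs n) \<C> (Gs (Suc n)))"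
  proof (rule dependent_nat_choice)
    fix X n assume X: "tagged_stage A n X \<and> (n = 0 \<longrightarrow> X = image_exp \<iota> G)"
    then have "tagged_stage A n X" ..
    from tagged_stage_Suc[OF char_zero A this]
    obtain H \<C> where "tagged_stage A (Suc n) H" "condition_S A X \<C>" "is_centralizer_extension A X \<C> H" .
    then show "\<exists>H. (tagged_stage A (Suc n) H \<and> (Suc n = 0 \<longrightarrow> H = image_exp \<iota> G)) \<and>
        (\<exists>\<C>. condition_S A X \<C> \<and> is_centralizer_extension A X \<C> H)" by auto
  qed (use base in auto)
  then obtain Gs where Gs: "Gs 0 = image_exp \<iota> G"
    "\<And>n. \<exists>\<C>. condition_S A (Gs n) \<C> \<and> is_centralizer_extension A (Gs n) \<C> (Gs (Suc n))" by blast
  then have "centralizer_chain A G Gs \<iota>"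
    unfolding centralizer_chain_def using image_exp_iso[OF gG inj] by auto
  then show ?thesis unfolding is_complete_tensor_extension_def by blast
qed

text \<open>The second half speaks about every chain, in any type and for any choice of the sets of
  centralizers. The first half exhibits, under its hypothesis, a type in which a chain exists, so
  that the second is not vacuous there.\<close>

theorem theorem8:
  fixes A :: "('r, 'n) ring_scheme" and G :: "('g, 'r) exp_struct"
  assumes "ring A"
    and "\<And>n :: int. [n] \<cdot>\<^bsub>A\<^esub> \<one>\<^bsub>A\<^esub> = \<zero>\<^bsub>A\<^esub> \<Longrightarrow> n = 0"
    and "no_involutions (add_monoid A)"
    and "partial_exp_group A G"
    and "\<not> comm_group G"
    and "CSA G"
    and "\<And>M. maximal_abelian G M \<Longrightarrow> abelian_faithful A (sub_exp G M)"
  shows "((\<forall>M. maximal_abelian G M \<longrightarrow> no_involutions (tensor A (sub_exp G M))) \<longrightarrow>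
           (\<exists>(U :: (('g + 'r) list, 'r) exp_struct) \<iota>. is_complete_tensor_extension A G U \<iota>)) \<and>
         (\<forall>(U :: ('u, 'r) exp_struct) \<iota>. is_complete_tensor_extension A G U \<iota> \<longrightarrow>
            is_tensor_completion TYPE('h) A G U \<iota>)"
proof (intro conjI impI allI)
  have G: "faithful_CSA A G" using assms(4-7) by (simp add: faithful_CSA_def)
  show "\<exists>(U :: (('g + 'r) list, 'r) exp_struct) \<iota>. is_complete_tensor_extension A G U \<iota>"
    if "\<forall>M. maximal_abelian G M \<longrightarrow> no_involutions (tensor A (sub_exp G M))"
    using that by (intro complete_tensor_extension_exists[OF assms(2,3) G]) simp_all
  show "is_tensor_completion TYPE('h) A G U \<iota>" if "is_complete_tensor_extension A G U \<iota>"
    for U :: "('u, 'r) exp_struct" and \<iota>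
    using that chain_union_tensor_completion[OF assms(1,2) G] unfolding is_complete_tensor_extension_def by blast
qed

end
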